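(* Let $A$ be a nonnegative partially fundamentally reducible operator in a Kreĭn space $(\mathcal K,[\cdot,\cdot])$ with associated symmetric operators $S_+$ and $S_-$. Let $(\mathbb C,\Gamma_0^+,\Gamma_1^+)$ be a boundary triple for $S_+^*$, let $(\mathbb C,\Gamma_0^-,\Gamma_1^-)$ be the boundary triple for $S_-^*$ induced by $A$, and let $m_\pm$ be the Weyl function of $S_\pm$ relative to $(\mathbb C,\Gamma_0^\pm,\Gamma_1^\pm)$. Assume that $m_+$ and $m_-$ both have $B_\infty$-property. Then $\infty\notin c_s(A)$ if and only if the pair $(m_+,m_-)$ has $D_\infty$-property.
   Context: **Kreĭn spaces.** A Kreĭn space $(\mathcal K,[\cdot,\cdot])$ is a complex vector space with a sesquilinear form for which there is a fundamental decomposition: a direct sum $\mathcal K=\mathcal K_+\dot+\mathcal K_-$ with $[\mathcal K_+,\mathcal K_-]=\{0\}$ such that $(\mathcal K_+,[\cdot,\cdot])$ and $(\mathcal K_-,-[\cdot,\cdot])$ are Hilbert spaces. $P_\pm$ are the corresponding projections, $J=P_+-P_-$ is the fundamental symmetry, and $\langle x,y\rangle=[Jx,y]$ is a Hilbert space inner product; topological notions refer to it (different decompositions give equivalent norms). A densely defined $A$ is self-adjoint in $(\mathcal K,[\cdot,\cdot])$ if $A=A^{[*]}$, the adjoint with respect to $[\cdot,\cdot]$, and nonnegative if $[Af,f]\ge0$ for all $f\in\operatorname{dom}(A)$. All operators are closed and densely defined. **Partially fundamentally reducible.** A self-adjoint operator $A$ in a Kreĭn space is partially fundamentally reducible if there is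 a fundamental decomposition $\mathcal K=\mathcal K_+\dot+\mathcal K_-$ such that $\mathcal D_\pm=\{f\in\mathcal K_\pm\cap\operatorname{dom}A:\ Af\in\mathcal K_\pm\}$ is dense in $\mathcal K_\pm$ and $S_+=A|_{\mathcal D_+}$, $S_-=-A|_{\mathcal D_-}$ are symmetric operators with defect numbers $(1,1)$ in the Hilbert spaces $(\mathcal K_+,[\cdot,\cdot])$, $(\mathcal K_-,-[\cdot,\cdot])$. This decomposition is fixed; $S_\pm^*$ is the adjoint in the Hilbert space $(\mathcal K_\pm,\pm[\cdot,\cdot])$. **Boundary triples, Weyl functions.** For a closed densely defined symmetric operator $S$ with defect numbers $(1,1)$ in a Hilbert space, a boundary triple $(\mathbb C,\Gamma_0,\Gamma_1)$ for $S^*$ consists of nonzero linear functionals $\Gamma_0,\Gamma_1:\operatorname{dom}(S^* )\to\mathbb C$ with $\ker\Gamma_0\cap\ker\Gamma_1=\operatorname{dom}(S)$ and $\langle S^*f,g\rangle-\langle f,S^*g\rangle=\Gamma_0(g)^*\Gamma_1(f)-\Gamma_1(g)^*\Gamma_0(f)$ for all $f,g\in\operatorname{dom}(S^* )$ ($z^*$ is the complex conjugate of $z$). For $z\in\mathbb C\setminus\mathbb R$ the Weyl solution $\psi(z)$ is the unique element of $\ker(S^*-z)$ with $\Gamma_0\psi(z)=1$, and the Weyl function is $m(z)=\Gamma_1\psi(z)$; it is a Nevanlinna function. **Triple induced by $A$.** Given a boundary triple $(\mathbb C,\Gamma_0^+,\Gamma_1^+)$ for $S_+^*$, one has $\operatorname{dom}(S_\pm^*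 )=P_\pm\operatorname{dom}(A)$, and the equalities $\Gamma_0^-P_-f=\Gamma_0^+P_+f$, $\Gamma_1^-P_-f=-\Gamma_1^+P_+f$ $(f\in\operatorname{dom}A)$ define a boundary triple $(\mathbb C,\Gamma_0^-,\Gamma_1^-)$ for $S_-^*$. **Singular critical points.** A nonnegative partially fundamentally reducible $A$ has nonempty resolvent set. A nonnegative self-adjoint $A$ in a Kreĭn space with $\rho(A)\ne\emptyset$ has real spectrum and a spectral function $E$ defined on the ring $\mathcal I$ of finite unions of bounded intervals with nonzero real endpoints and their complements in $\overline{\mathbb R}=\mathbb R\cup\{\infty\}$, with values bounded operators such that: $E(\emptyset)=0$, $E(\overline{\mathbb R})=I$; $E(\Delta)=E(\Delta)^{[*]}$; $E(\Delta_1\cap\Delta_2)=E(\Delta_1)E(\Delta_2)$; $E(\Delta_1\cup\Delta_2)=E(\Delta_1)+E(\Delta_2)$ for disjoint sets; $(E(\Delta)\mathcal K,\pm[\cdot,\cdot])$ is a Hilbert space if $\Delta\subset\mathbb R_\pm$; $E(\Delta)$ is in the double commutant of the resolvent of $A$; for bounded $\Delta$, $E(\Delta)\mathcal K\subseteq\operatorname{dom}A$ and $A|_{E(\Delta)\mathcal K}$ is bounded with spectrum in $\overline\Delta$. The point $0$ (respectively $\infty$) is a critical point of $A$ if $[\cdot,\cdot]$ is indefinite on $E(\Delta)\mathcal K$ for every $\Delta\in\mathcal I$ containing it. The critical point $0$ is regular if $\lim_{t\uparrow0}E([\lambda_1,t])$ and $\lim_{t\downarrow0}E([t,\lambda_2])$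 (with $\lambda_1<0<\lambda_2$) exist strongly; $\infty$ is regular if $\lim_{t\uparrow+\infty}E([\lambda_1,t])$ and $\lim_{t\downarrow-\infty}E([t,\lambda_2])$ exist strongly for some $\lambda_1,\lambda_2\in\mathbb R\setminus\{0\}$. A critical point that is not regular is singular; $c_s(A)\subseteq\{0,\infty\}$ is the set of singular critical points. **Nevanlinna functions, $B_\infty$-property.** A Nevanlinna function $m$ is holomorphic at least on $\mathbb C\setminus\mathbb R$, with $m(z^* )=m(z)^*$ and $\operatorname{Im}m(z)\ge0$ for $\operatorname{Im}z>0$. $\mathcal H(m)$ is the reproducing kernel Hilbert space of holomorphic functions on $\mathbb C\setminus\mathbb R$ with kernel $K_m(z,w)=\frac{m(z)-m(w)^*}{z-w^*}$ ($z\ne w^*$; extended by continuity). With $w_m(y)=1/\operatorname{Im}m(iy)$, $y>0$, $m$ has $B_\infty$-property if $h\mapsto\big(y\mapsto h(iy)\big)$ is a bounded operator from $\mathcal H(m)$ into the weighted space $L^2_{w_m}(1,\infty)$. **$D_\infty$-property.** A pair $(m_+,m_-)$ of Nevanlinna functions has $D_\infty$-property if the function $y\mapsto\dfrac{\operatorname{Im}m_+(iy)+\operatorname{Im}m_-(iy)}{|m_+(iy)+m_-(-iy)|}$ is (defined and) bounded on $(1,\infty)$. *)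

theory Defs
  imports "HOL-Analysis.Analysis" "HOL-Library.Function_Algebras"
begin

text \<open>
  Complex vector spaces are given by a scalar multiplication \<open>scl\<close> satisfying the library locale
  \<^locale>\<open>vector_space\<close>. Sesquilinear forms are linear in the first and conjugate linear in the
  second argument. Unbounded operators are represented by their graphs, so that \<^const>\<open>Domain\<close>
  is the domain and equality of operators is equality of graphs.
\<close>

section \<open>Inner products and Hilbert spaces\<close>

definition sesquilinear_on ::
  "(complex \<Rightarrow> 'a \<Rightarrow> 'a) \<Rightarrow> 'a::ab_group_add set \<Rightarrow> ('a \<Rightarrow> 'a \<Rightarrow> complex) \<Rightarrow> bool" where
  "sesquilinear_on scl V B \<longleftrightarrow>
     (\<forall>x\<in>V. \<forall>y\<in>V. \<forall>z\<in>V. B (x + y) z = B x z + B y z \<and> B x (y + z) = B x y + B x z) \<and>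
     (\<forall>c. \<forall>x\<in>V. \<forall>y\<in>V. B (scl c x) y = c * B x y \<and> B x (scl c y) = cnj c * B x y)"

definition hermitian_on :: "'a set \<Rightarrow> ('a \<Rightarrow> 'a \<Rightarrow> complex) \<Rightarrow> bool" where
  "hermitian_on V B \<longleftrightarrow> (\<forall>x\<in>V. \<forall>y\<in>V. B y x = cnj (B x y))"

definition inner_product_on ::
  "(complex \<Rightarrow> 'a \<Rightarrow> 'a) \<Rightarrow> 'a::ab_group_add set \<Rightarrow> ('a \<Rightarrow> 'a \<Rightarrow> complex) \<Rightarrow> bool" where
  "inner_product_on scl V B \<longleftrightarrow>
     sesquilinear_on scl V B \<and> hermitian_on V B \<and> (\<forall>x\<in>V. x \<noteq> 0 \<longrightarrow> 0 < Re (B x x))"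

definition ip_norm :: "('a \<Rightarrow> 'a \<Rightarrow> complex) \<Rightarrow> 'a \<Rightarrow> real" where
  "ip_norm B x = sqrt (Re (B x x))"

text \<open>The values outside \<open>V\<close> only serve to make this a metric in the sense of
  \<^locale>\<open>Metric_space\<close>, which requires global symmetry and nonnegativity.\<close>

definition ip_dist :: "'a::ab_group_add set \<Rightarrow> ('a \<Rightarrow> 'a \<Rightarrow> complex) \<Rightarrow> 'a \<Rightarrow> 'a \<Rightarrow> real" where
  "ip_dist V B x y = (if x \<in> V \<and> y \<in> V then ip_norm B (x - y) else 0)"

definition ip_topology :: "'a::ab_group_add set \<Rightarrow> ('a \<Rightarrow> 'a \<Rightarrow> complex) \<Rightarrow> 'a topology" where
  "ip_topology V B = Metric_space.mtopology V (ip_dist V B)"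

definition hilbert_space ::
  "(complex \<Rightarrow> 'a \<Rightarrow> 'a) \<Rightarrow> 'a::ab_group_add set \<Rightarrow> ('a \<Rightarrow> 'a \<Rightarrow> complex) \<Rightarrow> bool" where
  "hilbert_space scl V B \<longleftrightarrow>
     module.subspace scl V \<and> inner_product_on scl V B \<and> Metric_space.mcomplete V (ip_dist V B)"


section \<open>Krein spaces\<close>

definition fundamental_decomposition ::
  "(complex \<Rightarrow> 'a \<Rightarrow> 'a) \<Rightarrow> ('a \<Rightarrow> 'a \<Rightarrow> complex) \<Rightarrow> 'a::ab_group_add set \<Rightarrow> 'a set \<Rightarrow> bool" where
  "fundamental_decomposition scl B Kp Km \<longleftrightarrow>
     Kp \<inter> Km = {0} \<and> (\<forall>x. \<exists>a\<in>Kp. \<exists>b\<in>Km. x = a + b) \<and>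
     (\<forall>a\<in>Kp. \<forall>b\<in>Km. B a b = 0) \<and>
     hilbert_space scl Kp B \<and> hilbert_space scl Km (\<lambda>x y. - B x y)"

text \<open>As usual for Krein spaces, the form is Hermitian: \<open>[y, x]\<close> is the conjugate of \<open>[x, y]\<close>.\<close>

definition krein_space ::
  "(complex \<Rightarrow> 'a \<Rightarrow> 'a) \<Rightarrow> ('a::ab_group_add \<Rightarrow> 'a \<Rightarrow> complex) \<Rightarrow> bool" where
  "krein_space scl B \<longleftrightarrow>
     vector_space scl \<and> sesquilinear_on scl UNIV B \<and> hermitian_on UNIV B \<and>
     (\<exists>Kp Km. fundamental_decomposition scl B Kp Km)"

text \<open>The projection onto \<open>V\<close> along \<open>W\<close>.\<close>

definition proj_along :: "'a::ab_group_add set \<Rightarrow> 'a set \<Rightarrow> 'a \<Rightarrow> 'a" where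
  "proj_along V W x = (THE a. a \<in> V \<and> x - a \<in> W)"

definition fund_symmetry :: "'a::ab_group_add set \<Rightarrow> 'a set \<Rightarrow> 'a \<Rightarrow> 'a" where
  "fund_symmetry Kp Km x = proj_along Kp Km x - proj_along Km Kp x"

text \<open>All topological notions below refer to this inner product for a given fundamental
  decomposition; different decompositions give equivalent norms.\<close>

definition krein_ip ::
  "('a \<Rightarrow> 'a \<Rightarrow> complex) \<Rightarrow> 'a::ab_group_add set \<Rightarrow> 'a set \<Rightarrow> 'a \<Rightarrow> 'a \<Rightarrow> complex" where
  "krein_ip B Kp Km x y = B (fund_symmetry Kp Km x) y"


section \<open>Unbounded operators\<close>

definition operator_in ::
  "(complex \<Rightarrow> 'a \<Rightarrow> 'a) \<Rightarrow> 'a::ab_group_add set \<Rightarrow> ('a \<times> 'a) set \<Rightarrow> bool" where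
  "operator_in scl V T \<longleftrightarrow>
     T \<subseteq> V \<times> V \<and> single_valued T \<and> module.subspace (\<lambda>c p. (scl c (fst p), scl c (snd p))) T"

definition densely_defined_in ::
  "'a::ab_group_add set \<Rightarrow> ('a \<Rightarrow> 'a \<Rightarrow> complex) \<Rightarrow> ('a \<times> 'a) set \<Rightarrow> bool" where
  "densely_defined_in V H T \<longleftrightarrow> (ip_topology V H) closure_of (Domain T) = V"

definition closed_operator_in ::
  "'a::ab_group_add set \<Rightarrow> ('a \<Rightarrow> 'a \<Rightarrow> complex) \<Rightarrow> ('a \<times> 'a) set \<Rightarrow> bool" where
  "closed_operator_in V H T \<longleftrightarrow> closedin (prod_topology (ip_topology V H) (ip_topology V H)) T"

definition adjoint_in :: "'a set \<Rightarrow> ('a \<Rightarrow> 'a \<Rightarrow> complex) \<Rightarrow> ('a \<times> 'a) set \<Rightarrow> ('a \<times> 'a) set" where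
  "adjoint_in V B T = {(g, g'). g \<in> V \<and> g' \<in> V \<and> (\<forall>(f, f')\<in>T. B f' g = B f g')}"

definition symmetric_operator_in ::
  "(complex \<Rightarrow> 'a \<Rightarrow> 'a) \<Rightarrow> 'a::ab_group_add set \<Rightarrow> ('a \<Rightarrow> 'a \<Rightarrow> complex) \<Rightarrow> ('a \<times> 'a) set \<Rightarrow> bool"
  where
  "symmetric_operator_in scl V H S \<longleftrightarrow>
     operator_in scl V S \<and> densely_defined_in V H S \<and> closed_operator_in V H S \<and>
     (\<forall>(f, f')\<in>S. \<forall>(g, g')\<in>S. H f' g = H f g')"

definition deficiency_space ::
  "(complex \<Rightarrow> 'a \<Rightarrow> 'a) \<Rightarrow> 'a set \<Rightarrow> ('a \<Rightarrow> 'a \<Rightarrow> complex) \<Rightarrow> ('a \<times> 'a) set \<Rightarrow> complex \<Rightarrow> 'a set"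
  where
  "deficiency_space scl V H S z = {f. (f, scl z f) \<in> adjoint_in V H S}"

text \<open>The library dimension of an infinite dimensional space is \<open>0\<close>, so dimension \<open>1\<close> excludes it.\<close>

definition has_defect_one_one ::
  "(complex \<Rightarrow> 'a \<Rightarrow> 'a) \<Rightarrow> 'a::ab_group_add set \<Rightarrow> ('a \<Rightarrow> 'a \<Rightarrow> complex) \<Rightarrow> ('a \<times> 'a) set \<Rightarrow> bool"
  where
  "has_defect_one_one scl V H S \<longleftrightarrow>
     vector_space.dim scl (deficiency_space scl V H S \<i>) = 1 \<and>
     vector_space.dim scl (deficiency_space scl V H S (- \<i>)) = 1"

definition selfadjoint_krein ::
  "(complex \<Rightarrow> 'a \<Rightarrow> 'a) \<Rightarrow> ('a \<Rightarrow> 'a \<Rightarrow> complex) \<Rightarrow> 'a::ab_group_add set \<Rightarrow> 'a set \<Rightarrow>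
     ('a \<times> 'a) set \<Rightarrow> bool" where
  "selfadjoint_krein scl B Kp Km A \<longleftrightarrow>
     operator_in scl UNIV A \<and> densely_defined_in UNIV (krein_ip B Kp Km) A \<and>
     A = adjoint_in UNIV B A"

definition nonneg_operator :: "('a \<Rightarrow> 'a \<Rightarrow> complex) \<Rightarrow> ('a \<times> 'a) set \<Rightarrow> bool" where
  "nonneg_operator B A \<longleftrightarrow> (\<forall>(f, f')\<in>A. B f' f \<in> \<real>\<^sub>\<ge>\<^sub>0)"


section \<open>Partially fundamentally reducible operators\<close>

definition S_plus :: "'a set \<Rightarrow> ('a \<times> 'a) set \<Rightarrow> ('a \<times> 'a) set" where
  "S_plus Kp A = {(f, f'). (f, f') \<in> A \<and> f \<in> Kp \<and> f' \<in> Kp}"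

definition S_minus :: "'a::ab_group_add set \<Rightarrow> ('a \<times> 'a) set \<Rightarrow> ('a \<times> 'a) set" where
  "S_minus Km A = {(f, - f') | f f'. (f, f') \<in> A \<and> f \<in> Km \<and> f' \<in> Km}"

text \<open>The decomposition witnessing partial fundamental reducibility is a parameter, since the
  operators \<open>S\<^sub>\<plusminus>\<close> depend on it.\<close>

definition partially_fund_reducible ::
  "(complex \<Rightarrow> 'a \<Rightarrow> 'a) \<Rightarrow> ('a \<Rightarrow> 'a \<Rightarrow> complex) \<Rightarrow> 'a::ab_group_add set \<Rightarrow> 'a set \<Rightarrow>
     ('a \<times> 'a) set \<Rightarrow> bool" where
  "partially_fund_reducible scl B Kp Km A \<longleftrightarrow>
     fundamental_decomposition scl B Kp Km \<and>
     selfadjoint_krein scl B Kp Km A \<and>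
     symmetric_operator_in scl Kp B (S_plus Kp A) \<and>
     has_defect_one_one scl Kp B (S_plus Kp A) \<and>
     symmetric_operator_in scl Km (\<lambda>x y. - B x y) (S_minus Km A) \<and>
     has_defect_one_one scl Km (\<lambda>x y. - B x y) (S_minus Km A)"


section \<open>Boundary triples and Weyl functions\<close>

definition linear_functional_on ::
  "(complex \<Rightarrow> 'a \<Rightarrow> 'a) \<Rightarrow> 'a::ab_group_add set \<Rightarrow> ('a \<Rightarrow> complex) \<Rightarrow> bool" where
  "linear_functional_on scl D G \<longleftrightarrow>
     (\<forall>f\<in>D. \<forall>g\<in>D. G (f + g) = G f + G g) \<and> (\<forall>c. \<forall>f\<in>D. G (scl c f) = c * G f)"

definition boundary_triple ::
  "(complex \<Rightarrow> 'a \<Rightarrow> 'a) \<Rightarrow> 'a::ab_group_add set \<Rightarrow> ('a \<Rightarrow> 'a \<Rightarrow> complex) \<Rightarrow> ('a \<times> 'a) set \<Rightarrow>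
     ('a \<Rightarrow> complex) \<Rightarrow> ('a \<Rightarrow> complex) \<Rightarrow> bool" where
  "boundary_triple scl V H S G0 G1 \<longleftrightarrow>
     (let T = adjoint_in V H S; D = Domain T in
        linear_functional_on scl D G0 \<and> linear_functional_on scl D G1 \<and>
        (\<exists>f\<in>D. G0 f \<noteq> 0) \<and> (\<exists>f\<in>D. G1 f \<noteq> 0) \<and>
        {f\<in>D. G0 f = 0} \<inter> {f\<in>D. G1 f = 0} = Domain S \<and>
        (\<forall>(f, f')\<in>T. \<forall>(g, g')\<in>T.
           H f' g - H f g' = cnj (G0 g) * G1 f - cnj (G1 g) * G0 f))"

definition weyl_solution ::
  "(complex \<Rightarrow> 'a \<Rightarrow> 'a) \<Rightarrow> 'a set \<Rightarrow> ('a \<Rightarrow> 'a \<Rightarrow> complex) \<Rightarrow> ('a \<times> 'a) set \<Rightarrow>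
     ('a \<Rightarrow> complex) \<Rightarrow> complex \<Rightarrow> 'a" where
  "weyl_solution scl V H S G0 z = (THE f. f \<in> deficiency_space scl V H S z \<and> G0 f = 1)"

text \<open>Only the values at nonreal \<open>z\<close> are meaningful.\<close>

definition weyl_function ::
  "(complex \<Rightarrow> 'a \<Rightarrow> 'a) \<Rightarrow> 'a set \<Rightarrow> ('a \<Rightarrow> 'a \<Rightarrow> complex) \<Rightarrow> ('a \<times> 'a) set \<Rightarrow>
     ('a \<Rightarrow> complex) \<Rightarrow> ('a \<Rightarrow> complex) \<Rightarrow> complex \<Rightarrow> complex" where
  "weyl_function scl V H S G0 G1 z = G1 (weyl_solution scl V H S G0 z)"

definition induced_boundary_triple ::
  "(complex \<Rightarrow> 'a \<Rightarrow> 'a) \<Rightarrow> ('a \<Rightarrow> 'a \<Rightarrow> complex) \<Rightarrow> 'a::ab_group_add set \<Rightarrow> 'a set \<Rightarrow>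
     ('a \<times> 'a) set \<Rightarrow> ('a \<Rightarrow> complex) \<Rightarrow> ('a \<Rightarrow> complex) \<Rightarrow> ('a \<Rightarrow> complex) \<Rightarrow> ('a \<Rightarrow> complex) \<Rightarrow> bool"
  where
  "induced_boundary_triple scl B Kp Km A G0p G1p G0m G1m \<longleftrightarrow>
     boundary_triple scl Km (\<lambda>x y. - B x y) (S_minus Km A) G0m G1m \<and>
     (\<forall>f\<in>Domain A. G0m (proj_along Km Kp f) = G0p (proj_along Kp Km f) \<and>
                     G1m (proj_along Km Kp f) = - G1p (proj_along Kp Km f))"


section \<open>Resolvent set, spectral function, singular critical points\<close>

text \<open>Here \<open>H\<close> is the Hilbert space inner product, and \<open>V\<close> the subspace in which \<open>T\<close> acts.\<close>

definition resolvent :: "(complex \<Rightarrow> 'a \<Rightarrow> 'a) \<Rightarrow> ('a::ab_group_add \<times> 'a) set \<Rightarrow> complex \<Rightarrow> ('a \<times> 'a) set"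
  where
  "resolvent scl T z = {(f' - scl z f, f) | f f'. (f, f') \<in> T}"

definition resolvent_set ::
  "(complex \<Rightarrow> 'a \<Rightarrow> 'a) \<Rightarrow> 'a::ab_group_add set \<Rightarrow> ('a \<Rightarrow> 'a \<Rightarrow> complex) \<Rightarrow> ('a \<times> 'a) set \<Rightarrow> complex set"
  where
  "resolvent_set scl V H T =
     {z. single_valued (resolvent scl T z) \<and> Domain (resolvent scl T z) = V \<and>
         (\<exists>C. \<forall>(g, f)\<in>resolvent scl T z. ip_norm H f \<le> C * ip_norm H g)}"

definition spectrum ::
  "(complex \<Rightarrow> 'a \<Rightarrow> 'a) \<Rightarrow> 'a::ab_group_add set \<Rightarrow> ('a \<Rightarrow> 'a \<Rightarrow> complex) \<Rightarrow> ('a \<times> 'a) set \<Rightarrow> complex set"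
  where
  "spectrum scl V H T = - resolvent_set scl V H T"

definition bounded_op ::
  "(complex \<Rightarrow> 'a \<Rightarrow> 'a) \<Rightarrow> ('a::ab_group_add \<Rightarrow> 'a \<Rightarrow> complex) \<Rightarrow> ('a \<Rightarrow> 'a) \<Rightarrow> bool" where
  "bounded_op scl H T \<longleftrightarrow>
     Vector_Spaces.linear scl scl T \<and> (\<exists>C. \<forall>x. ip_norm H (T x) \<le> C * ip_norm H x)"

definition in_double_commutant_of_resolvent ::
  "(complex \<Rightarrow> 'a \<Rightarrow> 'a) \<Rightarrow> ('a::ab_group_add \<Rightarrow> 'a \<Rightarrow> complex) \<Rightarrow> ('a \<times> 'a) set \<Rightarrow> ('a \<Rightarrow> 'a) \<Rightarrow> bool"
  where
  "in_double_commutant_of_resolvent scl H A P \<longleftrightarrow>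
     (\<forall>T. bounded_op scl H T \<and>
          (\<forall>z\<in>resolvent_set scl UNIV H A. \<forall>(g, f)\<in>resolvent scl A z. (T g, T f) \<in> resolvent scl A z)
        \<longrightarrow> (\<forall>x. T (P x) = P (T x)))"

text \<open>The extended line \<open>\<real> \<union> {\<infinity>}\<close> with a single point at infinity is modelled by the type
  \<^typ>\<open>real option\<close>, with \<^const>\<open>None\<close> as \<open>\<infinity>\<close>.\<close>

definition nz_intervals :: "real set set" where
  "nz_intervals =
     {J. \<exists>a b. a \<noteq> 0 \<and> b \<noteq> 0 \<and> a \<le> b \<and> J \<in> {{a..b}, {a..<b}, {a<..b}, {a<..<b}}}"

definition spectral_ring :: "real option set set" where
  "spectral_ring =
     {\<Delta>. \<exists>F. finite F \<and> F \<subseteq> nz_intervals \<and> (\<Delta> = Some ` (\<Union>F) \<or> \<Delta> = - (Some ` (\<Union>F)))}"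

text \<open>These properties determine \<open>E\<close> only up to the assignment of eigenvectors of \<open>A\<close> to
  the two sides of an interval endpoint that is an eigenvalue; being a critical point and being
  regular do not depend on that choice.\<close>

definition spectral_function ::
  "(complex \<Rightarrow> 'a \<Rightarrow> 'a) \<Rightarrow> ('a \<Rightarrow> 'a \<Rightarrow> complex) \<Rightarrow> 'a::ab_group_add set \<Rightarrow> 'a set \<Rightarrow>
     ('a \<times> 'a) set \<Rightarrow> (real option set \<Rightarrow> 'a \<Rightarrow> 'a) \<Rightarrow> bool" where
  "spectral_function scl B Kp Km A E \<longleftrightarrow>
     (let H = krein_ip B Kp Km in
       (\<forall>\<Delta>\<in>spectral_ring. bounded_op scl H (E \<Delta>)) \<and>
       (\<forall>x. E {} x = 0) \<and> (\<forall>x. E UNIV x = x) \<and>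
       (\<forall>\<Delta>\<in>spectral_ring. \<forall>x y. B (E \<Delta> x) y = B x (E \<Delta> y)) \<and>
       (\<forall>\<Delta>1\<in>spectral_ring. \<forall>\<Delta>2\<in>spectral_ring. \<forall>x. E (\<Delta>1 \<inter> \<Delta>2) x = E \<Delta>1 (E \<Delta>2 x)) \<and>
       (\<forall>\<Delta>1\<in>spectral_ring. \<forall>\<Delta>2\<in>spectral_ring. \<Delta>1 \<inter> \<Delta>2 = {} \<longrightarrow>
          (\<forall>x. E (\<Delta>1 \<union> \<Delta>2) x = E \<Delta>1 x + E \<Delta>2 x)) \<and>
       (\<forall>\<Delta>\<in>spectral_ring. \<Delta> \<subseteq> Some ` {0<..} \<longrightarrow> hilbert_space scl (range (E \<Delta>)) B) \<and>
       (\<forall>\<Delta>\<in>spectral_ring. \<Delta> \<subseteq> Some ` {..<0} \<longrightarrow>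
          hilbert_space scl (range (E \<Delta>)) (\<lambda>x y. - B x y)) \<and>
       (\<forall>\<Delta>\<in>spectral_ring. in_double_commutant_of_resolvent scl H A (E \<Delta>)) \<and>
       (\<forall>S. Some ` S \<in> spectral_ring \<and> bounded S \<longrightarrow>
          (let R = range (E (Some ` S)); AR = {(f, f') \<in> A. f \<in> R} in
            R \<subseteq> Domain A \<and>
            (\<exists>C. \<forall>(f, f')\<in>AR. ip_norm H f' \<le> C * ip_norm H f) \<and>
            spectrum scl R H AR \<subseteq> complex_of_real ` closure S)))"

definition critical_point ::
  "('a \<Rightarrow> 'a \<Rightarrow> complex) \<Rightarrow> (real option set \<Rightarrow> 'a \<Rightarrow> 'a) \<Rightarrow> real option \<Rightarrow> bool" where
  "critical_point B E p \<longleftrightarrow> p \<in> {Some 0, None} \<and>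
     (\<forall>\<Delta>\<in>spectral_ring. p \<in> \<Delta> \<longrightarrow>
        (\<exists>x\<in>range (E \<Delta>). 0 < Re (B x x)) \<and> (\<exists>y\<in>range (E \<Delta>). Re (B y y) < 0))"

definition strong_limit_exists ::
  "('a::ab_group_add \<Rightarrow> 'a \<Rightarrow> complex) \<Rightarrow> (real \<Rightarrow> 'a \<Rightarrow> 'a) \<Rightarrow> real filter \<Rightarrow> bool" where
  "strong_limit_exists H T F \<longleftrightarrow> (\<forall>x. \<exists>l. limitin (ip_topology UNIV H) (\<lambda>t. T t x) l F)"

definition regular_point ::
  "('a::ab_group_add \<Rightarrow> 'a \<Rightarrow> complex) \<Rightarrow> (real option set \<Rightarrow> 'a \<Rightarrow> 'a) \<Rightarrow> real option \<Rightarrow> bool" where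
  "regular_point H E p \<longleftrightarrow>
     (case p of
        Some _ \<Rightarrow> \<exists>l1 l2. l1 < 0 \<and> 0 < l2 \<and>
          strong_limit_exists H (\<lambda>t. E (Some ` {l1..t})) (at_left 0) \<and>
          strong_limit_exists H (\<lambda>t. E (Some ` {t..l2})) (at_right 0)
      | None \<Rightarrow> \<exists>l1 l2. l1 \<noteq> 0 \<and> l2 \<noteq> 0 \<and>
          strong_limit_exists H (\<lambda>t. E (Some ` {l1..t})) at_top \<and>
          strong_limit_exists H (\<lambda>t. E (Some ` {t..l2})) at_bot)"

definition singular_critical_points ::
  "(complex \<Rightarrow> 'a \<Rightarrow> 'a) \<Rightarrow> ('a \<Rightarrow> 'a \<Rightarrow> complex) \<Rightarrow> 'a::ab_group_add set \<Rightarrow> 'a set \<Rightarrow>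
     ('a \<times> 'a) set \<Rightarrow> real option set" where
  "singular_critical_points scl B Kp Km A =
     {p. \<exists>E. spectral_function scl B Kp Km A E \<and>
             critical_point B E p \<and> \<not> regular_point (krein_ip B Kp Km) E p}"


section \<open>The properties \<open>B\<^sub>\<infinity>\<close> and \<open>D\<^sub>\<infinity>\<close>\<close>

definition nev_kernel :: "(complex \<Rightarrow> complex) \<Rightarrow> complex \<Rightarrow> complex \<Rightarrow> complex" where
  "nev_kernel m z w =
     (if z \<noteq> cnj w then (m z - cnj (m w)) / (z - cnj w)
      else Lim (at (cnj w)) (\<lambda>\<zeta>. (m \<zeta> - cnj (m w)) / (\<zeta> - cnj w)))"

text \<open>Functions on \<open>\<complex> - \<real>\<close> are represented by functions on \<open>\<complex>\<close> vanishing on \<open>\<real>\<close>. By the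
  Moore--Aronszajn theorem \<open>m\<close> determines the space \<open>\<H>(m) = (L, ip)\<close> uniquely.\<close>

definition nev_kernel_section :: "(complex \<Rightarrow> complex) \<Rightarrow> complex \<Rightarrow> complex \<Rightarrow> complex" where
  "nev_kernel_section m w = (\<lambda>z. if z \<in> \<real> then 0 else nev_kernel m z w)"

definition nev_rkhs ::
  "(complex \<Rightarrow> complex) \<Rightarrow> (complex \<Rightarrow> complex) set \<Rightarrow>
     ((complex \<Rightarrow> complex) \<Rightarrow> (complex \<Rightarrow> complex) \<Rightarrow> complex) \<Rightarrow> bool" where
  "nev_rkhs m L ip \<longleftrightarrow>
     hilbert_space (\<lambda>c h z. c * h z) L ip \<and>
     (\<forall>h\<in>L. h holomorphic_on - \<real> \<and> (\<forall>z\<in>\<real>. h z = 0)) \<and>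
     (\<forall>w\<in>- \<real>. nev_kernel_section m w \<in> L \<and> (\<forall>h\<in>L. ip h (nev_kernel_section m w) = h w))"

definition weighted_L2 :: "(real \<Rightarrow> real) \<Rightarrow> real set \<Rightarrow> (real \<Rightarrow> complex) set" where
  "weighted_L2 w I =
     {u. set_borel_measurable lborel I u \<and> set_integrable lborel I (\<lambda>y. (cmod (u y))\<^sup>2 * w y)}"

definition weighted_L2_norm :: "(real \<Rightarrow> real) \<Rightarrow> real set \<Rightarrow> (real \<Rightarrow> complex) \<Rightarrow> real" where
  "weighted_L2_norm w I u = sqrt (LINT y:I|lborel. (cmod (u y))\<^sup>2 * w y)"

text \<open>The following two properties are meant for Nevanlinna functions, which Weyl functions are;
  for Weyl functions the values \<open>Im (m (\<i> y))\<close> are positive, so that the weight is well defined.\<close>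

definition has_B_infty :: "(complex \<Rightarrow> complex) \<Rightarrow> bool" where
  "has_B_infty m \<longleftrightarrow>
     (let w = (\<lambda>y::real. 1 / Im (m (\<i> * of_real y))) in
       \<exists>L ip. nev_rkhs m L ip \<and>
         (\<exists>C. \<forall>h\<in>L. (\<lambda>y::real. h (\<i> * of_real y)) \<in> weighted_L2 w {1<..} \<and>
            weighted_L2_norm w {1<..} (\<lambda>y. h (\<i> * of_real y)) \<le> C * ip_norm ip h))"

definition has_D_infty :: "(complex \<Rightarrow> complex) \<Rightarrow> (complex \<Rightarrow> complex) \<Rightarrow> bool" where
  "has_D_infty mp mm \<longleftrightarrow>
     (\<forall>y::real. 1 < y \<longrightarrow> mp (\<i> * of_real y) + mm (- \<i> * of_real y) \<noteq> 0) \<and>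
     bounded ((\<lambda>y::real. (Im (mp (\<i> * of_real y)) + Im (mm (\<i> * of_real y))) /
                 cmod (mp (\<i> * of_real y) + mm (- \<i> * of_real y))) ` {1<..})"

end

theory Submission
  imports Defs
begin

text \<open>
  Krein's formula writes the resolvent \<open>R z\<close> of \<open>A\<close> as the resolvent of a decoupled operator plus a
  rank one term, whose norm on the imaginary axis is \<open>1 / y\<close> times the quotient in the
  \<open>D\<^sub>\<infinity>\<close>-property.

  If \<open>m\<^sub>+\<close>, \<open>m\<^sub>-\<close> have the \<open>B\<^sub>\<infinity>\<close>-property and the pair has the \<open>D\<^sub>\<infinity>\<close>-property, the formula bounds
  dyadic sums of \<open>2\<^sup>k Re [R (\<i> y) f, f]\<close>, \<open>y \<approx> 2\<^sup>k\<close>, by \<open>\<parallel>f\<parallel>\<^sup>2\<close>. Each term dominates the form of the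
  spectral projection of a block of length \<open>2\<^sup>k\<close>, so the definite projections \<open>E [1, t]\<close> are
  monotone and bounded, and hence converge.

  Conversely, if \<open>\<infinity>\<close> is regular or not critical, the space splits boundedly into a positive, a
  negative and a bounded spectral part. On each of them \<open>y R (\<i> y)\<close> is bounded, so the rank one term
  gives the \<open>D\<^sub>\<infinity>\<close>-property.

  The converse needs an actual spectral function. With \<open>R (\<plusminus> \<i>) = T \<plusminus> \<i> C\<close>, the operator \<open>J T\<close> is
  nonnegative in the Hilbert space; put \<open>D = (J T)\<^sup>1\<^sup>/\<^sup>2\<close>. By Reid's inequality operators commuting
  with the resolvent transfer through \<open>D\<close>, which turns \<open>T\<close> and \<open>C\<close> into commuting self-adjoint
  operators; their spectral projections are carried back to the Krein space.
\<close>


section \<open>Hilbert spaces given by a carrier and a form\<close>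

text \<open>The two directions meet the spectral function differently. A point is singular as soon
  as some \<open>E\<close> with the listed properties witnesses it, so sufficiency has to treat an
  arbitrary \<open>E\<close> of which only these properties are known, while necessity must exhibit
  one. The obstacle to the construction is that \<open>A\<close> is self-adjoint only for the
  indefinite form: \<open>T\<close> and \<open>C1\<close> are symmetric for \<open>B\<close>, not
  for \<open>H\<close>, so Hilbert space methods do not apply to them directly. They apply to
  \<open>tt = D J D\<close>, which is symmetric for \<open>H\<close> and satisfies
  \<open>tt D = D T\<close>. The delicate part is the way back, as \<open>D\<close> has no bounded
  inverse: a projection \<open>U\<close> returns as \<open>J D V D\<close> if
  \<open>U = tt V\<close> with a bounded \<open>V\<close>, and such a \<open>V\<close> is available
  when \<open>U\<close> stays away from the spectral values 0 and \<infinity>. Around 0, which may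
  itself be a singular critical point, a different projection is built with \<open>C1\<close> as a
  correction; it also has to be the identity on the kernel of \<open>A\<close>, which
  \<open>D\<close> annihilates. All projections come from signs of self-adjoint operators, found
  with square roots; no spectral integral is formed.\<close>

lemma null_sequence_bound:
  fixes f :: "nat \<Rightarrow> 'b::real_normed_vector"
  assumes "\<And>n. norm (f n) \<le> g n" and "g \<longlonglongrightarrow> 0"
  shows "f \<longlonglongrightarrow> 0"
  by (rule Lim_null_comparison[OF _ assms(2)]) (simp add: assms(1))

text \<open>Semidefiniteness suffices, so the estimate also serves for forms such as
  \<open>H (X x) y\<close> with a positive \<open>X\<close>, or the energy form of \<open>A\<close>
  on its domain.\<close>

lemma semi_Cauchy_Schwarz:
  assumes vs: "vector_space scl" and sub: "module.subspace scl V" and ses: "sesquilinear_on scl V h"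
    and herm: "hermitian_on V h" and pos: "\<And>x. x \<in> V \<Longrightarrow> 0 \<le> Re (h x x)"
    and x: "x \<in> V" and y: "y \<in> V"
  shows "(cmod (h x y))\<^sup>2 \<le> Re (h x x) * Re (h y y)"
proof -
  interpret vector_space scl by fact
  define b where "b = h x y"
  have yx: "h y x = cnj b"
    using herm x y unfolding hermitian_on_def b_def by blast
  have sc: "scl c z \<in> V" if "z \<in> V" for c z
    using subspace_scale[OF sub] that by blast
  have yy: "Im (h y y) = 0"
    using herm y unfolding hermitian_on_def by (metis Im_complex_of_real Reals_cases complex_cnj_cancel_iff Reals_cnj_iff)
  have key: "0 \<le> Re (h x x) - 2 * t * (cmod b)\<^sup>2 + t\<^sup>2 * (cmod b)\<^sup>2 * Re (h y y)" for t :: real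
  proof -
    define c where "c = - (of_real t * b)"
    have cy: "scl c y \<in> V" using sc y by blast
    have "h (x + scl c y) (x + scl c y) = h x x + cnj c * b + c * cnj b + c * cnj c * h y y"
      using ses x y cy subspace_add[OF sub] unfolding sesquilinear_on_def
      by (simp add: yx b_def algebra_simps)
    moreover have "0 \<le> Re (h (x + scl c y) (x + scl c y))"
      by (intro pos subspace_add[OF sub] x cy)
    moreover have "Re (cnj c * b + c * cnj b) = - 2 * t * (cmod b)\<^sup>2"
      unfolding c_def cmod_power2 by (simp add: algebra_simps power2_eq_square)
    moreover have "Re (c * cnj c * h y y) = t\<^sup>2 * (cmod b)\<^sup>2 * Re (h y y)"
      unfolding c_def cmod_power2 using yy by (simp add: algebra_simps power2_eq_square)
    moreover have "Re (u + cnj c * b + c * cnj b + v) = Re u + Re (cnj c * b + c * cnj b) + Re v" for u v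
      by simp
    ultimately show ?thesis by (simp only:)
  qed
  show ?thesis
  proof (cases "Re (h y y) = 0")
    case True
    have "cmod b = 0"
    proof (rule ccontr)
      assume "cmod b \<noteq> 0"
      then have p: "(cmod b)\<^sup>2 > 0" by simp
      have "0 \<le> Re (h x x) - 2 * ((Re (h x x) + 1) / (cmod b)\<^sup>2) * (cmod b)\<^sup>2"
        using key[of "(Re (h x x) + 1) / (cmod b)\<^sup>2"] True by simp
      then have "0 \<le> Re (h x x) - 2 * (Re (h x x) + 1)" using p by simp
      then show False using pos[OF x] by (simp add: algebra_simps)
    qed
    then show ?thesis using True b_def by simp
  next
    case False
    then have p: "Re (h y y) > 0" using pos[OF y] by simp
    have "0 \<le> Re (h x x) - 2 * (1 / Re (h y y)) * (cmod b)\<^sup>2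
        + (1 / Re (h y y))\<^sup>2 * (cmod b)\<^sup>2 * Re (h y y)"
      by (rule key)
    also have "\<dots> = Re (h x x) - (cmod b)\<^sup>2 / Re (h y y)"
      using p by (simp add: field_simps power2_eq_square)
    finally show ?thesis using p by (simp add: b_def field_simps)
  qed
qed

text \<open>Completeness is not assumed: the lemma supplies the metric in which completeness of
  \<open>H\<close> and of definite subspaces is proved afterwards.\<close>

lemma inner_product_metric:
  assumes vs: "vector_space scl" and sub: "module.subspace scl V" and ip: "inner_product_on scl V h"
  shows "Metric_space V (ip_dist V h)"
proof -
  interpret vector_space scl by fact
  note mem = subspace_0[OF sub] subspace_add[OF sub] subspace_diff[OF sub] subspace_neg[OF sub] subspace_scale[OF sub]
  have ses: "sesquilinear_on scl V h" and herm: "hermitian_on V h"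
    and pos: "\<And>x. x \<in> V \<Longrightarrow> x \<noteq> 0 \<Longrightarrow> 0 < Re (h x x)"
    using ip unfolding inner_product_on_def by blast+
  have add: "h (x + y) z = h x z + h y z" "h x (y + z) = h x y + h x z" if "x \<in> V" "y \<in> V" "z \<in> V" for x y z
    using ses that unfolding sesquilinear_on_def by blast+
  have z0: "h 0 0 = 0" using add(1)[of 0 0 0] mem(1) by simp
  have ge: "0 \<le> Re (h x x)" if "x \<in> V" for x using pos[OF that] z0 by (cases "x = 0") auto
  have CS: "(cmod (h x y))\<^sup>2 \<le> Re (h x x) * Re (h y y)" if "x \<in> V" "y \<in> V" for x y
    by (rule semi_Cauchy_Schwarz[OF vs sub ses herm ge that])
  have sq: "(ip_norm h x)\<^sup>2 = Re (h x x)" and nn: "0 \<le> ip_norm h x" if "x \<in> V" for x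
    using ge[OF that] by (simp_all add: ip_norm_def)
  have tri: "ip_norm h (x + y) \<le> ip_norm h x + ip_norm h y" if xy: "x \<in> V" "y \<in> V" for x y
  proof (rule power2_le_imp_le)
    have "Re (h x y) \<le> ip_norm h x * ip_norm h y"
    proof (rule power2_le_imp_le)
      have "(Re (h x y))\<^sup>2 \<le> (cmod (h x y))\<^sup>2" by (simp add: abs_Re_le_cmod abs_le_square_iff[symmetric])
      then show "(Re (h x y))\<^sup>2 \<le> (ip_norm h x * ip_norm h y)\<^sup>2"
        using CS[OF xy] by (simp add: power_mult_distrib sq xy)
    qed (simp add: nn xy)
    moreover have "Re (h y x) = Re (h x y)" using herm xy unfolding hermitian_on_def by (metis cnj.sel(1))
    moreover have "Re (h (x + y) (x + y)) = Re (h x x) + Re (h x y) + Re (h y x) + Re (h y y)"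
      using xy by (simp add: add mem)
    ultimately show "(ip_norm h (x + y))\<^sup>2 \<le> (ip_norm h x + ip_norm h y)\<^sup>2"
      unfolding power2_sum by (simp add: sq xy mem)
  qed (simp add: nn xy)
  have neg: "ip_norm h (- x) = ip_norm h x" if "x \<in> V" for x
  proof -
    have "h (scl (-1) x) (scl (-1) x) = - 1 * h x (scl (-1) x)" "h x (scl (-1) x) = cnj (-1) * h x x"
      using ses that mem(5)[OF that, of "-1"] unfolding sesquilinear_on_def by blast+
    then have "h (- x) (- x) = h x x" by simp
    then show ?thesis by (simp add: ip_norm_def)
  qed
  show ?thesis
  proof
    fix x y z
    show "0 \<le> ip_dist V h x y" using nn mem by (simp add: ip_dist_def)
    show "ip_dist V h x y = ip_dist V h y x" using neg[of "x - y"] mem by (simp add: ip_dist_def)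
    show "ip_dist V h x y = 0 \<longleftrightarrow> x = y" if xy: "x \<in> V" "y \<in> V"
      using pos[of "x - y"] z0 mem(3)[OF xy] xy by (cases "x = y") (auto simp: ip_dist_def ip_norm_def)
    show "ip_dist V h x z \<le> ip_dist V h x y + ip_dist V h y z" if xyz: "x \<in> V" "y \<in> V" "z \<in> V"
      using tri[of "x - y" "y - z"] xyz mem by (simp add: ip_dist_def)
  qed
qed

section \<open>Geometry, convergence and Riesz representation in a Hilbert space on a carrier
  set\<close>

locale hilb = vector_space scl for scl :: "complex \<Rightarrow> 'a::ab_group_add \<Rightarrow> 'a" +
  fixes V :: "'a set" and H :: "'a \<Rightarrow> 'a \<Rightarrow> complex"
  assumes hilbert: "hilbert_space scl V H"
begin

abbreviation "nm \<equiv> ip_norm H"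

lemma subV: "subspace V"
  using hilbert unfolding hilbert_space_def by blast

lemma
  shows V0 [simp, intro]: "0 \<in> V"
    and Vadd [simp, intro]: "x \<in> V \<Longrightarrow> y \<in> V \<Longrightarrow> x + y \<in> V"
    and Vdiff [simp, intro]: "x \<in> V \<Longrightarrow> y \<in> V \<Longrightarrow> x - y \<in> V"
    and Vneg [simp, intro]: "x \<in> V \<Longrightarrow> - x \<in> V"
    and Vscl [simp, intro]: "x \<in> V \<Longrightarrow> scl c x \<in> V"
  using subspace_0[OF subV] subspace_add[OF subV] subspace_diff[OF subV] subspace_neg[OF subV]
    subspace_scale[OF subV] by simp_all

lemma sesqH: "sesquilinear_on scl V H" and hermH: "hermitian_on V H"
  using hilbert unfolding hilbert_space_def inner_product_on_def by blast+

lemma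
  shows Hadd1: "x \<in> V \<Longrightarrow> y \<in> V \<Longrightarrow> z \<in> V \<Longrightarrow> H (x + y) z = H x z + H y z"
    and Hadd2: "x \<in> V \<Longrightarrow> y \<in> V \<Longrightarrow> z \<in> V \<Longrightarrow> H x (y + z) = H x y + H x z"
    and Hscl1: "x \<in> V \<Longrightarrow> y \<in> V \<Longrightarrow> H (scl c x) y = c * H x y"
    and Hscl2: "x \<in> V \<Longrightarrow> y \<in> V \<Longrightarrow> H x (scl c y) = cnj c * H x y"
  using sesqH unfolding sesquilinear_on_def by blast+

lemma Hcnj: "x \<in> V \<Longrightarrow> y \<in> V \<Longrightarrow> cnj (H x y) = H y x"
  using hermH unfolding hermitian_on_def by (metis complex_cnj_cnj)

lemma
  shows H01: "y \<in> V \<Longrightarrow> H 0 y = 0"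
    and H02: "y \<in> V \<Longrightarrow> H y 0 = 0"
proof -
  assume "y \<in> V"
  then show "H 0 y = 0" "H y 0 = 0"
    using Hscl1[of 0 y 0] Hscl2[of y 0 0] by simp_all
qed

lemma
  shows Hneg1: "x \<in> V \<Longrightarrow> y \<in> V \<Longrightarrow> H (- x) y = - H x y"
    and Hneg2: "x \<in> V \<Longrightarrow> y \<in> V \<Longrightarrow> H x (- y) = - H x y"
proof -
  assume "x \<in> V" "y \<in> V"
  then show "H (- x) y = - H x y" "H x (- y) = - H x y"
    using Hscl1[of x y "-1"] Hscl2[of x y "-1"] by simp_all
qed

lemma
  shows Hdiff1: "x \<in> V \<Longrightarrow> y \<in> V \<Longrightarrow> z \<in> V \<Longrightarrow> H (x - y) z = H x z - H y z"
    and Hdiff2: "x \<in> V \<Longrightarrow> y \<in> V \<Longrightarrow> z \<in> V \<Longrightarrow> H x (y - z) = H x y - H x z"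
proof -
  assume "x \<in> V" "y \<in> V" "z \<in> V"
  then show "H (x - y) z = H x z - H y z" "H x (y - z) = H x y - H x z"
    using Hadd1[of x "- y" z] Hadd2[of x y "- z"] Hneg1[of y z] Hneg2[of x z] by simp_all
qed

lemmas Hsimps = Hadd1 Hadd2 Hscl1 Hscl2 H01 H02 Hneg1 Hneg2 Hdiff1 Hdiff2

lemma Hself_pos: "x \<in> V \<Longrightarrow> 0 \<le> Re (H x x)"
  using hilbert H01[of 0] unfolding hilbert_space_def inner_product_on_def
  by (cases "x = 0") (auto simp: less_imp_le)

lemma Hself: "x \<in> V \<Longrightarrow> H x x = of_real ((nm x)\<^sup>2)"
  using Hcnj[of x x] Hself_pos[of x]
  by (simp add: ip_norm_def complex_eq_iff)

lemma ReHself: "x \<in> V \<Longrightarrow> Re (H x x) = (nm x)\<^sup>2"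
  by (simp add: Hself)

lemma nm_nonneg [simp]: "x \<in> V \<Longrightarrow> 0 \<le> nm x"
  using Hself_pos by (simp add: ip_norm_def)

lemma nm0 [simp]: "nm 0 = 0"
  by (simp add: ip_norm_def H01)

lemma nm_eq_0: "x \<in> V \<Longrightarrow> nm x = 0 \<longleftrightarrow> x = 0"
  using hilbert unfolding hilbert_space_def inner_product_on_def ip_norm_def
  by (metis H01 V0 order_less_irrefl real_sqrt_eq_zero_cancel_iff zero_complex.simps(1))

lemma nm_pos: "x \<in> V \<Longrightarrow> nm x \<noteq> 0 \<Longrightarrow> 0 < nm x"
  using nm_nonneg[of x] by argo

lemma H_eq0: "x \<in> V \<Longrightarrow> H x x = 0 \<Longrightarrow> x = 0"
  using nm_eq_0[of x] by (simp add: Hself)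

lemma Cauchy_Schwarz: "x \<in> V \<Longrightarrow> y \<in> V \<Longrightarrow> cmod (H x y) \<le> nm x * nm y"
proof -
  assume xy: "x \<in> V" "y \<in> V"
  have "(cmod (H x y))\<^sup>2 \<le> (nm x * nm y)\<^sup>2"
    using semi_Cauchy_Schwarz[OF vector_space_axioms subV sesqH hermH Hself_pos xy]
    by (simp add: ReHself xy power_mult_distrib)
  then show ?thesis using xy by (auto intro: power2_le_imp_le)
qed

lemma ReH_le: "x \<in> V \<Longrightarrow> y \<in> V \<Longrightarrow> Re (H x y) \<le> nm x * nm y"
  using Cauchy_Schwarz[of x y] complex_Re_le_cmod[of "H x y"] by linarith

lemma nm_scl [simp]: "x \<in> V \<Longrightarrow> nm (scl c x) = cmod c * nm x"
proof -
  assume x: "x \<in> V"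
  have "(nm (scl c x))\<^sup>2 = Re (c * (cnj c * H x x))"
    using x by (simp add: ReHself[symmetric] Hsimps mult.left_commute)
  also have "\<dots> = (cmod c * nm x)\<^sup>2"
    using x by (simp add: Hself complex_mult_cnj cmod_power2 power_mult_distrib algebra_simps
        flip: of_real_mult) (simp add: power2_eq_square algebra_simps)
  finally show ?thesis using x by (simp add: power2_eq_iff_nonneg)
qed

lemma nm_neg [simp]: "x \<in> V \<Longrightarrow> nm (- x) = nm x"
  using nm_scl[of x "-1"] by simp

lemma nm_add_sq: "x \<in> V \<Longrightarrow> y \<in> V \<Longrightarrow> (nm (x + y))\<^sup>2 = (nm x)\<^sup>2 + 2 * Re (H x y) + (nm y)\<^sup>2"
  using Hcnj[of x y] by (simp add: ReHself[symmetric] Hsimps complex_eq_iff)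

lemma nm_diff_sq: "x \<in> V \<Longrightarrow> y \<in> V \<Longrightarrow> (nm (x - y))\<^sup>2 = (nm x)\<^sup>2 - 2 * Re (H x y) + (nm y)\<^sup>2"
  using nm_add_sq[of x "- y"] by (simp add: Hsimps)

lemma nm_triangle: "x \<in> V \<Longrightarrow> y \<in> V \<Longrightarrow> nm (x + y) \<le> nm x + nm y"
proof -
  assume xy: "x \<in> V" "y \<in> V"
  have "(nm (x + y))\<^sup>2 \<le> (nm x + nm y)\<^sup>2"
    using ReH_le[OF xy] xy by (simp add: nm_add_sq power2_sum)
  then show ?thesis using xy by (auto intro: power2_le_imp_le)
qed

lemma nm_triangle_diff: "x \<in> V \<Longrightarrow> y \<in> V \<Longrightarrow> nm (x - y) \<le> nm x + nm y"
  using nm_triangle[of x "- y"] by simp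

lemma nm_minus_commute: "x \<in> V \<Longrightarrow> y \<in> V \<Longrightarrow> nm (x - y) = nm (y - x)"
  using nm_neg[of "x - y"] by simp

lemma nm_triangle3: "x \<in> V \<Longrightarrow> y \<in> V \<Longrightarrow> z \<in> V \<Longrightarrow> nm (x - z) \<le> nm (x - y) + nm (y - z)"
  using nm_triangle[of "x - y" "y - z"] by simp

lemma nm_le_diff: "x \<in> V \<Longrightarrow> y \<in> V \<Longrightarrow> nm x \<le> nm (x - y) + nm y"
  using nm_triangle[of "x - y" y] by simp

lemma metric: "Metric_space V (ip_dist V H)"
proof
  fix x y z
  show "0 \<le> ip_dist V H x y" "ip_dist V H x y = ip_dist V H y x"
    by (auto simp: ip_dist_def nm_minus_commute)
  show "ip_dist V H x y = 0 \<longleftrightarrow> x = y" if "x \<in> V" "y \<in> V"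
    using that nm_eq_0[of "x - y"] by (simp add: ip_dist_def)
  show "ip_dist V H x z \<le> ip_dist V H x y + ip_dist V H y z" if "x \<in> V" "y \<in> V" "z \<in> V"
    using that nm_triangle3 by (simp add: ip_dist_def)
qed

definition conv :: "(nat \<Rightarrow> 'a) \<Rightarrow> 'a \<Rightarrow> bool" where
  "conv X l \<longleftrightarrow> (\<forall>n. X n \<in> V) \<and> l \<in> V \<and> (\<lambda>n. nm (X n - l)) \<longlonglongrightarrow> 0"

lemma limitin_iff:
  "limitin (ip_topology V H) f l F \<longleftrightarrow>
     l \<in> V \<and> eventually (\<lambda>x. f x \<in> V) F \<and> ((\<lambda>x. nm (f x - l)) \<longlongrightarrow> 0) F"
proof -
  interpret Metric_space V "ip_dist V H" by (rule metric)
  have "((\<lambda>x. ip_dist V H (f x) l) \<longlongrightarrow> 0) F \<longleftrightarrow> ((\<lambda>x. nm (f x - l)) \<longlongrightarrow> 0) F"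
    if "l \<in> V" "eventually (\<lambda>x. f x \<in> V) F"
    by (rule tendsto_cong) (use that in \<open>auto simp: ip_dist_def elim: eventually_mono\<close>)
  then show ?thesis
    unfolding ip_topology_def limitin_metric_dist_null by blast
qed

lemma complete:
  assumes "\<And>n. X n \<in> V" and "\<And>e. e > 0 \<Longrightarrow> \<exists>N. \<forall>m\<ge>N. \<forall>n\<ge>N. nm (X m - X n) < e"
  obtains l where "conv X l"
proof -
  interpret Metric_space V "ip_dist V H" by (rule metric)
  have "MCauchy X"
    unfolding MCauchy_def using assms by (simp add: image_subset_iff ip_dist_def)
  then obtain l where "limitin mtopology X l sequentially"
    using hilbert unfolding hilbert_space_def mcomplete_def by blast
  then have "conv X l"
    using limitin_iff[of X l sequentially] assms(1) unfolding ip_topology_def conv_def by blast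
  then show thesis by (rule that)
qed

lemma conv_H1: "conv X l \<Longrightarrow> y \<in> V \<Longrightarrow> (\<lambda>n. H (X n) y) \<longlonglongrightarrow> H l y"
proof -
  assume c: "conv X l" and y: "y \<in> V"
  have "(\<lambda>n. nm (X n - l) * nm y) \<longlonglongrightarrow> 0 * nm y"
    using c unfolding conv_def by (intro tendsto_intros) auto
  then have "(\<lambda>n. nm (X n - l) * nm y) \<longlonglongrightarrow> 0" by simp
  moreover have "norm (H (X n) y - H l y) \<le> nm (X n - l) * nm y" for n
    using Cauchy_Schwarz[of "X n - l" y] c y unfolding conv_def by (simp add: Hsimps)
  ultimately have "(\<lambda>n. H (X n) y - H l y) \<longlonglongrightarrow> 0"
    by (rule null_sequence_bound[rotated])
  then show ?thesis by (simp add: LIM_zero_iff)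
qed

lemma conv_H2: "conv X l \<Longrightarrow> y \<in> V \<Longrightarrow> (\<lambda>n. H y (X n)) \<longlonglongrightarrow> H y l"
proof -
  assume c: "conv X l" and y: "y \<in> V"
  have "(\<lambda>n. cnj (H (X n) y)) \<longlonglongrightarrow> cnj (H l y)"
    using conv_H1[OF c y] by (intro tendsto_intros)
  then show ?thesis using c y unfolding conv_def by (simp add: Hcnj)
qed

lemma conv_nm: "conv X l \<Longrightarrow> (\<lambda>n. nm (X n)) \<longlonglongrightarrow> nm l"
proof -
  assume c: "conv X l"
  have "norm (nm (X n) - nm l) \<le> nm (X n - l)" for n
    using nm_le_diff[of "X n" l] nm_le_diff[of l "X n"] nm_minus_commute[of l "X n"] c
    unfolding conv_def by auto
  then have "(\<lambda>n. nm (X n) - nm l) \<longlonglongrightarrow> 0"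
    by (rule null_sequence_bound) (use c in \<open>simp add: conv_def\<close>)
  then show ?thesis by (simp add: LIM_zero_iff)
qed

lemma conv_add: "conv X l \<Longrightarrow> conv Y k \<Longrightarrow> conv (\<lambda>n. X n + Y n) (l + k)"
proof -
  assume c: "conv X l" "conv Y k"
  have "(\<lambda>n. nm (X n - l) + nm (Y n - k)) \<longlonglongrightarrow> 0 + 0"
    using c unfolding conv_def by (intro tendsto_intros) auto
  then have lim: "(\<lambda>n. nm (X n - l) + nm (Y n - k)) \<longlonglongrightarrow> 0" by simp
  have "norm (nm (X n + Y n - (l + k))) \<le> nm (X n - l) + nm (Y n - k)" for n
    using nm_triangle[of "X n - l" "Y n - k"] c unfolding conv_def
    by (auto simp: algebra_simps)
  then have "(\<lambda>n. nm (X n + Y n - (l + k))) \<longlonglongrightarrow> 0"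
    by (rule null_sequence_bound) (rule lim)
  then show ?thesis using c unfolding conv_def by auto
qed

lemma conv_scl: "conv X l \<Longrightarrow> conv (\<lambda>n. scl c (X n)) (scl c l)"
proof -
  assume c: "conv X l"
  have "(\<lambda>n. cmod c * nm (X n - l)) \<longlonglongrightarrow> cmod c * 0"
    using c unfolding conv_def by (intro tendsto_intros) auto
  then show ?thesis using c unfolding conv_def by (auto simp: scale_right_diff_distrib[symmetric])
qed

lemma conv_const: "l \<in> V \<Longrightarrow> conv (\<lambda>n. l) l"
  by (simp add: conv_def)

lemma conv_unique: "conv X l \<Longrightarrow> conv X k \<Longrightarrow> l = k"
proof -
  assume c: "conv X l" "conv X k"
  have lk: "l - k \<in> V" using c unfolding conv_def by auto
  have "H l (l - k) = H k (l - k)"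
    using conv_H1[OF c(1) lk] conv_H1[OF c(2) lk] LIMSEQ_unique by blast
  then have "H (l - k) (l - k) = 0" using c lk unfolding conv_def by (simp add: Hdiff1)
  then show ?thesis using H_eq0[OF lk] by simp
qed

text \<open>Minimising \<open>\<parallel>x\<parallel>\<^sup>2 - 2 Re l(x)\<close> over \<open>W\<close>: minimising sequences are Cauchy by the
  parallelogram law, and the limit represents \<open>l\<close>.\<close>

lemma Riesz_subspace:
  assumes W: "subspace W" "W \<subseteq> V"
    and l_add: "\<And>x y. x \<in> W \<Longrightarrow> y \<in> W \<Longrightarrow> l (x + y) = l x + l y"
    and l_scl: "\<And>c x. x \<in> W \<Longrightarrow> l (scl c x) = c * l x"
    and C: "0 \<le> C" and bd: "\<And>x. x \<in> W \<Longrightarrow> cmod (l x) \<le> C * nm x"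
  obtains g X where "g \<in> V" "\<And>x. x \<in> W \<Longrightarrow> l x = H x g" "nm g \<le> C" "\<And>n. X n \<in> W" "conv X g"
proof -
  define F where "F x = (nm x)\<^sup>2 - 2 * Re (l x)" for x
  have wV: "x \<in> V" if "x \<in> W" for x using W that by blast
  have lower: "- C\<^sup>2 \<le> F x" if "x \<in> W" for x
  proof -
    have "Re (l x) \<le> C * nm x" using bd[OF that] complex_Re_le_cmod[of "l x"] by linarith
    then have "F x \<ge> (nm x)\<^sup>2 - 2 * (C * nm x)" unfolding F_def by linarith
    moreover have "(nm x - C)\<^sup>2 \<ge> 0" by simp
    ultimately show ?thesis by (simp add: power2_diff algebra_simps)
  qed
  define m where "m = (INF x\<in>W. F x)"
  have bdd: "bdd_below (F ` W)" using lower by (intro bdd_belowI[of _ "- C\<^sup>2"]) auto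
  have ne: "W \<noteq> {}" using W subspace_0 by blast
  have mle: "m \<le> F x" if "x \<in> W" for x
    unfolding m_def by (rule cINF_lower[OF bdd that])
  have "\<exists>x\<in>W. F x < m + 1 / real (Suc n)" for n
    using cINF_less_iff[OF ne bdd, of "m + 1 / real (Suc n)"] by (simp add: m_def)
  then obtain X where X: "\<And>n. X n \<in> W" "\<And>n. F (X n) < m + 1 / real (Suc n)" by metis
  have par: "(nm (x - y))\<^sup>2 \<le> 2 * F x + 2 * F y - 4 * m" if "x \<in> W" "y \<in> W" for x y
  proof -
    define z where "z = scl (1 / 2) (x + y)"
    have z: "z \<in> W" unfolding z_def using W that subspace_add subspace_scale by blast
    have lz: "l z = (l x + l y) / 2" unfolding z_def using that W by (simp add: l_add l_scl subspace_add)
    moreover have "(nm z)\<^sup>2 = (nm (x + y))\<^sup>2 / 4"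
      unfolding z_def using that wV by (simp add: power_mult_distrib norm_divide power2_eq_square)
    ultimately have "(nm (x + y))\<^sup>2 / 4 - (Re (l x) + Re (l y)) \<ge> m"
      using mle[OF z] unfolding F_def lz by (simp add: field_simps)
    moreover have "b \<le> 2 * (n - 2 * r) + 2 * (p - 2 * s) - 4 * m"
      if "a / 4 - (r + s) \<ge> m" "a = n + 2 * q + p" "b = n - 2 * q + p" for a b n p q r s :: real
      using that by (simp add: field_simps)
    ultimately show ?thesis
      unfolding F_def using nm_add_sq[OF that[THEN wV]] nm_diff_sq[OF that[THEN wV]] by blast
  qed
  have "\<exists>N. \<forall>i\<ge>N. \<forall>j\<ge>N. nm (X i - X j) < e" if "e > 0" for e
  proof -
    obtain N where N: "4 / e\<^sup>2 < real N" using reals_Archimedean2 by blast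
    have "nm (X i - X j) < e" if ij: "i \<ge> N" "j \<ge> N" for i j
    proof -
      have N0: "real N > 0" using N \<open>e > 0\<close> by (smt (verit) divide_pos_pos zero_less_power)
      have "1 / real (Suc i) \<le> 1 / real N" "1 / real (Suc j) \<le> 1 / real N"
        using ij N0 by (simp_all add: field_simps)
      moreover have "4 / real N = 4 * (1 / real N)" by simp
      ultimately have "(nm (X i - X j))\<^sup>2 < 4 / real N"
        using par[OF X(1) X(1), of i j] X(2)[of i] X(2)[of j] by linarith
      also have "4 / real N < e\<^sup>2" using N N0 \<open>e > 0\<close> by (simp add: field_simps)
      finally show ?thesis using \<open>e > 0\<close> power_less_imp_less_base by fastforce
    qed
    then show ?thesis by blast
  qed
  then obtain g where g: "conv X g" using complete[of X] X(1) wV by blast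
  have gV: "g \<in> V" using g conv_def by blast
  have rep_re: "Re (l x) = Re (H x g)" if x: "x \<in> W" for x
  proof -
    \<comment> \<open>Compare the minimizing sequence with its perturbations by multiples of
      \<open>x\<close>. In the limit a quadratic polynomial in \<open>t\<close> without constant
      term stays nonnegative, which forces its linear coefficient \<open>d\<close> to
      vanish.\<close>
    have est: "(2 * t * (Re (H (X n) x) - Re (l x)) + t\<^sup>2 * (nm x)\<^sup>2) \<ge> - 1 / real (Suc n)" for t n
    proof -
      have "m \<le> F (X n + scl (of_real t) x)"
        using mle X(1) x W subspace_add subspace_scale by blast
      also have "\<dots> = F (X n) + 2 * t * (Re (H (X n) x) - Re (l x)) + t\<^sup>2 * (nm x)\<^sup>2"
        unfolding F_def using X(1) x W wV
        by (simp add: nm_add_sq Hsimps l_add l_scl subspace_scale power_mult_distrib algebra_simps)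
      finally show ?thesis using X(2)[of n] by simp
    qed
    have est': "0 \<le> 2 * t * (Re (H g x) - Re (l x)) + t\<^sup>2 * (nm x)\<^sup>2" for t
    proof (rule LIMSEQ_le)
      show "(\<lambda>n. - 1 / real (Suc n)) \<longlonglongrightarrow> 0"
        using tendsto_minus[OF LIMSEQ_inverse_real_of_nat] by (simp add: inverse_eq_divide)
      show "(\<lambda>n. 2 * t * (Re (H (X n) x) - Re (l x)) + t\<^sup>2 * (nm x)\<^sup>2)
         \<longlonglongrightarrow> 2 * t * (Re (H g x) - Re (l x)) + t\<^sup>2 * (nm x)\<^sup>2"
        using conv_H1[OF g wV[OF x]] by (intro tendsto_intros)
      show "\<exists>N. \<forall>n\<ge>N. - 1 / real (Suc n) \<le> 2 * t * (Re (H (X n) x) - Re (l x)) + t\<^sup>2 * (nm x)\<^sup>2"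
        using est by blast
    qed
    define d where "d = Re (H g x) - Re (l x)"
    have "d = 0"
    proof (rule ccontr)
      assume d: "d \<noteq> 0"
      \<comment> \<open>Adding 1 keeps the denominator of the test value \<open>- d / q\<close>
        positive even for \<open>x = 0\<close>.\<close>
      define q where "q = (nm x)\<^sup>2 + 1"
      have q: "q > 0" "(nm x)\<^sup>2 < q" by (auto simp: q_def add_nonneg_pos)
      have "0 \<le> 2 * (- d / q) * d + (- d / q)\<^sup>2 * (nm x)\<^sup>2" using est'[of "- d / q"] d_def by simp
      also have "\<dots> \<le> 2 * (- d / q) * d + (- d / q)\<^sup>2 * q"
        using q by (intro add_left_mono mult_left_mono) auto
      also have "\<dots> = - (d\<^sup>2 / q)" using q by (simp add: power2_eq_square field_simps)
      finally show False using q d by (smt (verit) divide_pos_pos zero_less_power2)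
    qed
    moreover have "Re (H g x) = Re (H x g)" using Hcnj[OF gV wV[OF x]] by (metis cnj.sel(1))
    ultimately show ?thesis by (simp add: d_def)
  qed
  have rep: "l x = H x g" if x: "x \<in> W" for x
  proof (rule complex_eqI)
    show "Re (l x) = Re (H x g)" by (rule rep_re[OF x])
    have "Re (l (scl (- \<i>) x)) = Re (H (scl (- \<i>) x) g)"
      using rep_re x W subspace_scale by blast
    then show "Im (l x) = Im (H x g)"
      using x wV gV l_scl[of x "- \<i>"] Hscl1[of x g "- \<i>"] by simp
  qed
  \<comment> \<open>The bound on \<open>g\<close> is inherited from the minimizing sequence, along
    which \<open>l\<close> converges to \<open>H g g\<close>.\<close>
  have "(\<lambda>n. cmod (l (X n))) \<longlonglongrightarrow> cmod (H g g)"
    using tendsto_norm[OF conv_H1[OF g gV]] X(1) rep by simp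
  moreover have "(\<lambda>n. C * nm (X n)) \<longlonglongrightarrow> C * nm g"
    using conv_nm[OF g] by (intro tendsto_intros)
  ultimately have "cmod (H g g) \<le> C * nm g"
    by (rule LIMSEQ_le) (use bd X(1) in blast)
  then have "nm g * nm g \<le> C * nm g" using gV by (simp add: Hself power2_eq_square norm_mult)
  then have "nm g \<le> C" using nm_nonneg[OF gV] C
    by (metis mult_right_le_imp_le order_le_less)
  then show thesis using that gV rep X(1) g by blast
qed

end

section \<open>Bounded operators on a Hilbert space\<close>

locale hilbU = hilb scl UNIV H for scl :: "complex \<Rightarrow> 'a::ab_group_add \<Rightarrow> 'a" and H
begin

abbreviation "bop \<equiv> bounded_op scl H"

definition comm :: "('a \<Rightarrow> 'a) \<Rightarrow> ('a \<Rightarrow> 'a) \<Rightarrow> bool" where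
  "comm X Y \<longleftrightarrow> (\<forall>x. X (Y x) = Y (X x))"

definition saop :: "('a \<Rightarrow> 'a) \<Rightarrow> bool" where
  "saop X \<longleftrightarrow> bop X \<and> (\<forall>x y. H (X x) y = H x (X y))"

definition posop :: "('a \<Rightarrow> 'a) \<Rightarrow> bool" where
  "posop X \<longleftrightarrow> saop X \<and> (\<forall>x. 0 \<le> Re (H (X x) x))"

lemma bopI:
  assumes "\<And>x y. X (x + y) = X x + X y" "\<And>c x. X (scl c x) = scl c (X x)" "\<And>x. nm (X x) \<le> C * nm x"
  shows "bop X"
proof -
  have "Vector_Spaces.linear scl scl X"
    by unfold_locales (use assms in auto)
  then show ?thesis using assms(3) unfolding bounded_op_def by blast
qed

lemma
  assumes "bop X"
  shows bop_add: "X (x + y) = X x + X y" and bop_scl: "X (scl c x) = scl c (X x)"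
proof -
  interpret L: Vector_Spaces.linear scl scl X using assms unfolding bounded_op_def by blast
  show "X (x + y) = X x + X y" "X (scl c x) = scl c (X x)" by (simp_all add: L.add L.scale)
qed

lemma bop_0: "bop X \<Longrightarrow> X 0 = 0"
  using bop_scl[of X 0 0] by simp

lemma bop_neg: "bop X \<Longrightarrow> X (- x) = - X x"
  using bop_scl[of X "-1" x] by simp

lemma bop_diff: "bop X \<Longrightarrow> X (x - y) = X x - X y"
  using bop_add[of X x "- y"] bop_neg[of X y] by simp

lemmas bop_lin = bop_add bop_scl bop_0 bop_neg bop_diff

lemma bop_bound:
  assumes "bop X" obtains C where "C > 0" "\<And>x. nm (X x) \<le> C * nm x"
proof -
  obtain C where C: "\<And>x. nm (X x) \<le> C * nm x" using assms unfolding bounded_op_def by blast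
  have "nm (X x) \<le> (max C 0 + 1) * nm x" for x
    using C[of x] by (smt (verit) UNIV_I mult_right_mono nm_nonneg)
  then show thesis using that[of "max C 0 + 1"] by fastforce
qed

lemma bop_id: "bop (\<lambda>x. x)"
  by (rule bopI[of _ 1]) auto

lemma bop_zero: "bop (\<lambda>x. 0)"
  by (rule bopI[of _ 0]) auto

lemma bop_sum: assumes "bop X" "bop Y" shows "bop (\<lambda>x. X x + Y x)"
proof -
  obtain C D where CD: "\<And>x. nm (X x) \<le> C * nm x" "\<And>x. nm (Y x) \<le> D * nm x"
    using assms bop_bound by metis
  show ?thesis
  proof (rule bopI)
    show "nm (X x + Y x) \<le> (C + D) * nm x" for x
      using nm_triangle[of "X x" "Y x"] CD(1)[of x] CD(2)[of x] by (simp add: algebra_simps)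
  qed (use assms in \<open>simp_all add: bop_lin scale_right_distrib algebra_simps\<close>)
qed

lemma bop_scale: assumes "bop X" shows "bop (\<lambda>x. scl c (X x))"
proof -
  obtain C where C: "\<And>x. nm (X x) \<le> C * nm x" using assms bop_bound by metis
  show ?thesis
  proof (rule bopI)
    show "nm (scl c (X x)) \<le> (cmod c * C) * nm x" for x
      using C[of x] by (simp add: mult.assoc mult_left_mono)
  qed (use assms in \<open>simp_all add: bop_lin scale_right_distrib mult.commute\<close>)
qed

lemma bop_minus: assumes "bop X" "bop Y" shows "bop (\<lambda>x. X x - Y x)"
  using bop_sum[OF assms(1) bop_scale[OF assms(2), of "-1"]] by simp

lemma bop_comp: assumes "bop X" "bop Y" shows "bop (\<lambda>x. X (Y x))"
proof -
  obtain C D where CD: "C > 0" "\<And>x. nm (X x) \<le> C * nm x" "\<And>x. nm (Y x) \<le> D * nm x"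
    using assms bop_bound by metis
  show ?thesis
  proof (rule bopI)
    show "nm (X (Y x)) \<le> (C * D) * nm x" for x
      using order_trans[OF CD(2)[of "Y x"] mult_left_mono[OF CD(3)[of x] less_imp_le[OF CD(1)]]]
      by (simp add: mult.assoc)
  qed (use assms in \<open>simp_all add: bop_lin\<close>)
qed

lemmas bops = bop_id bop_zero bop_sum bop_scale bop_minus

lemma bop_conv: assumes "bop X" "conv Z l" shows "conv (\<lambda>n. X (Z n)) (X l)"
proof -
  obtain C where C: "\<And>x. nm (X x) \<le> C * nm x" using assms bop_bound by metis
  have "(\<lambda>n. C * nm (Z n - l)) \<longlonglongrightarrow> C * 0"
    using assms(2) unfolding conv_def by (intro tendsto_intros) auto
  then have lim: "(\<lambda>n. C * nm (Z n - l)) \<longlonglongrightarrow> 0" by simp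
  have "norm (nm (X (Z n) - X l)) \<le> C * nm (Z n - l)" for n
    using C[of "Z n - l"] assms(1) by (simp add: bop_lin)
  then have "(\<lambda>n. nm (X (Z n) - X l)) \<longlonglongrightarrow> 0"
    by (rule null_sequence_bound) (rule lim)
  then show ?thesis by (simp add: conv_def)
qed

lemma H_eqI: "(\<And>y. H x y = H x' y) \<Longrightarrow> x = x'"
  using H_eq0[of "x - x'"] by (simp add: Hsimps)

lemma H_eqI2: "(\<And>y. H y x = H y x') \<Longrightarrow> x = x'"
  using H_eq0[of "x - x'"] by (simp add: Hsimps)

lemma adjoint_exists:
  assumes "bop X" obtains Y where "bop Y" "\<And>x y. H (X x) y = H x (Y y)"
proof -
  obtain C where C: "C > 0" "\<And>x. nm (X x) \<le> C * nm x" using assms bop_bound by metis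
  have "\<exists>g. (\<forall>x. H (X x) y = H x g) \<and> nm g \<le> C * nm y" for y
  proof -
    have "cmod (H (X x) y) \<le> (C * nm y) * nm x" for x
      using Cauchy_Schwarz[of "X x" y] mult_right_mono[OF C(2)[of x], of "nm y"]
      by (simp add: mult_ac)
    moreover have "0 \<le> C * nm y" using C(1) by simp
    ultimately obtain g where "\<And>x. x \<in> UNIV \<Longrightarrow> H (X x) y = H x g" "nm g \<le> C * nm y"
      by (rule_tac Riesz_subspace[of UNIV "\<lambda>x. H (X x) y" "C * nm y"])
        (simp_all add: subV bop_lin[OF assms] Hsimps)
    then show ?thesis by blast
  qed
  then obtain Y where Y: "\<And>x y. H (X x) y = H x (Y y)" "\<And>y. nm (Y y) \<le> C * nm y" by metis
  have "bop Y"
  proof (rule bopI[of _ C])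
    show "Y (x + y) = Y x + Y y" for x y
      by (rule H_eqI2) (simp add: Hsimps flip: Y(1))
    show "Y (scl c x) = scl c (Y x)" for c x
      by (rule H_eqI2) (simp add: Hsimps flip: Y(1))
  qed (rule Y(2))
  then show thesis using that Y(1) by blast
qed

lemma saop_bop: "saop X \<Longrightarrow> bop X"
  by (simp add: saop_def)

lemma saopH: "saop X \<Longrightarrow> H (X x) y = H x (X y)"
  by (simp add: saop_def)

lemma posop_saop: "posop X \<Longrightarrow> saop X" and posop_ge: "posop X \<Longrightarrow> 0 \<le> Re (H (X x) x)"
  by (simp_all add: posop_def)

lemma saop_id: "saop (\<lambda>x. x)" and saop_zero: "saop (\<lambda>x. 0)"
  by (simp_all add: saop_def bops Hsimps)

lemma saop_sum: "saop X \<Longrightarrow> saop Y \<Longrightarrow> saop (\<lambda>x. X x + Y x)"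
  and saop_minus: "saop X \<Longrightarrow> saop Y \<Longrightarrow> saop (\<lambda>x. X x - Y x)"
  and saop_scale: "saop X \<Longrightarrow> saop (\<lambda>x. scl (of_real r) (X x))"
  by (simp_all add: saop_def bops Hsimps)

lemma saop_comp: "saop X \<Longrightarrow> saop Y \<Longrightarrow> comm X Y \<Longrightarrow> saop (\<lambda>x. X (Y x))"
  unfolding saop_def comm_def by (metis bop_comp)

lemmas saops = saop_id saop_zero saop_sum saop_minus saop_scale

lemma comm_sym: "comm X Y \<Longrightarrow> comm Y X"
  by (simp add: comm_def)

lemma comm_self: "comm X X" and comm_id: "comm X (\<lambda>x. x)"
  by (simp_all add: comm_def)

lemma comm_sum: "bop X \<Longrightarrow> comm X Y \<Longrightarrow> comm X Z \<Longrightarrow> comm X (\<lambda>x. Y x + Z x)"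
  and comm_minus: "bop X \<Longrightarrow> comm X Y \<Longrightarrow> comm X Z \<Longrightarrow> comm X (\<lambda>x. Y x - Z x)"
  and comm_scale: "bop X \<Longrightarrow> comm X Y \<Longrightarrow> comm X (\<lambda>x. scl c (Y x))"
  and comm_zero: "bop X \<Longrightarrow> comm X (\<lambda>x. 0)"
  by (simp_all add: comm_def bop_lin)

lemmas comms = comm_sum comm_minus comm_scale comm_id comm_zero

lemma posop_CS:
  assumes "posop X" shows "(cmod (H (X x) y))\<^sup>2 \<le> Re (H (X x) x) * Re (H (X y) y)"
proof (rule semi_Cauchy_Schwarz[OF vector_space_axioms subV])
  have X: "bop X" "\<And>x y. H (X x) y = H x (X y)" using assms unfolding posop_def saop_def by blast+
  show "sesquilinear_on scl UNIV (\<lambda>x y. H (X x) y)"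
    unfolding sesquilinear_on_def using X(1) by (simp add: bop_lin Hsimps)
  show "hermitian_on UNIV (\<lambda>x y. H (X x) y)"
    unfolding hermitian_on_def using X by (simp add: Hcnj)
qed (use assms in \<open>auto simp: posop_def\<close>)

text \<open>Apply Cauchy-Schwarz for the form \<open>H (X x) y\<close> to \<open>x\<close> and
  \<open>X x\<close>. This is how form bounds become norm bounds throughout, in particular for
  \<open>J P\<close> with a definite projection \<open>P\<close>.\<close>

lemma posop_nm:
  assumes X: "posop X" and C: "\<And>x. nm (X x) \<le> C * nm x"
  shows "(nm (X x))\<^sup>2 \<le> C * Re (H (X x) x)"
proof (cases "nm (X x) = 0")
  case True
  have "C \<ge> 0 \<or> nm x = 0"
    using C[of x] True nm_pos[of x] by (auto simp: zero_le_mult_iff)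
  then show ?thesis using True posop_ge[OF X, of x] nm_eq_0[of x]
    by (auto simp: H02)
next
  case False
  then have p: "nm (X x) > 0" by (simp add: nm_pos)
  have "(cmod (H (X x) (X x)))\<^sup>2 \<le> Re (H (X x) x) * Re (H (X (X x)) (X x))" by (rule posop_CS[OF X])
  also have "Re (H (X (X x)) (X x)) \<le> C * nm (X x) * nm (X x)"
    using ReH_le[of "X (X x)" "X x"] mult_right_mono[OF C[of "X x"], of "nm (X x)"] by simp
  also have "cmod (H (X x) (X x)) = nm (X x) * nm (X x)" by (simp add: Hself power2_eq_square norm_mult)
  finally have "(nm (X x) * nm (X x))\<^sup>2 \<le> Re (H (X x) x) * (C * nm (X x) * nm (X x))"
    using posop_ge[OF X, of x] by (simp add: mult_left_mono)
  then have "(nm (X x))\<^sup>2 * (nm (X x))\<^sup>2 \<le> (C * Re (H (X x) x)) * (nm (X x))\<^sup>2"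
    by (simp add: power2_eq_square algebra_simps)
  then show ?thesis by (rule mult_right_le_imp_le) (use p in simp)
qed

lemma posop_eq0: "posop X \<Longrightarrow> Re (H (X x) x) \<le> 0 \<Longrightarrow> X x = 0"
proof -
  assume X: "posop X" "Re (H (X x) x) \<le> 0"
  obtain C where C: "\<And>x. nm (X x) \<le> C * nm x" using X bop_bound[of X] unfolding posop_def saop_def by metis
  have "(nm (X x))\<^sup>2 \<le> 0" using posop_nm[OF X(1) C, of x] X posop_ge[OF X(1), of x]
    by (smt (verit) mult_eq_0_iff)
  then show ?thesis using nm_eq_0[of "X x"] by simp
qed

lemma posop_bound:
  assumes X: "posop X" and C: "C \<ge> 0" "\<And>x. Re (H (X x) x) \<le> C * (nm x)\<^sup>2"
  shows "nm (X x) \<le> C * nm x"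
proof (cases "nm (X x) = 0")
  case True
  then show ?thesis using C by simp
next
  case False
  then have p: "nm (X x) > 0" by (simp add: nm_pos)
  have "(cmod (H (X x) (X x)))\<^sup>2 \<le> Re (H (X x) x) * Re (H (X (X x)) (X x))" by (rule posop_CS[OF X])
  also have "\<dots> \<le> (C * (nm x)\<^sup>2) * (C * (nm (X x))\<^sup>2)"
    using C posop_ge[OF X] by (intro mult_mono) auto
  also have "cmod (H (X x) (X x)) = (nm (X x))\<^sup>2" by (simp add: Hself norm_power)
  finally have "(nm (X x))\<^sup>2 * (nm (X x))\<^sup>2 \<le> (C * nm x)\<^sup>2 * (nm (X x))\<^sup>2"
    by (simp add: power2_eq_square algebra_simps)
  then have "(nm (X x))\<^sup>2 \<le> (C * nm x)\<^sup>2" by (rule mult_right_le_imp_le) (use p in simp)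
  then show ?thesis by (rule power2_le_imp_le) (use C in simp)
qed

lemma ReH_form_bound: "(\<And>x. nm (X x) \<le> C * nm x) \<Longrightarrow> Re (H (X x) x) \<le> C * (nm x)\<^sup>2"
  using ReH_le[of "X x" x] mult_right_mono[of "nm (X x)" "C * nm x" "nm x"]
  by (simp add: power2_eq_square mult.assoc)

subsection \<open>Square roots\<close>

text \<open>An inductive closure instead of lists of coefficients: commutation, symmetry and
  positivity all pass through the formation rules.\<close>

inductive nonneg_poly :: "('a \<Rightarrow> 'a) \<Rightarrow> ('a \<Rightarrow> 'a) \<Rightarrow> bool" for Z where
  np_id: "nonneg_poly Z (\<lambda>x. x)"
| np_scale: "nonneg_poly Z W \<Longrightarrow> 0 \<le> r \<Longrightarrow> nonneg_poly Z (\<lambda>x. scl (of_real r) (W x))"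
| np_add: "nonneg_poly Z W \<Longrightarrow> nonneg_poly Z W' \<Longrightarrow> nonneg_poly Z (\<lambda>x. W x + W' x)"
| np_mult: "nonneg_poly Z W \<Longrightarrow> nonneg_poly Z (\<lambda>x. Z (W x))"

lemma np_comm:
  assumes "bop Y" "comm Y Z" "nonneg_poly Z W" shows "comm Y W"
  using assms(3) by induction (use assms in \<open>auto simp: comm_def bop_lin\<close>)

lemma np_bop: "nonneg_poly Z W \<Longrightarrow> bop Z \<Longrightarrow> bop W"
  by (induction rule: nonneg_poly.induct) (auto intro: bop_id bop_scale bop_sum bop_comp)

lemma np_comp:
  assumes "nonneg_poly Z W'" "nonneg_poly Z W" shows "nonneg_poly Z (\<lambda>x. W (W' x))"
  using assms(2) by induction (auto intro: nonneg_poly.intros assms(1))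

lemma np_saop:
  assumes Z: "saop Z" shows "nonneg_poly Z W \<Longrightarrow> saop W"
proof (induction rule: nonneg_poly.induct)
  case (np_mult W)
  have "comm Z W" by (rule np_comm[OF saop_bop[OF Z] comm_self np_mult(1)])
  then show ?case using saop_comp[OF Z np_mult(2)] by simp
qed (auto intro: saops)

text \<open>The second conjunct keeps the induction going: in \<open>Z (Z W)\<close> one factor
  \<open>Z\<close> moves to the other argument and leaves \<open>W\<close> evaluated at
  \<open>Z x\<close>. Positivity of products of commuting positive operators is thus not
  presupposed; it is derived later from square roots.\<close>

lemma np_pos:
  assumes Z: "posop Z" shows "nonneg_poly Z W \<Longrightarrow> (\<forall>x. 0 \<le> Re (H (W x) x)) \<and> (\<forall>x. 0 \<le> Re (H (Z (W x)) x))"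
proof (induction rule: nonneg_poly.induct)
  case np_id
  then show ?case using posop_ge[OF Z] by (simp add: ReHself)
next
  case (np_mult W)
  have sa: "saop Z" by (rule posop_saop[OF Z])
  have "comm Z W" by (rule np_comm[OF saop_bop[OF sa] comm_self np_mult(1)])
  then have "H (Z (Z (W x))) x = H (W (Z x)) (Z x)" for x
    using saopH[OF sa, of "Z (W x)" x] by (simp add: comm_def)
  then show ?case using np_mult(2) by simp
qed (use saop_bop[OF posop_saop[OF Z]] in \<open>auto simp: Hsimps bop_lin\<close>)

lemma np_posop: "posop Z \<Longrightarrow> nonneg_poly Z W \<Longrightarrow> posop W"
  using np_saop[OF posop_saop] np_pos unfolding posop_def by blast

text \<open>With \<open>Z = 1 - X\<close>, the iteration \<open>W \<mapsto> (Z + W\<^sup>2) / 2\<close> started at \<open>0\<close> increases to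
  \<open>1 - X\<^sup>1\<^sup>/\<^sup>2\<close>, since its increments are polynomials in \<open>Z\<close> with nonnegative coefficients.\<close>

primrec sqrt_iter :: "('a \<Rightarrow> 'a) \<Rightarrow> nat \<Rightarrow> 'a \<Rightarrow> 'a" where
  "sqrt_iter Z 0 = (\<lambda>x. 0)"
| "sqrt_iter Z (Suc n) = (\<lambda>x. scl (1 / 2) (Z x + sqrt_iter Z n (sqrt_iter Z n x)))"

lemma np_zero: "nonneg_poly Z (\<lambda>x. 0)"
  using np_scale[OF np_id, of 0 Z] by simp

lemma np_half: "nonneg_poly Z W \<Longrightarrow> nonneg_poly Z (\<lambda>x. scl (1 / 2) (W x))"
  using np_scale[of Z W "1 / 2"] by simp

lemma sqrt_iter_np: "nonneg_poly Z (sqrt_iter Z n)"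
proof (induction n)
  case (Suc n)
  have "nonneg_poly Z (\<lambda>x. Z x + sqrt_iter Z n (sqrt_iter Z n x))"
    by (rule np_add[OF np_mult[OF np_id] np_comp[OF Suc Suc]])
  then show ?case using np_half by simp
qed (simp add: np_zero)

text \<open>Consecutive iterates \<open>W\<close>, \<open>W'\<close>, \<open>W''\<close> satisfy
  \<open>W'' - W' = (W' - W) (W' + W) / 2\<close>, a product of polynomials with nonnegative
  coefficients.\<close>

lemma sqrt_iter_incr:
  assumes Z: "saop Z" shows "nonneg_poly Z (\<lambda>x. sqrt_iter Z (Suc n) x - sqrt_iter Z n x)"
proof (induction n)
  case 0
  then show ?case using np_half[OF np_mult[OF np_id]] by (simp add: bop_0[OF saop_bop[OF Z]])
next
  case (Suc n)
  let ?a = "sqrt_iter Z (Suc n)" and ?b = "sqrt_iter Z n"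
  have bo: "bop ?a" "bop ?b" using np_bop[OF sqrt_iter_np] saop_bop[OF Z] by blast+
  have cm: "?a (?b x) = ?b (?a x)" for x
    using np_comm[OF bo(1) comm_sym[OF np_comm[OF saop_bop[OF Z] comm_self sqrt_iter_np]] sqrt_iter_np]
    unfolding comm_def by blast
  have "nonneg_poly Z (\<lambda>x. scl (1 / 2) ((\<lambda>x. ?a x - ?b x) (?a x + ?b x)))"
    by (intro np_half np_comp[OF _ Suc] np_add sqrt_iter_np)
  moreover have "scl (1 / 2) (?a (?a x + ?b x) - ?b (?a x + ?b x)) = sqrt_iter Z (Suc (Suc n)) x - ?a x" for x
  proof -
    have "?a (?a x + ?b x) - ?b (?a x + ?b x) = (Z x + ?a (?a x)) - (Z x + ?b (?b x))"
      by (simp only: bop_add[OF bo(1)] bop_add[OF bo(2)] cm) (simp add: algebra_simps)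
    then have "scl (1 / 2) (?a (?a x + ?b x) - ?b (?a x + ?b x))
        = scl (1 / 2) (Z x + ?a (?a x)) - scl (1 / 2) (Z x + ?b (?b x))"
      by (simp only: scale_right_diff_distrib)
    then show ?thesis unfolding sqrt_iter.simps .
  qed
  ultimately show ?case by simp
qed

lemma sqrt_iter_bound:
  assumes "\<And>x. nm (Z x) \<le> nm x" shows "nm (sqrt_iter Z n x) \<le> nm x"
proof (induction n arbitrary: x)
  case (Suc n)
  have "nm (sqrt_iter Z (Suc n) x) \<le> (nm (Z x) + nm (sqrt_iter Z n (sqrt_iter Z n x))) / 2"
    using nm_triangle[of "Z x" "sqrt_iter Z n (sqrt_iter Z n x)"] by simp
  then show ?case using assms[of x] Suc[of "sqrt_iter Z n x"] Suc[of x] by argo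
qed simp

text \<open>Differences of iterates are positive operators of norm at most 2, so
  \<open>posop_nm\<close> turns convergence of the monotone bounded forms into convergence in norm
  at each vector.\<close>

lemma sqrt_fixpoint:
  assumes Z: "posop Z" and Zb: "\<And>x. nm (Z x) \<le> nm x"
  obtains W where "saop W" "\<And>x. nm (W x) \<le> nm x" "\<And>x. scl 2 (W x) = Z x + W (W x)"
    "\<And>Y. bop Y \<Longrightarrow> comm Y Z \<Longrightarrow> comm Y W"
proof -
  let ?W = "sqrt_iter Z"
  have sa: "saop Z" by (rule posop_saop[OF Z])
  have boW: "bop (?W n)" and saW: "saop (?W n)" for n
    using np_saop[OF sa sqrt_iter_np] saop_bop by blast+
  note Wb = sqrt_iter_bound[of Z, OF Zb]
  have np_d: "nonneg_poly Z (\<lambda>x. ?W (n + k) x - ?W n x)" for n k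
  proof (induction k)
    case (Suc k)
    have "nonneg_poly Z (\<lambda>x. (?W (Suc (n + k)) x - ?W (n + k) x) + (?W (n + k) x - ?W n x))"
      by (rule np_add[OF sqrt_iter_incr[OF sa] Suc])
    then show ?case by simp
  qed (simp add: np_zero)
  have est: "(nm (?W m x - ?W n x))\<^sup>2 \<le> 2 * (Re (H (?W m x) x) - Re (H (?W n x) x))" if "n \<le> m" for m n x
  proof -
    have ps: "posop (\<lambda>x. ?W m x - ?W n x)" using np_posop[OF Z np_d[of n "m - n"]] that by simp
    have "nm (?W m x - ?W n x) \<le> 2 * nm x" for x
      using nm_triangle_diff[of "?W m x" "?W n x"] Wb[of m x] Wb[of n x] by simp
    from posop_nm[OF ps this, of x] show ?thesis by (simp add: Hsimps)
  qed
  have "\<exists>l. conv (\<lambda>n. ?W n x) l" for x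
  proof -
    define a where "a n = Re (H (?W n x) x)" for n
    have mono: "a n \<le> a m" if "n \<le> m" for n m
      using est[OF that, of x] zero_le_power2[of "nm (?W m x - ?W n x)"] unfolding a_def by argo
    have bd: "a n \<le> nm x * nm x" for n
      unfolding a_def using ReH_le[of "?W n x" x] mult_right_mono[OF Wb[of n x], of "nm x"] by simp
    have "incseq a" by (rule incseq_SucI) (rule mono, simp)
    then obtain l where "a \<longlonglongrightarrow> l" by (rule incseq_convergent[where B="nm x * nm x"]) (use bd in blast)
    then have ca: "Cauchy a" by (rule LIMSEQ_imp_Cauchy)
    have "\<exists>N. \<forall>m\<ge>N. \<forall>n\<ge>N. nm (?W m x - ?W n x) < e" if "e > 0" for e
    proof -
      have "e\<^sup>2 / 2 > 0" using that by simp
      then obtain N where N: "\<And>m n. m \<ge> N \<Longrightarrow> n \<ge> N \<Longrightarrow> dist (a m) (a n) < e\<^sup>2 / 2"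
        using ca unfolding Cauchy_def by meson
      have "nm (?W m x - ?W n x) < e" if mn: "m \<ge> N" "n \<ge> N" for m n
      proof -
        have "(nm (?W m x - ?W n x))\<^sup>2 \<le> 2 * \<bar>a m - a n\<bar>"
        proof (cases "n \<le> m")
          case True
          then show ?thesis using est[OF True, of x] unfolding a_def by (smt (verit))
        next
          case False
          then have "m \<le> n" by simp
          then show ?thesis using est[of m n x] nm_minus_commute[of "?W m x" "?W n x"] unfolding a_def by (smt (verit) UNIV_I)
        qed
        also have "\<dots> < e\<^sup>2" using N[OF mn] by (simp add: dist_real_def)
        finally show ?thesis using \<open>e > 0\<close> by (simp add: power_less_imp_less_base)
      qed
      then show ?thesis by blast
    qed
    then show ?thesis using complete[of "\<lambda>n. ?W n x"] by blast
  qed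
  then obtain W where W: "\<And>x. conv (\<lambda>n. ?W n x) (W x)" by metis
  have Wnm: "nm (W x) \<le> nm x" for x
    by (rule LIMSEQ_le_const2[OF conv_nm[OF W]]) (use Wb in blast)
  have boWW: "bop W"
  proof (rule bopI[of _ 1])
    show "W (x + y) = W x + W y" for x y
      using conv_unique[OF W conv_add[OF W W, of x y, unfolded bop_add[OF boW, symmetric]]] .
    show "W (scl c x) = scl c (W x)" for c x
      using conv_unique[OF W conv_scl[OF W, of c x, unfolded bop_scl[OF boW, symmetric]]] .
  qed (use Wnm in simp)
  have saWW: "saop W"
  proof -
    have "H (W x) y = H x (W y)" for x y
    proof (rule LIMSEQ_unique)
      show "(\<lambda>n. H (?W n x) y) \<longlonglongrightarrow> H (W x) y" by (rule conv_H1[OF W]) simp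
      show "(\<lambda>n. H (?W n x) y) \<longlonglongrightarrow> H x (W y)"
        using conv_H2[OF W, of x y] by (simp add: saopH[OF saW])
    qed
    then show ?thesis using boWW by (simp add: saop_def)
  qed
  have sq: "conv (\<lambda>n. ?W n (?W n x)) (W (W x))" for x
  proof -
    have "(\<lambda>n. nm (?W n x - W x) + nm (?W n (W x) - W (W x))) \<longlonglongrightarrow> 0 + 0"
      using W[of x] W[of "W x"] unfolding conv_def by (intro tendsto_intros) auto
    then have lim: "(\<lambda>n. nm (?W n x - W x) + nm (?W n (W x) - W (W x))) \<longlonglongrightarrow> 0" by simp
    have "norm (nm (?W n (?W n x) - W (W x))) \<le> nm (?W n x - W x) + nm (?W n (W x) - W (W x))" for n
      using nm_triangle3[of "?W n (?W n x)" "?W n (W x)" "W (W x)"] Wb[of n "?W n x - W x"]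
      by (simp add: bop_diff[OF boW])
    then have "(\<lambda>n. nm (?W n (?W n x) - W (W x))) \<longlonglongrightarrow> 0"
      by (rule null_sequence_bound) (rule lim)
    then show ?thesis by (simp add: conv_def)
  qed
  have fix_eq: "scl 2 (W x) = Z x + W (W x)" for x
  proof -
    have "conv (\<lambda>n. ?W (Suc n) x) (W x)"
      using W[of x] LIMSEQ_Suc unfolding conv_def by fast
    moreover have "conv (\<lambda>n. ?W (Suc n) x) (scl (1 / 2) (Z x + W (W x)))"
      unfolding sqrt_iter.simps by (intro conv_scl conv_add conv_const sq) simp
    ultimately have "W x = scl (1 / 2) (Z x + W (W x))" by (rule conv_unique)
    then have "scl 2 (W x) = scl 2 (scl (1 / 2) (Z x + W (W x)))" by simp
    then show ?thesis by simp
  qed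
  have "comm Y W" if Y: "bop Y" "comm Y Z" for Y
  proof -
    have "Y (W x) = W (Y x)" for x
    proof (rule conv_unique)
      show "conv (\<lambda>n. Y (?W n x)) (Y (W x))" by (rule bop_conv[OF Y(1) W])
      show "conv (\<lambda>n. Y (?W n x)) (W (Y x))"
        using W[of "Y x"] np_comm[OF Y sqrt_iter_np] by (simp add: comm_def)
    qed
    then show ?thesis by (simp add: comm_def)
  qed
  then show thesis using that[OF saWW Wnm fix_eq] by blast
qed

lemma sqrt_exists:
  assumes X: "posop X"
  obtains Y where "posop Y" "\<And>x. Y (Y x) = X x" "\<And>Z. bop Z \<Longrightarrow> comm Z X \<Longrightarrow> comm Z Y"
proof -
  have sa: "saop X" and bo: "bop X" using X saop_bop posop_saop by blast+
  obtain C where C: "C > 0" "\<And>x. nm (X x) \<le> C * nm x" using bop_bound[OF bo] by metis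
  \<comment> \<open>Scaling by \<open>C\<close> makes \<open>Z\<close> a positive contraction. The
    fixed point equation \<open>2 W = Z + W W\<close> says
    \<open>(1 - W)^2 = 1 - Z = X / C\<close>.\<close>
  define Z where "Z = (\<lambda>x. x - scl (of_real (1 / C)) (X x))"
  have Zq: "Re (H (Z x) x) = (nm x)\<^sup>2 - Re (H (X x) x) / C" for x
    by (simp add: Z_def Hsimps ReHself)
  have "posop Z"
    unfolding posop_def
  proof (intro conjI allI)
    show "saop Z" unfolding Z_def by (intro saops sa)
    show "0 \<le> Re (H (Z x) x)" for x
      using ReH_form_bound[of X C x, OF C(2)] C(1) by (simp add: Zq field_simps)
  qed
  moreover have "nm (Z x) \<le> nm x" for x
    using posop_bound[OF \<open>posop Z\<close>, of 1 x] posop_ge[OF X] C(1) by (simp add: Zq)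
  ultimately obtain W where W: "saop W" "\<And>x. nm (W x) \<le> nm x" "\<And>x. scl 2 (W x) = Z x + W (W x)"
      "\<And>Y. bop Y \<Longrightarrow> comm Y Z \<Longrightarrow> comm Y W"
    using sqrt_fixpoint[of Z] by metis
  have boW: "bop W" by (rule saop_bop[OF W(1)])
  define Y where "Y = (\<lambda>x. scl (of_real (sqrt C)) (x - W x))"
  have "posop Y"
    unfolding posop_def
  proof (intro conjI allI)
    show "saop Y" unfolding Y_def by (intro saops W(1))
    show "0 \<le> Re (H (Y x) x)" for x
      using ReH_form_bound[of W 1 x] W(2) C(1) by (simp add: Y_def Hsimps ReHself)
  qed
  moreover have "Y (Y x) = X x" for x
  proof -
    let ?s = "complex_of_real (sqrt C)"
    define u where "u = x - W x"
    have s: "?s * ?s = of_real C" "complex_of_real C * of_real (1 / C) = 1"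
      using C(1) by (simp_all flip: of_real_mult)
    have "u - W u = x - scl 2 (W x) + W (W x)"
      using scale_left_distrib[of 1 1 "W x"] by (simp add: bop_lin[OF boW] u_def)
    also have "\<dots> = scl (of_real (1 / C)) (X x)" unfolding W(3) by (simp add: Z_def)
    finally have u: "u - W u = scl (of_real (1 / C)) (X x)" .
    have "Y (Y x) = scl ?s (scl ?s u - W (scl ?s u))" by (simp only: Y_def u_def)
    also have "\<dots> = scl ?s (scl ?s (u - W u))" by (simp only: bop_scl[OF boW] scale_right_diff_distrib)
    also have "\<dots> = scl (of_real C) (u - W u)" by (simp only: scale_scale s(1))
    also have "\<dots> = X x" by (simp only: u scale_scale s(2) scale_one)
    finally show ?thesis .
  qed
  moreover have "comm V Y" if V: "bop V" "comm V X" for V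
  proof -
    have "comm V Z" unfolding Z_def by (intro comms V)
    then have "comm V W" using W(4) V(1) by blast
    then show ?thesis unfolding Y_def by (intro comms V)
  qed
  ultimately show thesis using that by blast
qed

text \<open>A square root \<open>R\<close> of \<open>X\<close> commutes with \<open>Y\<close>, hence
  \<open>H (X (Y x)) x = H (Y (R x)) (R x)\<close>.\<close>

lemma posop_comp:
  assumes X: "posop X" and Y: "posop Y" and c: "comm X Y" shows "posop (\<lambda>x. X (Y x))"
proof -
  obtain R where R: "posop R" "\<And>x. R (R x) = X x" "\<And>Z. bop Z \<Longrightarrow> comm Z X \<Longrightarrow> comm Z R"
    using sqrt_exists[OF X] by metis
  have cR: "R (Y x) = Y (R x)" for x
    using R(3)[OF saop_bop[OF posop_saop[OF Y]] comm_sym[OF c]] by (simp add: comm_def)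
  have "H (X (Y x)) x = H (Y (R x)) (R x)" for x
  proof -
    have "H (X (Y x)) x = H (R (R (Y x))) x" by (simp only: R(2))
    also have "\<dots> = H (R (Y x)) (R x)" by (rule saopH[OF posop_saop[OF R(1)]])
    finally show ?thesis by (simp only: cR)
  qed
  then show ?thesis
    using saop_comp[OF posop_saop[OF X] posop_saop[OF Y] c] posop_ge[OF Y] by (simp add: posop_def)
qed

subsection \<open>Projections and inverses\<close>

text \<open>The Riesz vector belongs to the kernel because it is a limit of vectors of the kernel
  and \<open>X\<close> is continuous.\<close>

lemma kernel_projection:
  assumes X: "bop X"
  obtains P where "saop P" "\<And>x. X (P x) = 0" "\<And>x. X x = 0 \<Longrightarrow> P x = x"
proof -
  let ?W = "{x. X x = 0}"
  have sub: "subspace ?W" by (rule subspaceI) (auto simp: bop_lin[OF X])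
  have "\<exists>g. X g = 0 \<and> (\<forall>w. X w = 0 \<longrightarrow> H w x = H w g)" for x
  proof -
    obtain g Z where g: "\<And>w. w \<in> ?W \<Longrightarrow> H w x = H w g" "\<And>n. Z n \<in> ?W" "conv Z g"
    proof (rule Riesz_subspace[of ?W "\<lambda>w. H w x" "nm x"])
      show "cmod (H w x) \<le> nm x * nm w" for w using Cauchy_Schwarz[of w x] by (simp add: mult.commute)
    qed (use sub in \<open>auto simp: Hsimps\<close>)
    have "conv (\<lambda>n. 0) (X g)" using bop_conv[OF X g(3)] g(2) by simp
    then have "X g = 0" using conv_unique conv_const[of 0] by blast
    then show ?thesis using g(1) by blast
  qed
  then obtain P where P: "\<And>x. X (P x) = 0" "\<And>x w. X w = 0 \<Longrightarrow> H w x = H w (P x)" by metis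
  have uniq: "g = P x" if "X g = 0" "\<And>w. X w = 0 \<Longrightarrow> H w x = H w g" for g x
  proof -
    have "X (g - P x) = 0" using that(1) P(1)[of x] by (simp add: bop_diff[OF X])
    then have "H (g - P x) (g - P x) = 0" using P(2)[of "g - P x" x] that(2)[of "g - P x"] by (simp add: Hsimps)
    then show ?thesis using H_eq0[of "g - P x"] by simp
  qed
  have id: "P x = x" if "X x = 0" for x using uniq[of x x] that by simp
  have sym: "H (P x) y = H x (P y)" for x y
  proof -
    have "H (P x) y = H (P x) (P y)" using P by blast
    also have "\<dots> = cnj (H (P y) (P x))" by (simp add: Hcnj)
    also have "\<dots> = cnj (H (P y) x)" using P by metis
    finally show ?thesis by (simp add: Hcnj)
  qed
  have "bop P"
  proof (rule bopI[of _ 1])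
    show "P (x + y) = P x + P y" for x y
      by (rule uniq[symmetric]) (auto simp: bop_lin[OF X] P(1) Hsimps simp flip: P(2))
    show "P (scl c x) = scl c (P x)" for c x
      by (rule uniq[symmetric]) (auto simp: bop_lin[OF X] P(1) Hsimps simp flip: P(2))
    show "nm (P x) \<le> 1 * nm x" for x
    proof -
      have "nm (P x) * nm (P x) = Re (H (P x) x)"
        using P(2)[OF P(1), of x x] by (simp add: ReHself power2_eq_square)
      also have "\<dots> \<le> nm (P x) * nm x" by (rule ReH_le) auto
      finally show ?thesis using nm_nonneg[of "P x"] nm_nonneg[of x]
        by (metis UNIV_I mult_1 mult_left_le_imp_le order_le_less)
    qed
  qed
  then have "saop P" using sym by (simp add: saop_def)
  then show thesis using that P(1) id by blast
qed

text \<open>Both \<open>Y\<close> and its adjoint leave the kernel of \<open>X\<close> invariant, so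
  \<open>P\<close> reduces \<open>Y\<close>.\<close>

lemma kernel_projection_comm:
  assumes X: "saop X" and P: "saop P" "\<And>x. X (P x) = 0" "\<And>x. X x = 0 \<Longrightarrow> P x = x"
    and Y: "bop Y" "comm Y X"
  shows "comm Y P"
proof -
  obtain Y' where Y': "bop Y'" "\<And>x y. H (Y x) y = H x (Y' y)" using adjoint_exists[OF Y(1)] by metis
  have Y'X: "X (Y' x) = Y' (X x)" for x
  proof (rule H_eqI2)
    fix y
    have "H y (X (Y' x)) = H (Y (X y)) x" by (simp add: Y'(2) flip: saopH[OF X])
    also have "\<dots> = H (X (Y y)) x" using Y(2) by (simp add: comm_def)
    also have "\<dots> = H y (Y' (X x))" by (simp add: saopH[OF X] Y'(2))
    finally show "H y (X (Y' x)) = H y (Y' (X x))" .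
  qed
  have "X (Y (P x)) = Y (X (P x))" for x using Y(2) by (simp add: comm_def)
  then have a: "P (Y (P x)) = Y (P x)" for x
    using P(3)[of "Y (P x)"] P(2)[of x] by (simp add: bop_0[OF Y(1)])
  have b: "P (Y' (P x)) = Y' (P x)" for x
    using P(3)[of "Y' (P x)"] P(2)[of x] Y'X Y'(1) by (simp add: bop_lin)
  have "P (Y x) = P (Y (P x))" for x
  proof (rule H_eqI)
    fix y
    have "H (P (Y x)) y = H x (Y' (P y))" by (simp add: saopH[OF P(1)] Y'(2))
    also have "\<dots> = H x (P (Y' (P y)))" by (simp add: b)
    also have "\<dots> = H (P (Y (P x))) y" by (simp add: Y'(2) saopH[OF P(1)] b flip: saopH[OF P(1), of x])
    finally show "H (P (Y x)) y = H (P (Y (P x))) y" .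
  qed
  then show ?thesis using a by (simp add: comm_def)
qed

text \<open>\<open>Q\<close> projects onto the kernel of \<open>|C| + C\<close>, where
  \<open>|C|\<close> is the root of \<open>C^2\<close>. The kernel of \<open>C\<close> is thereby
  put on the nonpositive side, and \<open>C\<close> is strictly positive on the complement, as the
  last clause records.\<close>

lemma spectral_projection:
  assumes C: "saop C"
  obtains Q where "saop Q" "\<And>x. Q (Q x) = Q x" "\<And>Y. bop Y \<Longrightarrow> comm Y C \<Longrightarrow> comm Y Q"
    "\<And>x. Re (H (C (Q x)) (Q x)) \<le> 0" "\<And>x. 0 \<le> Re (H (C (x - Q x)) (x - Q x))"
    "\<And>x. Re (H (C (x - Q x)) (x - Q x)) \<le> 0 \<Longrightarrow> Q x = x"
proof -
  have bo: "bop C" by (rule saop_bop[OF C])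
  have "posop (\<lambda>x. C (C x))"
    using saop_comp[OF C C comm_self] by (simp add: posop_def saopH[OF C, of "C x" x for x] ReHself)
  then obtain B where B: "posop B" "\<And>x. B (B x) = C (C x)"
      "\<And>Z. bop Z \<Longrightarrow> comm Z (\<lambda>x. C (C x)) \<Longrightarrow> comm Z B"
    using sqrt_exists by metis
  have boB: "bop B" and saB: "saop B" using B(1) posop_saop saop_bop by blast+
  have BC: "C (B x) = B (C x)" for x
    using B(3)[OF bo] by (simp add: comm_def)
  have saX: "saop (\<lambda>x. B x + C x)" by (intro saops saB C)
  obtain Q where Q: "saop Q" "\<And>x. B (Q x) + C (Q x) = 0" "\<And>x. B x + C x = 0 \<Longrightarrow> Q x = x"
    using kernel_projection[OF saop_bop[OF saX]] by metis
  have QQ: "Q (Q x) = Q x" for x using Q by blast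
  have boQ: "bop Q" by (rule saop_bop[OF Q(1)])
  have cQ: "comm Y Q" if Y: "bop Y" "comm Y C" for Y
  proof (rule kernel_projection_comm[OF saX Q Y(1)])
    have "comm Y B" using B(3)[OF Y(1)] Y(2) by (simp add: comm_def)
    then show "comm Y (\<lambda>x. B x + C x)" by (intro comms Y)
  qed
  have neg: "C (Q x) = - B (Q x)" for x using Q(2)[of x] by (simp add: eq_neg_iff_add_eq_0 add.commute)
  \<comment> \<open>Vectors \<open>C x - B x\<close> are annihilated by \<open>B + C\<close>, so
    \<open>Q\<close> fixes them; commuting \<open>Q\<close> through gives \<open>C = B\<close> off
    the range of \<open>Q\<close>.\<close>
  have pos: "C (x - Q x) = B (x - Q x)" for x
  proof -
    have k: "B (y) + C (y) = 0" if "y = C x - B x" for x y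
      by (simp add: that bop_lin[OF bo] bop_lin[OF boB] B(2) BC)
    have "Q (C x - B x) = C x - B x" for x using Q(3) k by blast
    then have "C (Q x) - B (Q x) = C x - B x" for x
      using cQ[OF bo comm_self] cQ[OF boB] BC by (simp add: comm_def bop_lin[OF boQ])
    then have "C (x - Q x) - B (x - Q x) = 0"
      by (simp add: bop_lin[OF bo] bop_lin[OF boB]) (simp add: algebra_simps)
    then show ?thesis by simp
  qed
  show thesis
  proof (rule that[OF Q(1) QQ cQ])
    show "Re (H (C (Q x)) (Q x)) \<le> 0" for x
      using posop_ge[OF B(1), of "Q x"] by (simp add: neg Hsimps)
    show "0 \<le> Re (H (C (x - Q x)) (x - Q x))" for x
      using posop_ge[OF B(1), of "x - Q x"] by (simp only: pos)
    show "Q x = x" if "Re (H (C (x - Q x)) (x - Q x)) \<le> 0" for x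
    proof -
      have "B (x - Q x) = 0" using posop_eq0[OF B(1), of "x - Q x"] that by (simp only: pos)
      then have "B (x - Q x) + C (x - Q x) = 0" using pos by simp
      then have "Q (x - Q x) = x - Q x" by (rule Q(3))
      then show ?thesis by (simp add: bop_lin[OF boQ] QQ)
    qed
  qed
qed

text \<open>Representing the functional \<open>M k \<mapsto> H k g\<close> on the range of
  \<open>M\<close> by the Riesz lemma yields a preimage of \<open>g\<close>, so surjectivity is
  obtained without a discussion of closed ranges.\<close>

lemma inverse_exists:
  assumes M: "saop M" and c: "c > 0" "\<And>x. c * nm x \<le> nm (M x)"
  obtains V where "saop V" "\<And>x. M (V x) = x" "\<And>x. V (M x) = x"
    "\<And>Y. comm Y M \<Longrightarrow> comm Y V"
proof -
  have bo: "bop M" by (rule saop_bop[OF M])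
  have inj: "x = y" if "M x = M y" for x y
  proof -
    have "c * nm (x - y) \<le> 0" using c(2)[of "x - y"] that by (simp add: bop_lin[OF bo])
    then have "nm (x - y) = 0" using c(1) nm_pos[of "x - y"] by (auto simp: mult_le_0_iff)
    then show ?thesis using nm_eq_0[of "x - y"] by simp
  qed
  have surj: "\<exists>f. M f = g" for g
  proof -
    define i where "i w = (SOME k. M k = w)" for w
    have i: "i (M k) = k" for k unfolding i_def using inj by (metis (mono_tags, lifting) someI)
    have sub: "subspace (range M)"
    proof (rule subspaceI)
      show "0 \<in> range M" by (rule range_eqI[of _ _ 0]) (simp add: bop_0[OF bo])
      show "x + y \<in> range M" if "x \<in> range M" "y \<in> range M" for x y
        using that by (auto simp flip: bop_add[OF bo])
      show "scl d x \<in> range M" if "x \<in> range M" for d x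
        using that by (auto simp flip: bop_scl[OF bo])
    qed
    obtain f where f: "\<And>w. w \<in> range M \<Longrightarrow> H (i w) g = H w f"
    proof (rule Riesz_subspace[OF sub, of "\<lambda>w. H (i w) g" "nm g / c"])
      show "H (i (x + y)) g = H (i x) g + H (i y) g" if "x \<in> range M" "y \<in> range M" for x y
        using that i by (auto simp: Hsimps simp flip: bop_add[OF bo])
      show "H (i (scl d x)) g = d * H (i x) g" if "x \<in> range M" for x d
        using that i by (auto simp: Hsimps simp flip: bop_scl[OF bo])
      show "cmod (H (i w) g) \<le> nm g / c * nm w" if w: "w \<in> range M" for w
      proof -
        obtain k where k: "w = M k" using w by blast
        have "cmod (H k g) \<le> nm k * nm g" by (rule Cauchy_Schwarz) auto
        also have "\<dots> \<le> (nm (M k) / c) * nm g"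
          using c(2)[of k] c(1) by (intro mult_right_mono) (auto simp: field_simps)
        finally show ?thesis by (simp add: k i mult.commute)
      qed
    qed (use c(1) in auto)
    have "M f = g"
    proof (rule H_eqI2)
      show "H k (M f) = H k g" for k using f[of "M k"] i by (simp add: saopH[OF M])
    qed
    then show ?thesis by blast
  qed
  define V where "V g = (SOME f. M f = g)" for g
  have MV: "M (V g) = g" for g unfolding V_def using surj[of g] by (rule someI_ex)
  have VM: "V (M g) = g" for g using inj MV by blast
  have "bop V"
  proof (rule bopI[of _ "1 / c"])
    show "V (x + y) = V x + V y" for x y by (rule inj) (simp add: MV bop_lin[OF bo])
    show "V (scl d x) = scl d (V x)" for d x by (rule inj) (simp add: MV bop_lin[OF bo])
    show "nm (V x) \<le> 1 / c * nm x" for x using c(2)[of "V x"] c(1) by (simp add: MV field_simps)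
  qed
  moreover have "H (V x) y = H x (V y)" for x y
    using saopH[OF M, of "V x" "V y"] by (simp add: MV)
  ultimately have sV: "saop V" by (simp add: saop_def)
  moreover have "comm Y V" if "comm Y M" for Y
    unfolding comm_def
  proof
    fix x
    have "M (Y (V x)) = Y (M (V x))" using that by (simp add: comm_def)
    then show "Y (V x) = V (Y x)" by (metis MV VM)
  qed
  ultimately show thesis using that MV VM by blast
qed

text \<open>If the conclusion fails, there are nested balls on which some \<open>nm (X n z)\<close> exceeds \<open>k\<close>; the
  sequence is unbounded at their common point.\<close>

lemma uniform_boundedness:
  assumes bo: "\<And>n::nat. bop (X n)" and bd: "\<And>x. \<exists>M. \<forall>n. nm (X n x) \<le> M"
  obtains M where "\<And>n x. nm (X n x) \<le> M * nm x"
proof (rule ccontr)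
  assume "\<not> thesis"
  then have unb: "\<exists>n x. nm (X n x) > M * nm x" for M using that by (metis not_le)
  \<comment> \<open>Moving from \<open>x\<close> by a vector \<open>u\<close> of length
    \<open>r\<close> on which some \<open>X n\<close> is large makes \<open>X n\<close> large at
    \<open>y = x + u\<close>; the surplus 1 leaves room for a ball around \<open>y\<close>.\<close>
  have big: "\<exists>n. \<exists>y. nm (y - x) \<le> r \<and> nm (X n y) > K \<and> (\<exists>d>0. \<forall>z. nm (z - y) \<le> d \<longrightarrow> nm (X n z) > K)"
    if r: "r > 0" for x r K
  proof -
    obtain M where M: "\<And>n. nm (X n x) \<le> M" using bd by blast
    obtain n v where nv: "nm (X n v) > ((\<bar>K\<bar> + \<bar>M\<bar> + 1) / r) * nm v" using unb by blast
    have v0: "nm v > 0"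
      using nv nm_eq_0[of v] nm_nonneg[of v] bop_0[OF bo[of n]] by (metis UNIV_I mult_zero_right nm0 order_le_less order_less_irrefl)
    define u where "u = scl (of_real (r / nm v)) v"
    have nu: "nm u = r" using v0 r by (simp add: u_def norm_divide)
    have "nm (X n u) = (r / nm v) * nm (X n v)"
      using v0 r by (simp add: u_def bop_lin[OF bo] norm_divide)
    also have "\<dots> > (r / nm v) * (((\<bar>K\<bar> + \<bar>M\<bar> + 1) / r) * nm v)"
      using v0 r by (intro mult_strict_left_mono nv) auto
    also have "(r / nm v) * (((\<bar>K\<bar> + \<bar>M\<bar> + 1) / r) * nm v) = \<bar>K\<bar> + \<bar>M\<bar> + 1" using v0 r by simp
    finally have Xu: "nm (X n u) > \<bar>K\<bar> + \<bar>M\<bar> + 1" .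
    define y where "y = x + u"
    have Xy: "nm (X n y) > \<bar>K\<bar> + 1"
    proof -
      have "nm (X n u) \<le> nm (X n y) + nm (X n x)"
        using nm_triangle_diff[of "X n y" "X n x"] by (simp add: y_def bop_lin[OF bo])
      then show ?thesis using Xu M[of n] by linarith
    qed
    obtain C where C: "C > 0" "\<And>z. nm (X n z) \<le> C * nm z" using bop_bound[OF bo[of n]] by metis
    have "nm (X n z) > K" if z: "nm (z - y) \<le> 1 / C" for z
    proof -
      have "nm (X n (y - z)) \<le> C * nm (y - z)" by (rule C)
      also have "\<dots> \<le> 1" using z C(1) nm_minus_commute[of z y] by (simp add: field_simps)
      finally have "nm (X n y - X n z) \<le> 1" by (simp add: bop_lin[OF bo])
      then show ?thesis using nm_le_diff[of "X n y" "X n z"] Xy by simp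
    qed
    then have "\<exists>d>0. \<forall>z. nm (z - y) \<le> d \<longrightarrow> nm (X n z) > K" using C(1) by (intro exI[of _ "1 / C"]) auto
    moreover have "nm (y - x) \<le> r" using nu by (simp add: y_def)
    moreover have "nm (X n y) > K" using Xy by linarith
    ultimately show ?thesis by blast
  qed
  define P where "P k s s' \<longleftrightarrow> 0 < snd s' \<and> snd s' \<le> snd s / 2 \<and> nm (fst s' - fst s) \<le> snd s / 2 \<and>
      (\<exists>n. \<forall>z. nm (z - fst s') \<le> snd s' \<longrightarrow> nm (X n z) > real k)" for k :: nat and s s' :: "'a \<times> real"
  have step: "\<exists>s'. 0 < snd s' \<and> P k s s'" if s: "0 < snd s" for k s
  proof -
    obtain n y d where "nm (y - fst s) \<le> snd s / 2" "d > 0" "\<forall>z. nm (z - y) \<le> d \<longrightarrow> nm (X n z) > real k"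
      using big[of "snd s / 2" "fst s" "real k"] s by (metis half_gt_zero)
    then have "P k s (y, min d (snd s / 2))" using s unfolding P_def by auto
    then show ?thesis unfolding P_def by blast
  qed
  have "\<exists>f. \<forall>k. 0 < snd (f k) \<and> P k (f k) (f (Suc k))"
  proof (rule dependent_nat_choice[where P="\<lambda>k s. 0 < snd s" and Q=P])
    show "\<exists>s::'a \<times> real. 0 < snd s" by (rule exI[of _ "(0, 1)"]) simp
  qed (use step in blast)
  then obtain f where f: "\<And>k. 0 < snd (f k)" "\<And>k. P k (f k) (f (Suc k))" by blast
  define x r where "x k = fst (f k)" and "r k = snd (f k)" for k
  have r: "r k > 0" "r (Suc k) \<le> r k / 2" "nm (x (Suc k) - x k) \<le> r k / 2" for k
    using f unfolding P_def x_def r_def by blast+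
  have tail: "nm (x (k + j) - x k) + r (k + j) \<le> r k" for k j
  proof (induction j)
    case (Suc j)
    have "nm (x (k + Suc j) - x k) \<le> nm (x (Suc (k + j)) - x (k + j)) + nm (x (k + j) - x k)"
      using nm_triangle3[of "x (Suc (k + j))" "x (k + j)" "x k"] by simp
    then show ?case using Suc r(2,3)[of "k + j"] by simp
  qed simp
  have rk: "r k \<le> r 0 / 2 ^ k" for k
  proof (induction k)
    case (Suc k)
    then have "r (Suc k) \<le> (r 0 / 2 ^ k) / 2" using r(2)[of k] by argo
    then show ?case by simp
  qed simp
  have near: "nm (x m - x k) \<le> r k" if "m \<ge> k" for m k
    using tail[of k "m - k"] r(1)[of m] that by simp
  have "\<exists>N. \<forall>m\<ge>N. \<forall>n\<ge>N. nm (x m - x n) < e" if e: "e > 0" for e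
  proof -
    have "(\<lambda>k. r 0 / 2 ^ k) \<longlonglongrightarrow> 0"
      using tendsto_mult_left[OF LIMSEQ_power_zero[of "1/2 :: real"], of "r 0"] by (simp add: field_simps power_divide)
    then obtain N where "r 0 / 2 ^ N < e / 2"
      using e order_tendstoD(2)[of _ 0 sequentially "e / 2"] by (metis eventually_sequentially half_gt_zero order_refl)
    then have rN: "r N < e / 2" using rk[of N] by linarith
    have "nm (x m - x n) < e" if "m \<ge> N" "n \<ge> N" for m n
      using nm_triangle3[of "x m" "x N" "x n"] near[OF that(1)] near[OF that(2)] rN
        nm_minus_commute[of "x N" "x n"] by simp
    then show ?thesis by blast
  qed
  then obtain l where l: "conv x l" using complete[of x] by blast
  have lk: "nm (l - x k) \<le> r k" for k
  proof (rule LIMSEQ_le_const2)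
    have "conv (\<lambda>m. x m + - x k) (l + - x k)" by (intro conv_add l conv_const) simp
    then show "(\<lambda>m. nm (x m - x k)) \<longlonglongrightarrow> nm (l - x k)" using conv_nm by fastforce
    show "\<exists>N. \<forall>m\<ge>N. nm (x m - x k) \<le> r k" using near by blast
  qed
  obtain M where M: "\<And>n. nm (X n l) \<le> M" using bd by blast
  obtain k where k: "M < real k" using reals_Archimedean2 by blast
  obtain n where "\<forall>z. nm (z - x (Suc k)) \<le> r (Suc k) \<longrightarrow> nm (X n z) > real k"
    using f(2)[of k] unfolding P_def x_def r_def by blast
  then have "nm (X n l) > real k" using lk by blast
  then show False using M[of n] k by linarith
qed

end

section \<open>Self-adjoint relations and boundary triples\<close>

context hilb
begin

lemma adj_D: "(g, g') \<in> adjoint_in V H T \<Longrightarrow> g \<in> V \<and> g' \<in> V"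
  by (simp add: adjoint_in_def)

lemma adj_eq: "(g, g') \<in> adjoint_in V H T \<Longrightarrow> (f, f') \<in> T \<Longrightarrow> H f' g = H f g'"
  by (auto simp: adjoint_in_def)

lemma adj_I:
  "g \<in> V \<Longrightarrow> g' \<in> V \<Longrightarrow> (\<And>f f'. (f, f') \<in> T \<Longrightarrow> H f' g = H f g') \<Longrightarrow> (g, g') \<in> adjoint_in V H T"
  by (auto simp: adjoint_in_def)

lemma adj_add:
  assumes T: "T \<subseteq> V \<times> V" and a: "(f, f') \<in> adjoint_in V H T" "(g, g') \<in> adjoint_in V H T"
  shows "(f + g, f' + g') \<in> adjoint_in V H T"
proof (rule adj_I)
  show "H k' (f + g) = H k (f' + g')" if k: "(k, k') \<in> T" for k k'
  proof -
    have "k \<in> V" "k' \<in> V" using T k by blast+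
    then show ?thesis using adj_D[OF a(1)] adj_D[OF a(2)] adj_eq[OF a(1) k] adj_eq[OF a(2) k]
      by (simp add: Hsimps)
  qed
qed (use adj_D[OF a(1)] adj_D[OF a(2)] in auto)

lemma adj_scl:
  assumes T: "T \<subseteq> V \<times> V" and a: "(f, f') \<in> adjoint_in V H T"
  shows "(scl c f, scl c f') \<in> adjoint_in V H T"
proof (rule adj_I)
  show "H k' (scl c f) = H k (scl c f')" if k: "(k, k') \<in> T" for k k'
  proof -
    have "k \<in> V" "k' \<in> V" using T k by blast+
    then show ?thesis using adj_D[OF a] adj_eq[OF a k] by (simp add: Hsimps)
  qed
qed (use adj_D[OF a] in auto)

lemma adj_diff:
  assumes T: "T \<subseteq> V \<times> V" and a: "(f, f') \<in> adjoint_in V H T" "(g, g') \<in> adjoint_in V H T"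
  shows "(f - g, f' - g') \<in> adjoint_in V H T"
  using adj_add[OF T a(1) adj_scl[OF T a(2), of "-1"]] by simp

text \<open>To solve \<open>(T0 - z) f = g\<close>, represent the functional
  \<open>(T0 - cnj z) k \<mapsto> H k g\<close>: the representing vector lies in the domain of the
  adjoint, which is \<open>T0\<close> itself. The lemma is used at nonreal points and at real points
  below a semibounded operator.\<close>

lemma selfadjoint_surj:
  assumes T0: "T0 = adjoint_in V H T0" and c: "c > 0"
    and bd: "\<And>k k'. (k, k') \<in> T0 \<Longrightarrow> c * nm k \<le> nm (k' - scl (cnj z) k)" and g: "g \<in> V"
  obtains f where "(f, g + scl z f) \<in> T0" "c * nm f \<le> nm g"
proof -
  have sub: "T0 \<subseteq> V \<times> V" using T0 adj_D by fast
  have mem: "k \<in> V \<and> k' \<in> V" if "(k, k') \<in> T0" for k k' using sub that by blast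
  have lin: "(k + l, k' + l') \<in> T0" "(k - l, k' - l') \<in> T0" if "(k, k') \<in> T0" "(l, l') \<in> T0" for k k' l l'
    using adj_add[OF sub] adj_diff[OF sub] T0 that by (simp_all flip: T0)
  have lin_scl: "(scl d k, scl d k') \<in> T0" if "(k, k') \<in> T0" for d k k'
    using adj_scl[OF sub] T0 that by (simp flip: T0)
  have zero: "(0, 0) \<in> T0" by (subst T0, rule adj_I) (use mem in \<open>auto simp: H02\<close>)
  define W where "W = {w. \<exists>k k'. (k, k') \<in> T0 \<and> w = k' - scl (cnj z) k}"
  define i where "i w = (SOME k. \<exists>k'. (k, k') \<in> T0 \<and> w = k' - scl (cnj z) k)" for w
  have uniq: "k = l" if "(k, k') \<in> T0" "(l, l') \<in> T0" "k' - scl (cnj z) k = l' - scl (cnj z) l" for k k' l l'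
  proof -
    have "k' - l' - scl (cnj z) (k - l) = 0" using that(3) by (simp add: algebra_simps)
    then have "c * nm (k - l) \<le> 0" using bd[OF lin(2)[OF that(1,2)]] by simp
    then have "nm (k - l) = 0" using c mem[OF that(1)] mem[OF that(2)] nm_pos[of "k - l"]
      by (auto simp: mult_le_0_iff)
    then show ?thesis using nm_eq_0[of "k - l"] mem[OF that(1)] mem[OF that(2)] by simp
  qed
  have i: "i (k' - scl (cnj z) k) = k" if "(k, k') \<in> T0" for k k'
  proof -
    have "\<exists>l'. (i (k' - scl (cnj z) k), l') \<in> T0
        \<and> k' - scl (cnj z) k = l' - scl (cnj z) (i (k' - scl (cnj z) k))"
      unfolding i_def using that
      by (rule_tac someI[where P="\<lambda>l. \<exists>l'. (l, l') \<in> T0 \<and> k' - scl (cnj z) k = l' - scl (cnj z) l"]) blast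
    then show ?thesis using uniq that by metis
  qed
  have W_V: "W \<subseteq> V" unfolding W_def using mem by auto
  have W_add: "x + y \<in> W" if xy: "x \<in> W" "y \<in> W" for x y
  proof -
    obtain k k' l l' where kl: "(k, k') \<in> T0" "x = k' - scl (cnj z) k" "(l, l') \<in> T0" "y = l' - scl (cnj z) l"
      using xy unfolding W_def by blast
    have "x + y = (k' + l') - scl (cnj z) (k + l)" by (simp add: kl scale_right_distrib)
    then show ?thesis unfolding W_def using lin(1)[OF kl(1,3)] by blast
  qed
  have W_scl: "scl d x \<in> W" if x: "x \<in> W" for d x
  proof -
    obtain k k' where kl: "(k, k') \<in> T0" "x = k' - scl (cnj z) k" using x unfolding W_def by blast
    have "scl d x = scl d k' - scl (cnj z) (scl d k)"
      by (simp add: kl scale_right_diff_distrib mult.commute)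
    then show ?thesis unfolding W_def using lin_scl[OF kl(1)] by blast
  qed
  have W_sub: "subspace W"
  proof (rule subspaceI)
    have "0 = 0 - scl (cnj z) 0" by simp
    then show "0 \<in> W" unfolding W_def using zero by blast
  qed (rule W_add W_scl; assumption)+
  obtain f where f: "f \<in> V" "\<And>w. w \<in> W \<Longrightarrow> H (i w) g = H w f" "nm f \<le> nm g / c"
  proof (rule Riesz_subspace[OF W_sub W_V, of "\<lambda>w. H (i w) g" "nm g / c"])
    show "H (i (x + y)) g = H (i x) g + H (i y) g" if xy: "x \<in> W" "y \<in> W" for x y
    proof -
      obtain k k' l l' where kl: "(k, k') \<in> T0" "x = k' - scl (cnj z) k" "(l, l') \<in> T0" "y = l' - scl (cnj z) l"
        using xy unfolding W_def by blast
      have "x + y = (k' + l') - scl (cnj z) (k + l)" by (simp add: kl scale_right_distrib)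
      then have "i (x + y) = k + l" using i[OF lin(1)[OF kl(1,3)]] by simp
      then show ?thesis using i[OF kl(1)] i[OF kl(3)] mem[OF kl(1)] mem[OF kl(3)] g
        by (simp add: kl(2,4) Hsimps)
    qed
    show "H (i (scl d x)) g = d * H (i x) g" if x: "x \<in> W" for d x
    proof -
      obtain k k' where kl: "(k, k') \<in> T0" "x = k' - scl (cnj z) k" using x unfolding W_def by blast
      have "scl d x = scl d k' - scl (cnj z) (scl d k)"
        by (simp add: kl scale_right_diff_distrib mult.commute)
      then show ?thesis using i[OF lin_scl[OF kl(1)]] i[OF kl(1)] mem[OF kl(1)] g
        by (simp add: kl(2) Hsimps)
    qed
    show "cmod (H (i w) g) \<le> nm g / c * nm w" if w: "w \<in> W" for w
    proof -
      obtain k k' where kl: "(k, k') \<in> T0" "w = k' - scl (cnj z) k" using w unfolding W_def by blast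
      have kV: "k \<in> V" using mem[OF kl(1)] by blast
      have "cmod (H k g) \<le> nm k * nm g" by (rule Cauchy_Schwarz[OF kV g])
      also have "\<dots> \<le> (nm w / c) * nm g"
        using bd[OF kl(1)] c g by (intro mult_right_mono) (auto simp: field_simps kl(2))
      finally show ?thesis using i[OF kl(1)] by (simp add: kl(2) mult.commute)
    qed
    show "0 \<le> nm g / c" using g c by simp
  qed blast
  have "(f, g + scl z f) \<in> adjoint_in V H T0"
  proof (rule adj_I)
    show "H k' f = H k (g + scl z f)" if k: "(k, k') \<in> T0" for k k'
    proof -
      have "H k g = H (k' - scl (cnj z) k) f" using f(2)[of "k' - scl (cnj z) k"] i[OF k] k unfolding W_def by auto
      then show ?thesis using mem[OF k] f(1) g by (simp add: Hsimps)
    qed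
  qed (use f(1) g in auto)
  then show thesis using that f(3) c T0 by (simp add: field_simps)
qed

end

section \<open>The reference extension, Weyl solutions and the Weyl function of a boundary
  triple\<close>

locale btriple = hilb scl V H for scl :: "complex \<Rightarrow> 'a::ab_group_add \<Rightarrow> 'a" and V H +
  fixes S :: "('a \<times> 'a) set" and G0 G1 :: "'a \<Rightarrow> complex"
  assumes symm: "symmetric_operator_in scl V H S"
    and defect: "has_defect_one_one scl V H S"
    and triple: "boundary_triple scl V H S G0 G1"
    and S_nonneg: "\<And>f f'. (f, f') \<in> S \<Longrightarrow> 0 \<le> Re (H f' f)"
begin

text \<open>\<open>T\<close> is the maximal operator, and \<open>A0\<close> its self-adjoint
  restriction that serves as reference operator in Krein's formula.\<close>

definition "T = adjoint_in V H S"
definition "A0 = {(f, f') \<in> T. G0 f = 0}"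

lemma S_VV: "S \<subseteq> V \<times> V"
  using symm unfolding symmetric_operator_in_def operator_in_def by blast

lemma T_mem: "(f, f') \<in> T \<Longrightarrow> f \<in> V \<and> f' \<in> V"
  unfolding T_def by (rule adj_D)

lemma T_fst: "(f, f') \<in> T \<Longrightarrow> f \<in> V" and T_snd: "(f, f') \<in> T \<Longrightarrow> f' \<in> V"
  using T_mem by blast+

lemmas T_add = adj_add[OF S_VV, folded T_def]
lemmas T_scl = adj_scl[OF S_VV, folded T_def]
lemmas T_diff = adj_diff[OF S_VV, folded T_def]

lemma S_T: "(f, f') \<in> S \<Longrightarrow> (f, f') \<in> T"
  unfolding T_def
proof (rule adj_I)
  assume f: "(f, f') \<in> S"
  show "H k' f = H k f'" if "(k, k') \<in> S" for k k'
    using symm f that unfolding symmetric_operator_in_def by blast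
qed (use S_VV in auto)

lemma G_lin:
  assumes "(f, f') \<in> T" "(g, g') \<in> T"
  shows "G0 (f + g) = G0 f + G0 g" "G1 (f + g) = G1 f + G1 g"
    "G0 (scl c f) = c * G0 f" "G1 (scl c f) = c * G1 f"
  using triple assms unfolding boundary_triple_def linear_functional_on_def Let_def T_def by blast+

lemma G_diff:
  assumes "(f, f') \<in> T" "(g, g') \<in> T"
  shows "G0 (f - g) = G0 f - G0 g" "G1 (f - g) = G1 f - G1 g"
  using G_lin(1,2)[OF assms(1) T_scl[OF assms(2), of "-1"]] G_lin(3,4)[OF assms(2,2), of "-1"] by simp_all

lemma Green:
  "(f, f') \<in> T \<Longrightarrow> (g, g') \<in> T \<Longrightarrow> H f' g - H f g' = cnj (G0 g) * G1 f - cnj (G1 g) * G0 f"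
  using triple unfolding boundary_triple_def Let_def T_def by blast

lemma dom_S: "(f, f') \<in> T \<Longrightarrow> G0 f = 0 \<Longrightarrow> G1 f = 0 \<Longrightarrow> f \<in> Domain S"
  using triple unfolding boundary_triple_def Let_def T_def by blast

lemma Domain_S_G: "f \<in> Domain S \<Longrightarrow> G0 f = 0 \<and> G1 f = 0"
  using triple unfolding boundary_triple_def Let_def T_def by blast

text \<open>The difference \<open>k\<close> of two images is orthogonal to the domain of
  \<open>S\<close>, which is dense.\<close>

lemma T_single: "(f, f') \<in> T \<Longrightarrow> (f, f'') \<in> T \<Longrightarrow> f' = f''"
proof -
  assume a: "(f, f') \<in> T" "(f, f'') \<in> T"
  define k where "k = f' - f''"
  have k: "(0, k) \<in> T" using T_diff[OF a] by (simp add: k_def)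
  have kV: "k \<in> V" by (rule T_snd[OF k])
  interpret M: Metric_space V "ip_dist V H" by (rule metric)
  have "M.mtopology closure_of (Domain S) = V"
    using symm unfolding symmetric_operator_in_def densely_defined_in_def ip_topology_def by blast
  then have dense: "\<exists>y\<in>Domain S. y \<in> V \<and> nm (k - y) < r" if "r > 0" for r
    using kV that unfolding M.metric_closure_of by (force simp: ip_dist_def)
  have orth: "H y k = 0" if "y \<in> Domain S" for y
    using that adj_eq[of 0 k S] k S_VV H02 unfolding T_def by (metis DomainE SigmaD2 subsetD)
  have "(nm k)\<^sup>2 \<le> nm k * r" if r: "r > 0" for r
  proof -
    obtain y where y: "y \<in> Domain S" "y \<in> V" "nm (k - y) < r" using dense[OF r] by blast
    have "(nm k)\<^sup>2 = Re (H (k - y) k)" using orth[OF y(1)] kV y(2) by (simp add: Hsimps ReHself)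
    also have "\<dots> \<le> nm (k - y) * nm k" by (rule ReH_le) (use kV y in auto)
    also have "\<dots> \<le> r * nm k" using y(3) kV by (intro mult_right_mono) auto
    finally show ?thesis by (simp add: mult.commute)
  qed
  then have "nm k \<le> r" if "r > 0" for r
    using that kV nm_pos[OF kV] by (cases "nm k = 0") (auto simp: power2_eq_square)
  then have "nm k \<le> 0" by (rule field_le_epsilon[of "nm k" 0, simplified])
  then have "k = 0" using kV nm_nonneg[OF kV] nm_eq_0[OF kV] by (simp add: antisym)
  then show "f' = f''" by (simp add: k_def)
qed

lemma S_dom_nonneg: "(f, f') \<in> T \<Longrightarrow> G0 f = 0 \<Longrightarrow> G1 f = 0 \<Longrightarrow> 0 \<le> Re (H f' f)"
  using dom_S[of f f'] S_T T_single S_nonneg by (metis DomainE)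

lemma A0_T: "(f, f') \<in> A0 \<Longrightarrow> (f, f') \<in> T" and A0_G: "(f, f') \<in> A0 \<Longrightarrow> G0 f = 0"
  by (auto simp: A0_def)

lemma A0_add: "(f, f') \<in> A0 \<Longrightarrow> (g, g') \<in> A0 \<Longrightarrow> (f + g, f' + g') \<in> A0"
  and A0_diff: "(f, f') \<in> A0 \<Longrightarrow> (g, g') \<in> A0 \<Longrightarrow> (f - g, f' - g') \<in> A0"
  and A0_scl: "(f, f') \<in> A0 \<Longrightarrow> (scl c f, scl c f') \<in> A0"
  unfolding A0_def using T_add T_diff T_scl G_lin G_diff by auto

lemma A0_sym: "(f, f') \<in> A0 \<Longrightarrow> (g, g') \<in> A0 \<Longrightarrow> H f' g = H f g'"
  using Green[OF A0_T A0_T, of f f' g g'] A0_G by force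

lemma defect_vector:
  assumes z: "z = \<i> \<or> z = - \<i>" obtains f where "(f, scl z f) \<in> T" "f \<noteq> 0"
proof -
  have "dim (deficiency_space scl V H S z) = 1"
    using defect z unfolding has_defect_one_one_def by auto
  then have "\<not> deficiency_space scl V H S z \<subseteq> span {}"
    using dim_le_card[of "deficiency_space scl V H S z" "{}"] by auto
  then show thesis using that unfolding deficiency_space_def T_def by auto
qed

text \<open>Otherwise \<open>G1 = c G0\<close> on the whole domain, and Green's identity at defect
  vectors for \<open>\<i>\<close> and \<open>- \<i>\<close> gives \<open>Im c\<close> both signs.
  The vector found here is what forces \<open>G0 = 0\<close> on the adjoint of
  \<open>A0\<close>.\<close>

lemma ker_G0_G1: "\<exists>f f'. (f, f') \<in> A0 \<and> G1 f \<noteq> 0"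
proof (rule ccontr)
  assume "\<nexists>f f'. (f, f') \<in> A0 \<and> G1 f \<noteq> 0"
  then have van: "G1 f = 0" if "(f, f') \<in> A0" for f f' using that by blast
  obtain f0 f0' where f0: "(f0, f0') \<in> T" "G0 f0 \<noteq> 0"
    using triple unfolding boundary_triple_def Let_def T_def by blast
  define c where "c = G1 f0 / G0 f0"
  have propor: "G1 f = c * G0 f" if f: "(f, f') \<in> T" for f f'
  proof -
    define d where "d = G0 f / G0 f0"
    have t: "(f - scl d f0, f' - scl d f0') \<in> T" by (rule T_diff[OF f T_scl[OF f0(1)]])
    have "G0 (f - scl d f0) = 0"
      using G_diff(1)[OF f T_scl[OF f0(1)]] G_lin(3)[OF f0(1) f0(1)] f0(2) by (simp add: d_def)
    then have "G1 (f - scl d f0) = 0" using van t unfolding A0_def by blast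
    then show ?thesis
      using G_diff(2)[OF f T_scl[OF f0(1)]] G_lin(4)[OF f0(1) f0(1)] f0(2) by (simp add: d_def c_def field_simps)
  qed
  have key: "(z - cnj z) * of_real ((nm f)\<^sup>2) = (c - cnj c) * (G0 f * cnj (G0 f))" if "(f, scl z f) \<in> T" for z f
    using Green[OF that that] T_fst[OF that] propor[OF that] by (simp add: Hsimps Hself algebra_simps)
  obtain f where f: "(f, scl \<i> f) \<in> T" "f \<noteq> 0" using defect_vector[of \<i>] by blast
  obtain g where g: "(g, scl (- \<i>) g) \<in> T" "g \<noteq> 0" using defect_vector[of "- \<i>"] by blast
  have e1: "2 * Im c * (cmod (G0 f))\<^sup>2 = 2 * (nm f)\<^sup>2"
    using arg_cong[OF key[OF f(1)], of Im] by (simp add: complex_mult_cnj cmod_power2 flip: of_real_power)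
  have e2: "2 * Im c * (cmod (G0 g))\<^sup>2 = - (2 * (nm g)\<^sup>2)"
    using arg_cong[OF key[OF g(1)], of Im] by (simp add: complex_mult_cnj cmod_power2 flip: of_real_power)
  have "(nm f)\<^sup>2 > 0" "(nm g)\<^sup>2 > 0"
    using f g T_fst nm_eq_0 by (metis zero_less_power2)+
  then have "2 * Im c * (cmod (G0 f))\<^sup>2 > 0" "2 * Im c * (cmod (G0 g))\<^sup>2 < 0"
    unfolding e1 e2 by simp_all
  then show False by (auto simp: zero_less_mult_iff mult_less_0_iff)
qed

lemma A0_selfadjoint: "A0 = adjoint_in V H A0"
proof (rule set_eqI, rule iffI)
  fix p assume p: "p \<in> A0"
  obtain g g' where pg: "p = (g, g')" by (cases p) blast
  have "(g, g') \<in> adjoint_in V H A0"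
    by (rule adj_I) (use p pg A0_sym T_mem[OF A0_T, of g g'] in blast)+
  then show "p \<in> adjoint_in V H A0" by (simp add: pg)
next
  fix p assume p: "p \<in> adjoint_in V H A0"
  obtain g g' where pg: "p = (g, g')" by (cases p) blast
  have S_A0: "(f, f') \<in> A0" if "(f, f') \<in> S" for f f'
    using S_T[OF that] Domain_S_G[of f] that unfolding A0_def by blast
  have gT: "(g, g') \<in> T"
    unfolding T_def using adj_D p[unfolded pg] adj_eq[OF p[unfolded pg] S_A0] by (intro adj_I) blast+
  obtain f f' where f: "(f, f') \<in> A0" "G1 f \<noteq> 0" using ker_G0_G1 by blast
  have "cnj (G0 g) * G1 f = 0"
    using Green[OF A0_T[OF f(1)] gT] adj_eq[OF p[unfolded pg] f(1)] A0_G[OF f(1)] by simp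
  then show "p \<in> A0" using f(2) gT pg by (simp add: A0_def)
qed

lemma A0_real: "(f, f') \<in> A0 \<Longrightarrow> Im (H f' f) = 0"
  using A0_sym[of f f' f f'] Hcnj[of f f'] T_mem[OF A0_T, of f f'] by (metis cnj.sel(2) neg_equal_zero)

lemma A0_lower:
  assumes f: "(f, f') \<in> A0" shows "\<bar>Im z\<bar> * nm f \<le> nm (f' - scl z f)"
proof (cases "nm f = 0")
  case False
  have m: "f \<in> V" "f' \<in> V" using T_mem[OF A0_T[OF f]] by blast+
  have p: "nm f > 0" using nm_pos[OF m(1)] False by simp
  have "Im (H (f' - scl z f) f) = - Im z * (nm f)\<^sup>2"
    using A0_real[OF f] m by (simp add: Hsimps Hself)
  then have "\<bar>Im z\<bar> * (nm f)\<^sup>2 \<le> cmod (H (f' - scl z f) f)"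
    using abs_Im_le_cmod[of "H (f' - scl z f) f"] by (simp add: abs_mult)
  also have "\<dots> \<le> nm (f' - scl z f) * nm f" by (rule Cauchy_Schwarz) (use m in auto)
  finally show ?thesis using p by (simp add: power2_eq_square)
qed (use T_mem[OF A0_T[OF f]] in simp)

definition "R0 z g = (SOME f. (f, g + scl z f) \<in> A0)"

lemma
  assumes z: "Im z \<noteq> 0" and g: "g \<in> V"
  shows R0: "(R0 z g, g + scl z (R0 z g)) \<in> A0" and R0_bound: "\<bar>Im z\<bar> * nm (R0 z g) \<le> nm g"
proof -
  obtain f where "(f, g + scl z f) \<in> A0"
    by (rule selfadjoint_surj[OF A0_selfadjoint _ A0_lower[of _ _ "cnj z"] g]) (use z in auto)
  then show r: "(R0 z g, g + scl z (R0 z g)) \<in> A0" unfolding R0_def by (rule someI)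
  show "\<bar>Im z\<bar> * nm (R0 z g) \<le> nm g" using A0_lower[OF r, of z] by simp
qed

lemma R0_V: "Im z \<noteq> 0 \<Longrightarrow> g \<in> V \<Longrightarrow> R0 z g \<in> V"
  using T_fst[OF A0_T[OF R0]] by blast

definition "psi z = weyl_solution scl V H S G0 z"
definition "m z = weyl_function scl V H S G0 G1 z"

text \<open>Any \<open>f\<close> with \<open>G0 f = 1\<close> is corrected by the resolvent of
  \<open>A0\<close>, which does not change \<open>G0\<close>. The difference of two solutions would
  be an eigenvector of \<open>A0\<close> at a nonreal point.\<close>

lemma psi_ex1: assumes z: "Im z \<noteq> 0" shows "\<exists>!f. f \<in> deficiency_space scl V H S z \<and> G0 f = 1"
proof -
  obtain f0 f0' where f0: "(f0, f0') \<in> T" "G0 f0 \<noteq> 0"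
    using triple unfolding boundary_triple_def Let_def T_def by blast
  define f f' where "f = scl (1 / G0 f0) f0" and "f' = scl (1 / G0 f0) f0'"
  have f: "(f, f') \<in> T" "G0 f = 1"
    unfolding f_def f'_def using T_scl[OF f0(1)] G_lin(3)[OF f0(1) f0(1)] f0(2) by simp_all
  define u where "u = R0 z (f' - scl z f)"
  have u: "(u, f' - scl z f + scl z u) \<in> A0"
    unfolding u_def by (rule R0[OF z]) (use T_mem[OF f(1)] in auto)
  have "(f - u, f' - (f' - scl z f + scl z u)) \<in> T" by (rule T_diff[OF f(1) A0_T[OF u]])
  then have "(f - u, scl z (f - u)) \<in> T" by (simp add: scale_right_diff_distrib)
  moreover have "G0 (f - u) = 1" using G_diff(1)[OF f(1) A0_T[OF u]] A0_G[OF u] f(2) by simp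
  moreover have "g = h" if g: "(g, scl z g) \<in> T" "G0 g = 1" and h: "(h, scl z h) \<in> T" "G0 h = 1" for g h
  proof -
    have "(g - h, scl z g - scl z h) \<in> A0"
      using T_diff[OF g(1) h(1)] G_diff(1)[OF g(1) h(1)] g(2) h(2) by (simp add: A0_def)
    then have "\<bar>Im z\<bar> * nm (g - h) \<le> 0"
      using A0_lower[of "g - h" "scl z g - scl z h" z] by (simp add: scale_right_diff_distrib)
    then have "nm (g - h) = 0"
      using z T_fst[OF g(1)] T_fst[OF h(1)] nm_pos[of "g - h"] by (auto simp: mult_le_0_iff)
    then show ?thesis using nm_eq_0[of "g - h"] T_fst[OF g(1)] T_fst[OF h(1)] by simp
  qed
  ultimately show ?thesis unfolding deficiency_space_def T_def[symmetric] by blast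
qed

lemma
  assumes "Im z \<noteq> 0"
  shows psi_T: "(psi z, scl z (psi z)) \<in> T" and psi_G0: "G0 (psi z) = 1" and psi_G1: "G1 (psi z) = m z"
  using theI'[OF psi_ex1[OF assms]]
  unfolding deficiency_space_def psi_def m_def weyl_function_def weyl_solution_def T_def by blast+

lemma psi_V: "Im z \<noteq> 0 \<Longrightarrow> psi z \<in> V"
  using T_fst[OF psi_T] by blast

text \<open>The Gram matrix of the Weyl solutions is the Nevanlinna kernel of \<open>m\<close>; this
  is the link between the boundary triple and the reproducing kernel space in the
  \<open>B_infty\<close> condition.\<close>

lemma psi_inner:
  assumes "Im z \<noteq> 0" "Im w \<noteq> 0" shows "(z - cnj w) * H (psi z) (psi w) = m z - cnj (m w)"
  using Green[OF psi_T[OF assms(1)] psi_T[OF assms(2)]] psi_V[OF assms(1)] psi_V[OF assms(2)]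
    psi_G0 psi_G1 assms by (simp add: Hsimps algebra_simps)

lemma m_cnj: "Im z \<noteq> 0 \<Longrightarrow> m (cnj z) = cnj (m z)"
  using psi_inner[of "cnj z" z] by simp

lemma Im_m: "Im z \<noteq> 0 \<Longrightarrow> Im (m z) = Im z * (nm (psi z))\<^sup>2"
  using arg_cong[OF psi_inner[of z z], of Im] psi_V[of z] by (simp add: Hself)

lemma psi_nz: "Im z \<noteq> 0 \<Longrightarrow> psi z \<noteq> 0"
  using psi_G0[of z] psi_T[of z] G_lin(3)[OF psi_T psi_T, of z z 0] by force

lemma nm_psi_pos: "Im z \<noteq> 0 \<Longrightarrow> nm (psi z) > 0"
  using psi_nz[of z] nm_eq_0[OF psi_V] nm_pos[OF psi_V] by blast

text \<open>Green's identity between the resolvent, where \<open>G0\<close> is 0, and the Weyl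
  solution at the conjugate point, where it is 1. The boundary value in the coupling condition thus
  becomes an inner product.\<close>

lemma G1_R0: assumes z: "Im z \<noteq> 0" and g: "g \<in> V" shows "G1 (R0 z g) = H g (psi (cnj z))"
proof -
  have z': "Im (cnj z) \<noteq> 0" using z by simp
  have "H (g + scl z (R0 z g)) (psi (cnj z)) - H (R0 z g) (scl (cnj z) (psi (cnj z))) = G1 (R0 z g)"
    using Green[OF A0_T[OF R0[OF z g]] psi_T[OF z']] A0_G[OF R0[OF z g]] psi_G0[OF z'] by simp
  then show ?thesis using psi_V[OF z'] R0_V[OF z g] g by (simp add: Hsimps)
qed

text \<open>Since \<open>S\<close> is nonnegative and has codimension one in \<open>A\<^sub>0\<close>, the form of \<open>A\<^sub>0\<close> has at most one
  negative square.\<close>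

lemma A0_bounded_below:
  obtains c where "c \<ge> 0" "\<And>f f'. (f, f') \<in> A0 \<Longrightarrow> - c * (nm f)\<^sup>2 \<le> Re (H f' f)"
proof (cases "\<exists>h h'. (h, h') \<in> A0 \<and> Re (H h' h) < 0")
  case False
  then show thesis using that[of 0] by (force simp: not_less)
next
  case True
  then obtain h h' where h: "(h, h') \<in> A0" and neg: "Re (H h' h) < 0" by blast
  define a where "a = Re (H h' h)"
  have Ha: "H h' h = of_real a" using A0_real[OF h] by (simp add: a_def complex_eq_iff)
  have a: "a < 0" using neg by (simp add: a_def)
  have hV: "h \<in> V" "h' \<in> V" using T_mem[OF A0_T[OF h]] by blast+
  have G1h: "G1 h \<noteq> 0" using S_dom_nonneg[OF A0_T[OF h] A0_G[OF h]] neg by force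
  \<comment> \<open>The combination \<open>p g + q h\<close> on which \<open>G1\<close> vanishes
    lies in the domain of \<open>S\<close>. Its energy is \<open>|p|^2\<close> times that of
    \<open>g\<close> plus \<open>|q|^2 a\<close> with \<open>a < 0\<close>, so the energy of
    \<open>g\<close> cannot be negative.\<close>
  have orth_pos: "0 \<le> Re (H g' g)" if g: "(g, g') \<in> A0" "H g' h = 0" for g g'
  proof -
    have gV: "g \<in> V" "g' \<in> V" using T_mem[OF A0_T[OF g(1)]] by blast+
    define p q where "p = G1 h" and "q = - G1 g"
    have v: "(scl p g + scl q h, scl p g' + scl q h') \<in> A0" by (intro A0_add A0_scl g h)
    have "G1 (scl p g + scl q h) = p * G1 g + q * G1 h"
      using G_lin[OF T_scl[OF A0_T[OF g(1)]] T_scl[OF A0_T[OF h]]]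
        G_lin(4)[OF A0_T[OF g(1)] A0_T[OF h]] G_lin(4)[OF A0_T[OF h] A0_T[OF h]] by simp
    then have "0 \<le> Re (H (scl p g' + scl q h') (scl p g + scl q h))"
      using S_dom_nonneg[OF A0_T[OF v] A0_G[OF v]] by (simp add: p_def q_def)
    moreover have "H h' g = 0" using A0_sym[OF g(1) h] g(2) Hcnj[of g h'] gV hV by simp
    moreover have "H (scl p g' + scl q h') (scl p g + scl q h)
        = p * cnj p * H g' g + p * cnj q * H g' h + q * cnj p * H h' g + q * cnj q * H h' h"
      using gV hV by (simp add: Hsimps algebra_simps)
    ultimately have "0 \<le> Re (of_real ((cmod p)\<^sup>2) * H g' g + of_real ((cmod q)\<^sup>2) * of_real a)"
      using g(2) Ha by (simp only: complex_norm_square mult_zero_right add_0_right)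
    then have "0 \<le> (cmod p)\<^sup>2 * Re (H g' g) + (cmod q)\<^sup>2 * a" by simp
    moreover have "(cmod q)\<^sup>2 * a \<le> 0" using a by (simp add: mult_nonneg_nonpos)
    moreover have "(cmod p)\<^sup>2 > 0" using G1h by (simp add: p_def)
    ultimately show ?thesis by (smt (verit) mult_pos_neg)
  qed
  \<comment> \<open>In \<open>f = g + d h\<close> with \<open>g\<close> orthogonal to
    \<open>h\<close> for the energy form only \<open>|d|^2 a\<close> is negative, and
    \<open>d = H f h' / a\<close> is at most \<open>nm f * nm h' / |a|\<close>.\<close>
  define c where "c = (nm h')\<^sup>2 / \<bar>a\<bar>"
  have "- c * (nm f)\<^sup>2 \<le> Re (H f' f)" if f: "(f, f') \<in> A0" for f f'
  proof -
    have fV: "f \<in> V" "f' \<in> V" using T_mem[OF A0_T[OF f]] by blast+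
    define d where "d = H f' h / of_real a"
    define g g' where "g = f - scl d h" and "g' = f' - scl d h'"
    have g: "(g, g') \<in> A0" unfolding g_def g'_def by (intro A0_diff A0_scl f h)
    have gV: "g \<in> V" "g' \<in> V" using T_mem[OF A0_T[OF g]] by blast+
    have gh: "H g' h = 0" unfolding g'_def using fV hV a Ha by (simp add: Hsimps d_def)
    have hg: "H h' g = 0" using A0_sym[OF g h] gh Hcnj[of g h'] gV hV by simp
    have "H f' f = H (g' + scl d h') (g + scl d h)" by (simp add: g_def g'_def)
    also have "\<dots> = H g' g + d * cnj d * of_real a"
      using gV hV by (simp add: Hsimps gh hg Ha algebra_simps)
    finally have "Re (H f' f) = Re (H g' g) + (cmod d)\<^sup>2 * a" by (simp add: complex_norm_square[symmetric])
    then have "Re (H f' f) \<ge> (cmod d)\<^sup>2 * a" using orth_pos[OF g gh] by simp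
    moreover have "cmod d \<le> nm f * nm h' / \<bar>a\<bar>"
      unfolding d_def A0_sym[OF f h] norm_divide
      using divide_right_mono[OF Cauchy_Schwarz[OF fV(1) hV(2)], of "\<bar>a\<bar>"] by simp
    then have "(cmod d)\<^sup>2 \<le> (nm f * nm h' / \<bar>a\<bar>)\<^sup>2" by (rule power_mono) simp
    then have "(cmod d)\<^sup>2 * a \<ge> (nm f * nm h' / \<bar>a\<bar>)\<^sup>2 * a" using a by (simp add: mult_right_mono_neg)
    moreover have "(nm f * nm h' / \<bar>a\<bar>)\<^sup>2 * a = - c * (nm f)\<^sup>2"
      unfolding c_def using a by (simp add: field_simps power2_eq_square)
    ultimately show ?thesis by linarith
  qed
  then show thesis using that[of c] by (simp add: c_def)
qed

text \<open>On the spectral side the estimate is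
  \<open>\<lambda> / (\<lambda>\<^sup>2 + y\<^sup>2) \<le> K / s (p s - p (2 s))\<close> with \<open>p s = (\<lambda> + c) / (\<lambda> + c + s)\<close>; the right-hand
  sides telescope over dyadic \<open>s\<close>.\<close>

lemma dyadic_estimate:
  obtains K and p :: "'a \<Rightarrow> real \<Rightarrow> real" where "K \<ge> 0"
    "\<And>f s. f \<in> V \<Longrightarrow> s > 0 \<Longrightarrow> 0 \<le> p f s \<and> p f s \<le> (nm f)\<^sup>2"
    "\<And>f s y. f \<in> V \<Longrightarrow> 1 \<le> s \<Longrightarrow> s \<le> \<bar>y\<bar> \<Longrightarrow> \<bar>y\<bar> \<le> 2 * s \<Longrightarrow>
       Re (H (R0 (\<i> * of_real y) f) f) \<le> K / s * (p f s - p f (2 * s))"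
proof -
  obtain c where c: "c \<ge> 0" "\<And>f f'. (f, f') \<in> A0 \<Longrightarrow> - c * (nm f)\<^sup>2 \<le> Re (H f' f)"
    using A0_bounded_below by blast
  let ?c = "complex_of_real c"
  \<comment> \<open>\<open>X\<close> is the nonnegative operator \<open>A0 + c\<close>. Below,
    \<open>w f s\<close> is \<open>(X + s)^-1 f\<close>, and \<open>p f s\<close> is the form of
    \<open>X (X + s)^-1\<close> at \<open>f\<close>.\<close>
  define X where "X = {(f, g). (f, g - scl ?c f) \<in> A0}"
  have X_A0: "(f, f' + scl ?c f) \<in> X \<longleftrightarrow> (f, f') \<in> A0" for f f' by (simp add: X_def)
  have X_V: "f \<in> V \<and> g \<in> V" if "(f, g) \<in> X" for f g
  proof -
    have "f \<in> V \<and> g - scl ?c f \<in> V" using that T_mem[OF A0_T] unfolding X_def by blast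
    then show ?thesis using Vadd[of "g - scl ?c f" "scl ?c f"] by auto
  qed
  have X_sym: "H f' g = H f g'" if "(f, f') \<in> X" "(g, g') \<in> X" for f f' g g'
  proof -
    have "H (f' - scl ?c f) g = H f (g' - scl ?c g)" using A0_sym that unfolding X_def by blast
    then show ?thesis using X_V[OF that(1)] X_V[OF that(2)] by (simp add: Hsimps)
  qed
  have X_pos: "0 \<le> Re (H f' f)" if "(f, f') \<in> X" for f f'
    using c(2)[of f "f' - scl ?c f"] that X_V[OF that] by (simp add: X_def Hsimps Hself)
  have X_add: "(f + g, f' + g') \<in> X" if "(f, f') \<in> X" "(g, g') \<in> X" for f f' g g'
    using A0_add[of f "f' - scl ?c f" g "g' - scl ?c g"] that by (simp add: X_def algebra_simps)
  have X_scl: "(scl d f, scl d f') \<in> X" if "(f, f') \<in> X" for d f f'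
    using A0_scl[of f "f' - scl ?c f" d] that by (simp add: X_def scale_right_diff_distrib mult.commute)
  have X_diff: "(f - g, f' - g') \<in> X" if "(f, f') \<in> X" "(g, g') \<in> X" for f f' g g'
    using X_add[OF that(1) X_scl[OF that(2), of "-1"]] by simp
  have X_single: "f' = f''" if "(f, f') \<in> X" "(f, f'') \<in> X" for f f' f''
    using that T_single A0_T unfolding X_def by (metis (no_types, lifting) case_prodD diff_add_cancel mem_Collect_eq)
  have X_quad: "Re (H (f' + g') (f + g)) \<le> 2 * Re (H f' f) + 2 * Re (H g' g)"
    if fg: "(f, f') \<in> X" "(g, g') \<in> X" for f f' g g'
    using X_pos[OF X_diff[OF fg]] X_V[OF fg(1)] X_V[OF fg(2)] by (simp add: Hsimps)
  have X_quad_scl: "Re (H (scl d f') (scl d f)) = (cmod d)\<^sup>2 * Re (H f' f)" if "(f, f') \<in> X" for d f f'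
  proof -
    have "H (scl d f') (scl d f) = of_real ((cmod d)\<^sup>2) * H f' f"
      using X_V[OF that] by (simp add: Hsimps complex_norm_square del: of_real_power)
    then show ?thesis by simp
  qed
  define w where "w f s = (SOME w. (w, f - scl (of_real s) w) \<in> X)" for f and s :: real
  have w: "(w f s, f - scl (of_real s) (w f s)) \<in> X" if f: "f \<in> V" and s: "s > 0" for f s
  proof -
    obtain u where "(u, f + scl (of_real (- (c + s))) u) \<in> A0"
    proof (rule selfadjoint_surj[OF A0_selfadjoint s _ f])
      fix k k' assume k: "(k, k') \<in> A0"
      have kV: "k \<in> V" "k' \<in> V" using T_mem[OF A0_T[OF k]] by blast+
      let ?r = "k' - scl (cnj (of_real (- (c + s)))) k"
      have "cnj (complex_of_real (- (c + s))) = - complex_of_real (c + s)" by simp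
      then have r: "?r = k' + scl (complex_of_real (c + s)) k"
        by (simp only: scale_minus_left diff_minus_eq_add)
      have "Re (H ?r k) = Re (H k' k) + (c + s) * (nm k)\<^sup>2"
        unfolding r using kV by (simp add: Hsimps Hself del: of_real_add)
      then have "s * (nm k)\<^sup>2 \<le> Re (H ?r k)" using c(2)[OF k] by (simp add: algebra_simps)
      also have "\<dots> \<le> nm ?r * nm k" by (rule ReH_le) (use kV in auto)
      finally have "s * nm k * nm k \<le> nm ?r * nm k" by (simp add: power2_eq_square)
      then show "s * nm k \<le> nm ?r" using kV nm_pos[OF kV(1)] by (cases "nm k = 0") auto
    qed blast
    then have "(u, f - scl (of_real s) u) \<in> X" by (simp add: X_def scale_left_distrib algebra_simps)
    then show ?thesis unfolding w_def by (rule someI)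
  qed
  have w_uniq: "u = w f s" if f: "f \<in> V" and s: "s > 0" and u: "(u, f - scl (of_real s) u) \<in> X" for f s u
  proof -
    have uV: "u - w f s \<in> V" using X_V[OF u] X_V[OF w[OF f s]] by blast
    have "0 \<le> Re (H (f - scl (of_real s) u - (f - scl (of_real s) (w f s))) (u - w f s))"
      by (rule X_pos[OF X_diff[OF u w[OF f s]]])
    also have "f - scl (of_real s) u - (f - scl (of_real s) (w f s)) = scl (of_real (- s)) (u - w f s)"
      by (simp add: scale_right_diff_distrib)
    finally have "s * (nm (u - w f s))\<^sup>2 \<le> 0" using uV by (simp add: Hsimps Hself)
    then have "nm (u - w f s) = 0" using s by (simp add: mult_le_0_iff)
    then show ?thesis using nm_eq_0[OF uV] by simp
  qed
  define p where "p f s = (nm f)\<^sup>2 - s * Re (H (w f s) f)" for f s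
  have p01: "0 \<le> p f s \<and> p f s \<le> (nm f)\<^sup>2" if f: "f \<in> V" and s: "s > 0" for f s
  proof -
    let ?w = "w f s" and ?x = "f - scl (of_real s) (w f s)"
    have m: "?w \<in> V" "?x \<in> V" using X_V[OF w[OF f s]] by blast+
    have f_eq: "f = ?x + scl (of_real s) ?w" by simp
    have q: "0 \<le> Re (H ?x ?w)" by (rule X_pos[OF w[OF f s]])
    have re: "Re (H ?w ?x) = Re (H ?x ?w)" using Hcnj[OF m] by (metis cnj.sel(1))
    have "H ?w f = H ?w (?x + scl (of_real s) ?w)" by simp
    also have "\<dots> = H ?w ?x + of_real s * H ?w ?w" using m by (simp only: Hsimps Vscl complex_cnj_complex_of_real)
    finally have a: "Re (H ?w f) = Re (H ?x ?w) + s * (nm ?w)\<^sup>2" using re m by (simp add: Hself)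
    have "(nm f)\<^sup>2 = (nm (?x + scl (of_real s) ?w))\<^sup>2" by simp
    also have "\<dots> = (nm ?x)\<^sup>2 + 2 * (s * Re (H ?x ?w)) + (s * nm ?w)\<^sup>2"
      using m s nm_add_sq[OF m(2) Vscl[OF m(1), of "of_real s"]] Hscl2[OF m(2) m(1), of "of_real s"] nm_scl[OF m(1), of "of_real s"]
      by simp
    finally have b: "(nm f)\<^sup>2 = (nm ?x)\<^sup>2 + 2 * (s * Re (H ?x ?w)) + (s * nm ?w)\<^sup>2" .
    have "p f s = (nm ?x)\<^sup>2 + s * Re (H ?x ?w)"
      unfolding p_def a b by (simp add: power2_eq_square algebra_simps)
    moreover have "0 \<le> s * Re (H ?w f)" unfolding a using s q by simp
    ultimately show ?thesis using s q by (simp add: p_def)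
  qed
  \<comment> \<open>For \<mu> in the spectrum of \<open>X\<close> this is \<open>s \<mu> / (\<mu> +
    2 s)^2 \<le> s \<mu> / ((\<mu> + s) (\<mu> + 2 s))\<close>. In terms of
    \<open>t = (X + s)^-1 v\<close>, \<open>a = X t\<close> and \<open>b = X a\<close> both sides
    are sums of the same nonnegative quantities with different coefficients.\<close>
  have p_diff: "s * Re (H (f - scl (of_real (2 * s)) (w f (2 * s))) (w f (2 * s))) \<le> p f s - p f (2 * s)"
    if f: "f \<in> V" and s: "s > 0" for f s
  proof -
    let ?s = "complex_of_real s"
    define v where "v = w f (2 * s)"
    define x where "x = f - scl (of_real (2 * s)) v"
    have v: "(v, x) \<in> X" unfolding v_def x_def using w[OF f, of "2 * s"] s by simp
    have vV: "v \<in> V" "x \<in> V" using X_V[OF v] by blast+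
    define t where "t = w v s"
    define a where "a = v - scl ?s t"
    have t: "(t, a) \<in> X" unfolding t_def a_def by (rule w[OF vV(1) s])
    have tV: "t \<in> V" "a \<in> V" using X_V[OF t] by blast+
    define b where "b = x - scl ?s a"
    have a: "(a, b) \<in> X" using X_diff[OF v X_scl[OF t, of ?s]] by (simp add: a_def b_def)
    have bV: "b \<in> V" using X_V[OF a] by blast
    have v_eq: "v = a + scl ?s t" and x_eq: "x = b + scl ?s a" by (simp_all add: a_def b_def)
    have f_eq: "f = x + scl (of_real (2 * s)) v" by (simp add: x_def)
    have "(v + scl ?s t, f - scl ?s (v + scl ?s t)) \<in> X"
    proof -
      have "f - scl ?s (v + scl ?s t) = x + scl ?s a"
      proof -
        have "scl (of_real (2 * s)) v = scl ?s v + scl ?s v"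
          by (simp flip: scale_left_distrib add: of_real_mult)
        then have "f - scl ?s (v + scl ?s t) = x + (scl ?s v - scl ?s (scl ?s t))"
          by (simp add: f_eq scale_right_distrib)
        then show ?thesis by (simp only: a_def scale_right_diff_distrib)
      qed
      then show ?thesis using X_add[OF v X_scl[OF t, of ?s]] by simp
    qed
    then have ws: "w f s = v + scl ?s t" using w_uniq[OF f s] by metis
    have hb: "Re (H b t) = (nm a)\<^sup>2" using X_sym[OF a t] tV by (simp add: Hself)
    have ab: "Re (H a b) = Re (H b a)" using Hcnj[OF tV(2) bV] by (metis cnj.sel(1))
    have at: "Re (H a t) = Re (H t a)" using Hcnj[OF tV(2,1)] by (metis cnj.sel(1))
    have q: "Re (H x v) = Re (H b a) + 2 * s * (nm a)\<^sup>2 + s * s * Re (H a t)"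
      unfolding v_eq x_eq using tV bV hb by (simp add: Hsimps Hself algebra_simps)
    have "p f s - p f (2 * s) = s * Re (H v f) - s * s * Re (H t f)"
      unfolding p_def ws v_def[symmetric] using vV tV f by (simp add: Hsimps algebra_simps)
    also have "\<dots> = s * Re (H a f)" using vV tV f by (simp add: a_def Hsimps algebra_simps)
    also have "Re (H a f) = Re (H a (b + scl ?s a + scl (of_real (2 * s)) (a + scl ?s t)))"
      using f_eq x_eq v_eq by simp
    also have "\<dots> = Re (H b a) + 3 * s * (nm a)\<^sup>2 + 2 * s * s * Re (H a t)"
      using tV bV by (simp add: Hsimps Hself ab algebra_simps)
    finally have d: "p f s - p f (2 * s) = s * (Re (H b a) + 3 * s * (nm a)\<^sup>2 + 2 * s * s * Re (H a t))" .
    have "0 \<le> s * (nm a)\<^sup>2" "0 \<le> s * s * Re (H a t)" using s X_pos[OF t] by simp_all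
    then have "Re (H x v) \<le> Re (H b a) + 3 * s * (nm a)\<^sup>2 + 2 * s * s * Re (H a t)" using q by argo
    then show ?thesis unfolding d v_def[symmetric] x_def[symmetric] using s by simp
  qed
  \<comment> \<open>\<open>(2 + c)^2 + 1\<close> bounds \<open>|d|^2 / y^2\<close> for the number
    \<open>d\<close> below, because \<open>1 \<le> s \<le> |y|\<close>; the factors 2 come from the
    quadratic form of a sum.\<close>
  define K where "K = 2 + 2 * ((2 + c)\<^sup>2 + 1)"
  have est: "Re (H (R0 (\<i> * of_real y) f) f) \<le> K / s * (p f s - p f (2 * s))"
    if f: "f \<in> V" and s: "1 \<le> s" and ys: "s \<le> \<bar>y\<bar>" "\<bar>y\<bar> \<le> 2 * s" for f s y
  proof -
    define z where "z = \<i> * complex_of_real y"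
    have zc: "cnj z = - z" and zz: "z * cnj z = of_real (y\<^sup>2)" and Imz: "Im z = y" "Re z = 0"
      by (simp_all add: z_def complex_eq_iff power2_eq_square)
    have y0: "y \<noteq> 0" and z: "Im z \<noteq> 0" using s ys Imz by auto
    define v where "v = w f (2 * s)"
    define x where "x = f - scl (of_real (2 * s)) v"
    have v: "(v, x) \<in> X" unfolding v_def x_def using w[OF f, of "2 * s"] s by simp
    have vV: "v \<in> V" "x \<in> V" using X_V[OF v] by blast+
    define u where "u = R0 z v"
    have u: "(u, v + scl z u) \<in> A0" unfolding u_def by (rule R0[OF z vV(1)])
    define u2 where "u2 = v + scl z u"
    define u1 where "u1 = u2 + scl ?c u"
    have uX: "(u, u1) \<in> X" unfolding u1_def X_A0 u2_def by (rule u)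
    have uV: "u \<in> V" "u1 \<in> V" using X_V[OF uX] by blast+
    define u2' where "u2' = x + scl z u1"
    have u2X: "(u2, u2') \<in> X" unfolding u2_def u2'_def by (intro X_add X_scl v uX)
    have u2V: "u2 \<in> V" "u2' \<in> V" using X_V[OF u2X] by blast+
    \<comment> \<open>Since \<open>v = (A0 - z) u\<close> with imaginary \<open>z\<close>, the mixed
      terms cancel: the \<open>X\<close>-energy of \<open>v\<close> is that of \<open>A0 u\<close>
      plus \<open>y^2\<close> times that of \<open>u\<close>.\<close>
    have yq: "y\<^sup>2 * Re (H u1 u) \<le> Re (H x v)"
    proof -
      have "H u2' u = H u2 u1" by (rule X_sym[OF u2X uX])
      also have "\<dots> = H u2 u2 + ?c * H u2 u" using uV u2V by (simp add: u1_def Hsimps)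
      also have "H u2 u = H u u2" using A0_sym[OF u u] unfolding u2_def by simp
      also have "H u2 u2 + ?c * H u u2 = H u1 u2" using uV u2V by (simp add: u1_def Hsimps)
      finally have "H u2' u = H u1 u2" .
      moreover have "H (u2' - scl z u1) (u2 - scl z u)
          = H u2' u2 - cnj z * H u2' u - z * H u1 u2 + z * cnj z * H u1 u"
        using uV u2V by (simp add: Hsimps algebra_simps)
      moreover have "x = u2' - scl z u1" "v = u2 - scl z u" by (simp_all add: u2'_def u2_def)
      ultimately have "H x v = H u2' u2 + of_real (y\<^sup>2) * H u1 u" by (simp only: zz) (simp only: zc, simp)
      then have "Re (H x v) = Re (H u2' u2) + y\<^sup>2 * Re (H u1 u)" by simp
      then show ?thesis using X_pos[OF u2X] by simp
    qed
    \<comment> \<open>\<open>d\<close> is the difference of the spectral parameters \<open>z\<close>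
      and \<open>- (c + 2 s)\<close>; the resolvent identity between them is
      \<open>g = v + d u\<close>.\<close>
    define d where "d = of_real (2 * s) + ?c + z"
    define g where "g = R0 z f"
    have g: "(g, f + scl z g) \<in> A0" unfolding g_def by (rule R0[OF z f])
    have gV: "g \<in> V" using T_fst[OF A0_T[OF g]] .
    have gX: "(g, f + scl z g + scl ?c g) \<in> X" unfolding X_A0 by (rule g)
    have sumX: "(v + scl d u, x + scl d u1) \<in> X" by (intro X_add X_scl v uX)
    have g_eq: "g = v + scl d u"
    proof -
      have "(v + scl d u, x + scl d u1 - scl ?c (v + scl d u)) \<in> A0" using sumX by (simp add: X_def)
      moreover have "x + scl d u1 - scl ?c (v + scl d u) = f + scl z (v + scl d u)"
        unfolding x_def u1_def u2_def d_def by (simp add: algebra_simps)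
      ultimately have k: "(v + scl d u, f + scl z (v + scl d u)) \<in> A0" by simp
      have "\<bar>y\<bar> * nm (g - (v + scl d u)) \<le> nm (f + scl z g - (f + scl z (v + scl d u)) - scl z (g - (v + scl d u)))"
        using A0_lower[OF A0_diff[OF g k], of z] by (simp only: Imz)
      also have "\<dots> = 0" by (simp add: scale_right_diff_distrib)
      finally have "nm (g - (v + scl d u)) = 0" using y0 nm_pos[of "g - (v + scl d u)"] gV vV uV
        by (auto simp: mult_le_0_iff)
      then show ?thesis using nm_eq_0[of "g - (v + scl d u)"] gV vV uV by simp
    qed
    have X_eq: "f + scl z g + scl ?c g = x + scl d u1" using X_single[OF gX] sumX g_eq by simp
    have "Re (H g f) = Re (H (f + scl z g) g)"
    proof -
      have "Re (H f g) = Re (H g f)" using Hcnj[OF f gV] by (metis cnj.sel(1))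
      then show ?thesis using f gV by (simp add: Hsimps Hself Imz)
    qed
    also have "\<dots> \<le> Re (H (f + scl z g + scl ?c g) g)" using f gV c(1) by (simp add: Hsimps Hself)
    also have "\<dots> = Re (H (x + scl d u1) (v + scl d u))" unfolding X_eq using g_eq by simp
    also have "\<dots> \<le> 2 * Re (H x v) + 2 * Re (H (scl d u1) (scl d u))" by (rule X_quad[OF v X_scl[OF uX]])
    also have "\<dots> = 2 * Re (H x v) + 2 * ((cmod d)\<^sup>2 * Re (H u1 u))" by (simp only: X_quad_scl[OF uX])
    also have "\<dots> \<le> 2 * Re (H x v) + 2 * (((2 + c)\<^sup>2 + 1) * Re (H x v))"
    proof -
      have "2 * s + c \<le> (2 + c) * \<bar>y\<bar>"
      proof -
        have "2 * s + c \<le> 2 * s + c * s" using s c(1) mult_left_mono[of 1 s c] by simp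
        also have "\<dots> = (2 + c) * s" by (simp add: algebra_simps)
        also have "\<dots> \<le> (2 + c) * \<bar>y\<bar>" using ys c(1) by (intro mult_left_mono) auto
        finally show ?thesis .
      qed
      then have "(2 * s + c)\<^sup>2 \<le> ((2 + c) * \<bar>y\<bar>)\<^sup>2" using s c(1) by (intro power_mono) auto
      then have "(2 * s + c)\<^sup>2 \<le> (2 + c)\<^sup>2 * y\<^sup>2" by (simp add: power_mult_distrib)
      moreover have "(cmod d)\<^sup>2 = (2 * s + c)\<^sup>2 + y\<^sup>2" by (simp add: d_def cmod_power2 Imz)
      ultimately have "(cmod d)\<^sup>2 \<le> ((2 + c)\<^sup>2 + 1) * y\<^sup>2" by (simp add: distrib_right)
      then have "(cmod d)\<^sup>2 * Re (H u1 u) \<le> ((2 + c)\<^sup>2 + 1) * y\<^sup>2 * Re (H u1 u)"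
        using X_pos[OF uX] by (rule mult_right_mono)
      also have "\<dots> = ((2 + c)\<^sup>2 + 1) * (y\<^sup>2 * Re (H u1 u))" by simp
      also have "\<dots> \<le> ((2 + c)\<^sup>2 + 1) * Re (H x v)" using yq by (intro mult_left_mono) auto
      finally show ?thesis by simp
    qed
    also have "\<dots> = K * Re (H x v)" by (simp add: K_def algebra_simps)
    also have "\<dots> \<le> K * ((p f s - p f (2 * s)) / s)"
    proof -
      have "Re (H x v) \<le> (p f s - p f (2 * s)) / s"
        using p_diff[OF f, of s] s unfolding v_def[symmetric] x_def[symmetric] by (simp add: field_simps)
      then show ?thesis by (intro mult_left_mono) (simp_all add: K_def add_nonneg_nonneg)
    qed
    finally show ?thesis by (simp add: g_def z_def)
  qed
  show thesis
  proof (rule that[of K p])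
    show "K \<ge> 0" by (simp add: K_def add_nonneg_nonneg)
  qed (use p01 est in auto)
qed

end

section \<open>The \<open>B\<^sub>\<infinity>\<close>-property as a weighted norm inequality\<close>

lemma vector_space_fun: "vector_space (\<lambda>c (h :: complex \<Rightarrow> complex) z. c * h z)"
  by unfold_locales (auto simp: fun_eq_iff algebra_simps)

text \<open>Passing to the conjugate space exchanges the arguments of the inner product. Weyl
  solutions in the upper half-plane are then covered by the same lemma as those in the lower
  one.\<close>

lemma (in hilb) conj_hilb: "hilb (\<lambda>c. scl (cnj c)) V (\<lambda>x y. H y x)"
proof -
  have vs: "vector_space (\<lambda>c. scl (cnj c))"
    by unfold_locales (auto simp: scale_left_distrib scale_right_distrib)
  interpret C: vector_space "\<lambda>c. scl (cnj c)" by (rule vs)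
  have "ip_norm (\<lambda>x y. H y x) = ip_norm H" by (simp add: ip_norm_def fun_eq_iff)
  then have d: "ip_dist V (\<lambda>x y. H y x) = ip_dist V H" by (simp add: ip_dist_def fun_eq_iff)
  have "hilbert_space (\<lambda>c. scl (cnj c)) V (\<lambda>x y. H y x)"
    unfolding hilbert_space_def inner_product_on_def d
  proof (intro conjI)
    show "C.subspace V" by (rule C.subspaceI) auto
    show "sesquilinear_on (\<lambda>c. scl (cnj c)) V (\<lambda>x y. H y x)"
      unfolding sesquilinear_on_def by (simp add: Hsimps)
    show "hermitian_on V (\<lambda>x y. H y x)" unfolding hermitian_on_def by (simp add: Hcnj)
    show "\<forall>x\<in>V. x \<noteq> 0 \<longrightarrow> 0 < Re (H x x)"
      using hilbert unfolding hilbert_space_def inner_product_on_def by blast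
    show "Metric_space.mcomplete V (ip_dist V H)" using hilbert unfolding hilbert_space_def by blast
  qed
  then show ?thesis by (intro hilb.intro hilb_axioms.intro vs)
qed

text \<open>A relation between combinations of the vectors \<open>\<phi> w\<close> and the same
  combinations of kernel sections. As a relation it needs no proof of being well defined before the
  Gram matrices have been compared.\<close>

inductive kernel_combination ::
    "(complex \<Rightarrow> 'a \<Rightarrow> 'a) \<Rightarrow> (complex \<Rightarrow> 'a::ab_group_add) \<Rightarrow> (complex \<Rightarrow> complex \<Rightarrow> complex) \<Rightarrow>
      'a \<Rightarrow> (complex \<Rightarrow> complex) \<Rightarrow> bool" for scl \<phi> K where
  kc_zero: "kernel_combination scl \<phi> K 0 0"
| kc_add: "kernel_combination scl \<phi> K v l \<Longrightarrow> Im w > 0 \<Longrightarrow>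
    kernel_combination scl \<phi> K (v + scl c (\<phi> w)) (l + (\<lambda>z. c * K w z))"

text \<open>The vectors \<open>\<phi> w\<close> have the same Gram matrix as the kernel sections of \<open>\<H>(m)\<close>, so
  \<open>f \<mapsto> \<langle>f, \<phi>(\<cdot>)\<rangle>\<close> is a contraction into \<open>\<H>(m)\<close>. Working in the upper half-plane only avoids the
  diagonal values of the kernel.\<close>

lemma B_infty_bound:
  assumes hil: "hilb scl V H" and phi: "\<And>z. Im z > 0 \<Longrightarrow> \<phi> z \<in> V"
    and gram: "\<And>z w. Im z > 0 \<Longrightarrow> Im w > 0 \<Longrightarrow> (z - cnj w) * H (\<phi> w) (\<phi> z) = m z - cnj (m w)"
    and B: "has_B_infty m" and Im_pos: "\<And>y. y > 0 \<Longrightarrow> 0 \<le> Im (m (\<i> * of_real y))"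
  shows "\<exists>C\<ge>0. \<forall>f\<in>V.
      set_integrable lborel {1<..} (\<lambda>y. (cmod (H f (\<phi> (\<i> * of_real y))))\<^sup>2 / Im (m (\<i> * of_real y))) \<and>
      (LINT y:{1<..}|lborel. (cmod (H f (\<phi> (\<i> * of_real y))))\<^sup>2 / Im (m (\<i> * of_real y))) \<le> C * (ip_norm H f)\<^sup>2"
proof -
  interpret hilb scl V H by (rule hil)
  obtain L ip C where rk: "nev_rkhs m L ip" and
    C: "\<And>h. h \<in> L \<Longrightarrow> (\<lambda>y::real. h (\<i> * of_real y)) \<in> weighted_L2 (\<lambda>y. 1 / Im (m (\<i> * of_real y))) {1<..} \<and>
      weighted_L2_norm (\<lambda>y. 1 / Im (m (\<i> * of_real y))) {1<..} (\<lambda>y. h (\<i> * of_real y)) \<le> C * ip_norm ip h"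
    using B unfolding has_B_infty_def Let_def by blast
  have hilL: "hilb (\<lambda>c h z. c * h z) L ip"
    using rk unfolding nev_rkhs_def by (intro hilb.intro hilb_axioms.intro vector_space_fun) blast
  interpret L: hilb "\<lambda>c h z. c * h z" L ip by (rule hilL)
  define K where "K = nev_kernel_section m"
  have K_L: "K w \<in> L" and repr: "\<And>h. h \<in> L \<Longrightarrow> ip h (K w) = h w" if "Im w > 0" for w
    using rk that unfolding nev_rkhs_def K_def by (auto simp: complex_is_Real_iff)
  have K_val: "K w z = H (\<phi> w) (\<phi> z)" if "Im z > 0" "Im w > 0" for z w
  proof -
    have ne: "z \<noteq> cnj w" using that by (auto simp: complex_eq_iff)
    have "K w z = (m z - cnj (m w)) / (z - cnj w)"
      using ne that unfolding K_def nev_kernel_section_def nev_kernel_def by (auto simp: complex_is_Real_iff)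
    also have "\<dots> = H (\<phi> w) (\<phi> z)" unfolding gram[OF that, symmetric] using ne by simp
    finally show ?thesis .
  qed
  define G where "G = kernel_combination scl \<phi> K"
  have G_mem: "v \<in> V \<and> l \<in> L" if "G v l" for v l
    using that unfolding G_def
  proof induction
    case kc_zero
    show ?case by (rule conjI[OF V0 L.V0])
  next
    case (kc_add v l w c)
    show ?case
      by (rule conjI[OF Vadd[OF conjunct1[OF kc_add.IH] Vscl[OF phi[OF kc_add.hyps(2)]]]
            L.Vadd[OF conjunct2[OF kc_add.IH] L.Vscl[OF K_L[OF kc_add.hyps(2)]]]])
  qed
  have G_val: "l z = H v (\<phi> z)" if "G v l" "Im z > 0" for v l z
    using that(1) unfolding G_def
  proof induction
    case kc_zero
    then show ?case using phi[OF that(2)] by (simp add: H01)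
  next
    case (kc_add v l w c)
    have "v \<in> V" using G_mem kc_add.hyps(1) unfolding G_def by blast
    then show ?case using kc_add phi that(2) by (simp add: Hsimps K_val)
  qed
  have G_ip: "ip l l' = H v v'" if "G v l" "G v' l'" for v l v' l'
    using that(2) unfolding G_def
  proof induction
    case kc_zero
    show ?case using L.H02[OF conjunct2[OF G_mem[OF that(1)]]] H02[OF conjunct1[OF G_mem[OF that(1)]]] by (simp only:)
  next
    case (kc_add v' l' w c)
    note w = kc_add.hyps(2)
    have m: "v' \<in> V" "l' \<in> L" "v \<in> V" "l \<in> L" using G_mem kc_add.hyps(1) that(1) unfolding G_def by blast+
    have "ip l (l' + (\<lambda>z. c * K w z)) = ip l l' + cnj c * ip l (K w)"
      using L.Hadd2[OF m(4) m(2) L.Vscl[OF K_L[OF w], of c]] L.Hscl2[OF m(4) K_L[OF w], of c] by simp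
    also have "\<dots> = H v v' + cnj c * H v (\<phi> w)"
      using kc_add.IH repr[OF w m(4)] G_val[OF that(1) w] by simp
    also have "\<dots> = H v (v' + scl c (\<phi> w))" using m phi[OF w] by (simp add: Hsimps)
    finally show ?case .
  qed
  have G_plus: "G (v + v') (l + l')" if "G v l" "G v' l'" for v l v' l'
    using that(2) unfolding G_def
  proof induction
    case kc_zero
    then show ?case using that(1) by (simp add: G_def)
  next
    case (kc_add v' l' w c)
    from kernel_combination.kc_add[OF kc_add.IH kc_add.hyps(2), of c]
    show ?case by (simp only: add.assoc)
  qed
  have G_scl: "G (scl d v) (\<lambda>z. d * l z)" if "G v l" for d v l
    using that unfolding G_def
  proof induction
    case kc_zero
    have "(\<lambda>z. d * (0::complex \<Rightarrow> complex) z) = 0" by (rule ext) simp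
    then show ?case using kernel_combination.kc_zero[of scl \<phi> K] by (simp only: scale_zero_right)
  next
    case (kc_add v l w c)
    have "(\<lambda>z. d * l z) + (\<lambda>z. (d * c) * K w z) = (\<lambda>z. d * (l + (\<lambda>z. c * K w z)) z)"
      by (rule ext) (simp only: plus_fun_apply distrib_left mult.assoc)
    with kernel_combination.kc_add[OF kc_add.IH kc_add.hyps(2), of "d * c"]
    show ?case by (simp only: scale_right_distrib scale_scale)
  qed
  \<comment> \<open>Equal Gram matrices make the relation isometric, so the second component
    determines the first.\<close>
  have G_uniq: "v = v'" if "G v l" "G v' l" for v v' l
  proof -
    have g: "G (v + scl (-1) v') (l + (\<lambda>z. -1 * l z))" by (intro G_plus G_scl that)
    have l0: "l + (\<lambda>z. -1 * l z) = 0" by (rule ext) simp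
    have "H (v + scl (-1) v') (v + scl (-1) v') = 0"
      using G_ip[OF g g] G_mem[OF g] unfolding l0 by (simp add: L.H01)
    then have "v + scl (-1) v' = 0" using H_eq0 G_mem[OF g] by blast
    then show ?thesis by simp
  qed
  have G_nm: "L.nm l = nm v" if "G v l" for v l
    using G_ip[OF that that] by (simp add: ip_norm_def)
  \<comment> \<open>\<open>h\<close> is the image of \<open>f\<close> under the adjoint of the
    isometry that sends kernel sections to the vectors \<open>\<phi> w\<close>; the Riesz lemma
    provides it together with its norm bound.\<close>
  have transfer: "\<exists>h\<in>L. L.nm h \<le> nm f \<and> (\<forall>z. Im z > 0 \<longrightarrow> h z = H f (\<phi> z))" if f: "f \<in> V" for f
  proof -
    define W where "W = {l. \<exists>v. G v l}"
    define i where "i l = (SOME v. G v l)" for l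
    have i: "i l = v" if "G v l" for v l unfolding i_def using that G_uniq by blast
    have subW: "L.subspace W"
    proof (rule L.subspaceI)
      show "0 \<in> W" unfolding W_def G_def using kernel_combination.kc_zero by blast
      show "x + y \<in> W" if "x \<in> W" "y \<in> W" for x y using that G_plus unfolding W_def by blast
      show "(\<lambda>z. c * x z) \<in> W" if "x \<in> W" for c x using that G_scl unfolding W_def by blast
    qed
    have WL: "W \<subseteq> L" unfolding W_def using G_mem by blast
    obtain h where h: "h \<in> L" "\<And>l. l \<in> W \<Longrightarrow> H (i l) f = ip l h" "L.nm h \<le> nm f"
    proof (rule L.Riesz_subspace[OF subW WL, of "\<lambda>l. H (i l) f" "nm f"])
      show "H (i (x + y)) f = H (i x) f + H (i y) f" if xy: "x \<in> W" "y \<in> W" for x y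
      proof -
        obtain u v where uv: "G u x" "G v y" using xy unfolding W_def by blast
        show ?thesis using i[OF uv(1)] i[OF uv(2)] i[OF G_plus[OF uv]] G_mem[OF uv(1)] G_mem[OF uv(2)] f
          by (simp add: Hadd1)
      qed
      show "H (i (\<lambda>z. c * x z)) f = c * H (i x) f" if x: "x \<in> W" for c x
      proof -
        obtain u where u: "G u x" using x unfolding W_def by blast
        show ?thesis using i[OF u] i[OF G_scl[OF u, of c]] G_mem[OF u] f by (simp add: Hscl1)
      qed
      show "cmod (H (i l) f) \<le> nm f * L.nm l" if l: "l \<in> W" for l
      proof -
        obtain v where v: "G v l" using l unfolding W_def by blast
        show ?thesis using Cauchy_Schwarz[of v f] G_mem[OF v] f i[OF v] G_nm[OF v] by (simp add: mult.commute)
      qed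
    qed (use f in auto)
    have "h z = H f (\<phi> z)" if z: "Im z > 0" for z
    proof -
      have "G (0 + scl 1 (\<phi> z)) (0 + (\<lambda>x. 1 * K z x))"
        unfolding G_def by (intro kernel_combination.intros z)
      then have g: "G (\<phi> z) (K z)" by simp
      have "h z = ip h (K z)" using repr[OF z h(1)] by simp
      also have "\<dots> = cnj (ip (K z) h)" using L.Hcnj[OF K_L[OF z] h(1)] by simp
      also have "K z \<in> W" unfolding W_def using g by blast
      then have "cnj (ip (K z) h) = cnj (H (\<phi> z) f)" using h(2)[of "K z"] i[OF g] by simp
      finally show ?thesis using Hcnj[OF phi[OF z] f] by simp
    qed
    then show ?thesis using h by blast
  qed
  show ?thesis
  proof (intro exI[of _ "(max C 0)\<^sup>2"] conjI ballI)
    show "0 \<le> (max C 0)\<^sup>2" by simp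
    fix f assume f: "f \<in> V"
    obtain h where h: "h \<in> L" "L.nm h \<le> nm f" "\<And>z. Im z > 0 \<Longrightarrow> h z = H f (\<phi> z)"
      using transfer[OF f] by blast
    let ?u = "\<lambda>y::real. (cmod (H f (\<phi> (\<i> * of_real y))))\<^sup>2 / Im (m (\<i> * of_real y))"
    let ?v = "\<lambda>y::real. (cmod (h (\<i> * of_real y)))\<^sup>2 * (1 / Im (m (\<i> * of_real y)))"
    have eq: "indicator {1<..} y *\<^sub>R ?v y = indicator {1<..} y *\<^sub>R ?u y" for y
      using h(3)[of "\<i> * of_real y"] by (auto simp: indicator_def)
    have "set_integrable lborel {1<..} ?v" using C[OF h(1)] unfolding weighted_L2_def by blast
    then have i: "set_integrable lborel {1<..} ?u" unfolding set_integrable_def eq .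
    have lint: "(LINT y:{1<..}|lborel. ?v y) = (LINT y:{1<..}|lborel. ?u y)"
      unfolding set_lebesgue_integral_def eq ..
    have nn: "0 \<le> (LINT y:{1<..}|lborel. ?u y)"
      unfolding set_lebesgue_integral_def
      by (rule integral_nonneg_AE) (use Im_pos in \<open>auto simp: indicator_def\<close>)
    have "sqrt (LINT y:{1<..}|lborel. ?u y) \<le> C * L.nm h"
      using C[OF h(1)] unfolding weighted_L2_norm_def lint by blast
    also have "\<dots> \<le> max C 0 * nm f"
      using h f by (meson L.nm_nonneg max.cobounded1 max.cobounded2 mult_mono)
    finally have "sqrt (LINT y:{1<..}|lborel. ?u y) \<le> max C 0 * nm f" .
    then have "(sqrt (LINT y:{1<..}|lborel. ?u y))\<^sup>2 \<le> (max C 0 * nm f)\<^sup>2"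
      using nn by (intro power_mono) auto
    then have "(LINT y:{1<..}|lborel. ?u y) \<le> (max C 0)\<^sup>2 * (nm f)\<^sup>2"
      using nn by (simp add: power_mult_distrib)
    then show "(LINT y:{1<..}|lborel. ?u y) \<le> (max C 0)\<^sup>2 * (nm f)\<^sup>2" .
    show "set_integrable lborel {1<..} ?u" by (rule i)
  qed
qed

section \<open>The weighted integral inequality for Weyl solutions\<close>

context btriple
begin

text \<open>Krein's formula contains Weyl solutions at \<open>\<i> y\<close> and at
  \<open>- \<i> y\<close>; the sign \<sigma> covers both with one constant.\<close>

lemma B_infty_psi:
  assumes "has_B_infty m"
  obtains C where "0 \<le> C" "\<And>f \<sigma>. f \<in> V \<Longrightarrow> \<sigma> = 1 \<or> \<sigma> = -1 \<Longrightarrow>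
      set_integrable lborel {1<..} (\<lambda>y. (cmod (H f (psi (\<sigma> * (\<i> * of_real y)))))\<^sup>2 / Im (m (\<i> * of_real y))) \<and>
      (LINT y:{1<..}|lborel. (cmod (H f (psi (\<sigma> * (\<i> * of_real y)))))\<^sup>2 / Im (m (\<i> * of_real y))) \<le> C * (nm f)\<^sup>2"
proof -
  have pos: "0 \<le> Im (m (\<i> * of_real y))" if "y > 0" for y
    using Im_m[of "\<i> * of_real y"] that by simp
  interpret C: hilb "\<lambda>c. scl (cnj c)" V "\<lambda>x y. H y x" by (rule conj_hilb)
  have "\<exists>C\<ge>0. \<forall>f\<in>V.
      set_integrable lborel {1<..} (\<lambda>y. (cmod (H f (psi (cnj (\<i> * of_real y)))))\<^sup>2 / Im (m (\<i> * of_real y))) \<and>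
      (LINT y:{1<..}|lborel. (cmod (H f (psi (cnj (\<i> * of_real y)))))\<^sup>2 / Im (m (\<i> * of_real y))) \<le> C * (nm f)\<^sup>2"
  proof (rule B_infty_bound[OF hilb_axioms _ _ assms pos, of "\<lambda>z. psi (cnj z)"])
    show "psi (cnj z) \<in> V" if "Im z > 0" for z using that by (intro psi_V) simp
    show "(z - cnj w) * H (psi (cnj w)) (psi (cnj z)) = m z - cnj (m w)" if "Im z > 0" "Im w > 0" for z w
    proof -
      have "(cnj w - z) * H (psi (cnj w)) (psi (cnj z)) = cnj (m w) - m z"
        using psi_inner[of "cnj w" "cnj z"] m_cnj[of w] m_cnj[of z] that by simp
      then have "- ((cnj w - z) * H (psi (cnj w)) (psi (cnj z))) = - (cnj (m w) - m z)" by simp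
      then show ?thesis by (simp add: algebra_simps)
    qed
  qed
  then obtain C1 where C1: "0 \<le> C1" "\<And>f. f \<in> V \<Longrightarrow>
      set_integrable lborel {1<..} (\<lambda>y. (cmod (H f (psi (cnj (\<i> * of_real y)))))\<^sup>2 / Im (m (\<i> * of_real y))) \<and>
      (LINT y:{1<..}|lborel. (cmod (H f (psi (cnj (\<i> * of_real y)))))\<^sup>2 / Im (m (\<i> * of_real y))) \<le> C1 * (nm f)\<^sup>2"
    by blast
  have cn: "ip_norm (\<lambda>x y. H y x) = ip_norm H" by (simp add: ip_norm_def fun_eq_iff)
  have "\<exists>C\<ge>0. \<forall>f\<in>V.
      set_integrable lborel {1<..} (\<lambda>y. (cmod (H (psi (\<i> * of_real y)) f))\<^sup>2 / Im (m (\<i> * of_real y))) \<and>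
      (LINT y:{1<..}|lborel. (cmod (H (psi (\<i> * of_real y)) f))\<^sup>2 / Im (m (\<i> * of_real y))) \<le> C * (nm f)\<^sup>2"
  proof (rule B_infty_bound[OF conj_hilb _ _ assms pos, of psi, unfolded cn])
    show "psi z \<in> V" if "Im z > 0" for z using that by (intro psi_V) simp
    show "(z - cnj w) * H (psi z) (psi w) = m z - cnj (m w)" if "Im z > 0" "Im w > 0" for z w
      using psi_inner[of z w] that by simp
  qed
  then obtain C2 where C2: "0 \<le> C2" "\<And>f. f \<in> V \<Longrightarrow>
      set_integrable lborel {1<..} (\<lambda>y. (cmod (H (psi (\<i> * of_real y)) f))\<^sup>2 / Im (m (\<i> * of_real y))) \<and>
      (LINT y:{1<..}|lborel. (cmod (H (psi (\<i> * of_real y)) f))\<^sup>2 / Im (m (\<i> * of_real y))) \<le> C2 * (nm f)\<^sup>2"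
    by blast
  have sw: "indicator {1<..} y *\<^sub>R ((cmod (H (psi (\<i> * of_real y)) f))\<^sup>2 / Im (m (\<i> * of_real y)))
      = indicator {1<..} y *\<^sub>R ((cmod (H f (psi (\<i> * of_real y))))\<^sup>2 / Im (m (\<i> * of_real y)))" if f: "f \<in> V" for f y
  proof (cases "y > 1")
    case True
    then have "psi (\<i> * of_real y) \<in> V" by (intro psi_V) simp
    then show ?thesis using Hcnj[of "psi (\<i> * of_real y)" f] f by (metis complex_mod_cnj)
  qed simp
  show thesis
  proof (rule that[of "max C1 C2"])
    show "0 \<le> max C1 C2" using C1(1) by simp
    fix f \<sigma> assume f: "f \<in> V" and s: "\<sigma> = 1 \<or> \<sigma> = (-1::complex)"
    have bd: "C1 * (nm f)\<^sup>2 \<le> max C1 C2 * (nm f)\<^sup>2" "C2 * (nm f)\<^sup>2 \<le> max C1 C2 * (nm f)\<^sup>2"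
      by (intro mult_right_mono; simp)+
    from s show "set_integrable lborel {1<..} (\<lambda>y. (cmod (H f (psi (\<sigma> * (\<i> * of_real y)))))\<^sup>2 / Im (m (\<i> * of_real y))) \<and>
      (LINT y:{1<..}|lborel. (cmod (H f (psi (\<sigma> * (\<i> * of_real y)))))\<^sup>2 / Im (m (\<i> * of_real y))) \<le> max C1 C2 * (nm f)\<^sup>2"
    proof
      assume s: "\<sigma> = 1"
      show ?thesis using C2(2)[OF f] bd(2) unfolding set_integrable_def set_lebesgue_integral_def sw[OF f] s mult_1 by linarith
    next
      assume s: "\<sigma> = - 1"
      have e: "- 1 * (\<i> * complex_of_real y) = cnj (\<i> * of_real y)" for y by simp
      show ?thesis using C1(2)[OF f] bd(1) unfolding s e by linarith
    qed
  qed
qed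

end

section \<open>Krein spaces\<close>

locale krein = vector_space scl for scl :: "complex \<Rightarrow> 'a::ab_group_add \<Rightarrow> 'a" +
  fixes B :: "'a \<Rightarrow> 'a \<Rightarrow> complex" and Kp Km :: "'a set"
  assumes sesqB: "sesquilinear_on scl UNIV B" and hermB: "hermitian_on UNIV B"
    and fd: "fundamental_decomposition scl B Kp Km"
begin

sublocale P: hilb scl Kp B
  by unfold_locales (use fd in \<open>simp add: fundamental_decomposition_def\<close>)

sublocale N: hilb scl Km "\<lambda>x y. - B x y"
  by unfold_locales (use fd in \<open>simp add: fundamental_decomposition_def\<close>)

lemma
  shows Badd1: "B (x + y) z = B x z + B y z" and Badd2: "B x (y + z) = B x y + B x z"
    and Bscl1: "B (scl c x) y = c * B x y" and Bscl2: "B x (scl c y) = cnj c * B x y"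
  using sesqB unfolding sesquilinear_on_def by simp_all

lemma Bcnj: "cnj (B x y) = B y x"
  using hermB unfolding hermitian_on_def by (metis UNIV_I complex_cnj_cnj)

lemma B01: "B 0 y = 0" and B02: "B y 0 = 0"
  using Bscl1[of 0 0 y] Bscl2[of y 0 0] by simp_all

lemma Bneg1: "B (- x) y = - B x y" and Bneg2: "B x (- y) = - B x y"
  using Bscl1[of "-1" x y] Bscl2[of x "-1" y] by simp_all

lemma Bdiff1: "B (x - y) z = B x z - B y z" and Bdiff2: "B x (y - z) = B x y - B x z"
  using Badd1[of x "- y" z] Badd2[of x y "- z"] Bneg1 Bneg2 by simp_all

lemmas Bsimps = Badd1 Badd2 Bscl1 Bscl2 B01 B02 Bneg1 Bneg2 Bdiff1 Bdiff2

lemma Bself: "Im (B x x) = 0"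
  using Bcnj[of x x] by (metis cnj.sel(2) neg_equal_zero)

abbreviation "pp \<equiv> proj_along Kp Km"
abbreviation "pm \<equiv> proj_along Km Kp"
abbreviation "J \<equiv> fund_symmetry Kp Km"
abbreviation "H \<equiv> krein_ip B Kp Km"

lemma decomp_unique: assumes "a \<in> Kp" "b \<in> Km" "a' \<in> Kp" "b' \<in> Km" "a + b = a' + b'" shows "a = a' \<and> b = b'"
proof -
  have "a - a' = b' - b" using assms(5) by (simp add: algebra_simps)
  then have "a - a' \<in> Kp \<inter> Km" using assms by (metis IntI N.Vdiff P.Vdiff)
  then have "a - a' = 0" using fd unfolding fundamental_decomposition_def by blast
  then show ?thesis using assms(5) by simp
qed

lemma pp_eq: assumes "a \<in> Kp" "b \<in> Km" shows "pp (a + b) = a"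
  unfolding proj_along_def
proof (rule the_equality)
  show "c = a" if "c \<in> Kp \<and> a + b - c \<in> Km" for c
  proof -
    have "c + (a + b - c) = a + b" by (simp add: algebra_simps)
    then show ?thesis using decomp_unique that assms by blast
  qed
qed (use assms in simp)

lemma pm_eq: assumes "a \<in> Kp" "b \<in> Km" shows "pm (a + b) = b"
  unfolding proj_along_def
proof (rule the_equality)
  show "c = b" if "c \<in> Km \<and> a + b - c \<in> Kp" for c
  proof -
    have "a + b - c + c = a + b" by (simp add: algebra_simps)
    then show ?thesis using decomp_unique that assms by blast
  qed
qed (use assms in simp)

lemma decomp: obtains a b where "a \<in> Kp" "b \<in> Km" "x = a + b"
  using fd[unfolded fundamental_decomposition_def, THEN conjunct2, THEN conjunct1] by blast

lemma pp_Kp [simp]: "pp x \<in> Kp" and pm_Km [simp]: "pm x \<in> Km" and pp_pm: "pp x + pm x = x"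
  by (rule decomp[of x]; simp add: pp_eq pm_eq)+

lemma pp_add: "pp (x + y) = pp x + pp y" and pm_add: "pm (x + y) = pm x + pm y"
proof -
  have "x + y = (pp x + pp y) + (pm x + pm y)" using pp_pm[of x] pp_pm[of y] by (simp add: algebra_simps)
  then show "pp (x + y) = pp x + pp y" "pm (x + y) = pm x + pm y"
    using pp_eq[of "pp x + pp y" "pm x + pm y"] pm_eq[of "pp x + pp y" "pm x + pm y"] by simp_all
qed

lemma pp_scl: "pp (scl c x) = scl c (pp x)" and pm_scl: "pm (scl c x) = scl c (pm x)"
proof -
  have "scl c x = scl c (pp x) + scl c (pm x)" using pp_pm[of x] by (simp flip: scale_right_distrib)
  then show "pp (scl c x) = scl c (pp x)" "pm (scl c x) = scl c (pm x)"
    using pp_eq[of "scl c (pp x)" "scl c (pm x)"] pm_eq[of "scl c (pp x)" "scl c (pm x)"] by simp_all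
qed

lemma pp_diff: "pp (x - y) = pp x - pp y" and pm_diff: "pm (x - y) = pm x - pm y"
  using pp_add[of x "scl (-1) y"] pm_add[of x "scl (-1) y"] pp_scl[of "-1" y] pm_scl[of "-1" y] by simp_all

lemma pp_id: "x \<in> Kp \<Longrightarrow> pp x = x" and pm_id: "x \<in> Km \<Longrightarrow> pm x = x"
  and pm_Kp: "x \<in> Kp \<Longrightarrow> pm x = 0" and pp_Km: "x \<in> Km \<Longrightarrow> pp x = 0"
  using pp_eq[of x 0] pm_eq[of 0 x] pm_eq[of x 0] pp_eq[of 0 x] by simp_all

lemma orth: "x \<in> Kp \<Longrightarrow> y \<in> Km \<Longrightarrow> B x y = 0" and orth': "x \<in> Kp \<Longrightarrow> y \<in> Km \<Longrightarrow> B y x = 0"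
proof -
  assume xy: "x \<in> Kp" "y \<in> Km"
  then show "B x y = 0" using fd unfolding fundamental_decomposition_def by blast
  then show "B y x = 0" using Bcnj[of x y] by simp
qed

lemma B_split: "B x y = B (pp x) (pp y) + B (pm x) (pm y)"
proof -
  have "B x y = B (pp x + pm x) (pp y + pm y)" by (simp add: pp_pm)
  also have "\<dots> = B (pp x) (pp y) + B (pm x) (pm y)"
    using orth[of "pp x" "pm y"] orth'[of "pp y" "pm x"] by (simp add: Bsimps)
  finally show ?thesis .
qed

lemma J_def': "J x = pp x - pm x"
  by (simp add: fund_symmetry_def)

lemma pp_J: "pp (J x) = pp x" and pm_J: "pm (J x) = - pm x"
  using pp_eq[of "pp x" "- pm x"] pm_eq[of "pp x" "- pm x"] by (simp_all add: J_def')

lemma J_J: "J (J x) = x"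
  using pp_pm[of x] by (simp add: J_def'[of "J x"] pp_J pm_J)

lemma H_split: "H x y = B (pp x) (pp y) - B (pm x) (pm y)"
  unfolding krein_ip_def using B_split[of "J x" y] by (simp add: pp_J pm_J Bsimps)

lemma B_H: "B x y = H (J x) y" and H_B: "H x y = B (J x) y"
  by (simp_all add: krein_ip_def J_J)

lemma H_nm: "Re (H x x) = (P.nm (pp x))\<^sup>2 + (N.nm (pm x))\<^sup>2"
  using P.ReHself[of "pp x"] N.ReHself[of "pm x"] by (simp add: H_split)

lemma H_ip: "inner_product_on scl UNIV H"
  unfolding inner_product_on_def
proof (intro conjI)
  show "sesquilinear_on scl UNIV H"
    unfolding sesquilinear_on_def H_split by (simp add: pp_add pm_add pp_scl pm_scl Bsimps algebra_simps)
  show "hermitian_on UNIV H"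
    unfolding hermitian_on_def H_split by (simp add: Bcnj)
  show "\<forall>x\<in>UNIV. x \<noteq> 0 \<longrightarrow> 0 < Re (H x x)"
  proof (intro ballI impI)
    fix x :: 'a assume "x \<noteq> 0"
    then have "pp x \<noteq> 0 \<or> pm x \<noteq> 0" using pp_pm[of x] by auto
    then have "P.nm (pp x) > 0 \<or> N.nm (pm x) > 0"
      using P.nm_eq_0 P.nm_pos N.nm_eq_0 N.nm_pos pp_Kp pm_Km by metis
    then show "0 < Re (H x x)" unfolding H_nm by (auto intro: add_pos_nonneg add_nonneg_pos)
  qed
qed

lemma nmH: "(ip_norm H x)\<^sup>2 = (P.nm (pp x))\<^sup>2 + (N.nm (pm x))\<^sup>2"
  unfolding ip_norm_def[of H] H_nm by simp

lemma nmH_nonneg: "0 \<le> ip_norm H x"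
  unfolding ip_norm_def[of H] H_nm by simp

lemma pp_le: "P.nm (pp x) \<le> ip_norm H x" and pm_le: "N.nm (pm x) \<le> ip_norm H x"
  and nmH_le: "ip_norm H x \<le> P.nm (pp x) + N.nm (pm x)"
proof -
  show "P.nm (pp x) \<le> ip_norm H x" "N.nm (pm x) \<le> ip_norm H x"
    by (rule power2_le_imp_le; simp add: nmH nmH_nonneg)+
  show "ip_norm H x \<le> P.nm (pp x) + N.nm (pm x)"
    by (rule power2_le_imp_le) (simp_all add: nmH power2_sum)
qed

lemma H_metric: "Metric_space UNIV (ip_dist UNIV H)"
  by (rule inner_product_metric[OF vector_space_axioms subspace_UNIV H_ip])

lemma H_complete: "Metric_space.mcomplete UNIV (ip_dist UNIV H)"
proof -
  interpret M: Metric_space UNIV "ip_dist UNIV H" by (rule H_metric)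
  show ?thesis
    unfolding M.mcomplete_def
  proof (intro allI impI)
    fix X assume C: "M.MCauchy X"
    have c: "\<exists>N. \<forall>m\<ge>N. \<forall>n\<ge>N. ip_norm H (X m - X n) < e" if e: "e > 0" for e
    proof -
      obtain N where "\<And>n n'. N \<le> n \<Longrightarrow> N \<le> n' \<Longrightarrow> ip_dist UNIV H (X n) (X n') < e"
        using C e unfolding M.MCauchy_def by blast
      then show ?thesis by (auto simp: ip_dist_def)
    qed
    obtain a where a: "P.conv (\<lambda>n. pp (X n)) a"
    proof (rule P.complete[of "\<lambda>n. pp (X n)"])
      show "\<exists>N. \<forall>m\<ge>N. \<forall>n\<ge>N. P.nm (pp (X m) - pp (X n)) < e" if e: "e > 0" for e
      proof -
        obtain M where M: "\<And>m n. m \<ge> M \<Longrightarrow> n \<ge> M \<Longrightarrow> ip_norm H (X m - X n) < e" using c[OF e] by blast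
        have "P.nm (pp (X m) - pp (X n)) < e" if "m \<ge> M" "n \<ge> M" for m n
          using M[OF that] pp_le[of "X m - X n"] by (simp add: pp_diff)
        then show ?thesis by blast
      qed
    qed simp
    obtain b where b: "N.conv (\<lambda>n. pm (X n)) b"
    proof (rule N.complete[of "\<lambda>n. pm (X n)"])
      show "\<exists>N. \<forall>m\<ge>N. \<forall>n\<ge>N. N.nm (pm (X m) - pm (X n)) < e" if e: "e > 0" for e
      proof -
        obtain M where M: "\<And>m n. m \<ge> M \<Longrightarrow> n \<ge> M \<Longrightarrow> ip_norm H (X m - X n) < e" using c[OF e] by blast
        have "N.nm (pm (X m) - pm (X n)) < e" if "m \<ge> M" "n \<ge> M" for m n
          using M[OF that] pm_le[of "X m - X n"] by (simp add: pm_diff)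
        then show ?thesis by blast
      qed
    qed simp
    have ab: "a \<in> Kp" "b \<in> Km" using a b unfolding P.conv_def N.conv_def by blast+
    have "(\<lambda>n. P.nm (pp (X n) - a) + N.nm (pm (X n) - b)) \<longlonglongrightarrow> 0 + 0"
      using a b unfolding P.conv_def N.conv_def by (intro tendsto_add) blast+
    then have lim: "(\<lambda>n. P.nm (pp (X n) - a) + N.nm (pm (X n) - b)) \<longlonglongrightarrow> 0" by simp
    have "norm (ip_norm H (X n - (a + b))) \<le> P.nm (pp (X n) - a) + N.nm (pm (X n) - b)" for n
      using nmH_le[of "X n - (a + b)"] nmH_nonneg[of "X n - (a + b)"] ab by (simp add: pp_diff pm_diff pp_eq pm_eq)
    then have "(\<lambda>n. ip_norm H (X n - (a + b))) \<longlonglongrightarrow> 0" by (rule null_sequence_bound) (rule lim)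
    then show "\<exists>x. limitin M.mtopology X x sequentially"
      unfolding M.limitin_metric_dist_null by (intro exI[of _ "a + b"]) (simp add: ip_dist_def)
  qed
qed

sublocale hilbU scl H
proof
  show "hilbert_space scl UNIV H"
    unfolding hilbert_space_def using H_ip H_complete by simp
qed

lemma bop_J: "bop J"
proof (rule bopI[of _ 1])
  show "J (x + y) = J x + J y" for x y by (simp add: J_def' pp_add pm_add)
  show "J (scl c x) = scl c (J x)" for c x by (simp add: J_def' pp_scl pm_scl scale_right_diff_distrib)
  have "(nm (J x))\<^sup>2 = (nm x)\<^sup>2" for x by (simp add: nmH pp_J pm_J)
  then show "nm (J x) \<le> 1 * nm x" for x by (simp add: power2_eq_iff_nonneg nmH_nonneg)
qed

lemma J_sym: "H (J x) y = H x (J y)"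
  by (simp add: H_split pp_J pm_J Bsimps)

lemma nm_J [simp]: "nm (J x) = nm x"
proof -
  have "(nm (J x))\<^sup>2 = (nm x)\<^sup>2" by (simp add: nmH pp_J pm_J)
  then show ?thesis by (simp add: power2_eq_iff_nonneg nmH_nonneg)
qed

lemma B_bound: "cmod (B x y) \<le> nm x * nm y"
  using Cauchy_Schwarz[of "J x" y] by (simp add: B_H)

lemma B_eqI: "(\<And>y. B x y = B x' y) \<Longrightarrow> x = x'"
proof -
  assume "\<And>y. B x y = B x' y"
  then have "J x = J x'" by (intro H_eqI) (simp flip: B_H)
  then show ?thesis by (metis J_J)
qed

lemma B_eqI2: "(\<And>y. B y x = B y x') \<Longrightarrow> x = x'"
  by (rule B_eqI) (metis Bcnj)

end

section \<open>Nonnegative self-adjoint operators in a Krein space and their resolvents\<close>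

locale nonneg_krein = krein scl B Kp Km
  for scl :: "complex \<Rightarrow> 'a::ab_group_add \<Rightarrow> 'a" and B Kp Km +
  fixes A :: "('a \<times> 'a) set"
  assumes opA: "operator_in scl UNIV A" and adjA: "A = adjoint_in UNIV B A"
    and nnA: "nonneg_operator B A"
    and resA: "\<And>z. Im z \<noteq> 0 \<Longrightarrow> \<exists>C. \<forall>g. \<exists>f. (f, g + scl z f) \<in> A \<and> ip_norm (krein_ip B Kp Km) f \<le> C * ip_norm (krein_ip B Kp Km) g"

text \<open>The part of the theory that precedes resolvents: the absence of nonreal eigenvalues is
  needed to derive the assumption \<open>resA\<close> of \<open>nonneg_krein\<close> from Krein's
  formula.\<close>

locale nonneg_krein0 = krein scl B Kp Km
  for scl :: "complex \<Rightarrow> 'a::ab_group_add \<Rightarrow> 'a" and B Kp Km +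
  fixes A :: "('a \<times> 'a) set"
  assumes opA: "operator_in scl UNIV A" and adjA: "A = adjoint_in UNIV B A"
    and nnA: "nonneg_operator B A"
begin

lemma A_I: "(\<And>k k'. (k, k') \<in> A \<Longrightarrow> B k' f = B k f') \<Longrightarrow> (f, f') \<in> A"
  by (subst adjA) (auto simp: adjoint_in_def)

lemma A_sym: "(f, f') \<in> A \<Longrightarrow> (g, g') \<in> A \<Longrightarrow> B f' g = B f g'"
proof -
  assume f: "(f, f') \<in> A" and "(g, g') \<in> A"
  then have "(g, g') \<in> adjoint_in UNIV B A" by (simp flip: adjA)
  then show "B f' g = B f g'" using f unfolding adjoint_in_def by blast
qed

lemma A_single: "(f, f') \<in> A \<Longrightarrow> (f, f'') \<in> A \<Longrightarrow> f' = f''"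
  using opA unfolding operator_in_def single_valued_def by blast

lemma A_add: "(f, f') \<in> A \<Longrightarrow> (g, g') \<in> A \<Longrightarrow> (f + g, f' + g') \<in> A"
  by (rule A_I) (simp add: Bsimps A_sym)

lemma A_scl: "(f, f') \<in> A \<Longrightarrow> (scl c f, scl c f') \<in> A"
  by (rule A_I) (simp add: Bsimps A_sym)

lemma A_diff: "(f, f') \<in> A \<Longrightarrow> (g, g') \<in> A \<Longrightarrow> (f - g, f' - g') \<in> A"
  by (rule A_I) (simp add: Bsimps A_sym)

lemma A_0: "(0, 0) \<in> A"
  by (rule A_I) (simp add: Bsimps)

lemma A_nn: "(f, f') \<in> A \<Longrightarrow> 0 \<le> Re (B f' f)" and A_real: "(f, f') \<in> A \<Longrightarrow> Im (B f' f) = 0"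
  using nnA unfolding nonneg_operator_def complex_nonneg_Reals_iff by blast+

lemma A_CS: assumes f: "(f, f') \<in> A" and g: "(g, g') \<in> A"
  shows "(cmod (B f' g))\<^sup>2 \<le> Re (B f' f) * Re (B g' g)"
proof -
  define a where "a x = (SOME x'. (x, x') \<in> A)" for x
  have a: "a x = x'" if "(x, x') \<in> A" for x x'
    unfolding a_def using that A_single by blast
  have aA: "(x, a x) \<in> A" if "x \<in> Domain A" for x
    using that a by blast
  have sub: "subspace (Domain A)"
  proof (rule subspaceI)
    show "0 \<in> Domain A" using A_0 by blast
    show "x + y \<in> Domain A" if "x \<in> Domain A" "y \<in> Domain A" for x y
      using A_add[OF aA[OF that(1)] aA[OF that(2)]] by blast
    show "scl c x \<in> Domain A" if "x \<in> Domain A" for c x using A_scl[OF aA[OF that]] by blast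
  qed
  have "(cmod (B (a f) g))\<^sup>2 \<le> Re (B (a f) f) * Re (B (a g) g)"
  proof (rule semi_Cauchy_Schwarz[OF vector_space_axioms sub, of "\<lambda>x y. B (a x) y"])
    show "sesquilinear_on scl (Domain A) (\<lambda>x y. B (a x) y)"
      unfolding sesquilinear_on_def
      using a[OF A_add[OF aA aA]] a[OF A_scl[OF aA]] by (simp add: Bsimps)
    show "hermitian_on (Domain A) (\<lambda>x y. B (a x) y)"
      unfolding hermitian_on_def using A_sym[OF aA aA] by (simp add: Bcnj)
    show "0 \<le> Re (B (a x) x)" if "x \<in> Domain A" for x by (rule A_nn[OF aA[OF that]])
  qed (use f g in blast)+
  then show ?thesis by (simp add: a[OF f] a[OF g])
qed

text \<open>By Cauchy-Schwarz for the energy form \<open>f'\<close> is orthogonal to the domain of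
  \<open>A\<close>, so \<open>(0, f')\<close> lies in the adjoint, which is the single-valued
  \<open>A\<close>.\<close>

lemma A_null: assumes f: "(f, f') \<in> A" and z: "Re (B f' f) \<le> 0" shows "f' = 0"
proof -
  have "B f' g = 0" if "(g, g') \<in> A" for g g'
  proof -
    have "(cmod (B f' g))\<^sup>2 \<le> 0" using A_CS[OF f that] A_nn[OF f] z by simp
    then show ?thesis by simp
  qed
  then have "B k f' = 0" if "(k, k') \<in> A" for k k' using that Bcnj[of f' k] by (metis complex_cnj_zero)
  then have "(0, f') \<in> A" by (intro A_I) (simp add: B02)
  then show ?thesis using A_single A_0 by blast
qed

lemma eigen_real: assumes z: "Im z \<noteq> 0" and f: "(f, scl z f) \<in> A" shows "f = 0"
proof -
  have "B (scl z f) f = z * of_real (Re (B f f))"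
    using Bself[of f] by (simp add: Bsimps complex_eq_iff)
  then have "Im z * Re (B f f) = 0" using A_real[OF f] by simp
  then have "Re (B f f) = 0" using z by simp
  then have "Re (B (scl z f) f) \<le> 0" using \<open>B (scl z f) f = _\<close> by simp
  then have "scl z f = 0" by (rule A_null[OF f])
  then show ?thesis using z by auto
qed

end

context nonneg_krein
begin

sublocale nonneg_krein0 scl B Kp Km A
  by unfold_locales (rule opA adjA nnA)+

definition "R z g = (SOME f. (f, g + scl z f) \<in> A)"

lemma R_A: assumes "Im z \<noteq> 0" shows "(R z g, g + scl z (R z g)) \<in> A"
proof -
  have "\<exists>f. (f, g + scl z f) \<in> A" using resA[OF assms] by blast
  then show ?thesis unfolding R_def by (rule someI_ex)
qed

lemma R_unique: assumes z: "Im z \<noteq> 0" and f: "(f, g + scl z f) \<in> A" shows "R z g = f"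
proof -
  have "(R z g - f, g + scl z (R z g) - (g + scl z f)) \<in> A" by (rule A_diff[OF R_A[OF z] f])
  then have "(R z g - f, scl z (R z g - f)) \<in> A" by (simp add: scale_right_diff_distrib)
  then show ?thesis using eigen_real[OF z, of "R z g - f"] by simp
qed

lemma R_eq: assumes z: "Im z \<noteq> 0" and f: "(f, f') \<in> A" shows "R z (f' - scl z f) = f"
  by (rule R_unique[OF z]) (use f in simp)

lemma R_bop: assumes z: "Im z \<noteq> 0" shows "bop (R z)"
proof -
  obtain C where C: "\<And>g. \<exists>f. (f, g + scl z f) \<in> A \<and> nm f \<le> C * nm g" using resA[OF z] by blast
  show ?thesis
  proof (rule bopI[of _ C])
    show "R z (x + y) = R z x + R z y" for x y
      using R_unique[OF z] A_add[OF R_A[OF z] R_A[OF z], of x y] by (simp add: scale_right_distrib algebra_simps)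
    show "R z (scl c x) = scl c (R z x)" for c x
      using R_unique[OF z] A_scl[OF R_A[OF z], of c x] by (simp add: scale_right_distrib mult.commute)
    show "nm (R z x) \<le> C * nm x" for x using C[of x] R_unique[OF z] by blast
  qed
qed

lemma R_B: assumes z: "Im z \<noteq> 0" shows "B (R z x) y = B x (R (cnj z) y)"
proof -
  have z': "Im (cnj z) \<noteq> 0" using z by simp
  show ?thesis using A_sym[OF R_A[OF z, of x] R_A[OF z', of y]] by (simp add: Bsimps)
qed

lemma R_commute_A: assumes z: "Im z \<noteq> 0" and f: "(f, f') \<in> A" shows "(R z f, R z f') \<in> A"
proof -
  have "R z f' = R z ((f' - scl z f) + scl z f)" by simp
  also have "\<dots> = f + scl z (R z f)"
    by (simp only: bop_add[OF R_bop[OF z]] bop_scl[OF R_bop[OF z]] R_eq[OF z f])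
  finally show ?thesis using R_A[OF z, of f] by simp
qed

lemma R_resolvent: assumes z: "Im z \<noteq> 0" and w: "Im w \<noteq> 0"
  shows "R z x - R w x = scl (z - w) (R z (R w x))"
proof -
  define u v where "u = R w x" and "v = R z u"
  have u: "(u, x + scl w u) \<in> A" unfolding u_def by (rule R_A[OF w])
  have v: "(v, u + scl z v) \<in> A" unfolding v_def by (rule R_A[OF z])
  have "(u + scl (z - w) v, x + scl w u + scl (z - w) (u + scl z v)) \<in> A"
    by (intro A_add A_scl u v)
  moreover have "x + scl w u + scl (z - w) (u + scl z v) = x + scl z (u + scl (z - w) v)"
    by (simp add: scale_right_distrib scale_left_diff_distrib scale_right_diff_distrib mult.commute algebra_simps)
  ultimately have "R z x = u + scl (z - w) v" using R_unique[OF z] by metis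
  then show ?thesis by (simp add: u_def v_def)
qed

lemma R_commute: assumes z: "Im z \<noteq> 0" and w: "Im w \<noteq> 0" shows "R z (R w x) = R w (R z x)"
proof (cases "z = w")
  case False
  have "scl (z - w) (R z (R w x)) = scl (z - w) (R w (R z x))"
  proof -
    have "scl (z - w) (R w (R z x)) = - (R w x - R z x)"
      unfolding R_resolvent[OF w z] by (simp flip: scale_minus_left)
    then show ?thesis by (simp flip: R_resolvent[OF z w])
  qed
  then show ?thesis using False by (simp add: scale_cancel_left)
qed simp

lemma R_in_resolvent: assumes z: "Im z \<noteq> 0" shows "(g, f) \<in> resolvent scl A z \<longleftrightarrow> f = R z g"
proof
  assume "(g, f) \<in> resolvent scl A z"
  then obtain f' where f': "g = f' - scl z f" "(f, f') \<in> A" unfolding resolvent_def by blast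
  show "f = R z g" unfolding f'(1) using R_eq[OF z f'(2)] by simp
next
  assume f: "f = R z g"
  show "(g, f) \<in> resolvent scl A z"
    unfolding resolvent_def f using R_A[OF z, of g] by force
qed

lemma nonreal_resolvent_set: assumes z: "Im z \<noteq> 0" shows "z \<in> resolvent_set scl UNIV H A"
proof -
  obtain C where "\<And>x. nm (R z x) \<le> C * nm x" using bop_bound[OF R_bop[OF z]] by metis
  moreover have "resolvent scl A z = range (\<lambda>g. (g, R z g))" using R_in_resolvent[OF z] by auto
  ultimately show ?thesis
    unfolding resolvent_set_def single_valued_def by (auto intro!: exI[of _ C])
qed

text \<open>The extra term \<open>\<i> y B f f\<close> is purely imaginary, so the real part of the
  resolvent form is the energy of the resolvent vector.\<close>

lemma quad_form: assumes y: "y \<noteq> 0" and f: "f = R (\<i> * of_real y) g"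
  shows "Re (B (g + scl (\<i> * of_real y) f) f) = Re (B f g)"
  using Bself[of f] Bcnj[of g f] by (simp add: Bsimps complex_eq_iff)

end

section \<open>Coupling of the two boundary triples and Krein's resolvent formula\<close>

locale pfr = krein scl B Kp Km
  for scl :: "complex \<Rightarrow> 'a::ab_group_add \<Rightarrow> 'a" and B Kp Km +
  fixes A :: "('a \<times> 'a) set" and G0p G1p G0m G1m :: "'a \<Rightarrow> complex"
  assumes pfr: "partially_fund_reducible scl B Kp Km A" and nn: "nonneg_operator B A"
    and triple_p: "boundary_triple scl Kp B (S_plus Kp A) G0p G1p"
    and induced: "induced_boundary_triple scl B Kp Km A G0p G1p G0m G1m"
begin

sublocale nonneg_krein0 scl B Kp Km A
  by unfold_locales (use pfr nn in \<open>auto simp: partially_fund_reducible_def selfadjoint_krein_def\<close>)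

sublocale Pt: btriple scl Kp B "S_plus Kp A" G0p G1p
proof
  show "symmetric_operator_in scl Kp B (S_plus Kp A)" "has_defect_one_one scl Kp B (S_plus Kp A)"
    using pfr unfolding partially_fund_reducible_def by blast+
  show "boundary_triple scl Kp B (S_plus Kp A) G0p G1p" by (rule triple_p)
  show "0 \<le> Re (B f' f)" if "(f, f') \<in> S_plus Kp A" for f f'
    using that A_nn unfolding S_plus_def by blast
qed

sublocale Nt: btriple scl Km "\<lambda>x y. - B x y" "S_minus Km A" G0m G1m
proof
  show "symmetric_operator_in scl Km (\<lambda>x y. - B x y) (S_minus Km A)"
    "has_defect_one_one scl Km (\<lambda>x y. - B x y) (S_minus Km A)"
    using pfr unfolding partially_fund_reducible_def by blast+
  show "boundary_triple scl Km (\<lambda>x y. - B x y) (S_minus Km A) G0m G1m"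
    using induced unfolding induced_boundary_triple_def by blast
  show "0 \<le> Re (- B f' f)" if "(f, f') \<in> S_minus Km A" for f f'
    using that A_nn unfolding S_minus_def by (auto simp: Bsimps)
qed

lemma A_match: "(f, f') \<in> A \<Longrightarrow> G0m (pm f) = G0p (pp f) \<and> G1m (pm f) = - G1p (pp f)"
  using induced unfolding induced_boundary_triple_def by blast

text \<open>Testing \<open>A\<close> against \<open>S_plus\<close>, whose elements have no component
  in \<open>Km\<close>, leaves exactly the condition that defines the adjoint of
  \<open>S_plus\<close>.\<close>

lemma A_split_p: assumes f: "(f, f') \<in> A" shows "(pp f, pp f') \<in> Pt.T"
  unfolding Pt.T_def
proof (rule P.adj_I)
  fix g g' assume "(g, g') \<in> S_plus Kp A"
  then have g: "(g, g') \<in> A" "g \<in> Kp" "g' \<in> Kp" unfolding S_plus_def by blast+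
  show "B g' (pp f) = B g (pp f')"
    using A_sym[OF g(1) f] B_split[of g' f] B_split[of g f'] g
    by (simp add: pp_id pm_Kp Bsimps)
qed simp_all

lemma A_split_m: assumes f: "(f, f') \<in> A" shows "(pm f, - pm f') \<in> Nt.T"
  unfolding Nt.T_def
proof (rule N.adj_I)
  fix g g' assume "(g, g') \<in> S_minus Km A"
  then obtain h where g: "(g, h) \<in> A" "g \<in> Km" "h \<in> Km" "g' = - h" unfolding S_minus_def by blast
  show "- B g' (pm f) = - B g (- pm f')"
    using A_sym[OF g(1) f] B_split[of h f] B_split[of g f'] g
    by (simp add: pm_id pp_Km Bsimps)
qed simp_all

text \<open>Under the matching conditions the boundary terms in Green's identities of the two
  triples cancel, so the glued pair lies in the adjoint of \<open>A\<close>, that is, in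
  \<open>A\<close>.\<close>

lemma A_glue:
  assumes u: "(u, u') \<in> Pt.T" and v: "(v, v') \<in> Nt.T"
    and match: "G0m v = G0p u" "G1m v = - G1p u"
  shows "(u + v, u' - v') \<in> A"
proof (rule A_I)
  fix h h' assume h: "(h, h') \<in> A"
  have m: "u \<in> Kp" "u' \<in> Kp" "v \<in> Km" "v' \<in> Km" using Pt.T_mem[OF u] Nt.T_mem[OF v] by blast+
  define X where "X = cnj (G0p u) * G1p (pp h) - cnj (G1p u) * G0p (pp h)"
  have "B (pp h') u - B (pp h) u' = X"
    unfolding X_def by (rule Pt.Green[OF A_split_p[OF h] u])
  then have e1: "B (pp h') u = X + B (pp h) u'" by (simp add: algebra_simps)
  have "- B (- pm h') v - - B (pm h) v' = cnj (G0m v) * G1m (pm h) - cnj (G1m v) * G0m (pm h)"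
    by (rule Nt.Green[OF A_split_m[OF h] v])
  also have "\<dots> = - X" using A_match[OF h] match by (simp add: X_def)
  finally have e2: "B (pm h') v = - X - B (pm h) v'" by (simp add: Bsimps algebra_simps)
  have "pp (u' - v') = u'" "pm (u' - v') = - v'" using pp_eq[of u' "- v'"] pm_eq[of u' "- v'"] m by simp_all
  then have "B h' (u + v) = B (pp h') u + B (pm h') v" "B h (u' - v') = B (pp h) u' - B (pm h) v'"
    using m B_split[of h' "u + v"] B_split[of h "u' - v'"] by (simp_all add: pp_eq pm_eq Bsimps)
  with e1 e2 show "B h' (u + v) = B h (u' - v')" by simp
qed

definition "dlt z = Pt.m z + Nt.m (- z)"

text \<open>At a zero the two Weyl solutions would match, and their sum would be an eigenvector of
  \<open>A\<close> at a nonreal point.\<close>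

lemma dlt_nz: assumes z: "Im z \<noteq> 0" shows "dlt z \<noteq> 0"
proof
  assume d: "dlt z = 0"
  have z': "Im (- z) \<noteq> 0" using z by simp
  have "(Pt.psi z + Nt.psi (- z), scl z (Pt.psi z) - scl (- z) (Nt.psi (- z))) \<in> A"
  proof (rule A_glue[OF Pt.psi_T[OF z] Nt.psi_T[OF z']])
    show "G1m (Nt.psi (- z)) = - G1p (Pt.psi z)"
      using d Pt.psi_G1[OF z] Nt.psi_G1[OF z'] unfolding dlt_def by (simp add: eq_neg_iff_add_eq_0 add.commute)
  qed (simp add: Pt.psi_G0[OF z] Nt.psi_G0[OF z'])
  then have "(Pt.psi z + Nt.psi (- z), scl z (Pt.psi z + Nt.psi (- z))) \<in> A"
    by (simp add: scale_right_distrib)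
  then have "Pt.psi z + Nt.psi (- z) = 0" by (rule eigen_real[OF z])
  then have "pp (Pt.psi z + Nt.psi (- z)) = pp 0" by simp
  then have "Pt.psi z = 0" using pp_eq[OF Pt.psi_V[OF z] Nt.psi_V[OF z']] pp_id[OF P.V0] by simp
  then show False using Pt.psi_nz[OF z] by simp
qed

text \<open>The coefficient for which the two corrected resolvents satisfy
  \<open>G1m = - G1p\<close>; the condition on \<open>G0\<close> holds for any common
  coefficient.\<close>

definition "cc z g = - (B (pp g) (Pt.psi (cnj z)) + B (pm g) (Nt.psi (- cnj z))) / dlt z"

lemma Krein_formula: assumes z: "Im z \<noteq> 0"
  shows "(Pt.R0 z (pp g) + scl (cc z g) (Pt.psi z) + (scl (cc z g) (Nt.psi (- z)) - Nt.R0 (- z) (pm g)),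
    g + scl z (Pt.R0 z (pp g) + scl (cc z g) (Pt.psi z) + (scl (cc z g) (Nt.psi (- z)) - Nt.R0 (- z) (pm g)))) \<in> A"
proof -
  have z': "Im (- z) \<noteq> 0" using z by simp
  define c where "c = cc z g"
  define u where "u = Pt.R0 z (pp g) + scl c (Pt.psi z)"
  define v where "v = scl c (Nt.psi (- z)) - Nt.R0 (- z) (pm g)"
  note r = Pt.A0_T[OF Pt.R0[OF z pp_Kp, of g]] and r' = Nt.A0_T[OF Nt.R0[OF z' pm_Km, of g]]
  note s = Pt.T_scl[OF Pt.psi_T[OF z], of c] and s' = Nt.T_scl[OF Nt.psi_T[OF z'], of c]
  have u: "(u, pp g + scl z (Pt.R0 z (pp g)) + scl c (scl z (Pt.psi z))) \<in> Pt.T"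
    unfolding u_def by (rule Pt.T_add[OF r s])
  have v: "(v, scl c (scl (- z) (Nt.psi (- z))) - (pm g + scl (- z) (Nt.R0 (- z) (pm g)))) \<in> Nt.T"
    unfolding v_def by (rule Nt.T_diff[OF s' r'])
  have G0u: "G0p u = c"
    unfolding u_def using Pt.G_lin(1)[OF r s] Pt.A0_G[OF Pt.R0[OF z pp_Kp, of g]]
      Pt.G_lin(3)[OF Pt.psi_T[OF z] Pt.psi_T[OF z], of c] Pt.psi_G0[OF z] by simp
  have G0v: "G0m v = c"
    unfolding v_def using Nt.G_diff(1)[OF s' r'] Nt.A0_G[OF Nt.R0[OF z' pm_Km, of g]]
      Nt.G_lin(3)[OF Nt.psi_T[OF z'] Nt.psi_T[OF z'], of c] Nt.psi_G0[OF z'] by simp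
  have G1u: "G1p u = B (pp g) (Pt.psi (cnj z)) + c * Pt.m z"
    unfolding u_def using Pt.G_lin(2)[OF r s] Pt.G1_R0[OF z pp_Kp, of g]
      Pt.G_lin(4)[OF Pt.psi_T[OF z] Pt.psi_T[OF z], of c] Pt.psi_G1[OF z] by simp
  have G1v: "G1m v = c * Nt.m (- z) + B (pm g) (Nt.psi (- cnj z))"
    unfolding v_def using Nt.G_diff(2)[OF s' r'] Nt.G1_R0[OF z' pm_Km, of g]
      Nt.G_lin(4)[OF Nt.psi_T[OF z'] Nt.psi_T[OF z'], of c] Nt.psi_G1[OF z'] by simp
  have cd: "c * dlt z = - (B (pp g) (Pt.psi (cnj z)) + B (pm g) (Nt.psi (- cnj z)))"
    unfolding c_def cc_def using dlt_nz[OF z] by simp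
  have "G1m v + G1p u = c * dlt z + (B (pp g) (Pt.psi (cnj z)) + B (pm g) (Nt.psi (- cnj z)))"
    unfolding G1u G1v by (simp add: dlt_def algebra_simps)
  then have "G1m v + G1p u = 0" unfolding cd by simp
  then have "G1m v = - G1p u" by (simp add: eq_neg_iff_add_eq_0)
  then have "(u + v, pp g + scl z (Pt.R0 z (pp g)) + scl c (scl z (Pt.psi z))
      - (scl c (scl (- z) (Nt.psi (- z))) - (pm g + scl (- z) (Nt.R0 (- z) (pm g))))) \<in> A"
    by (intro A_glue[OF u v]) (simp add: G0u G0v)
  moreover have "pp g + scl z (Pt.R0 z (pp g)) + scl c (scl z (Pt.psi z))
      - (scl c (scl (- z) (Nt.psi (- z))) - (pm g + scl (- z) (Nt.R0 (- z) (pm g)))) = g + scl z (u + v)"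
  proof -
    have "scl z (u + v) = scl z (Pt.R0 z (pp g)) + scl (z * c) (Pt.psi z) + scl (z * c) (Nt.psi (- z))
        - scl z (Nt.R0 (- z) (pm g))"
      unfolding u_def v_def by (simp add: scale_right_distrib scale_right_diff_distrib)
    then show ?thesis using pp_pm[of g] by (simp add: mult.commute algebra_simps)
  qed
  ultimately show ?thesis unfolding u_def v_def c_def by simp
qed

sublocale nonneg_krein scl B Kp Km A
proof unfold_locales
  show "operator_in scl UNIV A" by (rule opA)
  show "A = adjoint_in UNIV B A" by (rule adjA)
  show "nonneg_operator B A" by (rule nnA)
  fix z assume z: "Im z \<noteq> 0"
  have z': "Im (- z) \<noteq> 0" "Im (cnj z) \<noteq> 0" "Im (- cnj z) \<noteq> 0" using z by simp_all
  let ?f = "\<lambda>g. Pt.R0 z (pp g) + scl (cc z g) (Pt.psi z) + (scl (cc z g) (Nt.psi (- z)) - Nt.R0 (- z) (pm g))"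
  define M where "M = (P.nm (Pt.psi (cnj z)) + N.nm (Nt.psi (- cnj z))) / cmod (dlt z)"
  define a b where "a = Pt.psi z" and "b = Nt.psi (- z)"
  have V: "a \<in> Kp" "b \<in> Km" "Pt.psi (cnj z) \<in> Kp" "Nt.psi (- cnj z) \<in> Km"
    unfolding a_def b_def using Pt.psi_V Nt.psi_V z z' by blast+
  have nmP: "nm x = P.nm x" if "x \<in> Kp" for x
    unfolding ip_norm_def using that by (simp add: H_split pp_id pm_Kp B01)
  have nmN: "nm x = N.nm x" if "x \<in> Km" for x
    unfolding ip_norm_def using that by (simp add: H_split pm_id pp_Km B01)
  have bound: "nm (?f g) \<le> (2 / \<bar>Im z\<bar> + M * (nm a + nm b)) * nm g" for g
  proof -
    have 1: "nm (Pt.R0 z (pp g)) \<le> nm g / \<bar>Im z\<bar>"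
      using Pt.R0_bound[OF z pp_Kp, of g] pp_le[of g] z nmP[OF Pt.R0_V[OF z pp_Kp]] by (simp add: field_simps)
    have 2: "nm (Nt.R0 (- z) (pm g)) \<le> nm g / \<bar>Im z\<bar>"
      using Nt.R0_bound[OF z'(1) pm_Km, of g] pm_le[of g] z nmN[OF Nt.R0_V[OF z'(1) pm_Km]] by (simp add: field_simps)
    have "cmod (B (pp g) (Pt.psi (cnj z))) \<le> nm g * P.nm (Pt.psi (cnj z))"
      using order_trans[OF P.Cauchy_Schwarz[OF pp_Kp V(3)] mult_right_mono[OF pp_le P.nm_nonneg[OF V(3)]]] .
    moreover have "cmod (B (pm g) (Nt.psi (- cnj z))) \<le> nm g * N.nm (Nt.psi (- cnj z))"
      using order_trans[OF N.Cauchy_Schwarz[OF pm_Km V(4)] mult_right_mono[OF pm_le N.nm_nonneg[OF V(4)]]] by simp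
    ultimately have "cmod (B (pp g) (Pt.psi (cnj z)) + B (pm g) (Nt.psi (- cnj z)))
        \<le> nm g * (P.nm (Pt.psi (cnj z)) + N.nm (Nt.psi (- cnj z)))"
      using norm_triangle_ineq[of "B (pp g) (Pt.psi (cnj z))" "B (pm g) (Nt.psi (- cnj z))"]
      by (simp add: distrib_left)
    then have 3: "cmod (cc z g) \<le> M * nm g"
      unfolding cc_def M_def by (simp add: norm_divide divide_right_mono mult.commute del: minus_add_distrib)
    have "nm (?f g) \<le> nm (Pt.R0 z (pp g)) + nm (scl (cc z g) a) + (nm (scl (cc z g) b) + nm (Nt.R0 (- z) (pm g)))"
      unfolding a_def b_def
      by (intro order_trans[OF nm_triangle] add_mono nm_triangle nm_triangle_diff) simp_all
    also have "\<dots> \<le> nm g / \<bar>Im z\<bar> + (M * nm g) * nm a + ((M * nm g) * nm b + nm g / \<bar>Im z\<bar>)"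
      using 1 2 3 by (intro add_mono) (simp_all add: mult_right_mono)
    also have "\<dots> = (2 / \<bar>Im z\<bar> + M * (nm a + nm b)) * nm g" by (simp add: algebra_simps)
    finally show ?thesis .
  qed
  show "\<exists>C. \<forall>g. \<exists>f. (f, g + scl z f) \<in> A \<and> nm f \<le> C * nm g"
    using Krein_formula[OF z] bound by blast
qed

lemma nm_Kp: "x \<in> Kp \<Longrightarrow> nm x = P.nm x" and nm_Km: "x \<in> Km \<Longrightarrow> nm x = N.nm x"
  unfolding ip_norm_def by (simp_all add: H_split pp_id pm_id pm_Kp pp_Km B01)

lemma R_formula: assumes z: "Im z \<noteq> 0"
  shows "R z g = Pt.R0 z (pp g) + scl (cc z g) (Pt.psi z) + (scl (cc z g) (Nt.psi (- z)) - Nt.R0 (- z) (pm g))"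
  by (rule R_unique[OF z Krein_formula[OF z]])

lemma BR_formula: assumes z: "Im z \<noteq> 0"
  shows "B (R z g) g = B (Pt.R0 z (pp g)) (pp g) + - B (Nt.R0 (- z) (pm g)) (pm g)
    + cc z g * (B (Pt.psi z) (pp g) + B (Nt.psi (- z)) (pm g))"
proof -
  have z': "Im (- z) \<noteq> 0" using z by simp
  have V: "Pt.psi z \<in> Kp" "Nt.psi (- z) \<in> Km" "Pt.R0 z (pp g) \<in> Kp" "Nt.R0 (- z) (pm g) \<in> Km"
    using Pt.psi_V Nt.psi_V Pt.R0_V Nt.R0_V z z' by simp_all
  define u v where "u = Pt.R0 z (pp g) + scl (cc z g) (Pt.psi z)"
    and "v = scl (cc z g) (Nt.psi (- z)) - Nt.R0 (- z) (pm g)"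
  have uv: "u \<in> Kp" "v \<in> Km" unfolding u_def v_def using V by simp_all
  have "R z g = u + v" unfolding R_formula[OF z] u_def v_def ..
  then have "B (R z g) g = B u (pp g) + B v (pm g)" using B_split[of "u + v" g] pp_eq[OF uv] pm_eq[OF uv] by simp
  then show ?thesis unfolding u_def v_def by (simp add: Bsimps algebra_simps)
qed

text \<open>The difference of the resolvents of \<open>A\<close> and of the decoupled operator has rank one; its norm
  is \<open>(Im m\<^sub>+ + Im m\<^sub>-) / (y |m\<^sub>+ + m\<^sub>-|)\<close>.\<close>

lemma D_infty_if_resolvent_bound:
  assumes bd: "\<And>y g. y > 1 \<Longrightarrow> y * nm (R (\<i> * of_real y) g) \<le> C * nm g"
  shows "has_D_infty Pt.m Nt.m"
proof -
  have main: "(Im (Pt.m (\<i> * of_real y)) + Im (Nt.m (\<i> * of_real y))) / cmod (dlt (\<i> * of_real y)) \<in> {0..C + 2}"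
    if y: "y > 1" for y
  proof -
    define z where "z = \<i> * complex_of_real y"
    have z: "Im z = y" "cnj z = - z" "Im z \<noteq> 0" "Im (- z) \<noteq> 0" using y by (simp_all add: z_def)
    define a b where "a = Pt.psi (- z)" and "b = Nt.psi z"
    define a' b' where "a' = Pt.psi z" and "b' = Nt.psi (- z)"
    have V: "a \<in> Kp" "b \<in> Km" "a' \<in> Kp" "b' \<in> Km"
      unfolding a_def b_def a'_def b'_def using Pt.psi_V Nt.psi_V z by simp_all
    have im: "Im (Pt.m z) = y * (P.nm a)\<^sup>2" "Im (Pt.m z) = y * (P.nm a')\<^sup>2"
      "Im (Nt.m z) = y * (N.nm b)\<^sup>2" "Im (Nt.m z) = y * (N.nm b')\<^sup>2"
      using Pt.Im_m[of z] Pt.Im_m[of "- z"] Nt.Im_m[of z] Nt.Im_m[of "- z"] Pt.m_cnj[of z] Nt.m_cnj[of z] z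
      unfolding a_def b_def a'_def b'_def by simp_all
    have eqs: "(P.nm a')\<^sup>2 = (P.nm a)\<^sup>2" "(N.nm b')\<^sup>2 = (N.nm b)\<^sup>2" using im y by simp_all
    define \<sigma> where "\<sigma> = (P.nm a)\<^sup>2 + (N.nm b)\<^sup>2"
    have "P.nm a > 0" unfolding a_def by (rule Pt.nm_psi_pos[OF z(4)])
    then have \<sigma>: "\<sigma> > 0" unfolding \<sigma>_def by (simp add: add_pos_nonneg)
    \<comment> \<open>A test vector for the norm of the rank one term: both inner products in
      \<open>cc\<close> become squared norms, and the minus sign before \<open>b\<close> makes them
      add up, the form being negative on \<open>Km\<close>.\<close>
    define g where "g = a - b"
    have g: "pp g = a" "pm g = - b" using V pp_eq[of a "- b"] pm_eq[of a "- b"] by (simp_all add: g_def)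
    have ng: "(nm g)\<^sup>2 = \<sigma>" unfolding nmH g using V by (simp add: \<sigma>_def)
    define c where "c = cc z g"
    have "B a a = of_real ((P.nm a)\<^sup>2)" using P.Hself[OF V(1)] .
    moreover have "B b b = - of_real ((N.nm b)\<^sup>2)" using N.Hself[OF V(2)] by (simp add: minus_equation_iff[of "B b b"])
    ultimately have "c = - of_real \<sigma> / dlt z"
      unfolding c_def cc_def g \<sigma>_def z(2) minus_minus using a_def b_def by (simp add: Bsimps)
    then have cm: "cmod c = \<sigma> / cmod (dlt z)" using \<sigma> by (simp add: norm_divide)
    have "(nm (scl c (a' + b')))\<^sup>2 = (cmod c)\<^sup>2 * \<sigma>"
    proof -
      have "(nm (a' + b'))\<^sup>2 = \<sigma>" unfolding nmH using V eqs by (simp add: pp_eq pm_eq \<sigma>_def)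
      then show ?thesis by (simp add: power_mult_distrib)
    qed
    then have "(nm (scl c (a' + b')))\<^sup>2 = (cmod c * nm g)\<^sup>2" using ng by (simp add: power_mult_distrib)
    then have n1: "nm (scl c (a' + b')) = cmod c * nm g" by (simp add: power2_eq_iff_nonneg)
    have "scl c (a' + b') = R z g - Pt.R0 z (pp g) + Nt.R0 (- z) (pm g)"
      unfolding R_formula[OF z(3)] c_def a'_def b'_def by (simp add: scale_right_distrib algebra_simps)
    then have "nm (scl c (a' + b')) \<le> nm (R z g) + nm (Pt.R0 z (pp g)) + nm (Nt.R0 (- z) (pm g))"
      using nm_triangle[of "R z g - Pt.R0 z (pp g)" "Nt.R0 (- z) (pm g)"] nm_triangle_diff[of "R z g" "Pt.R0 z (pp g)"]
      by simp
    then have "y * nm (scl c (a' + b')) \<le> y * (nm (R z g) + nm (Pt.R0 z (pp g)) + nm (Nt.R0 (- z) (pm g)))"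
      using y by (intro mult_left_mono) auto
    \<comment> \<open>Each of the two decoupled resolvents has norm at most \<open>1 / y\<close>;
      they account for the 2 in \<open>C + 2\<close>.\<close>
    also have "\<dots> \<le> C * nm g + nm g + nm g"
    proof -
      have "y * nm (R z g) \<le> C * nm g" using bd[OF y] by (simp add: z_def)
      moreover have "y * nm (Pt.R0 z (pp g)) \<le> nm g"
        using Pt.R0_bound[OF z(3) pp_Kp, of g] pp_le[of g] y nm_Kp[OF Pt.R0_V[OF z(3) pp_Kp]] by (simp add: z(1))
      moreover have "y * nm (Nt.R0 (- z) (pm g)) \<le> nm g"
        using Nt.R0_bound[OF z(4) pm_Km, of g] pm_le[of g] y nm_Km[OF Nt.R0_V[OF z(4) pm_Km]] by (simp add: z(1))
      ultimately show ?thesis by (simp add: distrib_left)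
    qed
    finally have "(y * cmod c) * nm g \<le> (C + 2) * nm g" unfolding n1 by (simp add: algebra_simps)
    moreover have "nm g > 0" using \<sigma> ng nm_pos[of g] by force
    ultimately have "y * cmod c \<le> C + 2" by simp
    moreover have "y * cmod c = (Im (Pt.m z) + Im (Nt.m z)) / cmod (dlt z)"
      unfolding cm im(1,3) \<sigma>_def by (simp add: algebra_simps)
    moreover have "0 \<le> y * cmod c" using y by simp
    ultimately show ?thesis unfolding z_def[symmetric] by simp
  qed
  have e: "- \<i> * complex_of_real y = - (\<i> * complex_of_real y)" for y by simp
  show ?thesis
    unfolding has_D_infty_def e dlt_def[symmetric]
  proof (intro conjI allI impI)
    show "dlt (\<i> * complex_of_real y) \<noteq> 0" if "1 < y" for y using that by (intro dlt_nz) simp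
    show "bounded ((\<lambda>y. (Im (Pt.m (\<i> * complex_of_real y)) + Im (Nt.m (\<i> * complex_of_real y))) /
        cmod (dlt (\<i> * complex_of_real y))) ` {1<..})"
      by (rule bounded_subset[OF bounded_closed_interval[of 0 "C + 2"]]) (use main in auto)
  qed
qed

end

section \<open>Definite spectral subspaces\<close>

context krein
begin

lemma HJ1: "H (J x) y = B x y" and HJ2: "H x (J y) = B x y"
  using J_sym[of x y] by (simp_all add: B_H)

definition krein_proj :: "('a \<Rightarrow> 'a) \<Rightarrow> bool" where
  "krein_proj P \<longleftrightarrow> bop P \<and> (\<forall>x y. B (P x) y = B x (P y)) \<and> (\<forall>x. P (P x) = P x)"

lemma krein_projD:
  assumes "krein_proj P"
  shows "bop P" "B (P x) y = B x (P y)" "P (P x) = P x"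
  using assms unfolding krein_proj_def by blast+

lemma krein_proj_self: "krein_proj P \<Longrightarrow> B (P x) (P x) = B (P x) x"
  using krein_projD[of P] by metis

definition definite_range :: "real \<Rightarrow> ('a \<Rightarrow> 'a) \<Rightarrow> bool" where
  "definite_range \<sigma> P \<longleftrightarrow> (\<sigma> = 1 \<or> \<sigma> = -1) \<and> (\<forall>x. 0 \<le> \<sigma> * Re (B (P x) (P x)))"

lemma definite_posop:
  assumes P: "krein_proj P" and d: "definite_range \<sigma> P"
  shows "posop (\<lambda>x. scl (of_real \<sigma>) (J (P x)))"
  unfolding posop_def saop_def
proof (intro conjI allI)
  show "bop (\<lambda>x. scl (of_real \<sigma>) (J (P x)))"
    by (intro bop_scale bop_comp[OF bop_J] krein_projD(1)[OF P])
  show "H (scl (of_real \<sigma>) (J (P x))) y = H x (scl (of_real \<sigma>) (J (P y)))" for x y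
    using krein_projD(2)[OF P, of x y] by (simp add: Hsimps HJ1 HJ2)
  show "0 \<le> Re (H (scl (of_real \<sigma>) (J (P x))) x)" for x
    using d unfolding definite_range_def krein_proj_self[OF P] by (simp add: Hsimps HJ1)
qed

text \<open>\<open>\<sigma> J P\<close> is a positive operator, so \<open>posop_nm\<close> applies.
  The constant is a norm bound of \<open>P\<close>, hence uniformly bounded projections give uniform
  estimates.\<close>

lemma definite_bound_const:
  assumes P: "krein_proj P" and d: "definite_range \<sigma> P" and C: "\<And>x. nm (P x) \<le> C * nm x"
  shows "(nm (P x))\<^sup>2 \<le> C * (\<sigma> * Re (B (P x) x))"
proof -
  have s: "\<bar>\<sigma>\<bar> = 1" using d unfolding definite_range_def by auto
  have "nm (scl (of_real \<sigma>) (J (P x))) \<le> C * nm x" for x using C s by simp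
  from posop_nm[OF definite_posop[OF P d] this]
  show ?thesis using s by (simp add: Hsimps HJ1)
qed

lemma definite_bound:
  assumes P: "krein_proj P" and d: "definite_range \<sigma> P"
  obtains C where "C > 0" "\<And>x. (nm (P x))\<^sup>2 \<le> C * (\<sigma> * Re (B (P x) x))"
  using bop_bound[OF krein_projD(1)[OF P]] definite_bound_const[OF P d] by metis

lemma Re_B_bound: "\<bar>Re (B x y)\<bar> \<le> nm x * nm y"
  using B_bound[of x y] abs_Re_le_cmod[of "B x y"] by linarith

end

section \<open>The numerical range of the operator on a definite spectral subspace\<close>

context nonneg_krein
begin

lemma commute_A:
  assumes P: "bop P" and c: "\<And>x. P (R \<i> x) = R \<i> (P x)" and f: "(f, f') \<in> A"
  shows "(P f, P f') \<in> A"
proof -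
  have i: "Im \<i> \<noteq> 0" by simp
  have "P f = R \<i> (P (f' - scl \<i> f))" using R_eq[OF i f] c[of "f' - scl \<i> f"] by simp
  then have "(P f, P (f' - scl \<i> f) + scl \<i> (P f)) \<in> A" using R_A[OF i, of "P (f' - scl \<i> f)"] by simp
  then show ?thesis by (simp add: bop_lin[OF P])
qed

lemma range_operator:
  assumes P: "bop P" and C: "\<And>x. \<exists>w. (P x, w) \<in> A \<and> nm w \<le> C * nm x"
  obtains W where "bop W" "\<And>x. (P x, W x) \<in> A"
proof -
  obtain W where W: "\<And>x. (P x, W x) \<in> A" "\<And>x. nm (W x) \<le> C * nm x" using C by metis
  have "bop W"
  proof (rule bopI[of _ C])
    show "W (x + y) = W x + W y" for x y
      using A_add[OF W(1) W(1), of x y] W(1)[of "x + y"] A_single by (simp add: bop_lin[OF P])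
    show "W (scl c x) = scl c (W x)" for c x
      using A_scl[OF W(1), of c x] W(1)[of "scl c x"] A_single by (simp add: bop_lin[OF P])
  qed (rule W(2))
  then show thesis using that W(1) by blast
qed

text \<open>On the range of \<open>P\<close> the operator
  \<open>\<rho> J (A - \<sigma> \<mu>)\<close> is bounded and positive. For such an operator
  \<open>posop_nm\<close> improves semidefiniteness to a strict gap once it is bounded below in
  norm.\<close>

lemma range_gap:
  assumes P: "krein_proj P" and cR: "\<And>x. P (R \<i> x) = R \<i> (P x)" and d: "definite_range \<sigma> P"
    and W: "bop W" "\<And>x. (P x, W x) \<in> A" and r: "\<rho> = 1 \<or> \<rho> = (-1::real)"
    and nonneg: "\<And>f f'. (f, f') \<in> A \<Longrightarrow> P f = f \<Longrightarrow> 0 \<le> \<rho> * (Re (B f' f) - \<mu> * (\<sigma> * Re (B f f)))"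
    and lower: "\<And>f f'. (f, f') \<in> A \<Longrightarrow> P f = f \<Longrightarrow> nm f \<le> c * nm (f' - scl (of_real (\<sigma> * \<mu>)) f)"
  shows "\<exists>\<delta>>0. \<forall>f f'. (f, f') \<in> A \<longrightarrow> P f = f \<longrightarrow>
    \<delta> * (\<sigma> * Re (B f f)) \<le> \<rho> * (Re (B f' f) - \<mu> * (\<sigma> * Re (B f f)))"
proof -
  note Pd = krein_projD[OF P]
  have s: "\<bar>\<sigma>\<bar> = 1" using d unfolding definite_range_def by auto
  have PW: "P (W x) = W x" for x
    using A_single[OF commute_A[OF Pd(1) cR W(2)[of x]]] W(2)[of x] Pd(3)[of x] by metis
  define Y where "Y x = W x - scl (of_real (\<sigma> * \<mu>)) (P x)" for x
  have boY: "bop Y" unfolding Y_def by (intro bop_minus bop_scale W(1) Pd(1))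
  have BW: "B (W x) y = B x (W y)" for x y
  proof -
    have "B (W x) y = B (P (W x)) y" by (simp add: PW)
    also have "\<dots> = B (W x) (P y)" by (rule Pd(2))
    also have "\<dots> = B (P x) (W y)" by (rule A_sym[OF W(2) W(2)])
    also have "\<dots> = B x (P (W y))" by (rule Pd(2))
    finally show ?thesis by (simp add: PW)
  qed
  have BY: "B (Y x) y = B x (Y y)" for x y
    unfolding Y_def by (simp add: Bsimps BW Pd(2)[of x y])
  have BYx: "Re (B (Y x) x) = Re (B (W x) (P x)) - \<mu> * (\<sigma> * Re (B (P x) (P x)))" for x
  proof -
    have "B (W x) x = B (W x) (P x)" using Pd(2)[of "W x" x] PW[of x] by simp
    then show ?thesis unfolding Y_def by (simp add: Bsimps krein_proj_self[OF P])
  qed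
  have "posop (\<lambda>x. scl (of_real \<rho>) (J (Y x)))"
    unfolding posop_def saop_def
  proof (intro conjI allI)
    show "bop (\<lambda>x. scl (of_real \<rho>) (J (Y x)))" by (intro bop_scale bop_comp[OF bop_J] boY)
    show "H (scl (of_real \<rho>) (J (Y x))) y = H x (scl (of_real \<rho>) (J (Y y)))" for x y
      using BY[of x y] by (simp add: Hsimps HJ1 HJ2)
    show "0 \<le> Re (H (scl (of_real \<rho>) (J (Y x))) x)" for x
      using nonneg[OF W(2) Pd(3)] by (simp add: Hsimps BYx HJ1)
  qed
  moreover obtain C where C: "C > 0" "\<And>x. nm (Y x) \<le> C * nm x" using bop_bound[OF boY] by metis
  moreover have "\<bar>\<rho>\<bar> = 1" using r by auto
  ultimately have est: "(nm (Y x))\<^sup>2 \<le> C * (\<rho> * Re (B (Y x) x))" for x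
    using posop_nm[of "\<lambda>x. scl (of_real \<rho>) (J (Y x))" C x] by (simp add: Hsimps HJ1)
  define \<delta> where "\<delta> = 1 / (c\<^sup>2 * C + 1)"
  have dp: "\<delta> > 0" using C(1) by (simp add: \<delta>_def add_nonneg_pos)
  have "\<delta> * (\<sigma> * Re (B f f)) \<le> \<rho> * (Re (B f' f) - \<mu> * (\<sigma> * Re (B f f)))" if f: "(f, f') \<in> A" "P f = f" for f f'
  proof -
    have Wf: "W f = f'" using A_single[OF W(2)[of f]] f by simp
    let ?h = "\<rho> * (Re (B f' f) - \<mu> * (\<sigma> * Re (B f f)))"
    have h0: "0 \<le> ?h" by (rule nonneg[OF f])
    have "\<sigma> * Re (B f f) \<le> \<bar>Re (B f f)\<bar>" using s abs_ge_self[of "\<sigma> * Re (B f f)"] by (simp add: abs_mult)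
    also have "\<dots> \<le> (nm f)\<^sup>2" using Re_B_bound[of f f] by (simp add: power2_eq_square)
    also have "\<dots> \<le> (c * nm (Y f))\<^sup>2"
      using lower[OF f] by (intro power_mono) (simp_all add: Y_def Wf f(2))
    also have "\<dots> = c\<^sup>2 * (nm (Y f))\<^sup>2" by (rule power_mult_distrib)
    also have "\<dots> \<le> c\<^sup>2 * (C * ?h)"
      using est[of f] by (intro mult_left_mono) (simp_all add: BYx Wf f(2))
    also have "\<dots> \<le> (c\<^sup>2 * C + 1) * ?h" using h0 by (simp add: algebra_simps)
    finally have "\<delta> * (\<sigma> * Re (B f f)) \<le> \<delta> * ((c\<^sup>2 * C + 1) * ?h)" using dp by (simp add: mult_left_mono)
    also have "\<dots> = ?h"
    proof -
      have "c\<^sup>2 * C + 1 > 0" using C(1) by (simp add: add_nonneg_pos)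
      then have "\<delta> * (c\<^sup>2 * C + 1) = 1" unfolding \<delta>_def by simp
      then show ?thesis by (simp add: mult.assoc[symmetric])
    qed
    finally show ?thesis .
  qed
  then show ?thesis using dp by blast
qed

text \<open>If an extreme value \<mu> of the Rayleigh quotient lay outside \<open>[lo, hi]\<close>,
  then \<open>A - \<sigma> \<mu>\<close> would be bounded below and \<open>range_gap\<close> would
  move the extreme value further inside. This extracts form bounds from mere knowledge of the
  spectrum.\<close>

lemma numerical_range:
  assumes P: "krein_proj P" and cR: "\<And>x. P (R \<i> x) = R \<i> (P x)" and d: "definite_range \<sigma> P"
    and W: "bop W" "\<And>x. (P x, W x) \<in> A"
    and lower: "\<And>s. s < lo \<or> hi < s \<Longrightarrow>
      \<exists>c. \<forall>f f'. (f, f') \<in> A \<longrightarrow> P f = f \<longrightarrow> nm f \<le> c * nm (f' - scl (of_real (\<sigma> * s)) f)"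
    and f: "(f, f') \<in> A" "P f = f"
  shows "lo * (\<sigma> * Re (B f f)) \<le> Re (B f' f)" "Re (B f' f) \<le> hi * (\<sigma> * Re (B f f))"
proof -
  note Pd = krein_projD[OF P]
  obtain M where M: "M > 0" "\<And>x. (nm (P x))\<^sup>2 \<le> M * (\<sigma> * Re (B (P x) x))"
    by (rule definite_bound[OF P d]) blast
  define n b where "n x = \<sigma> * Re (B x x)" and "b x = Re (B (W x) x)" for x
  have b_eq: "Re (B g' g) = b g" if "(g, g') \<in> A" "P g = g" for g g'
    using A_single[OF W(2)[of g]] that by (auto simp: b_def)
  have pos: "n x > 0" if "P x = x" "x \<noteq> 0" for x
  proof -
    have "0 < (nm x)\<^sup>2" using that(2) nm_eq_0[of x] by simp
    also have "\<dots> \<le> M * n x" using M(2)[of x] that(1) by (simp add: n_def)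
    finally show ?thesis using M(1) by (simp add: zero_less_mult_iff)
  qed
  define Q where "Q = {b x / n x |x. P x = x \<and> x \<noteq> 0}"
  have qle: "b x \<le> K * n x" if "\<And>q. q \<in> Q \<Longrightarrow> q \<le> K" "P x = x" for K x
  proof (cases "x = 0")
    case False
    then have "b x / n x \<le> K" using that unfolding Q_def by blast
    then show ?thesis using pos[OF that(2) False] by (simp add: field_simps)
  qed (simp add: b_def n_def B02)
  have qge: "K * n x \<le> b x" if "\<And>q. q \<in> Q \<Longrightarrow> K \<le> q" "P x = x" for K x
  proof (cases "x = 0")
    case False
    then have "K \<le> b x / n x" using that unfolding Q_def by blast
    then show ?thesis using pos[OF that(2) False] by (simp add: field_simps)
  qed (simp add: b_def n_def B02)
  have b0: "0 \<le> b x" if "P x = x" for x using A_nn[OF W(2)[of x]] that by (simp add: b_def)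
  obtain C where C: "C > 0" "\<And>x. nm (W x) \<le> C * nm x" using bop_bound[OF W(1)] by metis
  have bC: "b x \<le> (C * M) * n x" if x: "P x = x" for x
  proof -
    have "b x \<le> nm (W x) * nm x" using Re_B_bound[of "W x" x] by (simp add: b_def)
    also have "\<dots> \<le> C * nm x * nm x" by (intro mult_right_mono C) simp
    also have "\<dots> = C * (nm x)\<^sup>2" by (simp add: power2_eq_square)
    also have "\<dots> \<le> C * (M * n x)" using M(2)[of x] x C(1) by (intro mult_left_mono) (simp_all add: n_def)
    finally show ?thesis by simp
  qed
  show "lo * (\<sigma> * Re (B f f)) \<le> Re (B f' f)" "Re (B f' f) \<le> hi * (\<sigma> * Re (B f f))"
  proof -
    show "lo * (\<sigma> * Re (B f f)) \<le> Re (B f' f)"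
    proof (cases "f = 0")
      case False
      then have ne: "Q \<noteq> {}" using f(2) unfolding Q_def by blast
      have bdd: "bdd_below Q"
        by (rule bdd_belowI[of _ 0]) (use b0 pos in \<open>fastforce simp: Q_def less_imp_le\<close>)
      define \<mu> where "\<mu> = Inf Q"
      have mu: "\<mu> * n x \<le> b x" if "P x = x" for x
        by (rule qge[OF _ that]) (simp add: \<mu>_def cInf_lower bdd)
      have "lo \<le> \<mu>"
      proof (rule ccontr)
        assume "\<not> lo \<le> \<mu>"
        then obtain c where c: "\<And>f f'. (f, f') \<in> A \<Longrightarrow> P f = f \<Longrightarrow> nm f \<le> c * nm (f' - scl (of_real (\<sigma> * \<mu>)) f)"
          using lower[of \<mu>] by auto
        have "\<exists>\<delta>>0. \<forall>f f'. (f, f') \<in> A \<longrightarrow> P f = f \<longrightarrow>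
            \<delta> * (\<sigma> * Re (B f f)) \<le> 1 * (Re (B f' f) - \<mu> * (\<sigma> * Re (B f f)))"
          by (rule range_gap[OF P cR d W _ _ c]) (use mu b_eq in \<open>auto simp: n_def\<close>)
        then obtain \<delta> where \<delta>: "\<delta> > 0" "\<And>x. P x = x \<Longrightarrow> \<delta> * n x \<le> b x - \<mu> * n x"
          using W(2) unfolding n_def b_def by (metis mult_1)
        have "\<mu> + \<delta> \<le> Inf Q"
        proof (rule cInf_greatest[OF ne])
          fix q assume "q \<in> Q"
          then obtain x where x: "P x = x" "x \<noteq> 0" "q = b x / n x" unfolding Q_def by blast
          have "(\<mu> + \<delta>) * n x \<le> b x" using \<delta>(2)[OF x(1)] by (simp add: algebra_simps)
          then show "\<mu> + \<delta> \<le> q" using pos[OF x(1,2)] x(3) by (simp add: pos_le_divide_eq)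
        qed
        then show False using \<delta>(1) by (simp add: \<mu>_def)
      qed
      then have "lo * n f \<le> \<mu> * n f" using pos[OF f(2) False] by (simp add: mult_right_mono)
      then show ?thesis using mu[OF f(2)] b_eq[OF f] by (simp add: n_def)
    qed (use b_eq[OF f] b0[OF f(2)] in \<open>simp add: B01\<close>)
    show "Re (B f' f) \<le> hi * (\<sigma> * Re (B f f))"
    proof (cases "f = 0")
      case False
      then have ne: "Q \<noteq> {}" using f(2) unfolding Q_def by blast
      have bdd: "bdd_above Q"
      proof (rule bdd_aboveI[of _ "C * M"])
        fix q assume "q \<in> Q"
        then obtain x where x: "P x = x" "x \<noteq> 0" "q = b x / n x" unfolding Q_def by blast
        then show "q \<le> C * M" using bC[OF x(1)] pos[OF x(1,2)] by (simp add: pos_divide_le_eq)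
      qed
      define \<mu> where "\<mu> = Sup Q"
      have mu: "b x \<le> \<mu> * n x" if "P x = x" for x
        by (rule qle[OF _ that]) (simp add: \<mu>_def cSup_upper bdd)
      have "\<mu> \<le> hi"
      proof (rule ccontr)
        assume "\<not> \<mu> \<le> hi"
        then obtain c where c: "\<And>f f'. (f, f') \<in> A \<Longrightarrow> P f = f \<Longrightarrow> nm f \<le> c * nm (f' - scl (of_real (\<sigma> * \<mu>)) f)"
          using lower[of \<mu>] by auto
        have "\<exists>\<delta>>0. \<forall>f f'. (f, f') \<in> A \<longrightarrow> P f = f \<longrightarrow>
            \<delta> * (\<sigma> * Re (B f f)) \<le> (-1) * (Re (B f' f) - \<mu> * (\<sigma> * Re (B f f)))"
          by (rule range_gap[OF P cR d W _ _ c]) (use mu b_eq in \<open>auto simp: n_def\<close>)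
        then obtain \<delta> where \<delta>: "\<delta> > 0" "\<And>x. P x = x \<Longrightarrow> \<delta> * n x \<le> \<mu> * n x - b x"
          using W(2) unfolding n_def b_def by (metis minus_diff_eq mult_minus1)
        have "Sup Q \<le> \<mu> - \<delta>"
        proof (rule cSup_least[OF ne])
          fix q assume "q \<in> Q"
          then obtain x where x: "P x = x" "x \<noteq> 0" "q = b x / n x" unfolding Q_def by blast
          have "b x \<le> (\<mu> - \<delta>) * n x" using \<delta>(2)[OF x(1)] by (simp add: algebra_simps)
          then show "q \<le> \<mu> - \<delta>" using pos[OF x(1,2)] x(3) by (simp add: pos_divide_le_eq)
        qed
        then show False using \<delta>(1) by (simp add: \<mu>_def)
      qed
      then have "\<mu> * n f \<le> hi * n f" using pos[OF f(2) False] by (simp add: mult_right_mono)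
      then show ?thesis using mu[OF f(2)] b_eq[OF f] by (simp add: n_def)
    qed (use b_eq[OF f] in \<open>simp add: B01 B02 b_def\<close>)
  qed
qed

text \<open>By \<open>quad_form\<close> this is the energy of \<open>R (\<i> y) f\<close>, hence
  nonnegative. On a definite spectral part it corresponds to
  \<open>|\<lambda>| / (\<lambda>^2 + y^2)\<close>.\<close>

definition "q y f = Re (B (R (\<i> * of_real y) f) f)"

text \<open>For \<open>|\<lambda>|\<close> in \<open>[s, 2 s]\<close> one has
  \<open>\<lambda>^2 + y^2 \<le> 6 s |\<lambda>|\<close>, since
  \<open>\<lambda>^2 \<le> 2 s |\<lambda>|\<close> and
  \<open>y^2 \<le> 4 s^2 \<le> 4 s |\<lambda>|\<close>. The complement of the block only adds to the
  energy \<open>q y f\<close>.\<close>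

lemma spectral_block:
  assumes P: "krein_proj P" and cR: "\<And>z x. Im z \<noteq> 0 \<Longrightarrow> P (R z x) = R z (P x)" and d: "definite_range \<sigma> P"
    and W: "bop W" "\<And>x. (P x, W x) \<in> A" and s: "0 < s" and y: "0 < y" "y \<le> 2 * s"
    and lower: "\<And>t. t < s \<or> 2 * s < t \<Longrightarrow>
      \<exists>c. \<forall>f f'. (f, f') \<in> A \<longrightarrow> P f = f \<longrightarrow> nm f \<le> c * nm (f' - scl (of_real (\<sigma> * t)) f)"
  shows "\<sigma> * Re (B (P f) f) \<le> 6 * s * q y f"
proof -
  note Pd = krein_projD[OF P]
  have iI: "Im \<i> \<noteq> 0" by simp
  note nr = numerical_range[OF P cR[OF iI] d W lower]
  note cA = commute_A[OF Pd(1) cR[OF iI]]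
  define z where "z = \<i> * complex_of_real y"
  have z: "Im z \<noteq> 0" "cnj z = - z" using y by (simp_all add: z_def)
  have zz: "z * cnj z = of_real (y\<^sup>2)" by (simp add: z_def complex_eq_iff power2_eq_square)
  define u where "u = R z f"
  have u: "(u, f + scl z u) \<in> A" unfolding u_def by (rule R_A[OF z(1)])
  define w w' where "w = P u" and "w' = P (f + scl z u)"
  have w: "(w, w') \<in> A" "P w = w" "P w' = w'" unfolding w_def w'_def using cA[OF u] Pd(3) by blast+
  have v: "(u - w, f + scl z u - w') \<in> A" by (rule A_diff[OF u w(1)])
  obtain w'' where w'': "(w', w'') \<in> A" using W(2)[of w'] w(3) by auto
  define n b where "n x = \<sigma> * Re (B x x)" and "b = Re (B w' w)" for x
  have b0: "0 \<le> b" unfolding b_def by (rule A_nn[OF w(1)])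
  have n0: "0 \<le> n x" if "P x = x" for x
    using d that unfolding definite_range_def n_def by metis
  have 1: "s * n w \<le> b" unfolding n_def b_def by (rule nr(1)[OF _ w(1,2)])
  have 2: "n w' \<le> 2 * s * b"
  proof (cases "n w' = 0")
    case False
    have sq: "(n w')\<^sup>2 = (cmod (B w' w'))\<^sup>2"
      using d Bself[of w'] unfolding n_def definite_range_def by (auto simp: cmod_power2)
    have "(n w')\<^sup>2 \<le> b * Re (B w'' w')" unfolding sq b_def by (rule A_CS[OF w(1) w''])
    also have "\<dots> \<le> b * (2 * s * n w')"
      unfolding n_def by (intro mult_left_mono nr(2)[OF _ w'' w(3)] b0)
    finally have "n w' * n w' \<le> (2 * s * b) * n w'" by (simp add: power2_eq_square algebra_simps)
    moreover have "n w' > 0" using False n0[OF w(3)] by simp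
    ultimately show ?thesis by simp
  qed (use b0 s in simp)
  have Pf: "P f = w' - scl z w" by (simp add: w'_def w_def bop_lin[OF Pd(1)])
  have "B (P f) (P f) = B w' w' + z * (B w' w - B w w') + of_real (y\<^sup>2) * B w w"
  proof -
    have "B (P f) (P f) = B w' w' - cnj z * B w' w - z * B w w' + z * cnj z * B w w"
      unfolding Pf by (simp add: Bsimps algebra_simps)
    then show ?thesis unfolding zz by (simp add: z(2) algebra_simps)
  qed
  then have "B (P f) (P f) = B w' w' + of_real (y\<^sup>2) * B w w"
    using A_sym[OF w(1) w(1)] by simp
  then have "\<sigma> * Re (B (P f) f) = n w' + y\<^sup>2 * n w"
    unfolding krein_proj_self[OF P, symmetric] n_def by (simp add: algebra_simps)
  also have "\<dots> \<le> 2 * s * b + (2 * s)\<^sup>2 * n w"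
    using 2 y n0[OF w(2)] by (intro add_mono mult_right_mono power_mono) auto
  also have "(2 * s)\<^sup>2 * n w = 4 * s * (s * n w)" by (simp add: power2_eq_square)
  also have "2 * s * b + 4 * s * (s * n w) \<le> 2 * s * b + 4 * s * b"
    using 1 s by (intro add_left_mono mult_left_mono) auto
  also have "\<dots> = 6 * s * b" by simp
  finally have le: "\<sigma> * Re (B (P f) f) \<le> 6 * s * b" .
  have "b \<le> q y f"
  proof -
    have "q y f = Re (B (f + scl z u) u)"
      using quad_form[of y u f] y unfolding q_def u_def z_def by simp
    also have "B (f + scl z u) u = B w' w + B (f + scl z u - w') (u - w)"
    proof -
      have "B (f + scl z u) w = B w' w"
        using Pd(2)[of "f + scl z u" w] w(2) by (simp add: w'_def)
      moreover have "B w' u = B w' w"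
        using Pd(2)[of w' u] w(3) by (simp add: w_def)
      ultimately show ?thesis by (simp add: Bdiff1 Bdiff2)
    qed
    finally show ?thesis using A_nn[OF v] by (simp add: b_def)
  qed
  then have "6 * s * b \<le> 6 * s * q y f" using s by simp
  then show ?thesis using le by linarith
qed

end

section \<open>Convergence of families dominated by a bounded monotone function\<close>

context hilbU
begin

lemma monotone_convergence:
  fixes X :: "real \<Rightarrow> 'a"
  assumes mono: "\<And>s t. 1 \<le> s \<Longrightarrow> s \<le> t \<Longrightarrow> (nm (X t - X s))\<^sup>2 \<le> C * (\<phi> t - \<phi> s)"
    and inc: "\<And>s t. 1 \<le> s \<Longrightarrow> s \<le> t \<Longrightarrow> \<phi> s \<le> \<phi> t" and bd: "\<And>t. 1 \<le> t \<Longrightarrow> \<phi> t \<le> b" and C: "C > 0"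
  shows "\<exists>l. ((\<lambda>t. nm (X t - l)) \<longlongrightarrow> 0) at_top"
proof -
  define L where "L = Sup (\<phi> ` {1..})"
  have bdd: "bdd_above (\<phi> ` {1..})" by (rule bdd_aboveI[of _ b]) (use bd in auto)
  have Lup: "\<phi> t \<le> L" if "1 \<le> t" for t unfolding L_def using that bdd by (intro cSup_upper) auto
  have near: "\<exists>N\<ge>1. \<forall>s\<ge>N. \<forall>t\<ge>N. nm (X t - X s) < e" if e: "e > 0" for e
  proof -
    have "L - e\<^sup>2 / C < L" using e C by simp
    then obtain N where N: "N \<ge> 1" "L - e\<^sup>2 / C < \<phi> N"
      unfolding L_def using less_cSup_iff[OF _ bdd] by auto
    have *: "nm (X t - X s) < e" if "N \<le> s" "s \<le> t" for s t
    proof -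
      have "(nm (X t - X s))\<^sup>2 \<le> C * (\<phi> t - \<phi> s)" using mono that N by simp
      also have "\<dots> \<le> C * (L - \<phi> N)" using inc[of N s] Lup[of t] that N C by (intro mult_left_mono) auto
      also have "\<dots> < e\<^sup>2" using N(2) C by (simp add: field_simps)
      finally show ?thesis using e by (simp add: power_less_imp_less_base)
    qed
    have "nm (X t - X s) < e" if "N \<le> s" "N \<le> t" for s t
      using *[of s t] *[of t s] that nm_minus_commute[of "X s" "X t"] by (cases "s \<le> t") auto
    then show ?thesis using N(1) by blast
  qed
  obtain l where l: "conv (\<lambda>n. X (real n)) l"
  proof (rule complete[of "\<lambda>n. X (real n)"])
    fix e :: real assume e: "e > 0"
    obtain N where N: "\<And>s t. s \<ge> N \<Longrightarrow> t \<ge> N \<Longrightarrow> nm (X t - X s) < e" using near[OF e] by blast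
    obtain k where "N \<le> real k" using real_arch_simple by blast
    then show "\<exists>N. \<forall>m\<ge>N. \<forall>n\<ge>N. nm (X (real m) - X (real n)) < e"
      by (intro exI[of _ k]) (auto intro!: N)
  qed simp
  have "((\<lambda>t. nm (X t - l)) \<longlongrightarrow> 0) at_top"
  proof (rule tendstoI)
    fix e :: real assume e: "e > 0"
    obtain N where N: "\<And>s t. s \<ge> N \<Longrightarrow> t \<ge> N \<Longrightarrow> nm (X t - X s) < e / 2" using near[of "e / 2"] e by auto
    have "eventually (\<lambda>n. nm (X (real n) - l) < e / 2) sequentially"
      using l e unfolding conv_def by (intro order_tendstoD(2)[of _ 0]) auto
    moreover have "eventually (\<lambda>n. N \<le> real n) sequentially"
      using filterlim_real_sequentially unfolding filterlim_at_top by blast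
    ultimately have "eventually (\<lambda>n. nm (X (real n) - l) < e / 2 \<and> N \<le> real n) sequentially" by (rule eventually_conj)
    then obtain k where k: "nm (X (real k) - l) < e / 2" "N \<le> real k"
      using eventually_happens'[OF sequentially_bot] by blast
    have "dist (nm (X t - l)) 0 < e" if t: "N \<le> t" for t
      using nm_triangle3[of "X t" "X (real k)" l] N[OF k(2) t] k(1) by simp
    then show "eventually (\<lambda>t. dist (nm (X t - l)) 0 < e) at_top"
      unfolding eventually_at_top_linorder by blast
  qed
  then show ?thesis by blast
qed

end

section \<open>Sufficiency of the \<open>D\<^sub>\<infinity>\<close>-property\<close>

context pfr
begin

lemma q_upper_pointwise:
  assumes D: "(Im (Pt.m z) + Im (Nt.m z)) / cmod (dlt z) \<le> Cd" and y: "y > 0" and z: "z = \<i> * of_real y"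
  shows "q y f \<le> Re (B (Pt.R0 z (pp f)) (pp f)) + Re (- B (Nt.R0 (- z) (pm f)) (pm f))
    + Cd * ((cmod (B (pp f) (Pt.psi (- z))))\<^sup>2 / Im (Pt.m z) + (cmod (B (pp f) (Pt.psi z)))\<^sup>2 / Im (Pt.m z)
      + ((cmod (B (pm f) (Nt.psi (- z))))\<^sup>2 / Im (Nt.m z) + (cmod (B (pm f) (Nt.psi z)))\<^sup>2 / Im (Nt.m z)))"
proof -
  have z0: "Im z \<noteq> 0" "cnj z = - z" "Im z = y" using y z by simp_all
  define a1 a2 a3 a4 where "a1 = cmod (B (pp f) (Pt.psi (- z)))" and "a2 = cmod (B (pp f) (Pt.psi z))"
    and "a3 = cmod (B (pm f) (Nt.psi z))" and "a4 = cmod (B (pm f) (Nt.psi (- z)))"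
  define I I' where "I = Im (Pt.m z)" and "I' = Im (Nt.m z)"
  have I: "I > 0" "I' > 0"
    unfolding I_def I'_def using Pt.Im_m[OF z0(1)] Nt.Im_m[OF z0(1)] Pt.nm_psi_pos[OF z0(1)] Nt.nm_psi_pos[OF z0(1)] y z0(3)
    by simp_all
  have d: "cmod (dlt z) > 0" using dlt_nz[OF z0(1)] by simp
  have Cd: "0 \<le> Cd" using D I d unfolding I_def[symmetric] I'_def[symmetric]
    by (smt (verit) divide_nonneg_pos)
  define N where "N = a1\<^sup>2 + a2\<^sup>2 + (a4\<^sup>2 + a3\<^sup>2)"
  have N0: "0 \<le> N" by (simp add: N_def)
  have "cmod (cc z f * (B (Pt.psi z) (pp f) + B (Nt.psi (- z)) (pm f)))
      = cmod (B (pp f) (Pt.psi (- z)) + B (pm f) (Nt.psi z)) * cmod (B (Pt.psi z) (pp f) + B (Nt.psi (- z)) (pm f)) / cmod (dlt z)"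
    unfolding cc_def z0(2) minus_minus by (simp add: norm_mult norm_divide del: minus_add_distrib)
  also have "\<dots> \<le> (a1 + a3) * (a2 + a4) / cmod (dlt z)"
  proof (intro divide_right_mono mult_mono)
    show "cmod (B (pp f) (Pt.psi (- z)) + B (pm f) (Nt.psi z)) \<le> a1 + a3"
      unfolding a1_def a3_def by (rule norm_triangle_ineq)
    have "cmod (B (Pt.psi z) (pp f)) = a2" "cmod (B (Nt.psi (- z)) (pm f)) = a4"
      unfolding a2_def a4_def using Bcnj complex_mod_cnj by metis+
    then show "cmod (B (Pt.psi z) (pp f) + B (Nt.psi (- z)) (pm f)) \<le> a2 + a4"
      using norm_triangle_ineq[of "B (Pt.psi z) (pp f)" "B (Nt.psi (- z)) (pm f)"] by simp
  qed (simp_all add: a1_def a3_def)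
  also have "\<dots> \<le> N / cmod (dlt z)"
  proof (rule divide_right_mono)
    \<comment> \<open>The three squares add up to
      \<open>2 N - 2 (a1 + a3) (a2 + a4)\<close>.\<close>
    have "0 \<le> (a1 - a3)\<^sup>2 + (a2 - a4)\<^sup>2 + ((a1 + a3) - (a2 + a4))\<^sup>2" by simp
    then show "(a1 + a3) * (a2 + a4) \<le> N" unfolding N_def by (simp add: power2_eq_square algebra_simps)
  qed simp
  \<comment> \<open>Here the quotient of the pair enters, as
    \<open>1 / |dlt z| \<le> Cd / (I + I')\<close>. Dropping one summand of \<open>I + I'\<close> in
    each term then leaves the weights of the two \<open>B_infty\<close> inequalities.\<close>
  also have "\<dots> \<le> Cd * (N / (I + I'))"
  proof -
    have "(I + I') * N \<le> (Cd * cmod (dlt z)) * N"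
      using D d N0 unfolding I_def I'_def by (intro mult_right_mono) (simp_all add: pos_divide_le_eq)
    then show ?thesis using d I by (simp add: field_simps)
  qed
  also have "\<dots> \<le> Cd * (a1\<^sup>2 / I + a2\<^sup>2 / I + (a4\<^sup>2 / I' + a3\<^sup>2 / I'))"
  proof (rule mult_left_mono[OF _ Cd])
    have "t / (I + I') \<le> t / I" "t / (I + I') \<le> t / I'" if "t \<ge> 0" for t
      using I that by (auto intro!: divide_left_mono)
    then show "N / (I + I') \<le> a1\<^sup>2 / I + a2\<^sup>2 / I + (a4\<^sup>2 / I' + a3\<^sup>2 / I')"
      unfolding N_def add_divide_distrib by (intro add_mono) simp_all
  qed
  finally have "Re (cc z f * (B (Pt.psi z) (pp f) + B (Nt.psi (- z)) (pm f)))
      \<le> Cd * (a1\<^sup>2 / I + a2\<^sup>2 / I + (a4\<^sup>2 / I' + a3\<^sup>2 / I'))"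
    using complex_Re_le_cmod order_trans by blast
  then show ?thesis
    unfolding q_def z[symmetric] BR_formula[OF z0(1)] plus_complex.sel a1_def a2_def a3_def a4_def I_def I'_def
    by simp
qed

text \<open>The bound on \<open>a k\<close> holds for every \<open>y\<close> in the block and may be
  integrated over it, the block having length \<open>2^k\<close>. The decoupled part telescopes by
  \<open>dyadic_estimate\<close>; the rank one part adds up to integrals over
  \<open>{1<..}\<close>.\<close>

lemma dyadic_sum_bound:
  assumes Bp: "has_B_infty Pt.m" and Bm: "has_B_infty Nt.m" and D: "has_D_infty Pt.m Nt.m"
  shows "\<exists>M\<ge>0. \<forall>f n (a :: nat \<Rightarrow> real).
    (\<forall>k<n. \<forall>y. 2 ^ k < y \<and> y \<le> 2 ^ Suc k \<longrightarrow> a k \<le> 2 ^ k * q y f) \<longrightarrow> (\<Sum>k<n. a k) \<le> M * (nm f)\<^sup>2"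
proof -
  obtain K p where K: "K \<ge> 0" "\<And>f s. f \<in> Kp \<Longrightarrow> s > 0 \<Longrightarrow> 0 \<le> p f s \<and> p f s \<le> (P.nm f)\<^sup>2"
    "\<And>f s y. f \<in> Kp \<Longrightarrow> 1 \<le> s \<Longrightarrow> s \<le> \<bar>y\<bar> \<Longrightarrow> \<bar>y\<bar> \<le> 2 * s \<Longrightarrow>
       Re (B (Pt.R0 (\<i> * of_real y) f) f) \<le> K / s * (p f s - p f (2 * s))"
    using Pt.dyadic_estimate by blast
  obtain K' p' where K': "K' \<ge> 0" "\<And>f s. f \<in> Km \<Longrightarrow> s > 0 \<Longrightarrow> 0 \<le> p' f s \<and> p' f s \<le> (N.nm f)\<^sup>2"
    "\<And>f s y. f \<in> Km \<Longrightarrow> 1 \<le> s \<Longrightarrow> s \<le> \<bar>y\<bar> \<Longrightarrow> \<bar>y\<bar> \<le> 2 * s \<Longrightarrow>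
       Re (- B (Nt.R0 (\<i> * of_real y) f) f) \<le> K' / s * (p' f s - p' f (2 * s))"
    using Nt.dyadic_estimate by blast
  obtain C1 where C1: "0 \<le> C1" "\<And>f \<sigma>. f \<in> Kp \<Longrightarrow> \<sigma> = 1 \<or> \<sigma> = -1 \<Longrightarrow>
      set_integrable lborel {1<..} (\<lambda>y. (cmod (B f (Pt.psi (\<sigma> * (\<i> * of_real y)))))\<^sup>2 / Im (Pt.m (\<i> * of_real y))) \<and>
      (LINT y:{1<..}|lborel. (cmod (B f (Pt.psi (\<sigma> * (\<i> * of_real y)))))\<^sup>2 / Im (Pt.m (\<i> * of_real y))) \<le> C1 * (P.nm f)\<^sup>2"
    using Pt.B_infty_psi[OF Bp] by blast
  obtain C2 where C2: "0 \<le> C2" "\<And>f \<sigma>. f \<in> Km \<Longrightarrow> \<sigma> = 1 \<or> \<sigma> = -1 \<Longrightarrow>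
      set_integrable lborel {1<..} (\<lambda>y. (cmod (- B f (Nt.psi (\<sigma> * (\<i> * of_real y)))))\<^sup>2 / Im (Nt.m (\<i> * of_real y))) \<and>
      (LINT y:{1<..}|lborel. (cmod (- B f (Nt.psi (\<sigma> * (\<i> * of_real y)))))\<^sup>2 / Im (Nt.m (\<i> * of_real y))) \<le> C2 * (N.nm f)\<^sup>2"
    using Nt.B_infty_psi[OF Bm] by blast
  have neg: "- \<i> * complex_of_real y = - (\<i> * of_real y)" for y by simp
  obtain Cd0 where Cd0: "\<And>y::real. y > 1 \<Longrightarrow>
      \<bar>(Im (Pt.m (\<i> * of_real y)) + Im (Nt.m (\<i> * of_real y))) / cmod (dlt (\<i> * of_real y))\<bar> \<le> Cd0"
    using D unfolding has_D_infty_def neg dlt_def[symmetric] bounded_iff by auto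
  define Cd where "Cd = max Cd0 0"
  have Cd: "Cd \<ge> 0" "\<And>y::real. y > 1 \<Longrightarrow>
      (Im (Pt.m (\<i> * of_real y)) + Im (Nt.m (\<i> * of_real y))) / cmod (dlt (\<i> * of_real y)) \<le> Cd"
    unfolding Cd_def using Cd0 by (auto intro: order_trans[OF abs_ge_self] simp: max.coboundedI1)
  define M where "M = K + K' + Cd * (2 * C1 + 2 * C2)"
  have M0: "M \<ge> 0" unfolding M_def using K(1) K'(1) Cd(1) C1(1) C2(1) by simp
  have "(\<Sum>k<n. a k) \<le> M * (nm f)\<^sup>2"
    if a: "\<And>k y. k < n \<Longrightarrow> 2 ^ k < y \<Longrightarrow> y \<le> 2 ^ Suc k \<Longrightarrow> a k \<le> 2 ^ k * q y f" for f n and a :: "nat \<Rightarrow> real"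
  proof -
    define h1 h2 h3 h4 where
      "h1 y = (cmod (B (pp f) (Pt.psi (- (\<i> * of_real y)))))\<^sup>2 / Im (Pt.m (\<i> * of_real y))"
      and "h2 y = (cmod (B (pp f) (Pt.psi (\<i> * of_real y))))\<^sup>2 / Im (Pt.m (\<i> * of_real y))"
      and "h3 y = (cmod (B (pm f) (Nt.psi (- (\<i> * of_real y)))))\<^sup>2 / Im (Nt.m (\<i> * of_real y))"
      and "h4 y = (cmod (B (pm f) (Nt.psi (\<i> * of_real y))))\<^sup>2 / Im (Nt.m (\<i> * of_real y))" for y :: real
    define g where "g y = Cd * (h1 y + h2 y + (h3 y + h4 y))" for y
    have i1: "set_integrable lborel {1<..} h1" "(LINT y:{1<..}|lborel. h1 y) \<le> C1 * (P.nm (pp f))\<^sup>2"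
      using C1(2)[OF pp_Kp, of "-1" f] unfolding h1_def by simp_all
    have i2: "set_integrable lborel {1<..} h2" "(LINT y:{1<..}|lborel. h2 y) \<le> C1 * (P.nm (pp f))\<^sup>2"
      using C1(2)[OF pp_Kp, of 1 f] unfolding h2_def by simp_all
    have i3: "set_integrable lborel {1<..} h3" "(LINT y:{1<..}|lborel. h3 y) \<le> C2 * (N.nm (pm f))\<^sup>2"
      using C2(2)[OF pm_Km, of "-1" f] unfolding h3_def by simp_all
    have i4: "set_integrable lborel {1<..} h4" "(LINT y:{1<..}|lborel. h4 y) \<le> C2 * (N.nm (pm f))\<^sup>2"
      using C2(2)[OF pm_Km, of 1 f] unfolding h4_def by simp_all
    have ig: "set_integrable lborel {1<..} g"
      unfolding g_def by (intro set_integrable_mult_right set_integral_add i1 i2 i3 i4)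
    have g_int: "(LINT y:{1<..}|lborel. g y) \<le> Cd * (2 * C1 + 2 * C2) * (nm f)\<^sup>2"
    proof -
      have "(LINT y:{1<..}|lborel. g y) = Cd * ((LINT y:{1<..}|lborel. h1 y) + (LINT y:{1<..}|lborel. h2 y)
          + ((LINT y:{1<..}|lborel. h3 y) + (LINT y:{1<..}|lborel. h4 y)))"
        unfolding g_def by (simp add: set_integral_add i1(1) i2(1) i3(1) i4(1))
      also have "\<dots> \<le> Cd * (C1 * (P.nm (pp f))\<^sup>2 + C1 * (P.nm (pp f))\<^sup>2 + (C2 * (N.nm (pm f))\<^sup>2 + C2 * (N.nm (pm f))\<^sup>2))"
        by (intro mult_left_mono add_mono i1 i2 i3 i4 Cd)
      also have "\<dots> \<le> Cd * (C1 * (nm f)\<^sup>2 + C1 * (nm f)\<^sup>2 + (C2 * (nm f)\<^sup>2 + C2 * (nm f)\<^sup>2))"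
        by (intro mult_left_mono add_mono Cd C1 C2 power_mono pp_le pm_le) simp_all
      finally show ?thesis by (simp add: algebra_simps)
    qed
    have g0: "0 \<le> g y" if "y > 1" for y
    proof -
      have "0 < Im (Pt.m (\<i> * of_real y))" "0 < Im (Nt.m (\<i> * of_real y))"
        using Pt.Im_m[of "\<i> * of_real y"] Nt.Im_m[of "\<i> * of_real y"] Pt.nm_psi_pos[of "\<i> * of_real y"]
          Nt.nm_psi_pos[of "\<i> * of_real y"] that by simp_all
      then show ?thesis unfolding g_def h1_def h2_def h3_def h4_def using Cd(1) by (intro mult_nonneg_nonneg add_nonneg_nonneg) simp_all
    qed
    have igs: "set_integrable lborel {c<..d} g" if "c \<ge> 1" for c d
      by (rule set_integrable_subset[OF ig]) (use that in auto)
    define P where "P s = K * p (pp f) s + K' * p' (pm f) s" for s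
    have step: "a k \<le> P (2 ^ k) - P (2 ^ Suc k) + (LINT y:{2^k<..2^Suc k}|lborel. g y)" if k: "k < n" for k
    proof -
      define s :: real where "s = 2 ^ k"
      have s: "1 \<le> s" "2 ^ Suc k = 2 * s" by (simp_all add: s_def)
      \<comment> \<open>In this form the pointwise estimate bounds a constant by \<open>g\<close>,
        and integration over \<open>{s<..2 * s}\<close> gives back the numerator.\<close>
      define c where "c = (a k - (P s - P (2 * s))) / s"
      have cg: "c \<le> g y" if y: "y \<in> {s<..2 * s}" for y
      proof -
        have y1: "1 < y" "0 < y" using y s by auto
        define z where "z = \<i> * complex_of_real y"
        have "q y f \<le> Re (B (Pt.R0 z (pp f)) (pp f)) + Re (- B (Nt.R0 (- z) (pm f)) (pm f)) + g y"
          unfolding g_def h1_def h2_def h3_def h4_def z_def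
          by (rule q_upper_pointwise[OF Cd(2)[OF y1(1)] y1(2) refl])
        moreover have "Re (B (Pt.R0 z (pp f)) (pp f)) \<le> K / s * (p (pp f) s - p (pp f) (2 * s))"
          unfolding z_def by (rule K(3)[OF pp_Kp s(1)]) (use y y1 in auto)
        moreover have "Re (- B (Nt.R0 (- z) (pm f)) (pm f)) \<le> K' / s * (p' (pm f) s - p' (pm f) (2 * s))"
        proof -
          have "- z = \<i> * of_real (- y)" by (simp add: z_def)
          then show ?thesis using K'(3)[OF pm_Km s(1), of "- y" f] y y1 by (simp only:) auto
        qed
        ultimately have "q y f \<le> (P s - P (2 * s)) / s + g y"
          unfolding P_def by (simp add: diff_divide_distrib add_divide_distrib algebra_simps)
        then have "s * q y f \<le> s * ((P s - P (2 * s)) / s + g y)" using s by (intro mult_left_mono) auto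
        also have "\<dots> = (P s - P (2 * s)) + s * g y" using s by (simp add: distrib_left)
        finally have "a k \<le> (P s - P (2 * s)) + s * g y"
          using a[OF k, of y] y unfolding s(2)[symmetric] s_def[symmetric] by (simp add: s_def)
        then show ?thesis unfolding c_def using s by (simp add: pos_divide_le_eq algebra_simps)
      qed
      have "set_integrable lborel {s<..2 * s} (\<lambda>y. c)"
        unfolding set_integrable_def using s by (intro integrable_scaleR_left integrable_real_indicator) auto
      then have "(LINT y:{s<..2 * s}|lborel. c) \<le> (LINT y:{s<..2 * s}|lborel. g y)"
        by (rule set_integral_mono[OF _ igs[OF s(1)] cg])
      moreover have "(LINT y:{s<..2 * s}|lborel. c) = s * c"
        using s by (subst set_integral_const) (simp_all)
      moreover have "s * c = a k - (P s - P (2 * s))" unfolding c_def using s by simp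
      ultimately show ?thesis unfolding s(2) s_def[symmetric] by linarith
    qed
    have "(\<Sum>k<j. a k) \<le> P 1 - P (2 ^ j) + (LINT y:{1<..2 ^ j}|lborel. g y)" if "j \<le> n" for j
      using that
    proof (induction j)
      case (Suc j)
      have "{1<..c :: real} = {1<..b} \<union> {b<..c}" if "1 \<le> b" "b \<le> c" for b c
        using that by auto
      from this[of "2 ^ j" "2 ^ Suc j"] have "{1<..2 ^ Suc j :: real} = {1<..2 ^ j} \<union> {2 ^ j<..2 ^ Suc j}"
        by simp
      moreover have "(LINT y:{1<..2 ^ j} \<union> {2 ^ j<..2 ^ Suc j}|lborel. g y)
          = (LINT y:{1<..2 ^ j}|lborel. g y) + (LINT y:{2 ^ j<..2 ^ Suc j}|lborel. g y)"
        by (rule set_integral_Un) (use igs one_le_power[of "2::real" j] in auto)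
      ultimately have u: "(LINT y:{1<..2 ^ Suc j}|lborel. g y)
          = (LINT y:{1<..2 ^ j}|lborel. g y) + (LINT y:{2 ^ j<..2 ^ Suc j}|lborel. g y)" by simp
      have "(\<Sum>k<Suc j. a k) = (\<Sum>k<j. a k) + a j" by simp
      also have "\<dots> \<le> (P 1 - P (2 ^ j) + (LINT y:{1<..2 ^ j}|lborel. g y))
          + (P (2 ^ j) - P (2 ^ Suc j) + (LINT y:{2 ^ j<..2 ^ Suc j}|lborel. g y))"
        using Suc step[of j] by (intro add_mono) simp_all
      finally show ?case unfolding u by simp
    qed (simp add: set_lebesgue_integral_def)
    then have "(\<Sum>k<n. a k) \<le> P 1 - P (2 ^ n) + (LINT y:{1<..2 ^ n}|lborel. g y)" by simp
    also have "\<dots> \<le> K * (nm f)\<^sup>2 + K' * (nm f)\<^sup>2 + (LINT y:{1<..}|lborel. g y)"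
    proof (intro add_mono)
      have b: "(P.nm (pp f))\<^sup>2 \<le> (nm f)\<^sup>2" "(N.nm (pm f))\<^sup>2 \<le> (nm f)\<^sup>2"
        by (intro power_mono pp_le pm_le; simp)+
      have "p (pp f) 1 \<le> (nm f)\<^sup>2" "p' (pm f) 1 \<le> (nm f)\<^sup>2"
        using K(2)[OF pp_Kp, of 1 f] K'(2)[OF pm_Km, of 1 f] b by linarith+
      then have "P 1 \<le> K * (nm f)\<^sup>2 + K' * (nm f)\<^sup>2"
        unfolding P_def using K(1) K'(1) by (intro add_mono mult_left_mono)
      moreover have "0 \<le> P (2 ^ n)"
        unfolding P_def using K(2)[OF pp_Kp, of "2^n" f] K'(2)[OF pm_Km, of "2^n" f] K(1) K'(1) by simp
      ultimately show "P 1 - P (2 ^ n) \<le> K * (nm f)\<^sup>2 + K' * (nm f)\<^sup>2" by simp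
      show "(LINT y:{1<..2 ^ n}|lborel. g y) \<le> (LINT y:{1<..}|lborel. g y)"
        unfolding set_lebesgue_integral_def
      proof (rule integral_mono)
        show "integrable lborel (\<lambda>x. indicat_real {1<..2 ^ n} x *\<^sub>R g x)"
          using igs[of 1 "2^n"] unfolding set_integrable_def by simp
        show "integrable lborel (\<lambda>x. indicat_real {1<..} x *\<^sub>R g x)"
          using ig unfolding set_integrable_def by simp
        show "indicat_real {1<..2 ^ n} x *\<^sub>R g x \<le> indicat_real {1<..} x *\<^sub>R g x" for x
          using g0[of x] by (auto simp: indicator_def)
      qed
    qed
    also have "\<dots> \<le> M * (nm f)\<^sup>2" using g_int unfolding M_def by (simp add: algebra_simps)
    finally show ?thesis .
  qed
  then show ?thesis using M0 by blast
qed

end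

section \<open>From dyadic sums to strong limits of spectral projections\<close>

context nonneg_krein
begin

lemma regular_at_infinity:
  assumes E: "spectral_function scl B Kp Km A E"
    and M: "M \<ge> 0" "\<And>f n (a :: nat \<Rightarrow> real). (\<And>k y. k < n \<Longrightarrow> 2 ^ k < y \<Longrightarrow> y \<le> 2 ^ Suc k \<Longrightarrow> a k \<le> 2 ^ k * q y f)
       \<Longrightarrow> (\<Sum>k<n. a k) \<le> M * (nm f)\<^sup>2"
  shows "regular_point H E None"
proof -
  note E' = E[unfolded spectral_function_def Let_def]
  have E_bop: "bop (E \<Delta>)" if "\<Delta> \<in> spectral_ring" for \<Delta> using E'[THEN conjunct1] that by blast
  have E_sym: "B (E \<Delta> x) y = B x (E \<Delta> y)" if "\<Delta> \<in> spectral_ring" for \<Delta> x y using E'[THEN conjunct2, THEN conjunct2, THEN conjunct2, THEN conjunct1] that by blast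
  have E_mult: "E (\<Delta>1 \<inter> \<Delta>2) x = E \<Delta>1 (E \<Delta>2 x)" if "\<Delta>1 \<in> spectral_ring" "\<Delta>2 \<in> spectral_ring" for \<Delta>1 \<Delta>2 x
    using E'[THEN conjunct2, THEN conjunct2, THEN conjunct2, THEN conjunct2, THEN conjunct1] that by blast
  have E_add: "E (\<Delta>1 \<union> \<Delta>2) x = E \<Delta>1 x + E \<Delta>2 x"
    if "\<Delta>1 \<in> spectral_ring" "\<Delta>2 \<in> spectral_ring" "\<Delta>1 \<inter> \<Delta>2 = {}" for \<Delta>1 \<Delta>2 x
    using E'[THEN conjunct2, THEN conjunct2, THEN conjunct2, THEN conjunct2, THEN conjunct2, THEN conjunct1] that by blast
  have E_pos: "hilbert_space scl (range (E \<Delta>)) B" if "\<Delta> \<in> spectral_ring" "\<Delta> \<subseteq> Some ` {0<..}" for \<Delta>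
    using E'[THEN conjunct2, THEN conjunct2, THEN conjunct2, THEN conjunct2, THEN conjunct2, THEN conjunct2, THEN conjunct1] that by blast
  have E_neg: "hilbert_space scl (range (E \<Delta>)) (\<lambda>x y. - B x y)" if "\<Delta> \<in> spectral_ring" "\<Delta> \<subseteq> Some ` {..<0}" for \<Delta>
    using E'[THEN conjunct2, THEN conjunct2, THEN conjunct2, THEN conjunct2, THEN conjunct2, THEN conjunct2, THEN conjunct2, THEN conjunct1] that by blast
  have E_comm: "in_double_commutant_of_resolvent scl H A (E \<Delta>)" if "\<Delta> \<in> spectral_ring" for \<Delta>
    using E'[THEN conjunct2, THEN conjunct2, THEN conjunct2, THEN conjunct2, THEN conjunct2, THEN conjunct2, THEN conjunct2, THEN conjunct2, THEN conjunct1] that by blast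
  have E_bd: "range (E (Some ` S)) \<subseteq> Domain A"
    "\<exists>C. \<forall>(f, f')\<in>{(f, f') \<in> A. f \<in> range (E (Some ` S))}. nm f' \<le> C * nm f"
    "spectrum scl (range (E (Some ` S))) H {(f, f') \<in> A. f \<in> range (E (Some ` S))} \<subseteq> complex_of_real ` closure S"
    if "Some ` S \<in> spectral_ring" "bounded S" for S
    using E'[THEN conjunct2, THEN conjunct2, THEN conjunct2, THEN conjunct2, THEN conjunct2, THEN conjunct2, THEN conjunct2, THEN conjunct2, THEN conjunct2] that by blast+
  have proj: "krein_proj (E \<Delta>)" if "\<Delta> \<in> spectral_ring" for \<Delta>
    unfolding krein_proj_def using E_bop[OF that] E_sym[OF that] E_mult[OF that that] by simp
  have com: "E \<Delta> (R z x) = R z (E \<Delta> x)" if D: "\<Delta> \<in> spectral_ring" and z: "Im z \<noteq> 0" for \<Delta> z x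
  proof -
    have "(R z g, R z f) \<in> resolvent scl A w" if gf: "(g, f) \<in> resolvent scl A w" for w g f
    proof -
      obtain f' where f': "g = f' - scl w f" "(f, f') \<in> A" using gf unfolding resolvent_def by blast
      have "R z g = R z f' - scl w (R z f)" unfolding f'(1) by (simp only: bop_diff[OF R_bop[OF z]] bop_scl[OF R_bop[OF z]])
      then show ?thesis using R_commute_A[OF z f'(2)] unfolding resolvent_def by blast
    qed
    then have "R z (E \<Delta> x) = E \<Delta> (R z x)"
      using E_comm[OF D] R_bop[OF z] unfolding in_double_commutant_of_resolvent_def by blast
    then show ?thesis by simp
  qed
  have ring: "Some ` J \<in> spectral_ring" if "J \<in> nz_intervals" for J
    unfolding spectral_ring_def using that by (intro CollectI exI[of _ "{J}"]) simp
  \<comment> \<open>The factor \<sigma> treats both half-lines at once; the limit at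
    \<open>- \<infinity>\<close> is read off by reflection.\<close>
  have main: "\<exists>l. ((\<lambda>t. nm (E (Some ` ((*) \<sigma> ` {1..t})) f0 - l)) \<longlongrightarrow> 0) at_top" if \<sigma>: "\<sigma> = 1 \<or> \<sigma> = -1" for \<sigma> :: real and f0
  proof -
    define G where "G S = Some ` ((*) \<sigma> ` S)" for S :: "real set"
    have um: "(*) (-1) = (uminus :: real \<Rightarrow> real)" by (simp add: fun_eq_iff)
    have nz: "(*) \<sigma> ` S \<in> nz_intervals"
      if ab: "0 < a" "a \<le> b" and S: "S \<in> {{a..b}, {a..<b}, {a<..b}, {a<..<b}}" for a b S
      using \<sigma>
    proof
      assume "\<sigma> = 1"
      then have "(*) \<sigma> ` S = S" by (simp add: image_def)
      then show ?thesis unfolding nz_intervals_def using ab S by (intro CollectI exI[of _ a] exI[of _ b]) auto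
    next
      assume "\<sigma> = -1"
      then have "(*) \<sigma> ` S \<in> {{-b..-a}, {-b..<-a}, {-b<..-a}, {-b<..<-a}}" using S by (auto simp: um)
      then show ?thesis unfolding nz_intervals_def using ab by (intro CollectI exI[of _ "- b"] exI[of _ "- a"]) auto
    qed
    have rG: "G {a..b} \<in> spectral_ring" "G {a..<b} \<in> spectral_ring" "G {a<..b} \<in> spectral_ring" "G {a<..<b} \<in> spectral_ring"
      if "0 < a" "a \<le> b" for a b
      unfolding G_def using ring[OF nz[OF that]] by auto
    have GU: "G (S \<union> T) = G S \<union> G T" for S T by (simp add: G_def image_Un)
    have inj: "inj ((*) \<sigma>)" using \<sigma> by (auto simp: inj_on_def)
    have GI: "G S \<inter> G T = {}" if "S \<inter> T = {}" for S T
      unfolding G_def using inj that by (auto simp: inj_on_def)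
    have add: "E (G (S \<union> T)) x = E (G S) x + E (G T) x"
      if "G S \<in> spectral_ring" "G T \<in> spectral_ring" "S \<inter> T = {}" for S T x
      unfolding GU by (rule E_add[OF that(1,2) GI[OF that(3)]])
    have def: "definite_range \<sigma> (E (G S))" if S: "S \<subseteq> {0<..}" "G S \<in> spectral_ring" for S
      unfolding definite_range_def
    proof (intro conjI allI \<sigma>)
      fix x
      let ?y = "E (G S) x"
      show "0 \<le> \<sigma> * Re (B ?y ?y)"
        using \<sigma>
      proof
        assume s: "\<sigma> = 1"
        then have "G S \<subseteq> Some ` {0<..}" using S unfolding G_def by auto
        then have "?y \<noteq> 0 \<longrightarrow> 0 < Re (B ?y ?y)"
          using E_pos[OF S(2)] unfolding hilbert_space_def inner_product_on_def by blast
        then show ?thesis using s by (cases "?y = 0") (auto simp: B01)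
      next
        assume s: "\<sigma> = -1"
        then have "G S \<subseteq> Some ` {..<0}" using S unfolding G_def by auto
        then have "?y \<noteq> 0 \<longrightarrow> 0 < Re (- B ?y ?y)"
          using E_neg[OF S(2)] unfolding hilbert_space_def inner_product_on_def by blast
        then show ?thesis using s by (cases "?y = 0") (auto simp: B01)
      qed
    qed
    have form0: "0 \<le> \<sigma> * Re (B (E (G S) x) x)" if "S \<subseteq> {0<..}" "G S \<in> spectral_ring" for S x
      using def[OF that] krein_proj_self[OF proj[OF that(2)]] unfolding definite_range_def by simp
    have block: "\<sigma> * Re (B (E (G {s..<2 * s}) f) f) \<le> 6 * s * q y f" if s: "0 < s" and y: "0 < y" "y \<le> 2 * s" for s y f
    proof -
      let ?S = "(*) \<sigma> ` {s..<2 * s}"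
      let ?P = "E (G {s..<2 * s})"
      have r: "G {s..<2 * s} \<in> spectral_ring" using rG(2)[of s "2 * s"] s by simp
      have bdS: "bounded ?S" using bounded_scaling[of "{s..<2 * s}" \<sigma>] by simp
      note eb = E_bd[OF r[unfolded G_def] bdS, folded G_def]
      obtain C where C: "\<forall>(f, f')\<in>{(f, f') \<in> A. f \<in> range ?P}. nm f' \<le> C * nm f" using eb(2) by blast
      obtain D where D: "D > 0" "\<And>x. nm (?P x) \<le> D * nm x" using bop_bound[OF E_bop[OF r]] by metis
      have "\<exists>w. (?P x, w) \<in> A \<and> nm w \<le> (\<bar>C\<bar> * D) * nm x" for x
      proof -
        obtain w where w: "(?P x, w) \<in> A" using eb(1) by blast
        then have "nm w \<le> C * nm (?P x)" using C by blast
        also have "\<dots> \<le> \<bar>C\<bar> * (D * nm x)" using D by (intro mult_mono) auto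
        finally show ?thesis using w by (auto simp: mult.assoc)
      qed
      then obtain W where W: "bop W" "\<And>x. (?P x, W x) \<in> A" using range_operator[OF E_bop[OF r]] by metis
      have cl: "closure ?S \<subseteq> (*) \<sigma> ` {s..2 * s}"
      proof (rule closure_minimal)
        show "closed ((*) \<sigma> ` {s..2 * s})"
          by (intro compact_imp_closed compact_continuous_image continuous_intros compact_Icc)
      qed auto
      \<comment> \<open>Outside the closed block the spectrum clause provides a bounded inverse,
        which is all that \<open>spectral_block\<close> has to know about the spectrum.\<close>
      have lower: "\<exists>c. \<forall>f f'. (f, f') \<in> A \<longrightarrow> ?P f = f \<longrightarrow> nm f \<le> c * nm (f' - scl (of_real (\<sigma> * t)) f)"
        if t: "t < s \<or> 2 * s < t" for t
      proof -
        have "\<sigma> * t \<notin> (*) \<sigma> ` {s..2 * s}" using t inj by (auto simp: inj_on_def)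
        then have "complex_of_real (\<sigma> * t) \<notin> complex_of_real ` closure ?S" using cl by auto
        then have "complex_of_real (\<sigma> * t) \<in> resolvent_set scl (range ?P) H {(f, f') \<in> A. f \<in> range ?P}"
          using eb(3) unfolding spectrum_def by blast
        then obtain c where c: "\<forall>(g, f)\<in>resolvent scl {(f, f') \<in> A. f \<in> range ?P} (of_real (\<sigma> * t)). nm f \<le> c * nm g"
          unfolding resolvent_set_def by blast
        have "nm f \<le> c * nm (f' - scl (of_real (\<sigma> * t)) f)" if "(f, f') \<in> A" "?P f = f" for f f'
        proof -
          have "f \<in> range ?P" using that(2) by (metis rangeI)
          then have "(f' - scl (of_real (\<sigma> * t)) f, f) \<in> resolvent scl {(f, f') \<in> A. f \<in> range ?P} (of_real (\<sigma> * t))"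
            unfolding resolvent_def using that(1) by blast
          then show ?thesis using c by blast
        qed
        then show ?thesis by blast
      qed
      have dr: "definite_range \<sigma> ?P" by (rule def[OF _ r]) (use s in auto)
      show ?thesis by (rule spectral_block[OF proj[OF r] com[OF r] dr W s y lower])
    qed
    have sumE: "E (G {1..<2 ^ n}) x = (\<Sum>k<n. E (G {2 ^ k..<2 * 2 ^ k}) x)" for n x
    proof (induction n)
      case 0
      have "G {1..<(1::real)} = {}" by (simp add: G_def)
      then show ?case using E' by simp
    next
      case (Suc n)
      have p: "(1::real) \<le> 2 ^ n" by simp
      have "{1..<c :: real} = {1..<b} \<union> {b..<c}" if "1 \<le> b" "b \<le> c" for b c
        using that by auto
      from this[of "2 ^ n" "2 * 2 ^ n"] have u: "{1..<2 ^ Suc n} = {1..<2 ^ n} \<union> {2 ^ n..<2 * 2 ^ n :: real}"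
        by simp
      have "E (G {1..<2 ^ Suc n}) x = E (G {1..<2 ^ n}) x + E (G {2 ^ n..<2 * 2 ^ n}) x"
        unfolding u by (rule add[OF rG(2) rG(2)]) auto
      then show ?case using Suc by simp
    qed
    have sumB: "Re (B (\<Sum>k<n. g k) x) = (\<Sum>k<n. Re (B (g k) x))" for g :: "nat \<Rightarrow> 'a" and n x
      by (induction n) (simp_all add: Badd1 B01)
    have bound: "\<sigma> * Re (B (E (G {1..<2 ^ n}) f) f) \<le> 6 * M * (nm f)\<^sup>2" for n f
    proof -
      \<comment> \<open>Dividing by the constant 6 of \<open>spectral_block\<close> brings the block
        forms into the shape required by the assumption on \<open>M\<close>.\<close>
      define a where "a k = \<sigma> * Re (B (E (G {2 ^ k..<2 * 2 ^ k}) f) f) / 6" for k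
      have "(\<Sum>k<n. a k) \<le> M * (nm f)\<^sup>2"
      proof (rule M(2))
        fix k y assume "k < n" and y: "(2::real) ^ k < y" "y \<le> 2 ^ Suc k"
        have "(0::real) < 2 ^ k" by simp
        then have y0: "0 < y" using y(1) by linarith
        have "\<sigma> * Re (B (E (G {2 ^ k..<2 * 2 ^ k}) f) f) \<le> 6 * 2 ^ k * q y f"
          by (rule block) (use y y0 in simp_all)
        then show "a k \<le> 2 ^ k * q y f" by (simp add: a_def)
      qed
      moreover have "(\<Sum>k<n. a k) = \<sigma> * Re (B (E (G {1..<2 ^ n}) f) f) / 6"
        unfolding a_def sumE sumB sum_distrib_left sum_divide_distrib ..
      ultimately show ?thesis by simp
    qed
    have bound_t: "\<sigma> * Re (B (E (G {1..t}) f) f) \<le> 6 * M * (nm f)\<^sup>2" if t: "1 \<le> t" for t f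
    proof -
      obtain n where n: "t < 2 ^ n" using real_arch_pow[of 2 t] by auto
      have u: "{1..<2 ^ n} = {1..t} \<union> {t<..<2 ^ n}" using t n by auto
      have "E (G {1..<2 ^ n}) f = E (G {1..t}) f + E (G {t<..<2 ^ n}) f"
        unfolding u by (rule add[OF rG(1) rG(4)]) (use t n in auto)
      moreover have "0 \<le> \<sigma> * Re (B (E (G {t<..<2 ^ n}) f) f)"
        by (rule form0) (use rG(4)[of t "2^n"] t n in auto)
      ultimately show ?thesis using bound[of n f] by (simp add: Badd1 distrib_left)
    qed
    have incr: "E (G {1..t}) f - E (G {1..s}) f = E (G {s<..t}) f" if "1 \<le> s" "s \<le> t" for s t f
    proof -
      have u: "{1..t} = {1..s} \<union> {s<..t}" using that by auto
      have "E (G {1..t}) f = E (G {1..s}) f + E (G {s<..t}) f"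
        unfolding u by (rule add[OF rG(1) rG(3)]) (use that in auto)
      then show ?thesis by simp
    qed
    have incr0: "0 \<le> \<sigma> * Re (B (E (G {s<..t}) f) f)" if "1 \<le> s" "s \<le> t" for s t f
      by (rule form0) (use that rG(3)[of s t] in auto)
    \<comment> \<open>The form of an increment is at most \<open>6 * M * (nm x)^2\<close>;
      \<open>posop_bound\<close> makes this a norm bound independent of \<open>s\<close> and
      \<open>t\<close>, and \<open>posop_nm\<close> then bounds the squared norm by the form. The
      extra 1 makes the constant positive for \<open>monotone_convergence\<close>.\<close>
    have incr_nm: "(nm (E (G {s<..t}) f))\<^sup>2 \<le> (6 * M + 1) * (\<sigma> * Re (B (E (G {s<..t}) f) f))"
      if st: "1 \<le> s" "s \<le> t" for s t f
    proof -
      let ?Y = "\<lambda>x. scl (of_real \<sigma>) (J (E (G {s<..t}) x))"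
      have r: "G {s<..t} \<in> spectral_ring" using rG(3)[of s t] st by simp
      have ps: "posop ?Y" by (rule definite_posop[OF proj[OF r] def[OF _ r]]) (use st in auto)
      have s1: "\<bar>\<sigma>\<bar> = 1" using \<sigma> by auto
      have H_Y: "Re (H (?Y x) x) = \<sigma> * Re (B (E (G {s<..t}) x) x)" for x by (simp add: Hsimps HJ1)
      have "Re (H (?Y x) x) \<le> (6 * M) * (nm x)\<^sup>2" for x
      proof -
        have "\<sigma> * Re (B (E (G {1..t}) x) x) - \<sigma> * Re (B (E (G {1..s}) x) x) = \<sigma> * Re (B (E (G {s<..t}) x) x)"
          unfolding incr[OF st, symmetric] by (simp add: Bdiff1 right_diff_distrib)
        moreover have "0 \<le> \<sigma> * Re (B (E (G {1..s}) x) x)" by (rule form0) (use st rG(1)[of 1 s] in auto)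
        moreover have "\<sigma> * Re (B (E (G {1..t}) x) x) \<le> 6 * M * (nm x)\<^sup>2" by (rule bound_t) (use st in simp)
        ultimately show ?thesis unfolding H_Y by linarith
      qed
      then have "nm (?Y x) \<le> (6 * M) * nm x" for x using posop_bound[OF ps, of "6 * M"] M(1) by simp
      from posop_nm[OF ps this, of f]
      have "(nm (E (G {s<..t}) f))\<^sup>2 \<le> (6 * M) * (\<sigma> * Re (B (E (G {s<..t}) f) f))"
        unfolding H_Y using s1 by simp
      also have "\<dots> \<le> (6 * M + 1) * (\<sigma> * Re (B (E (G {s<..t}) f) f))"
        using incr0[OF st, of f] by (simp add: distrib_right)
      finally show ?thesis .
    qed
    show ?thesis
      unfolding G_def[symmetric]
    proof (rule monotone_convergence[of _ "6 * M + 1" "\<lambda>t. \<sigma> * Re (B (E (G {1..t}) f0) f0)" "6 * M * (nm f0)\<^sup>2"])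
      fix s t :: real assume st: "1 \<le> s" "s \<le> t"
      have d: "\<sigma> * Re (B (E (G {1..t}) f0) f0) - \<sigma> * Re (B (E (G {1..s}) f0) f0) = \<sigma> * Re (B (E (G {s<..t}) f0) f0)"
        unfolding incr[OF st, symmetric] by (simp add: Bdiff1 right_diff_distrib)
      show "(nm (E (G {1..t}) f0 - E (G {1..s}) f0))\<^sup>2
          \<le> (6 * M + 1) * (\<sigma> * Re (B (E (G {1..t}) f0) f0) - \<sigma> * Re (B (E (G {1..s}) f0) f0))"
        unfolding d incr[OF st] by (rule incr_nm[OF st])
      show "\<sigma> * Re (B (E (G {1..s}) f0) f0) \<le> \<sigma> * Re (B (E (G {1..t}) f0) f0)"
        using d incr0[OF st, of f0] by linarith
    next
      show "\<sigma> * Re (B (E (G {1..t}) f0) f0) \<le> 6 * M * (nm f0)\<^sup>2" if "1 \<le> t" for t by (rule bound_t[OF that])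
      show "0 < 6 * M + 1" using M(1) by simp
    qed
  qed
  show ?thesis
    unfolding regular_point_def option.case strong_limit_exists_def limitin_iff
  proof (rule exI[of _ "1::real"], rule exI[of _ "-1::real"], intro conjI allI)
    fix x
    have "(*) (1::real) ` {1..t} = {1..t}" for t :: real by (simp add: image_def)
    then obtain l where "((\<lambda>t. nm (E (Some ` {1..t}) x - l)) \<longlongrightarrow> 0) at_top" using main[of 1 x] by auto
    then show "\<exists>l. l \<in> UNIV \<and> (\<forall>\<^sub>F t in at_top. E (Some ` {1..t}) x \<in> UNIV) \<and>
        ((\<lambda>t. nm (E (Some ` {1..t}) x - l)) \<longlongrightarrow> 0) at_top" by auto
    have "(*) (- 1 :: real) = uminus" by (simp add: fun_eq_iff)
    then have "(*) (- 1 :: real) ` {1..t} = {- t..- 1}" for t :: real by simp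
    then obtain l where "((\<lambda>t. nm (E (Some ` {- t..- 1}) x - l)) \<longlongrightarrow> 0) at_top" using main[of "-1" x] by auto
    then have "((\<lambda>t. nm (E (Some ` {t..- 1}) x - l)) \<longlongrightarrow> 0) at_bot" unfolding filterlim_at_bot_mirror .
    then show "\<exists>l. l \<in> UNIV \<and> (\<forall>\<^sub>F t in at_bot. E (Some ` {t..- 1}) x \<in> UNIV) \<and>
        ((\<lambda>t. nm (E (Some ` {t..- 1}) x - l)) \<longlongrightarrow> 0) at_bot" by auto
  qed simp_all
qed

end

section \<open>A commuting pair of operators and its spectral projections\<close>

text \<open>On the spectral side \<open>tt\<close> and \<open>ct\<close> are \<open>\<lambda> / (1 + \<lambda>\<^sup>2)\<close> and \<open>1 / (1 + \<lambda>\<^sup>2)\<close>, so the sign of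
  \<open>tt - a ct\<close> is the sign of \<open>\<lambda> - a\<close>.\<close>

locale pencil = hilbU scl H for scl :: "complex \<Rightarrow> 'a::ab_group_add \<Rightarrow> 'a" and H +
  fixes tt ct :: "'a \<Rightarrow> 'a"
  assumes sa_tt: "saop tt" and sa_ct: "saop ct" and tt_ct: "tt (ct h) = ct (tt h)"
    and tt_tt: "tt (tt h) = ct h - ct (ct h)"
begin

lemma bo_tt: "bop tt" and bo_ct: "bop ct"
  using sa_tt sa_ct saop_bop by blast+

text \<open>Membership in the double commutant of \<open>tt\<close> and \<open>ct\<close>. Such
  operators commute with each other, and what they yield in the Krein space commutes with everything
  that commutes with the resolvent.\<close>

definition bic :: "('a \<Rightarrow> 'a) \<Rightarrow> bool" where
  "bic Y \<longleftrightarrow> bop Y \<and> (\<forall>X. bop X \<longrightarrow> comm X tt \<longrightarrow> comm X ct \<longrightarrow> comm X Y)"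

lemma bic_bop: "bic Y \<Longrightarrow> bop Y"
  by (simp add: bic_def)

lemma bic_D: "bic Y \<Longrightarrow> bop X \<Longrightarrow> comm X tt \<Longrightarrow> comm X ct \<Longrightarrow> X (Y h) = Y (X h)"
  by (simp add: bic_def comm_def)

lemma bic_tt: "bic tt" and bic_ct: "bic ct"
  by (simp_all add: bic_def bo_tt bo_ct)

lemma bic_comm_gen: "bic Y \<Longrightarrow> comm Y tt \<and> comm Y ct"
proof -
  assume Y: "bic Y"
  have "comm tt tt" "comm tt ct" "comm ct tt" "comm ct ct" by (simp_all add: comm_def tt_ct)
  then show ?thesis using Y bo_tt bo_ct comm_sym unfolding bic_def by blast
qed

lemma bic_comm: "bic X \<Longrightarrow> bic Y \<Longrightarrow> X (Y h) = Y (X h)"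
  using bic_D[of Y X h] bic_bop[of X] bic_comm_gen[of X] by blast

lemma bic_id: "bic (\<lambda>h. h)"
  by (simp add: bic_def bop_id comm_def)

lemma bic_sum: "bic X \<Longrightarrow> bic Y \<Longrightarrow> bic (\<lambda>h. X h + Y h)"
  and bic_minus: "bic X \<Longrightarrow> bic Y \<Longrightarrow> bic (\<lambda>h. X h - Y h)"
  and bic_scale: "bic X \<Longrightarrow> bic (\<lambda>h. scl c (X h))"
  by (auto simp: bic_def intro: bops comms)

lemma bic_comp: "bic X \<Longrightarrow> bic Y \<Longrightarrow> bic (\<lambda>h. X (Y h))"
  by (auto simp: bic_def comm_def intro: bop_comp)

lemma bic_saop_comp: "bic X \<Longrightarrow> bic Y \<Longrightarrow> saop X \<Longrightarrow> saop Y \<Longrightarrow> saop (\<lambda>h. X (Y h))"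
  by (rule saop_comp) (simp_all add: comm_def bic_comm)

lemma ct_form: "Re (H (ct h) h) = (nm (ct h))\<^sup>2 + (nm (tt h))\<^sup>2"
proof -
  have "ct h = tt (tt h) + ct (ct h)" by (simp add: tt_tt)
  then have "H (ct h) h = H (tt (tt h)) h + H (ct (ct h)) h" by (metis Hadd1 UNIV_I)
  then have "H (ct h) h = H (tt h) (tt h) + H (ct h) (ct h)" by (simp add: saopH[OF sa_tt] saopH[OF sa_ct])
  then show ?thesis by (simp add: Hself)
qed

lemma posop_ct: "posop ct"
  unfolding posop_def using sa_ct ct_form by simp

lemma ct_ker: "ct h = 0 \<Longrightarrow> tt h = 0"
  using ct_form[of h] nm_eq_0[of "tt h"] by (simp add: H01)

lemma ct_le1: "nm (ct h) \<le> nm h"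
proof -
  have "(nm (ct h))\<^sup>2 \<le> nm (ct h) * nm h"
    using ct_form[of h] ReH_le[of "ct h" h] zero_le_power2[of "nm (tt h)"] by (smt (verit) UNIV_I)
  then show ?thesis
    using nm_pos[of "ct h"] by (cases "nm (ct h) = 0") (auto simp: power2_eq_square)
qed

section \<open>Sign projections of the pencil\<close>

definition "Cl s h = tt h - scl (complex_of_real s) (ct h)"

lemma bic_Cl: "bic (Cl s)" and saop_Cl: "saop (Cl s)"
proof -
  have e: "Cl s = (\<lambda>h. tt h - scl (complex_of_real s) (ct h))" by (simp add: Cl_def fun_eq_iff)
  show "bic (Cl s)" unfolding e by (intro bic_minus bic_scale bic_tt bic_ct)
  show "saop (Cl s)" unfolding e by (intro saop_minus saop_scale sa_tt sa_ct)
qed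

lemma Cl_shift: "Re (H (Cl s h) h) = Re (H (Cl r h) h) - (s - r) * Re (H (ct h) h)"
  by (simp add: Cl_def Hsimps algebra_simps)

text \<open>The projection of the spectral values up to \<open>s\<close> together with the kernel of
  \<open>ct\<close>, the spectral value \<infinity>. The latter cancels in the differences
  \<open>QQ\<close>.\<close>

definition "Q s = (SOME Q. saop Q \<and> (\<forall>x. Q (Q x) = Q x) \<and> (\<forall>Y. bop Y \<longrightarrow> comm Y (Cl s) \<longrightarrow> comm Y Q) \<and>
    (\<forall>x. Re (H (Cl s (Q x)) (Q x)) \<le> 0) \<and> (\<forall>x. 0 \<le> Re (H (Cl s (x - Q x)) (x - Q x))) \<and>
    (\<forall>x. Re (H (Cl s (x - Q x)) (x - Q x)) \<le> 0 \<longrightarrow> Q x = x))"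

lemma
  shows saop_Q: "saop (Q s)" and Q_idem: "Q s (Q s x) = Q s x"
    and Q_comm: "bop Y \<Longrightarrow> comm Y (Cl s) \<Longrightarrow> comm Y (Q s)"
    and Q_le: "Re (H (Cl s (Q s x)) (Q s x)) \<le> 0" and Q_ge: "0 \<le> Re (H (Cl s (x - Q s x)) (x - Q s x))"
    and Q_strict: "Re (H (Cl s (x - Q s x)) (x - Q s x)) \<le> 0 \<Longrightarrow> Q s x = x"
proof -
  obtain Q' where "saop Q'" "\<And>x. Q' (Q' x) = Q' x" "\<And>Y. bop Y \<Longrightarrow> comm Y (Cl s) \<Longrightarrow> comm Y Q'"
    "\<And>x. Re (H (Cl s (Q' x)) (Q' x)) \<le> 0" "\<And>x. 0 \<le> Re (H (Cl s (x - Q' x)) (x - Q' x))"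
    "\<And>x. Re (H (Cl s (x - Q' x)) (x - Q' x)) \<le> 0 \<Longrightarrow> Q' x = x"
    using spectral_projection[OF saop_Cl] by metis
  then have ex: "\<exists>Q. saop Q \<and> (\<forall>x. Q (Q x) = Q x) \<and> (\<forall>Y. bop Y \<longrightarrow> comm Y (Cl s) \<longrightarrow> comm Y Q) \<and>
    (\<forall>x. Re (H (Cl s (Q x)) (Q x)) \<le> 0) \<and> (\<forall>x. 0 \<le> Re (H (Cl s (x - Q x)) (x - Q x))) \<and>
    (\<forall>x. Re (H (Cl s (x - Q x)) (x - Q x)) \<le> 0 \<longrightarrow> Q x = x)" by (intro exI[of _ Q']) simp
  note q = someI_ex[OF ex, folded Q_def]
  show "saop (Q s)" "Q s (Q s x) = Q s x" "bop Y \<Longrightarrow> comm Y (Cl s) \<Longrightarrow> comm Y (Q s)"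
    "Re (H (Cl s (Q s x)) (Q s x)) \<le> 0" "0 \<le> Re (H (Cl s (x - Q s x)) (x - Q s x))"
    "Re (H (Cl s (x - Q s x)) (x - Q s x)) \<le> 0 \<Longrightarrow> Q s x = x"
    using q by simp_all
qed

lemma bo_Q: "bop (Q s)"
  by (rule saop_bop[OF saop_Q])

lemma bic_Q: "bic (Q s)"
  unfolding bic_def
proof (intro conjI allI impI bo_Q)
  fix X assume X: "bop X" "comm X tt" "comm X ct"
  have "comm X (Cl s)" using X unfolding comm_def Cl_def by (simp add: bop_lin)
  then show "comm X (Q s)" using Q_comm X(1) by blast
qed

lemma Q_ker: "ct h = 0 \<Longrightarrow> Q s h = h"
proof (rule Q_strict)
  assume h: "ct h = 0"
  have "ct (h - Q s h) = 0" "tt (h - Q s h) = 0"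
    using h ct_ker[OF h] bic_comm[OF bic_ct bic_Q, of s h] bic_comm[OF bic_tt bic_Q, of s h]
    by (simp_all add: bop_lin[OF bo_ct] bop_lin[OF bo_tt] bop_0[OF bo_Q])
  then show "Re (H (Cl s (h - Q s h)) (h - Q s h)) \<le> 0" by (simp add: Cl_def H01)
qed

text \<open>As \<open>ct\<close> is positive, \<open>Cl b\<close> lies below \<open>Cl a\<close>, so
  \<open>Cl b\<close> is nonpositive on the range of \<open>Q a\<close>; the strictness clause
  \<open>Q_strict\<close> then gives the nesting.\<close>

lemma Q_mono: assumes "a \<le> b" shows "Q b (Q a h) = Q a h"
proof (rule Q_strict)
  let ?k = "Q a h - Q b (Q a h)"
  have k: "Q a ?k = ?k" using bic_comm[OF bic_Q bic_Q, of a b "Q a h"] by (simp add: bop_lin[OF bo_Q] Q_idem)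
  have "Re (H (Cl b ?k) ?k) = Re (H (Cl a ?k) ?k) - (b - a) * Re (H (ct ?k) ?k)" by (rule Cl_shift)
  also have "\<dots> \<le> 0" using Q_le[of a ?k] posop_ge[OF posop_ct, of ?k] assms
    unfolding k by (smt (verit) mult_nonneg_nonneg)
  finally show "Re (H (Cl b ?k) ?k) \<le> 0" .
qed

lemma Q_Q: "Q a (Q b h) = Q (min a b) h"
  using Q_mono[of a b h] Q_mono[of b a h] bic_comm[OF bic_Q bic_Q, of a b h]
  by (cases "a \<le> b") (simp_all add: min_def)

text \<open>The last condition excludes the spectral value \<infinity>.\<close>

definition bproj :: "('a \<Rightarrow> 'a) \<Rightarrow> bool" where
  "bproj U \<longleftrightarrow> bic U \<and> saop U \<and> (\<forall>h. U (U h) = U h) \<and> (\<forall>h. ct h = 0 \<longrightarrow> U h = 0)"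

lemma bprojD:
  assumes "bproj U"
  shows "bic U" "saop U" "U (U h) = U h" "ct h = 0 \<Longrightarrow> U h = 0" "bop U"
  using assms bic_bop unfolding bproj_def by blast+

lemma bproj_diff: assumes U: "bproj U" and W: "bic W" "saop W" "\<And>h. W (W h) = W h"
  shows "bproj (\<lambda>h. U (h - W h))"
  unfolding bproj_def
proof (intro conjI allI impI)
  show "bic (\<lambda>h. U (h - W h))" by (rule bic_comp[OF bprojD(1)[OF U] bic_minus[OF bic_id W(1)]])
  show "saop (\<lambda>h. U (h - W h))"
    by (rule bic_saop_comp[OF bprojD(1)[OF U] bic_minus[OF bic_id W(1)] bprojD(2)[OF U] saop_minus[OF saop_id W(2)]])
  show "U (U (h - W h) - W (U (h - W h))) = U (h - W h)" for h
    using bic_comm[OF W(1) bprojD(1)[OF U]] W(3)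
    by (simp add: bop_lin[OF bprojD(5)[OF U]] bop_lin[OF bic_bop[OF W(1)]] bprojD(3)[OF U])
  show "U (h - W h) = 0" if "ct h = 0" for h
    using bprojD(4)[OF U that] bic_comm[OF bprojD(1)[OF U] W(1), of h]
    by (simp add: bop_lin[OF bprojD(5)[OF U]] bop_0[OF bic_bop[OF W(1)]])
qed

definition "QQ a b h = Q b h - Q a h"

lemma bproj_QQ: assumes "a \<le> b" shows "bproj (QQ a b)"
proof -
  have e: "QQ a b = (\<lambda>h. Q b h - Q a h)" by (simp add: QQ_def fun_eq_iff)
  show ?thesis
    unfolding bproj_def
  proof (intro conjI allI impI)
    show "bic (QQ a b)" "saop (QQ a b)" unfolding e by (rule bic_minus[OF bic_Q bic_Q] saop_minus[OF saop_Q saop_Q])+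
    show "QQ a b (QQ a b h) = QQ a b h" for h
      unfolding QQ_def using assms by (simp add: bop_lin[OF bo_Q] Q_Q min_def)
    show "QQ a b h = 0" if "ct h = 0" for h unfolding QQ_def using Q_ker[OF that] by simp
  qed
qed

lemma QQ_QQ: assumes "a \<le> b" "c \<le> d"
  shows "QQ a b (QQ c d h) = (if max a c \<le> min b d then QQ (max a c) (min b d) h else 0)"
  unfolding QQ_def using assms by (auto simp: bop_lin[OF bo_Q] Q_Q min_def max_def)

lemma QQ_range:
  assumes "a \<le> b" and k: "QQ a b k = k"
  shows "Re (H (Cl b k) k) \<le> 0" "0 \<le> Re (H (Cl a k) k)"
proof -
  have "Q b (QQ a b k) = QQ a b k" using assms(1) by (simp add: QQ_def bop_lin[OF bo_Q] Q_Q min_def)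
  then have "Q b k = k" using k by simp
  then show "Re (H (Cl b k) k) \<le> 0" using Q_le[of b k] by simp
  have "Q a k = 0"
  proof -
    have "Q a (Q b k - Q a k) = 0" using assms(1) by (simp add: bop_lin[OF bo_Q] Q_Q min_def)
    then show ?thesis using k unfolding QQ_def by simp
  qed
  then show "0 \<le> Re (H (Cl a k) k)" using Q_ge[of a k] by simp
qed

text \<open>On the spectral side this is \<open>1 / (1 + \<lambda>^2) \<ge> d\<close>: the range of
  \<open>U\<close> involves only a bounded set of \<lambda>.\<close>

definition low :: "real \<Rightarrow> ('a \<Rightarrow> 'a) \<Rightarrow> bool" where
  "low d U \<longleftrightarrow> d > 0 \<and> (\<forall>h. d * (nm (U h))\<^sup>2 \<le> Re (H (ct (U h)) (U h)))"

lemma bproj_orth: assumes U: "saop U" "\<And>h. U (U h) = U h" and c: "X (U h) = U (X h)" shows "H (X (U h)) (k - U k) = 0"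
proof -
  have "H (X (U h)) (k - U k) = H (U (X h)) (k - U k)" by (simp add: c)
  also have "\<dots> = H (X h) (U (k - U k))" by (rule saopH[OF U(1)])
  finally show ?thesis by (simp add: bop_lin[OF saop_bop[OF U(1)]] U(2) H02)
qed

lemma split_sum:
  assumes U: "saop U" "\<And>h. U (U h) = U h"
  shows "(nm h)\<^sup>2 = (nm (U h))\<^sup>2 + (nm (h - U h))\<^sup>2"
proof -
  have "H (U h) (h - U h) = 0" using bproj_orth[OF U, of "\<lambda>x. x"] by simp
  then have "(nm (U h + (h - U h)))\<^sup>2 = (nm (U h))\<^sup>2 + (nm (h - U h))\<^sup>2"
    using nm_add_sq[of "U h" "h - U h"] by simp
  then show ?thesis by simp
qed

text \<open>If \<open>X\<close> is positive on one half of an orthogonal splitting and negative on the other, it is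
  bounded below.\<close>

lemma sign_split_lower:
  assumes U: "saop U" "\<And>h. U (U h) = U h" and X: "saop X" "X (U k) = U (X k)"
    and neg: "Re (H (X (U k)) (U k)) \<le> - e * (nm (U k))\<^sup>2"
    and pos: "e * (nm (k - U k))\<^sup>2 \<le> Re (H (X (k - U k)) (k - U k))"
  shows "e * nm k \<le> nm (X k)"
proof (cases "nm k = 0")
  case False
  let ?u = "U k" and ?v = "k - U k"
  have bo: "bop X" "bop U" using U X saop_bop by blast+
  have o1: "H (X ?u) ?v = 0" by (rule bproj_orth[where X=X, OF U X(2)])
  have o2: "H (X ?v) ?u = 0" using o1 saopH[OF X(1), of ?v ?u] Hcnj[of "X ?u" ?v] by simp
  have "X k = X ?u + X ?v" by (simp add: bop_lin[OF bo(1)])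
  moreover have "H (a + b) (v - u) = H a v - H a u + (H b v - H b u)" for a b v u
    by (simp add: Hsimps)
  ultimately have "H (X k) (?v - ?u) = H (X ?u) ?v - H (X ?u) ?u + (H (X ?v) ?v - H (X ?v) ?u)" by metis
  then have "Re (H (X k) (?v - ?u)) = Re (H (X ?v) ?v) - Re (H (X ?u) ?u)" using o1 o2 by simp
  then have "e * (nm k)\<^sup>2 \<le> Re (H (X k) (?v - ?u))"
    using neg pos unfolding split_sum[OF U, of k] by (simp add: distrib_left)
  also have "\<dots> \<le> nm (X k) * nm (?v - ?u)" by (rule ReH_le) auto
  also have "nm (?v - ?u) = nm k"
  proof -
    have "H ?v ?u = 0" using bproj_orth[OF U, of "\<lambda>x. x" k k] Hcnj[of ?u ?v] by simp
    then have "(nm (?v - ?u))\<^sup>2 = (nm k)\<^sup>2" using nm_diff_sq[of ?v ?u] split_sum[OF U, of k] by simp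
    then show ?thesis by (simp add: power2_eq_iff_nonneg)
  qed
  finally show ?thesis using nm_pos[of k] False by (simp add: power2_eq_square)
qed simp

text \<open>As \<open>U\<close> misses the cell from \<open>s1\<close> to \<open>s2\<close>, its
  range is split by \<open>Q s1\<close> into a part with \<open>Cl s \<le> - (s - s1) ct\<close> and
  a part with \<open>Cl s \<ge> (s2 - s) ct\<close>; there \<open>low\<close> bounds
  \<open>ct\<close> from below.\<close>

lemma pencil_lower:
  assumes U: "bproj U" and d: "low d U" and s: "s1 < s" "s < s2" and Z: "\<And>h. U (QQ s1 s2 h) = 0"
  shows "\<exists>c>0. \<forall>h. c * nm (U h) \<le> nm (Cl s (U h))"
proof -
  define e where "e = min (s - s1) (s2 - s) * d"
  have d0: "d > 0" and dl: "\<And>h. d * (nm (U h))\<^sup>2 \<le> Re (H (ct (U h)) (U h))" using d unfolding low_def by blast+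
  have e0: "e > 0" using s d0 by (simp add: e_def)
  have "e * nm (U h) \<le> nm (Cl s (U h))" for h
  proof -
    define k where "k = U h"
    have Uk: "U k = k" by (simp add: k_def bprojD(3)[OF U])
    have "QQ s1 s2 k = 0"
      using Z[of h] bic_comm[OF bprojD(1)[OF U] bprojD(1)[OF bproj_QQ], of s1 s2 h] s by (simp add: k_def)
    then have qq: "Q s2 k = Q s1 k" by (simp add: QQ_def)
    have UQ: "U (Q r k) = Q r k" for r using bic_comm[OF bprojD(1)[OF U] bic_Q, of r k] Uk by simp
    have Uv: "U (k - Q r k) = k - Q r k" for r using UQ[of r] Uk by (simp add: bop_lin[OF bprojD(5)[OF U]])
    have cl: "d * (nm v)\<^sup>2 \<le> Re (H (ct v) v)" if "U v = v" for v using dl[of v] that by simp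
    show ?thesis
      unfolding k_def[symmetric]
    proof (rule sign_split_lower[OF saop_Q[of s1] Q_idem saop_Cl bic_comm[OF bic_Cl bic_Q]])
      have "Re (H (Cl s (Q s1 k)) (Q s1 k)) = Re (H (Cl s1 (Q s1 k)) (Q s1 k)) - (s - s1) * Re (H (ct (Q s1 k)) (Q s1 k))"
        by (rule Cl_shift)
      also have "\<dots> \<le> 0 - e * (nm (Q s1 k))\<^sup>2"
      proof (rule diff_mono[OF Q_le])
        have "e * (nm (Q s1 k))\<^sup>2 \<le> (s - s1) * d * (nm (Q s1 k))\<^sup>2"
          unfolding e_def using d0 by (intro mult_right_mono) auto
        also have "\<dots> \<le> (s - s1) * Re (H (ct (Q s1 k)) (Q s1 k))"
          using cl[OF UQ[of s1]] s by (simp add: mult.assoc mult_left_mono)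
        finally show "e * (nm (Q s1 k))\<^sup>2 \<le> (s - s1) * Re (H (ct (Q s1 k)) (Q s1 k))" .
      qed
      finally show "Re (H (Cl s (Q s1 k)) (Q s1 k)) \<le> - e * (nm (Q s1 k))\<^sup>2" by simp
      let ?v = "k - Q s1 k"
      have v: "?v = k - Q s2 k" by (simp add: qq)
      have "e * (nm ?v)\<^sup>2 \<le> (s2 - s) * d * (nm ?v)\<^sup>2"
        unfolding e_def using d0 by (intro mult_right_mono) auto
      also have "\<dots> \<le> (s2 - s) * Re (H (ct ?v) ?v)"
        using cl[OF Uv[of s1]] s by (simp add: mult.assoc mult_left_mono)
      also have "\<dots> \<le> Re (H (Cl s2 ?v) ?v) + (s2 - s) * Re (H (ct ?v) ?v)" using Q_ge[of s2 k] v by simp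
      also have "\<dots> = Re (H (Cl s ?v) ?v)" using Cl_shift[of s ?v s2] by (simp add: algebra_simps)
      finally show "e * (nm ?v)\<^sup>2 \<le> Re (H (Cl s ?v) ?v)" .
    qed
  qed
  then show ?thesis using e0 by blast
qed

text \<open>Completing \<open>X\<close> by the identity off the range of \<open>U\<close> gives an
  operator that is bounded below on the whole space.\<close>

lemma inverse_on:
  assumes U: "bproj U" and X: "bic X" "saop X" and c: "c > 0" "\<And>h. c * nm (U h) \<le> nm (X (U h))"
  obtains V where "bic V" "saop V" "\<And>h. X (V h) = U h" "\<And>h. U (V h) = V h"
proof -
  note Ud = bprojD[OF U]
  define M where "M = (\<lambda>h. X (U h) + (h - U h))"
  have bicM: "bic M" unfolding M_def by (rule bic_sum[OF bic_comp[OF X(1) Ud(1)] bic_minus[OF bic_id Ud(1)]])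
  have saM: "saop M" unfolding M_def
    by (rule saop_sum[OF bic_saop_comp[OF X(1) Ud(1) X(2) Ud(2)] saop_minus[OF saop_id Ud(2)]])
  define e where "e = min c 1"
  have e0: "e > 0" using c(1) by (simp add: e_def)
  have UX: "X (U h) = U (X h)" for h by (rule bic_comm[OF X(1) Ud(1)])
  have lower: "e * nm h \<le> nm (M h)" for h
  proof (rule power2_le_imp_le)
    have "U (M h) = X (U h)" unfolding M_def by (simp add: bop_lin[OF Ud(5)] UX Ud(3))
    then have "(nm (M h))\<^sup>2 = (nm (X (U h)))\<^sup>2 + (nm (h - U h))\<^sup>2"
      using split_sum[OF Ud(2,3), of "M h"] by (simp add: M_def)
    moreover have "(e * nm (U h))\<^sup>2 \<le> (nm (X (U h)))\<^sup>2"
    proof (intro power_mono)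
      have "e * nm (U h) \<le> c * nm (U h)" unfolding e_def by (intro mult_right_mono) auto
      then show "e * nm (U h) \<le> nm (X (U h))" using c(2)[of h] by linarith
    qed (use e0 in simp)
    moreover have "(e * nm (h - U h))\<^sup>2 \<le> (1 * nm (h - U h))\<^sup>2"
      using e0 by (intro power_mono mult_right_mono) (auto simp: e_def)
    ultimately show "(e * nm h)\<^sup>2 \<le> (nm (M h))\<^sup>2"
      unfolding power_mult_distrib split_sum[OF Ud(2,3), of h] by (simp add: distrib_left)
  qed simp
  obtain I where I: "saop I" "\<And>x. M (I x) = x" "\<And>x. I (M x) = x" "\<And>Y. comm Y M \<Longrightarrow> comm Y I"
    using inverse_exists[OF saM e0 lower] by metis
  have bicI: "bic I"
    unfolding bic_def using saop_bop[OF I(1)] bicM I(4) unfolding bic_def by blast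
  define V where "V = (\<lambda>h. I (U h))"
  have UV: "U (V h) = V h" for h unfolding V_def using bic_comm[OF Ud(1) bicI, of "U h"] by (simp add: Ud(3))
  have "X (V h) = U h" for h
  proof -
    have "M (V h) = U h" by (simp add: V_def I(2))
    then show ?thesis unfolding M_def UV by simp
  qed
  then show thesis
    using that[of V] UV bic_comp[OF bicI Ud(1)] bic_saop_comp[OF bicI Ud(1) I(1) Ud(2)] unfolding V_def by blast
qed

lemma posop_on_range:
  assumes U: "bproj U" and X: "bic X" "saop X" "\<And>k. U k = k \<Longrightarrow> 0 \<le> Re (H (X k) k)"
  shows "posop (\<lambda>h. X (U h))"
  unfolding posop_def
proof (intro conjI allI)
  show "saop (\<lambda>h. X (U h))" by (rule bic_saop_comp[OF X(1) bprojD(1)[OF U] X(2) bprojD(2)[OF U]])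
  fix h
  have "H (X (U h)) h = H (X (U h)) (U h)"
    using bic_comm[OF X(1) bprojD(1)[OF U], of "U h"] saopH[OF bprojD(2)[OF U], of "X (U h)" h]
    by (simp add: bprojD(3)[OF U])
  then show "0 \<le> Re (H (X (U h)) h)" using X(3)[of "U h"] by (simp add: bprojD(3)[OF U])
qed

text \<open>The factors are positive on the range of \<open>U\<close> only; cutting both by
  \<open>U\<close> reduces the product to \<open>posop_comp\<close>.\<close>

lemma posop_pair:
  assumes U: "bproj U" and X: "bic X" "saop X" "\<And>k. U k = k \<Longrightarrow> 0 \<le> Re (H (X k) k)"
    and Y: "bic Y" "saop Y" "\<And>k. U k = k \<Longrightarrow> 0 \<le> Re (H (Y k) k)" and k: "U k = k"
  shows "0 \<le> Re (H (X (Y k)) k)"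
proof -
  have "posop (\<lambda>h. (\<lambda>h. X (U h)) ((\<lambda>h. Y (U h)) h))"
  proof (rule posop_comp[OF posop_on_range[OF U X] posop_on_range[OF U Y]])
    show "comm (\<lambda>h. X (U h)) (\<lambda>h. Y (U h))"
      unfolding comm_def using bic_comm[OF bic_comp[OF X(1) bprojD(1)[OF U]] bic_comp[OF Y(1) bprojD(1)[OF U]]] by blast
  qed
  from posop_ge[OF this, of k] show ?thesis
    using bic_comm[OF Y(1) bprojD(1)[OF U], of k] k by simp
qed

text \<open>On the range of \<open>QQ a b\<close> one has \<open>|tt| \<le> c ct\<close>, hence \<open>ct - ct\<^sup>2 = tt\<^sup>2 \<le> c\<^sup>2 ct\<^sup>2\<close>; as \<open>ct\<close> is
  injective there, \<open>ct \<ge> 1 / (1 + c\<^sup>2)\<close>.\<close>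

lemma ct_lower:
  assumes ab: "a \<le> b" and c: "- c \<le> a" "b \<le> c" shows "low (1 / (1 + c\<^sup>2)) (QQ a b)"
proof -
  define d where "d = 1 / (1 + c\<^sup>2)"
  have d0: "d > 0" by (simp add: d_def add_pos_nonneg)
  have U: "bproj (QQ a b)" by (rule bproj_QQ[OF ab])
  note Ud = bprojD[OF U]
  have bicX: "bic (Cl s)" "saop (Cl s)" for s by (rule bic_Cl saop_Cl)+
  define X where "X = (\<lambda>h. scl (of_real (-1)) (Cl c h))"
  have X: "bic X" "saop X" unfolding X_def by (rule bic_scale[OF bic_Cl] saop_scale[OF saop_Cl])+
  have Xp: "0 \<le> Re (H (X k) k)" if k: "QQ a b k = k" for k
  proof -
    have "Re (H (Cl c k) k) = Re (H (Cl b k) k) - (c - b) * Re (H (ct k) k)" by (rule Cl_shift)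
    also have "\<dots> \<le> 0" using QQ_range(1)[OF ab k] posop_ge[OF posop_ct, of k] c(2) by (smt (verit) mult_nonneg_nonneg)
    finally show ?thesis by (simp add: X_def Hsimps)
  qed
  have Yp: "0 \<le> Re (H (Cl (- c) k) k)" if k: "QQ a b k = k" for k
  proof -
    have "Re (H (Cl (-c) k) k) = Re (H (Cl a k) k) + (a + c) * Re (H (ct k) k)"
      using Cl_shift[of "-c" k a] by (simp add: algebra_simps)
    then show ?thesis using QQ_range(2)[OF ab k] posop_ge[OF posop_ct, of k] c(1) by simp
  qed
  have key: "(nm (ct k))\<^sup>2 \<ge> d * Re (H (ct k) k)" if k: "QQ a b k = k" for k
  proof -
    have "0 \<le> Re (H (X (Cl (- c) k)) k)" by (rule posop_pair[OF U X Xp bicX Yp k])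
    also have "X (Cl (- c) k) = scl (of_real (c\<^sup>2)) (ct (ct k)) - tt (tt k)"
      unfolding X_def Cl_def
      by (simp add: bop_lin[OF bo_tt] bop_lin[OF bo_ct] tt_ct scale_right_diff_distrib scale_right_distrib power2_eq_square)
    also have "Re (H \<dots> k) = c\<^sup>2 * (nm (ct k))\<^sup>2 - (nm (tt k))\<^sup>2"
      by (simp add: Hsimps saopH[OF sa_ct, of "ct k" k] saopH[OF sa_tt, of "tt k" k] Hself)
    finally have "(nm (tt k))\<^sup>2 \<le> c\<^sup>2 * (nm (ct k))\<^sup>2" by simp
    then have "Re (H (ct k) k) \<le> (1 + c\<^sup>2) * (nm (ct k))\<^sup>2" unfolding ct_form by (simp add: distrib_right)
    then have "d * Re (H (ct k) k) \<le> d * ((1 + c\<^sup>2) * (nm (ct k))\<^sup>2)" using d0 by (simp add: mult_left_mono)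
    moreover have "d * (1 + c\<^sup>2) = 1"
    proof -
      have "1 + c\<^sup>2 \<noteq> 0" using zero_le_power2[of c] by linarith
      then show ?thesis unfolding d_def by simp
    qed
    ultimately show ?thesis by (simp add: mult.assoc[symmetric])
  qed
  define C where "C = (\<lambda>h. ct h - scl (of_real d) h)"
  have C: "bic C" "saop C" unfolding C_def by (rule bic_minus[OF bic_ct bic_scale[OF bic_id]] saop_minus[OF sa_ct saop_scale[OF saop_id]]
      bic_minus[OF bic_scale[OF bic_id] bic_ct] saop_minus[OF saop_scale[OF saop_id] sa_ct])+
  define N where "N = (\<lambda>h. scl (of_real (-1)) (C h))"
  have N: "bic N" "saop N" unfolding N_def by (rule bic_scale[OF C(1)] saop_scale[OF C(2)])+
  \<comment> \<open>\<open>P\<close> singles out the part with \<open>ct \<le> d\<close>. On its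
    intersection \<open>u\<close> with the range of \<open>QQ a b\<close>, \<open>key\<close> turns
    this into an equality of forms, so \<open>ct\<close> annihilates \<open>C u\<close>, and
    injectivity gives \<open>ct u = d u\<close>.\<close>
  obtain P where P: "saop P" "\<And>x. P (P x) = P x" "\<And>Y. bop Y \<Longrightarrow> comm Y C \<Longrightarrow> comm Y P"
    "\<And>x. Re (H (C (P x)) (P x)) \<le> 0" "\<And>x. 0 \<le> Re (H (C (x - P x)) (x - P x))"
    using spectral_projection[OF C(2)] by metis
  have bicP: "bic P" unfolding bic_def using P(3) C(1) saop_bop[OF P(1)] unfolding bic_def by blast
  have "d * (nm (QQ a b h))\<^sup>2 \<le> Re (H (ct (QQ a b h)) (QQ a b h))" for h
  proof -
    define k where "k = QQ a b h"
    have k: "QQ a b k = k" by (simp add: k_def Ud(3))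
    define u v where "u = P k" and "v = k - P k"
    have Uu: "QQ a b u = u" using bic_comm[OF Ud(1) bicP, of k] k by (simp add: u_def)
    have Pu: "P u = u" by (simp add: u_def P(2))
    have "Re (H (C u) u) \<le> 0" using P(4)[of k] by (simp add: u_def)
    define U2 where "U2 = (\<lambda>h. QQ a b (P h))"
    have U2: "bproj U2"
      unfolding bproj_def U2_def
      using Ud bic_comm[OF bicP Ud(1)] bicP P(1,2)
      by (auto intro: bic_comp bic_saop_comp simp: bop_0[OF Ud(5)])
        (metis bic_comm[OF bicP Ud(1)] bop_0 bic_bop bicP)
    have Cneg: "0 \<le> Re (H (N w) w)" if "U2 w = w" for w
    proof -
      have "P w = w" using that bic_comm[OF bicP Ud(1)] P(2) unfolding U2_def by metis
      then show ?thesis using P(4)[of w] by (simp add: N_def Hsimps)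
    qed
    have U2u: "U2 u = u" by (simp add: U2_def Pu Uu)
    have ctN: "ct (N u) = scl (of_real d) (ct u) - ct (ct u)"
      by (simp add: N_def C_def bop_lin[OF bo_ct])
    have "0 \<le> Re (H (ct (N u)) u)"
      by (rule posop_pair[OF U2 bic_ct sa_ct posop_ge[OF posop_ct] N Cneg U2u])
    then have "(nm (ct u))\<^sup>2 \<le> d * Re (H (ct u) u)"
      unfolding ctN by (simp add: Hsimps saopH[OF sa_ct, of "ct u" u] Hself)
    then have eq: "(nm (ct u))\<^sup>2 = d * Re (H (ct u) u)" using key[OF Uu] by simp
    define Z where "Z = (\<lambda>h. ct (N (U2 h)))"
    have "posop (\<lambda>h. ct ((\<lambda>h. N (U2 h)) h))"
    proof (rule posop_comp[OF posop_ct posop_on_range[OF U2 N Cneg]])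
      show "comm ct (\<lambda>h. N (U2 h))"
        unfolding comm_def using bic_comm[OF bic_ct bic_comp[OF N(1) bprojD(1)[OF U2]]] by blast
    qed
    then have "posop Z" by (simp add: Z_def)
    moreover have "Re (H (Z u) u) \<le> 0"
      unfolding Z_def U2u ctN using eq by (simp add: Hsimps saopH[OF sa_ct, of "ct u" u] Hself)
    ultimately have "Z u = 0" by (rule posop_eq0)
    then have "ct (C u) = 0" by (simp add: Z_def U2u N_def bop_lin[OF bo_ct])
    moreover have "QQ a b (C u) = C u" using bic_comm[OF Ud(1) C(1), of u] Uu by simp
    ultimately have "C u = 0" using Ud(4)[of "C u"] by simp
    then have cu: "ct u = scl (of_real d) u" by (simp add: C_def)
    have "Re (H (C k) k) = Re (H (C u) u) + Re (H (C v) v)"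
    proof -
      have kuv: "k = u + v" by (simp add: u_def v_def)
      have o1: "H (C u) v = 0" unfolding u_def v_def
        by (rule bproj_orth[where X=C, OF P(1,2) bic_comm[OF C(1) bicP]])
      have o2: "H (C v) u = 0" using o1 saopH[OF C(2), of v u] Hcnj[of "C u" v] by simp
      show ?thesis unfolding kuv by (simp add: bop_lin[OF saop_bop[OF C(2)]] Hsimps o1 o2)
    qed
    also have "\<dots> \<ge> 0" using P(5)[of k] \<open>C u = 0\<close> by (simp add: v_def H01)
    finally have "0 \<le> Re (H (C k) k)" .
    then show ?thesis unfolding k_def[symmetric] by (simp add: C_def Hsimps Hself)
  qed
  then show ?thesis unfolding low_def d_def[symmetric] using d0 by blast
qed

text \<open>The spectral part \<open>|\<lambda>| \<le> 1\<close>, which is where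
  \<open>1 / (1 + \<lambda>^2)\<close> is at least \<open>1 / 2\<close>.\<close>

lemma half_projection:
  obtains P where "bproj P" "low (1 / 2) P" "\<And>h. Re (H (ct (h - P h)) (h - P h)) \<le> (nm (h - P h))\<^sup>2 / 2"
proof -
  define C where "C = (\<lambda>h. scl (of_real (1 / 2)) h - ct h)"
  have C: "bic C" "saop C" unfolding C_def by (rule bic_minus[OF bic_ct bic_scale[OF bic_id]] saop_minus[OF sa_ct saop_scale[OF saop_id]]
      bic_minus[OF bic_scale[OF bic_id] bic_ct] saop_minus[OF saop_scale[OF saop_id] sa_ct])+
  obtain P where P: "saop P" "\<And>x. P (P x) = P x" "\<And>Y. bop Y \<Longrightarrow> comm Y C \<Longrightarrow> comm Y P"
    "\<And>x. Re (H (C (P x)) (P x)) \<le> 0" "\<And>x. 0 \<le> Re (H (C (x - P x)) (x - P x))"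
    using spectral_projection[OF C(2)] by metis
  have bicP: "bic P" unfolding bic_def using P(3) C(1) saop_bop[OF P(1)] unfolding bic_def by blast
  have HC: "Re (H (C x) x) = (nm x)\<^sup>2 / 2 - Re (H (ct x) x)" for x
    by (simp add: C_def Hsimps Hself)
  have ker: "P h = 0" if "ct h = 0" for h
  proof -
    have "ct (P h) = 0" using bic_comm[OF bic_ct bicP, of h] that by (simp add: bop_0[OF saop_bop[OF P(1)]])
    then have "(nm (P h))\<^sup>2 / 2 \<le> 0" using P(4)[of h] unfolding HC by (simp add: H01)
    then show ?thesis using nm_eq_0[of "P h"] by simp
  qed
  show thesis
  proof (rule that)
    show "bproj P" unfolding bproj_def using bicP P(1,2) ker by blast
    show "low (1 / 2) P" unfolding low_def using P(4) unfolding HC by simp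
    show "Re (H (ct (h - P h)) (h - P h)) \<le> (nm (h - P h))\<^sup>2 / 2" for h using P(5)[of h] unfolding HC by simp
  qed
qed

text \<open>A vector missed by all bounded intervals is the sum of a part \<open>u\<close> above
  every \<open>t\<close> and a part \<open>v\<close> below every \<open>- t\<close>. There the form
  of \<open>t ct\<close> stays below that of \<open>tt\<close>, respectively \<open>- tt\<close>,
  for all large \<open>t\<close>, so \<open>ct\<close> vanishes on both.\<close>

lemma Q_trivial_ker:
  assumes "\<And>t. t > 0 \<Longrightarrow> QQ (- t) t h = 0"
  shows "ct h = 0"
proof -
  define u v where "u = h - Q 1 h" and "v = Q (- 1) h"
  have Q1: "Q 1 h = Q (- 1) h" using assms[of 1] by (simp add: QQ_def)
  have up: "0 \<le> Re (H (Cl t u) u)" if "t \<ge> 1" for t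
  proof -
    have eq: "Q t h = Q (- t) h" using assms[of t] that by (simp add: QQ_def)
    have "Q t u = Q t h - Q t (Q (- 1) h)" by (simp add: u_def Q1 bop_lin[OF bo_Q])
    also have "\<dots> = Q (- t) h - Q (- 1) h" using that by (simp add: eq Q_Q min_def)
    finally have "Q t u = Q (- t) h - Q (- 1) h" .
    moreover have "Q (- t) h = Q (- 1) h"
    proof -
      have "Q 1 (Q t h) = Q 1 (Q (- t) h)" by (simp add: eq)
      then show ?thesis using that Q1 by (simp add: Q_Q min_def)
    qed
    ultimately have "Q t u = 0" by simp
    then show ?thesis using Q_ge[of t u] by simp
  qed
  have vp: "Re (H (Cl (- t) v) v) \<le> 0" if "t \<ge> 1" for t
  proof -
    have eq: "Q t h = Q (- t) h" using assms[of t] that by (simp add: QQ_def)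
    have "Q 1 (Q t h) = Q 1 (Q (- t) h)" by (simp add: eq)
    then have "Q (- t) h = Q (- 1) h" using that Q1 by (simp add: Q_Q min_def)
    then have "v = Q (- t) h" by (simp add: v_def)
    then show ?thesis using Q_le[of "- t" h] by simp
  qed
  have z: "ct w = 0" if w: "\<And>t. t \<ge> 1 \<Longrightarrow> t * Re (H (ct w) w) \<le> a" for w a
  proof (rule posop_eq0[OF posop_ct], rule ccontr)
    assume "\<not> Re (H (ct w) w) \<le> 0"
    then have p: "Re (H (ct w) w) > 0" by simp
    let ?t = "max 1 ((a + 1) / Re (H (ct w) w))"
    have "a + 1 \<le> ?t * Re (H (ct w) w)" using p by (simp add: pos_divide_le_eq[symmetric])
    then show False using w[of ?t] by simp
  qed
  have "ct u = 0" using up by (intro z[of u "Re (H (tt u) u)"]) (simp add: Cl_def Hsimps)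
  moreover have "ct v = 0" using vp by (intro z[of v "- Re (H (tt v) v)"]) (force simp add: Cl_def Hsimps)
  moreover have "h = u + v" by (simp add: u_def v_def Q1)
  ultimately show ?thesis using bop_lin(1)[OF bo_ct, of u v] by simp
qed

text \<open>On the spectral side \<open>P\<close> is the indicator of
  \<open>|\<lambda>| \<le> 1\<close>, \<open>g\<close> is \<lambda> there and
  \<open>- 1 / \<lambda>\<close> elsewhere, and \<open>W\<close> is \<open>1 + \<lambda>^2\<close>
  there and 0 elsewhere. All are bounded although \<open>tt\<close> is not invertible at 0; the
  identity \<open>ct + tt g = P\<close> is what yields a projection around 0.\<close>

lemma zero_cell:
  obtains P g W where "bproj P" "low (1 / 2) P" "bic g" "saop g" "bic W"
    "\<And>h. ct (g h) + P (g h) - g h = tt h" "\<And>h. tt (g h) = P h - ct h" "\<And>h. ct (W h) = P h"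
    "\<And>h. tt (W h) = P (g h)" "\<And>h. Re (H (ct (h - P h)) (h - P h)) \<le> (nm (h - P h))\<^sup>2 / 2"
proof -
  obtain P where P: "bproj P" "low (1 / 2) P"
    and Pc: "\<And>h. Re (H (ct (h - P h)) (h - P h)) \<le> (nm (h - P h))\<^sup>2 / 2"
    using half_projection by blast
  note Pd = bprojD[OF P(1)]
  \<comment> \<open>\<open>M\<close> equals \<open>ct\<close> on the range of \<open>P\<close> and
    \<open>ct - 1\<close> off it; the sign change at \<open>|\<lambda>| = 1\<close> jumps over
    \<open>(-1/2, 1/2)\<close>. The function \<open>g\<close> is the quotient
    \<open>tt / M\<close>.\<close>
  define M where "M = (\<lambda>h. ct h + P h - h)"
  have M: "bic M" "saop M" unfolding M_def
    by (rule bic_minus[OF bic_sum[OF bic_ct Pd(1)] bic_id] saop_minus[OF saop_sum[OF sa_ct Pd(2)] saop_id])+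
  have idc: "bic (\<lambda>h. h - P h)" by (rule bic_minus[OF bic_id Pd(1)])
  have lower: "1 / 2 * nm h \<le> nm (M h)" for h
  proof -
    let ?U = "\<lambda>h. h - P h"
    have c: "h - ?U h = P h" for h by simp
    show ?thesis
    proof (rule sign_split_lower[where U="?U" and k=h])
      show "saop ?U" by (rule saop_minus[OF saop_id Pd(2)])
      show "?U (?U h) = ?U h" for h by (simp add: bop_lin[OF Pd(5)] Pd(3))
      show "saop M" by (rule M(2))
      show "M (?U h) = ?U (M h)" by (rule bic_comm[OF M(1) idc])
      have "M (?U h) = ct (?U h) - ?U h" by (simp add: M_def bop_lin[OF Pd(5)] Pd(3))
      then show "Re (H (M (?U h)) (?U h)) \<le> - (1 / 2) * (nm (?U h))\<^sup>2"
        using Pc[of h] by (simp add: Hsimps(1-4) Hdiff1 Hself del: Hdiff2)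
      have "M (P h) = ct (P h)" by (simp add: M_def Pd(3))
      then show "1 / 2 * (nm (h - ?U h))\<^sup>2 \<le> Re (H (M (h - ?U h)) (h - ?U h))"
        using P(2) unfolding low_def c by simp
    qed
  qed
  obtain V where V: "saop V" "\<And>x. M (V x) = x" "\<And>x. V (M x) = x" "\<And>Y. comm Y M \<Longrightarrow> comm Y V"
    using inverse_exists[OF M(2) _ lower] by (metis half_gt_zero_iff zero_less_one)
  have bicV: "bic V" unfolding bic_def using saop_bop[OF V(1)] M(1) V(4) unfolding bic_def by blast
  define g where "g = (\<lambda>h. tt (V h))"
  define W where "W = (\<lambda>h. P (V h))"
  have Mg: "M (g h) = tt h" for h
    using bic_comm[OF M(1) bic_tt, of "V h"] by (simp add: g_def V(2))
  have ctP: "ct (P h) = M (P h)" for h by (simp add: M_def Pd(3))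
  show thesis
  proof (rule that[OF P bic_comp[OF bic_tt bicV, folded g_def] _ bic_comp[OF Pd(1) bicV, folded W_def] _ _ _ _ Pc])
    show "saop g" unfolding g_def by (rule bic_saop_comp[OF bic_tt bicV sa_tt V(1)])
    show "ct (g h) + P (g h) - g h = tt h" for h using Mg[of h] by (simp add: M_def)
    have MP: "M (P h - ct h) = ct h - ct (ct h)" for h
      unfolding M_def using bic_comm[OF bic_ct Pd(1), of h]
      by (simp add: bop_lin[OF bo_ct] bop_lin[OF Pd(5)] Pd(3))
    show "tt (g h) = P h - ct h" for h
    proof -
      have "tt (g h) = V (tt (tt h))" unfolding g_def using bic_comm[OF bic_tt bicV] by simp
      also have "\<dots> = V (M (P h - ct h))" by (simp add: MP tt_tt)
      finally show ?thesis by (simp add: V(3))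
    qed
    show "tt (W h) = P (g h)" for h
      unfolding W_def g_def by (rule bic_comm[OF bic_tt Pd(1)])
    show "ct (W h) = P h" for h
    proof -
      have "ct (W h) = M (P (V h))" by (simp add: W_def ctP)
      then show ?thesis using bic_comm[OF M(1) Pd(1), of "V h"] by (simp add: V(2))
    qed
  qed
qed

end

section \<open>Symmetrization of a nonnegative operator\<close>

text \<open>Log-convexity makes the ratios of consecutive terms nondecreasing, so a first ratio
  above \<open>c\<close> would outgrow \<open>K * c ^ n\<close>.\<close>

lemma log_convex_bound:
  fixes a :: "nat \<Rightarrow> real"
  assumes a0: "\<And>n. 0 \<le> a n" and lc: "\<And>n. (a (Suc n))\<^sup>2 \<le> a n * a (Suc (Suc n))"
    and gr: "\<And>n. a n \<le> K * c ^ n" and c: "c > 0"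
  shows "a 1 \<le> c * a 0"
proof (rule ccontr)
  assume "\<not> a 1 \<le> c * a 0"
  then have lt: "c * a 0 < a 1" by simp
  have a1: "a 1 > 0" using lt a0[of 0] c by (smt (verit) mult_nonneg_nonneg)
  have z: "a 0 \<noteq> 0" using lc[of 0] a1 by auto
  then have p0: "a 0 > 0" using a0[of 0] by simp
  define r where "r = a 1 / a 0"
  have rc: "c < r" using lt p0 by (simp add: r_def pos_less_divide_eq)
  have r0: "r > 0" using rc c by simp
  have step: "a n > 0 \<and> r * a n \<le> a (Suc n)" for n
  proof (induction n)
    case 0
    show ?case using p0 by (simp add: r_def)
  next
    case (Suc n)
    have p: "a (Suc n) > 0" using Suc.IH r0 by (smt (verit) mult_pos_pos)
    have "r * (a (Suc n))\<^sup>2 \<le> r * (a n * a (Suc (Suc n)))" using lc[of n] r0 by simp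
    also have "\<dots> = (r * a n) * a (Suc (Suc n))" by simp
    also have "\<dots> \<le> a (Suc n) * a (Suc (Suc n))" using Suc.IH a0 by (intro mult_right_mono) auto
    finally have "a (Suc n) * (r * a (Suc n)) \<le> a (Suc n) * a (Suc (Suc n))" by (simp add: power2_eq_square ac_simps)
    then show ?case using p by simp
  qed
  have low: "a 0 * r ^ n \<le> a n" for n
  proof (induction n)
    case (Suc n)
    have "a 0 * r ^ Suc n = r * (a 0 * r ^ n)" by simp
    also have "\<dots> \<le> r * a n" using Suc.IH r0 by simp
    finally show ?case using step[of n] by simp
  qed simp
  obtain n where n: "K / a 0 < (r / c) ^ n"
    using real_arch_pow[of "r / c" "K / a 0"] rc c by (auto simp: pos_less_divide_eq)
  have "a 0 * r ^ n \<le> K * c ^ n" using low[of n] gr[of n] by linarith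
  then have "(r / c) ^ n \<le> K / a 0" using p0 c by (simp add: power_divide field_simps)
  then show False using n by simp
qed

context nonneg_krein
begin

text \<open>\<open>C1\<close> is \<open>(A^2 + 1)^-1\<close> and \<open>T\<close> is
  \<open>A (A^2 + 1)^-1\<close>.\<close>

definition "C1 x = R \<i> (R (- \<i>) x)"
definition "T x = R \<i> x - scl \<i> (C1 x)"

lemma Im_i: "Im \<i> \<noteq> 0" "Im (- \<i>) \<noteq> 0"
  by simp_all

lemma R_i: "R \<i> x = T x + scl \<i> (C1 x)" and R_mi: "R (- \<i>) x = T x - scl \<i> (C1 x)"
proof -
  show "R \<i> x = T x + scl \<i> (C1 x)" by (simp add: T_def)
  have "R \<i> x - R (- \<i>) x = scl (2 * \<i>) (C1 x)" using R_resolvent[OF Im_i, of x] by (simp add: C1_def)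
  moreover have "scl (2 * \<i>) (C1 x) = scl \<i> (C1 x) + scl \<i> (C1 x)"
    by (simp flip: scale_left_distrib)
  ultimately have "R (- \<i>) x = R \<i> x - (scl \<i> (C1 x) + scl \<i> (C1 x))" by (metis diff_diff_eq2 add_diff_cancel_left' diff_add_cancel)
  then show "R (- \<i>) x = T x - scl \<i> (C1 x)" by (simp add: T_def)
qed

lemma bop_C1: "bop C1"
proof -
  have "C1 = (\<lambda>x. R \<i> (R (- \<i>) x))" by (simp add: C1_def fun_eq_iff)
  then show ?thesis using bop_comp[OF R_bop[OF Im_i(1)] R_bop[OF Im_i(2)]] by simp
qed

lemma bop_T: "bop T"
proof -
  have "T = (\<lambda>x. R \<i> x - scl \<i> (C1 x))" by (simp add: T_def fun_eq_iff)
  then show ?thesis using bop_minus[OF R_bop[OF Im_i(1)] bop_scale[OF bop_C1]] by simp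
qed

lemma C1_A: "(C1 x, T x) \<in> A"
proof -
  have "(C1 x, R (- \<i>) x + scl \<i> (C1 x)) \<in> A" unfolding C1_def by (rule R_A[OF Im_i(1)])
  then show ?thesis by (simp add: R_mi)
qed

lemma C1_B: "B (C1 x) y = B x (C1 y)"
  unfolding C1_def using R_B[OF Im_i(1), of "R (- \<i>) x" y] R_B[OF Im_i(2), of x "R (- \<i>) y"] R_commute[OF Im_i, of y]
  by simp

lemma T_B: "B (T x) y = B x (T y)"
proof -
  have "B (T x) y = B (R \<i> x) y - \<i> * B (C1 x) y" by (simp add: T_def Bsimps)
  also have "\<dots> = B x (R (- \<i>) y) - \<i> * B x (C1 y)" using R_B[OF Im_i(1), of x y] by (simp add: C1_B)
  finally show ?thesis by (simp add: R_mi Bsimps)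
qed

lemma R_commutes_C1: "Im z \<noteq> 0 \<Longrightarrow> R z (C1 x) = C1 (R z x)"
  unfolding C1_def using R_commute[of z] Im_i by metis

lemma T_C1: "T (C1 x) = C1 (T x)"
  unfolding T_def using R_commutes_C1[OF Im_i(1), of x] by (simp add: bop_lin[OF bop_C1])

lemma T_T: "T (T x) = C1 x - C1 (C1 x)"
proof -
  have "C1 x = R \<i> (R (- \<i>) x)" by (simp add: C1_def)
  also have "\<dots> = T (T x) + C1 (C1 x)" unfolding R_i R_mi by (simp add: bop_lin[OF bop_T] bop_lin[OF bop_C1] T_C1 scale_right_diff_distrib)
  finally show ?thesis by (metis add_diff_cancel_right')
qed

lemma C1_inj: assumes "C1 x = 0" shows "x = 0"
proof -
  have z: "y = 0" if "R z y = 0" "Im z \<noteq> 0" for z y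
    using R_A[OF that(2), of y] A_single[OF A_0] that(1) by (metis add.right_neutral scale_zero_right)
  show ?thesis using z[of \<i> "R (- \<i>) x"] z[of "- \<i>" x] assms by (simp add: C1_def)
qed

lemma T_zero: assumes "T x = 0" shows "C1 x = x" "(x, 0) \<in> A"
proof -
  have "C1 (x - C1 x) = 0" using T_T[of x] assms by (simp add: bop_lin[OF bop_C1] bop_0[OF bop_T])
  then show 1: "C1 x = x" using C1_inj[of "x - C1 x"] by simp
  show "(x, 0) \<in> A" using C1_A[of x] 1 assms by simp
qed

text \<open>The form of \<open>T\<close> at \<open>x\<close> is the energy of
  \<open>R (- \<i>) x\<close>.\<close>

lemma T_nonneg: "0 \<le> Re (B (T x) x)"
proof -
  define v w where "v = R (- \<i>) x" and "w = x - scl \<i> v"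
  have vw: "(v, w) \<in> A" using R_A[OF Im_i(2), of x] by (simp add: v_def w_def)
  have Tx: "T x = v + scl \<i> (C1 x)" by (simp add: v_def R_mi)
  have xw: "x = w + scl \<i> v" by (simp add: w_def)
  have "B (C1 x) x = B v v" unfolding C1_def using R_B[OF Im_i(1), of v x] by (simp add: v_def)
  then have "B (T x) x = B v x + \<i> * B v v" by (simp add: Tx Bsimps)
  also have "B v x = B v w - \<i> * B v v" by (subst xw) (simp add: Bsimps)
  finally have "B (T x) x = B v w" by simp
  then show ?thesis using A_nn[OF vw] Bcnj[of v w] by (metis cnj.sel(1))
qed

section \<open>The square root of \<open>J T\<close> and the lifting of operators through it\<close>

definition "D = (SOME D. posop D \<and> (\<forall>x. D (D x) = J (T x)))"

lemma posop_D: "posop D" and D_D: "D (D x) = J (T x)"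
proof -
  have "posop (\<lambda>x. J (T x))"
    unfolding posop_def saop_def using bop_comp[OF bop_J bop_T] T_nonneg by (simp add: HJ1 HJ2 T_B)
  then obtain D' where "posop D'" "\<And>x. D' (D' x) = J (T x)" using sqrt_exists[of "\<lambda>x. J (T x)"] by metis
  then have "\<exists>D. posop D \<and> (\<forall>x. D (D x) = J (T x))" by blast
  from someI_ex[OF this] show "posop D" "D (D x) = J (T x)" unfolding D_def by blast+
qed

lemma saop_D: "saop D" and bop_D: "bop D"
  using posop_D posop_saop saop_bop by blast+

lemma H_D: "H (D x) (D y) = B (T x) y"
  using saopH[OF saop_D, of "D x" y] by (simp add: D_D HJ1)

lemma J_D_D: "J (D (D x)) = T x"
  by (simp add: D_D J_J)

lemma D_zero: "D x = 0 \<longleftrightarrow> T x = 0"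
  using H_D[of x x] J_D_D[of x] H_eq0[of "D x"] by (auto simp: B01 bop_0[OF bop_D] bop_0[OF bop_J])

text \<open>\<open>D\<close> is self-adjoint, so its range and its kernel together span a dense
  subspace. Identities between lifted operators are checked on these two pieces.\<close>

lemma D_range_eqI:
  assumes X: "bop X" and Y: "bop Y" and r: "\<And>x. X (D x) = Y (D x)" and k: "\<And>k. D k = 0 \<Longrightarrow> X k = Y k"
  shows "X h = Y h"
proof -
  obtain Z where Z: "bop Z" "\<And>x y. H (X x - Y x) y = H x (Z y)"
    using adjoint_exists[OF bop_minus[OF X Y]] by metis
  have "D (Z y) = 0" for y
  proof (rule H_eqI2)
    fix x show "H x (D (Z y)) = H x 0"
      using Z(2)[of "D x" y] r[of x] saopH[OF saop_D, of x "Z y"] by (simp add: H01 H02)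
  qed
  then have "H (Z y) (Z y) = 0" for y using Z(2)[of "Z y" y] k[of "Z y"] by (simp add: H01)
  then have "Z y = 0" for y using H_eq0 by simp
  then have "H (X h) y = H (Y h) y" for y using Z(2)[of h y] by (simp add: Hsimps)
  then show ?thesis by (rule H_eqI)
qed

text \<open>Commutation at the two points \<open>\<i>\<close> and \<open>- \<i>\<close> already
  implies commutation at all nonreal points, see \<open>resc_R\<close>.\<close>

definition "resc X \<longleftrightarrow> bop X \<and> (\<forall>x. X (R \<i> x) = R \<i> (X x)) \<and> (\<forall>x. X (R (- \<i>) x) = R (- \<i>) (X x))"

lemma resc_D:
  assumes "resc X" shows "bop X" "X (C1 x) = C1 (X x)" "X (T x) = T (X x)" "X (R \<i> x) = R \<i> (X x)"
proof -
  show b: "bop X" and "X (R \<i> x) = R \<i> (X x)" using assms unfolding resc_def by blast+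
  show c: "X (C1 x) = C1 (X x)" using assms unfolding resc_def C1_def by simp
  show "X (T x) = T (X x)" using assms c unfolding resc_def T_def by (simp add: bop_lin[OF b])
qed

lemma rescI: "bop X \<Longrightarrow> (\<And>x. X (C1 x) = C1 (X x)) \<Longrightarrow> (\<And>x. X (T x) = T (X x)) \<Longrightarrow> resc X"
  unfolding resc_def R_i R_mi by (simp add: bop_lin)

lemma resc_R: assumes X: "resc X" and z: "Im z \<noteq> 0" shows "X (R z x) = R z (X x)"
proof -
  have "(X (R z x), X (x + scl z (R z x))) \<in> A" by (rule commute_A[OF resc_D(1,4)[OF X] R_A[OF z]])
  then show ?thesis using R_unique[OF z, of "X (R z x)" "X x"] by (simp add: bop_lin[OF resc_D(1)[OF X]])
qed

text \<open>Reid's inequality: a \<open>B\<close>-symmetric operator commuting with \<open>T\<close> is bounded in the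
  seminorm \<open>nm \<circ> D\<close>, since its powers are log-convex there.\<close>

lemma Reid:
  assumes X: "bop X" and s: "\<And>x y. B (X x) y = B x (X y)" and c: "\<And>x. X (T x) = T (X x)"
  obtains C where "C > 0" "\<And>x. nm (D (X x)) \<le> C * nm (D x)"
proof -
  obtain C where C: "C > 0" "\<And>x. nm (X x) \<le> C * nm x" using bop_bound[OF X] by metis
  obtain d where d: "d > 0" "\<And>x. nm (D x) \<le> d * nm x" using bop_bound[OF bop_D] by metis
  have "nm (D (X x)) \<le> C * nm (D x)" for x
  proof -
    define a where "a n = nm (D ((X ^^ n) x))" for n
    have "a 1 \<le> C * a 0"
    proof (rule log_convex_bound[OF _ _ _ C(1)])
      show "0 \<le> a n" for n by (simp add: a_def)
      show "(a (Suc n))\<^sup>2 \<le> a n * a (Suc (Suc n))" for n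
      proof -
        let ?u = "(X ^^ n) x"
        have "(a (Suc n))\<^sup>2 = Re (H (D (X ?u)) (D (X ?u)))" by (simp add: a_def Hself)
        also have "\<dots> = Re (H (D ?u) (D (X (X ?u))))" unfolding H_D using s[of "T ?u" "X ?u"] by (simp add: c)
        also have "\<dots> \<le> nm (D ?u) * nm (D (X (X ?u)))" by (rule ReH_le) auto
        finally show ?thesis by (simp add: a_def)
      qed
      have pw: "nm ((X ^^ n) x) \<le> C ^ n * nm x" for n
      proof (induction n)
        case (Suc n)
        have "nm ((X ^^ Suc n) x) \<le> C * nm ((X ^^ n) x)" using C(2) by simp
        also have "\<dots> \<le> C * (C ^ n * nm x)" using Suc.IH C(1) by simp
        finally show ?case by simp
      qed simp
      show "a n \<le> (d * nm x) * C ^ n" for n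
      proof -
        have "a n \<le> d * nm ((X ^^ n) x)" unfolding a_def by (rule d(2))
        also have "\<dots> \<le> d * (C ^ n * nm x)" using pw[of n] d(1) by simp
        finally show ?thesis by (simp add: ac_simps)
      qed
    qed
    then show ?thesis by (simp add: a_def)
  qed
  then show thesis using that C(1) by blast
qed

text \<open>Reid's inequality makes \<open>D x \<mapsto> D (X x)\<close> well defined and bounded.
  The Riesz lemma yields the adjoint of this map, normalized to be orthogonal to the kernel of
  \<open>D\<close>; by symmetry of \<open>X\<close> it again sends \<open>D x\<close> to
  \<open>D (X x)\<close>, and it is self-adjoint.\<close>

lemma lift_exists:
  assumes X: "bop X" and s: "\<And>x y. B (X x) y = B x (X y)" and c: "\<And>x. X (T x) = T (X x)"
  obtains L where "saop L" "\<And>x. L (D x) = D (X x)" "\<And>k. D k = 0 \<Longrightarrow> L k = 0"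
proof -
  obtain C where C: "C > 0" "\<And>x. nm (D (X x)) \<le> C * nm (D x)" using Reid[OF X s c] by metis
  obtain P0 where P0: "saop P0" "\<And>x. D (P0 x) = 0" "\<And>x. D x = 0 \<Longrightarrow> P0 x = x"
    using kernel_projection[OF bop_D] by metis
  have P0D: "P0 (D x) = 0" for x
  proof (rule H_eqI)
    fix y show "H (P0 (D x)) y = H 0 y"
      using saopH[OF P0(1), of "D x" y] saopH[OF saop_D, of x "P0 y"] by (simp add: P0(2) H01 H02)
  qed
  have same: "D (X x) = D (X x')" if "D x = D x'" for x x'
  proof -
    have "nm (D (X (x - x'))) \<le> C * nm (D (x - x'))" by (rule C(2))
    also have "\<dots> = 0" using that by (simp add: bop_lin[OF bop_D])
    finally have "D (X (x - x')) = 0" by (metis nm_eq_0 nm_nonneg UNIV_I order_antisym)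
    then show ?thesis by (simp add: bop_lin[OF bop_D] bop_lin[OF X])
  qed
  have ex: "\<exists>u. (\<forall>x. H (D x) u = H (D (X x)) y) \<and> nm u \<le> C * nm y \<and> P0 u = 0" for y
  proof -
    define l where "l w = H (D (X (SOME x. D x = w))) y" for w
    have l: "l (D x) = H (D (X x)) y" for x
    proof -
      have "D (SOME z. D z = D x) = D x" by (rule someI) simp
      from same[OF this] show ?thesis by (simp add: l_def)
    qed
    have sub: "subspace (range D)"
    proof (rule subspaceI)
      show "0 \<in> range D" using bop_0[OF bop_D] by (metis rangeI)
      show "u + v \<in> range D" if uv: "u \<in> range D" "v \<in> range D" for u v
      proof -
        obtain x y where "u = D x" "v = D y" using uv by blast
        then have "u + v = D (x + y)" by (simp add: bop_add[OF bop_D])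
        then show ?thesis by blast
      qed
      show "scl c u \<in> range D" if "u \<in> range D" for c u
        using that bop_scl[OF bop_D] by (metis imageE rangeI)
    qed
    have b: "cmod (l w) \<le> (C * nm y) * nm w" if "w \<in> range D" for w
    proof -
      obtain x where w: "w = D x" using \<open>w \<in> range D\<close> by blast
      have "cmod (l w) \<le> nm (D (X x)) * nm y" unfolding w l by (rule Cauchy_Schwarz) auto
      also have "\<dots> \<le> C * nm (D x) * nm y" using C(2) by (intro mult_right_mono) auto
      finally show ?thesis by (simp add: w ac_simps)
    qed
    have add: "l (w + w') = l w + l w'" if "w \<in> range D" "w' \<in> range D" for w w'
      using that by (auto simp: l simp flip: bop_add[OF bop_D]) (simp add: bop_lin[OF bop_D] bop_lin[OF X] Hsimps)
    have scl: "l (scl c w) = c * l w" if "w \<in> range D" for c w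
      using that by (auto simp: l simp flip: bop_scl[OF bop_D]) (simp add: bop_lin[OF bop_D] bop_lin[OF X] Hsimps)
    have C0: "0 \<le> C * nm y" using C(1) by simp
    obtain u Z where u: "\<And>w. w \<in> range D \<Longrightarrow> l w = H w u" "nm u \<le> C * nm y" "\<And>n. Z n \<in> range D" "conv Z u"
      using Riesz_subspace[OF sub subset_UNIV add scl C0 b] by metis
    have "P0 (Z n) = 0" for n using u(3)[of n] P0D by auto
    then have "conv (\<lambda>n. 0) (P0 u)" using bop_conv[OF saop_bop[OF P0(1)] u(4)] by simp
    then have "P0 u = 0" using conv_unique[OF _ conv_const[of 0]] by simp
    then show ?thesis using u(1,2) l by auto
  qed
  obtain L where L: "\<And>x y. H (D x) (L y) = H (D (X x)) y" "\<And>y. nm (L y) \<le> C * nm y" "\<And>y. P0 (L y) = 0"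
    using ex by metis
  have uniq: "u = v" if "\<And>x. H (D x) u = H (D x) v" "P0 u = 0" "P0 v = 0" for u v
  proof -
    have "D (u - v) = 0"
    proof (rule H_eqI2)
      fix x show "H x (D (u - v)) = H x 0"
        using that(1)[of x] saopH[OF saop_D, of x "u - v"] by (simp add: Hsimps)
    qed
    then show ?thesis using P0(3)[of "u - v"] that(2,3) by (simp add: bop_lin[OF saop_bop[OF P0(1)]])
  qed
  note P0l = bop_lin[OF saop_bop[OF P0(1)]]
  have Lb: "bop L"
  proof (rule bopI[of _ C])
    show "L (x + y) = L x + L y" for x y by (rule uniq) (simp_all add: L Hsimps P0l)
    show "L (scl c x) = scl c (L x)" for c x by (rule uniq) (simp_all add: L Hsimps P0l)
  qed (rule L(2))
  have LD: "L (D y) = D (X y)" for y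
    by (rule uniq) (simp_all add: L P0D H_D flip: s c)
  have Lk: "L k = 0" if k: "D k = 0" for k
  proof (rule uniq)
    show "H (D x) (L k) = H (D x) 0" for x
      using saopH[OF saop_D, of "X x" k] by (simp add: L k H02)
  qed (simp_all add: L P0l)
  obtain M where M: "bop M" "\<And>x y. H (L x) y = H x (M y)" using adjoint_exists[OF Lb] by metis
  have M': "H (M y) x = H y (L x)" for x y using M(2)[of x y] Hcnj[of "L x" y] Hcnj[of x "M y"] by simp
  have "M h = L h" for h
  proof (rule D_range_eqI[OF M(1) Lb])
    show "M (D x) = L (D x)" for x by (rule H_eqI) (simp add: M' L LD)
    show "M k = L k" if k: "D k = 0" for k
    proof (rule H_eqI)
      fix y show "H (M k) y = H (L k) y"
        using saopH[OF P0(1), of k "L y"] P0(3)[OF k] by (simp add: M' L(3) Lk[OF k] H01 H02)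
    qed
  qed
  then have "saop L" unfolding saop_def using Lb M(2) by simp
  then show thesis using that LD Lk by blast
qed

definition "tt h = D (J (D h))"
definition "ct = (SOME L. saop L \<and> (\<forall>x. L (D x) = D (C1 x)) \<and> (\<forall>k. D k = 0 \<longrightarrow> L k = 0))"

lemma saop_ct: "saop ct" and ct_D: "ct (D x) = D (C1 x)" and ct_kerD: "D k = 0 \<Longrightarrow> ct k = 0"
proof -
  obtain L where "saop L" "\<And>x. L (D x) = D (C1 x)" "\<And>k. D k = 0 \<Longrightarrow> L k = 0"
    using lift_exists[OF bop_C1 C1_B T_C1[symmetric]] by blast
  then have "\<exists>L. saop L \<and> (\<forall>x. L (D x) = D (C1 x)) \<and> (\<forall>k. D k = 0 \<longrightarrow> L k = 0)" by blast
  from someI_ex[OF this, folded ct_def]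
  show "saop ct" "ct (D x) = D (C1 x)" "D k = 0 \<Longrightarrow> ct k = 0" by blast+
qed

lemma tt_D: "tt (D x) = D (T x)" and tt_kerD: "D k = 0 \<Longrightarrow> tt k = 0"
  by (simp_all add: tt_def J_D_D bop_0[OF bop_J] bop_0[OF bop_D])

lemma saop_tt: "saop tt"
proof -
  have e: "tt = (\<lambda>h. D (J (D h)))" by (simp add: tt_def fun_eq_iff)
  show ?thesis unfolding saop_def
  proof (intro conjI allI)
    show "bop tt" unfolding e by (rule bop_comp[OF bop_D bop_comp[OF bop_J bop_D]])
    show "H (tt x) y = H x (tt y)" for x y by (simp add: tt_def saopH[OF saop_D] J_sym)
  qed
qed

sublocale pencil scl H tt ct
proof unfold_locales
  have b: "bop tt" "bop ct" using saop_tt saop_ct saop_bop by blast+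
  show "saop tt" "saop ct" by (rule saop_tt saop_ct)+
  show "tt (ct h) = ct (tt h)" for h
    by (rule D_range_eqI[OF bop_comp[OF b] bop_comp[OF b(2,1)]])
      (simp_all add: tt_D ct_D T_C1 tt_kerD ct_kerD bop_0[OF b(1)] bop_0[OF b(2)])
  show "tt (tt h) = ct h - ct (ct h)" for h
    by (rule D_range_eqI[OF bop_comp[OF b(1) b(1)] bop_minus[OF b(2) bop_comp[OF b(2) b(2)]]])
      (simp_all add: tt_D ct_D T_T tt_kerD ct_kerD bop_0[OF b(1)] bop_0[OF b(2)] bop_lin[OF bop_D])
qed

lemma lift_resc_symmetric:
  assumes X: "resc X" and s: "\<And>x y. B (X x) y = B x (X y)"
  obtains L where "bop L" "\<And>x. L (D x) = D (X x)" "\<And>k. D k = 0 \<Longrightarrow> L k = 0"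
  using lift_exists[OF resc_D(1)[OF X] s resc_D(3)[OF X]] saop_bop by metis

lemma B_adjoint:
  assumes X: "resc X" obtains Y where "resc Y" "\<And>x y. B (X x) y = B x (Y y)"
proof -
  note Xb = resc_D(1)[OF X]
  obtain Z where Z: "bop Z" "\<And>x y. H (J (X x)) y = H x (Z y)" using adjoint_exists[OF bop_comp[OF bop_J Xb]] by metis
  define Y where "Y y = J (Z y)" for y
  have XY: "B (X x) y = B x (Y y)" for x y using Z(2)[of x y] HJ2[of x "J (Z y)"] by (simp add: HJ1 Y_def J_J)
  have "bop Y" using bop_comp[OF bop_J Z(1)] unfolding Y_def[abs_def] .
  moreover have "Y (C1 y) = C1 (Y y)" for y
    by (rule B_eqI2) (simp add: resc_D(2)[OF X] C1_B flip: XY, metis C1_B XY resc_D(2)[OF X])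
  moreover have "Y (T y) = T (Y y)" for y
    by (rule B_eqI2) (metis T_B XY resc_D(3)[OF X])
  ultimately have "resc Y" by (rule rescI)
  then show thesis using that XY by blast
qed

text \<open>Reid's inequality requires symmetry, so \<open>X\<close> is split into two
  \<open>B\<close>-symmetric parts by means of its \<open>B\<close>-adjoint, which commutes with the
  resolvent as well.\<close>

lemma lift_resc:
  assumes X: "resc X"
  obtains L where "bop L" "\<And>x. L (D x) = D (X x)" "\<And>k. D k = 0 \<Longrightarrow> L k = 0"
proof -
  obtain Y where Y: "resc Y" "\<And>x y. B (X x) y = B x (Y y)" using B_adjoint[OF X] by metis
  have Y': "B (Y x) y = B x (X y)" for x y using Y(2)[of y x] Bcnj by metis
  define X1 where "X1 x = scl (1 / 2) (X x + Y x)" for x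
  define X2 where "X2 x = scl (- \<i> / 2) (X x - Y x)" for x
  have b: "bop X1" "bop X2" unfolding X1_def[abs_def] X2_def[abs_def]
    by (rule bop_scale[OF bop_sum[OF resc_D(1)[OF X] resc_D(1)[OF Y(1)]]]
        bop_scale[OF bop_minus[OF resc_D(1)[OF X] resc_D(1)[OF Y(1)]]])+
  have "resc X1" "resc X2"
    by (intro rescI b; simp add: X1_def X2_def resc_D(2,3)[OF X] resc_D(2,3)[OF Y(1)] bop_lin[OF bop_C1] bop_lin[OF bop_T])+
  moreover have "B (X1 x) y = B x (X1 y)" "B (X2 x) y = B x (X2 y)" for x y
    by (simp_all add: X1_def X2_def Bsimps Y Y' algebra_simps)
  ultimately obtain L1 L2 where L1: "bop L1" "\<And>x. L1 (D x) = D (X1 x)" "\<And>k. D k = 0 \<Longrightarrow> L1 k = 0"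
    and L2: "bop L2" "\<And>x. L2 (D x) = D (X2 x)" "\<And>k. D k = 0 \<Longrightarrow> L2 k = 0"
    using lift_resc_symmetric[of X1] lift_resc_symmetric[of X2] by metis
  have XX: "X x = X1 x + scl \<i> (X2 x)" for x
    by (simp add: X1_def X2_def scale_right_distrib scale_right_diff_distrib flip: scale_left_distrib)
  show thesis
  proof (rule that)
    show "bop (\<lambda>h. L1 h + scl \<i> (L2 h))" by (intro bop_sum bop_scale L1 L2)
  qed (simp_all add: L1 L2 XX bop_lin[OF bop_D])
qed

text \<open>The third identity reads \<open>X J D = J D L\<close>: while \<open>D\<close> carries
  \<open>X\<close> to \<open>L\<close>, \<open>J D\<close> carries \<open>L\<close> back to
  \<open>X\<close>.\<close>

lemma lift_properties:
  assumes X: "resc X" and L: "bop L" "\<And>x. L (D x) = D (X x)" "\<And>k. D k = 0 \<Longrightarrow> L k = 0"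
  shows "comm L tt" "comm L ct" "X (J (D h)) = J (D (L h))"
proof -
  have "L (tt h) = tt (L h)" for h
    by (rule D_range_eqI[OF bop_comp[OF L(1) bo_tt] bop_comp[OF bo_tt L(1)]])
      (simp_all add: tt_D L tt_kerD resc_D(3)[OF X] bop_0[OF L(1)] bop_0[OF bo_tt])
  then show "comm L tt" unfolding comm_def by blast
  have "L (ct h) = ct (L h)" for h
    by (rule D_range_eqI[OF bop_comp[OF L(1) bo_ct] bop_comp[OF bo_ct L(1)]])
      (simp_all add: ct_D L ct_kerD resc_D(2)[OF X] bop_0[OF L(1)] bop_0[OF bo_ct])
  then show "comm L ct" unfolding comm_def by blast
  show "X (J (D h)) = J (D (L h))"
    by (rule D_range_eqI[OF bop_comp[OF resc_D(1)[OF X] bop_comp[OF bop_J bop_D]] bop_comp[OF bop_J bop_comp[OF bop_D L(1)]]])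
      (simp_all add: J_D_D L resc_D(3)[OF X] bop_0[OF resc_D(1)[OF X]] bop_0[OF bop_J] bop_0[OF bop_D])
qed

text \<open>The lift of \<open>X\<close> commutes with \<open>tt\<close> and \<open>ct\<close>,
  hence with \<open>V\<close>. Operators \<open>J D V D\<close> therefore lie in the double
  commutant of the resolvent.\<close>

lemma resc_JDVD:
  assumes X: "resc X" and V: "bic V" shows "X (J (D (V (D x)))) = J (D (V (D (X x))))"
proof -
  obtain L where L: "bop L" "\<And>x. L (D x) = D (X x)" "\<And>k. D k = 0 \<Longrightarrow> L k = 0" using lift_resc[OF X] by metis
  note p = lift_properties[OF X L]
  show ?thesis using p(3)[of "V (D x)"] bic_D[OF V L(1) p(1,2), of "D x"] by (simp add: L(2))
qed

lemma resc_C1: "resc C1"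
  by (rule rescI) (simp_all add: bop_C1 T_C1)

lemma resc_T: "resc T"
  by (rule rescI) (simp_all add: bop_T T_C1)

lemma C1_JD: "C1 (J (D h)) = J (D (ct h))"
  by (rule lift_properties(3)[OF resc_C1 bo_ct ct_D ct_kerD])

lemma T_JD: "T (J (D h)) = J (D (tt h))"
  by (rule lift_properties(3)[OF resc_T bo_tt tt_D tt_kerD])

lemma ct_zero: "ct h = 0 \<longleftrightarrow> D h = 0"
proof
  assume "ct h = 0"
  then have "C1 (J (D h)) = 0" by (simp add: C1_JD bop_0[OF bop_J] bop_0[OF bop_D])
  then have "J (J (D h)) = 0" using C1_inj bop_0[OF bop_J] by metis
  then show "D h = 0" by (simp add: J_J)
qed (rule ct_kerD)

end

section \<open>Spectral projections of bounded intervals\<close>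

context nonneg_krein
begin

text \<open>The projection \<open>E\<close> lifts to the projection \<open>Q'\<close> on the closure of the range of \<open>D\<close>, while
  the flag \<open>b\<close> records its action on the kernel of \<open>A\<close>, which \<open>D\<close> does not see.\<close>

definition kop :: "('a \<Rightarrow> 'a) \<Rightarrow> ('a \<Rightarrow> 'a) \<Rightarrow> bool \<Rightarrow> bool" where
  "kop E Q' b \<longleftrightarrow> krein_proj E \<and> (\<forall>x. D (E x) = Q' (D x)) \<and>
     (\<forall>x. D x = 0 \<longrightarrow> E x = (if b then x else 0)) \<and> (\<forall>X. resc X \<longrightarrow> (\<forall>x. X (E x) = E (X x)))"

lemma kopD:
  assumes "kop E Q' b"
  shows "krein_proj E" "D (E x) = Q' (D x)" "D x = 0 \<Longrightarrow> E x = (if b then x else 0)"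
    "resc X \<Longrightarrow> X (E x) = E (X x)" "bop E" "E (E x) = E x" "B (E x) y = B x (E y)" "resc E"
proof -
  show 1: "krein_proj E" and "D (E x) = Q' (D x)" and "D x = 0 \<Longrightarrow> E x = (if b then x else 0)"
    and 2: "\<And>X x. resc X \<Longrightarrow> X (E x) = E (X x)"
    using assms unfolding kop_def by blast+
  show b: "bop E" and "E (E x) = E x" and "B (E x) y = B x (E y)" using krein_projD[OF 1] by blast+
  show "resc E" by (rule rescI[OF b]) (simp_all add: 2 resc_C1 resc_T)
qed

lemma kop_cong: "kop E Q1 b \<Longrightarrow> (\<And>h. Q1 h = Q2 h) \<Longrightarrow> b = c \<Longrightarrow> kop E Q2 c"
  unfolding kop_def by simp

lemma kop_commute: "kop E Q1 b \<Longrightarrow> kop F Q2 c \<Longrightarrow> E (F x) = F (E x)"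
  using kopD(4,8) by blast

text \<open>\<open>E - F\<close> maps into the kernel of \<open>D\<close>, where both act according
  to the flag; as they commute, no difference is left. Identities between projections can thus be
  read off from lifts and flags.\<close>

lemma kop_unique:
  assumes E: "kop E Q' b" and F: "kop F Q' b" shows "E x = F x"
proof -
  have D0: "D (E x - F x) = 0" by (simp add: bop_lin[OF bop_D] kopD(2)[OF E] kopD(2)[OF F])
  have EF: "E (F x) = F (E x)" by (rule kop_commute[OF E F])
  have "E (E x - F x) = (if b then E x - F x else 0)" "F (E x - F x) = (if b then E x - F x else 0)"
    using kopD(3)[OF E D0] kopD(3)[OF F D0] by simp_all
  then show ?thesis using EF
    by (cases b) (simp_all add: bop_lin[OF kopD(5)[OF E]] bop_lin[OF kopD(5)[OF F]] kopD(6)[OF E] kopD(6)[OF F])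
qed

lemma kop_zero: "kop (\<lambda>x. 0) (\<lambda>h. 0) False"
  unfolding kop_def krein_proj_def resc_def by (simp add: bops Bsimps bop_0[OF bop_D] bop_0)

lemma kop_compl: assumes E: "kop E Q' b" shows "kop (\<lambda>x. x - E x) (\<lambda>h. h - Q' h) (\<not> b)"
  unfolding kop_def krein_proj_def
proof (intro conjI allI impI)
  show "bop (\<lambda>x. x - E x)" by (rule bop_minus[OF bop_id kopD(5)[OF E]])
qed (simp_all add: Bsimps kopD(7)[OF E] bop_lin[OF kopD(5)[OF E]] kopD(6)[OF E] bop_lin[OF bop_D] kopD(2)[OF E]
    kopD(3)[OF E] bop_lin[OF resc_D(1)] kopD(4)[OF E])

lemma kop_prod: assumes E: "kop E Q1 b" and F: "kop F Q2 c" shows "kop (\<lambda>x. E (F x)) (\<lambda>h. Q1 (Q2 h)) (b \<and> c)"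
  unfolding kop_def krein_proj_def
proof (intro conjI allI impI)
  show "bop (\<lambda>x. E (F x))" by (rule bop_comp[OF kopD(5)[OF E] kopD(5)[OF F]])
qed (simp_all add: kopD(7)[OF E] kopD(7)[OF F] kop_commute[OF E F, symmetric] kopD(6)[OF E] kopD(6)[OF F]
    kopD(2)[OF E] kopD(2)[OF F] kopD(3)[OF E] kopD(3)[OF F] kopD(4)[OF E] kopD(4)[OF F] bop_0[OF kopD(5)[OF E]])

lemma kop_union:
  assumes E: "kop E Q1 b" and F: "kop F Q2 c"
  shows "kop (\<lambda>x. E x + F x - E (F x)) (\<lambda>h. h - (h - Q1 h - Q2 (h - Q1 h))) (b \<or> c)"
proof -
  have *: "kop (\<lambda>x. x - ((x - E x) - F (x - E x))) (\<lambda>h. h - (h - Q1 h - Q2 (h - Q1 h))) (\<not> (\<not> c \<and> \<not> b))"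
    by (rule kop_compl[OF kop_prod[OF kop_compl[OF F] kop_compl[OF E]]])
  have "(\<lambda>x. x - ((x - E x) - F (x - E x))) = (\<lambda>x. E x + F x - E (F x))"
    by (simp add: fun_eq_iff bop_lin[OF kopD(5)[OF F]] kop_commute[OF E F] algebra_simps)
  note ** = *[unfolded this]
  show ?thesis by (rule kop_cong[OF **]) auto
qed

definition "abd E \<longleftrightarrow> (\<exists>C. \<forall>x. \<exists>w. (E x, w) \<in> A \<and> nm w \<le> C * nm x)"

lemma abdI: "bop W \<Longrightarrow> (\<And>x. (E x, W x) \<in> A) \<Longrightarrow> abd E"
  unfolding abd_def using bop_bound by metis

lemma abdE: assumes "abd E" "bop E" obtains W where "bop W" "\<And>x. (E x, W x) \<in> A"
proof -
  obtain C where "\<And>x. \<exists>w. (E x, w) \<in> A \<and> nm w \<le> C * nm x" using assms(1) unfolding abd_def by blast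
  from range_operator[OF assms(2) this] show thesis using that by blast
qed

lemma abd_comp: assumes "abd E" "bop E" "bop X" shows "abd (\<lambda>x. E (X x))"
proof -
  obtain W where W: "bop W" "\<And>x. (E x, W x) \<in> A" using abdE[OF assms(1,2)] by metis
  show ?thesis by (rule abdI[OF bop_comp[OF W(1) assms(3)] W(2)])
qed

lemma abd_sum: assumes "abd E" "bop E" "abd F" "bop F" shows "abd (\<lambda>x. E x + F x)" "abd (\<lambda>x. E x - F x)"
proof -
  obtain W where W: "bop W" "\<And>x. (E x, W x) \<in> A" using abdE[OF assms(1,2)] by metis
  obtain V where V: "bop V" "\<And>x. (F x, V x) \<in> A" using abdE[OF assms(3,4)] by metis
  show "abd (\<lambda>x. E x + F x)" by (rule abdI[OF bop_sum[OF W(1) V(1)] A_add[OF W(2) V(2)]])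
  show "abd (\<lambda>x. E x - F x)" by (rule abdI[OF bop_minus[OF W(1) V(1)] A_diff[OF W(2) V(2)]])
qed

lemma abd_zero: "abd (\<lambda>x. 0)"
  by (rule abdI[OF bop_zero A_0])

lemma abd_union:
  assumes "abd E" "bop E" "abd F" "bop F" shows "abd (\<lambda>x. E x + F x - E (F x))"
  by (rule abd_sum(2)[OF abd_sum(1)[OF assms] bop_sum[OF assms(2,4)] abd_comp[OF assms(1,2,4)] bop_comp[OF assms(2,4)]])

lemma A_R_i: assumes "R \<i> (f' - scl \<i> f) = f" shows "(f, f') \<in> A"
  using R_A[OF Im_i(1), of "f' - scl \<i> f"] assms by simp

lemma R_i_JD: "R \<i> (J (D h)) = J (D (tt h + scl \<i> (ct h)))"
  by (simp add: R_i T_JD C1_JD bop_lin[OF bop_D] bop_lin[OF bop_J])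

lemma bop_JDVD: "bop V \<Longrightarrow> bop (\<lambda>x. J (D (V (D x))))"
  by (rule bop_comp[OF bop_J bop_comp[OF bop_D bop_comp[OF _ bop_D]]])

lemma JDVD_sym: "saop V \<Longrightarrow> B (J (D (V (D x)))) y = B x (J (D (V (D y))))"
  by (simp add: HJ1 HJ2 saopH[OF saop_D] saopH[of V] flip: H_B) (simp add: B_H J_sym J_J saopH[OF saop_D] saopH[of V])

lemmas JD_lin = bop_lin[OF bop_J] bop_lin[OF bop_D]

text \<open>On the cell \<open>V\<close> is \<open>(1 + \<lambda>^2) / \<lambda>\<close> and an
  auxiliary \<open>W\<close> is \<open>1 + \<lambda>^2\<close>; both are bounded as the cell avoids
  0 and \<infinity>. From \<open>tt V = U\<close> the operator \<open>J D V D\<close> is a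
  projection, and \<open>A\<close> times it is \<open>J D W D\<close>.\<close>

lemma definite_cell:
  assumes U: "bproj U" and low: "low d U" and s: "s1 < 0" "0 < s2" and Z: "\<And>h. U (QQ s1 s2 h) = 0"
  obtains V where "bic V" "saop V" "\<And>h. tt (V h) = U h" "\<And>h. U (V h) = V h"
    "kop (\<lambda>x. J (D (V (D x)))) U False" "abd (\<lambda>x. J (D (V (D x))))"
proof -
  note Ud = bprojD[OF U]
  obtain c where c: "c > 0" "\<And>h. c * nm (U h) \<le> nm (Cl 0 (U h))" using pencil_lower[OF U low s Z] by blast
  have "c * nm (U h) \<le> nm (tt (U h))" for h using c(2)[of h] by (simp add: Cl_def)
  then obtain V where V: "bic V" "saop V" "\<And>h. tt (V h) = U h" "\<And>h. U (V h) = V h"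
    using inverse_on[OF U bic_tt sa_tt c(1)] by metis
  have d0: "d > 0" and dl: "\<And>h. d * (nm (U h))\<^sup>2 \<le> Re (H (ct (U h)) (U h))" using low unfolding low_def by blast+
  have "d * nm (U h) \<le> nm (ct (U h))" for h
  proof (cases "nm (U h) = 0")
    case False
    have "d * (nm (U h))\<^sup>2 \<le> nm (ct (U h)) * nm (U h)" using dl[of h] ReH_le[of "ct (U h)" "U h"] by simp
    then show ?thesis using False nm_pos[of "U h"] by (simp add: power2_eq_square)
  qed simp
  then obtain W where W: "bic W" "saop W" "\<And>h. ct (W h) = U h" "\<And>h. U (W h) = W h"
    using inverse_on[OF U bic_ct sa_ct d0] by metis
  note bV = bic_bop[OF V(1)] and bW = bic_bop[OF W(1)]
  have VU: "V (U h) = V h" for h using bic_comm[OF V(1) Ud(1), of h] V(4) by simp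
  have inj: "h = 0" if "U h = h" "tt h = 0" for h
    using that V(3)[of h] bic_comm[OF V(1) bic_tt, of h] bop_0[OF bV] by simp
  \<comment> \<open>This is
    \<open>\<lambda> + 1 / \<lambda> = (1 + \<lambda>^2) / \<lambda>\<close>, checked after applying
    \<open>tt\<close>, which is injective on the range of \<open>U\<close>.\<close>
  have key: "tt (W h) + ct (V h) = V h" for h
  proof -
    have "tt (tt (W h) + ct (V h) - V h) = 0"
    proof -
      have "tt (ct (V h)) = ct (U h)" using tt_ct[of "V h"] V(3) by simp
      moreover have "tt (tt (W h)) = U h - ct (U h)" by (simp add: tt_tt W(3))
      ultimately show ?thesis by (simp add: bop_lin[OF bo_tt] V(3))
    qed
    moreover have "U (tt (W h) + ct (V h) - V h) = tt (W h) + ct (V h) - V h"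
      using bic_comm[OF Ud(1) bic_tt, of "W h"] bic_comm[OF Ud(1) bic_ct, of "V h"]
      by (simp add: bop_lin[OF Ud(5)] V(4) W(4))
    ultimately show ?thesis using inj by fastforce
  qed
  let ?E = "\<lambda>x. J (D (V (D x)))"
  have DE: "D (?E x) = U (D x)" for x using V(3)[of "D x"] by (simp add: tt_def)
  show thesis
  proof (rule that[OF V])
    show "kop ?E U False"
      unfolding kop_def krein_proj_def
    proof (intro conjI allI impI)
      show "bop ?E" by (rule bop_JDVD[OF bV])
      show "B (?E x) y = B x (?E y)" for x y by (rule JDVD_sym[OF V(2)])
      show "?E (?E x) = ?E x" for x by (simp only: DE VU)
      show "X (?E x) = ?E (X x)" if "resc X" for X x by (rule resc_JDVD[OF that V(1)])
    qed (simp_all add: DE bop_0[OF bV] JD_lin)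
    show "abd ?E"
    proof (rule abdI[OF bop_JDVD[OF bW]])
      fix x
      let ?h = "D x"
      have "J (D (W ?h)) - scl \<i> (?E x) = J (D (W ?h - scl \<i> (V ?h)))" by (simp add: JD_lin)
      moreover have "tt (W ?h - scl \<i> (V ?h)) + scl \<i> (ct (W ?h - scl \<i> (V ?h))) = tt (W ?h) + ct (V ?h)"
        by (simp add: bop_lin[OF bo_tt] bop_lin[OF bo_ct] V(3) W(3) scale_right_diff_distrib)
      ultimately have "R \<i> (J (D (W ?h)) - scl \<i> (?E x)) = ?E x" by (simp only: R_i_JD key)
      then show "(?E x, J (D (W ?h))) \<in> A" by (rule A_R_i)
    qed
  qed
qed

text \<open>\<open>C1 + J D g D\<close> has the lift \<open>ct + tt g = P\<close>. On the kernel of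
  \<open>A\<close> the second summand vanishes and \<open>C1\<close> is the identity, whence the
  flag \<open>True\<close>.\<close>

lemma zero_kop:
  obtains e P where "bproj P" "low (1 / 2) P" "\<And>h. Re (H (ct (h - P h)) (h - P h)) \<le> (nm (h - P h))\<^sup>2 / 2"
    "kop e P True" "abd e"
proof -
  obtain P g W where P: "bproj P" "low (1 / 2) P" and gW: "bic g" "saop g" "bic W"
    and g: "\<And>h. ct (g h) + P (g h) - g h = tt h" "\<And>h. tt (g h) = P h - ct h" "\<And>h. ct (W h) = P h"
      "\<And>h. tt (W h) = P (g h)" and Pc: "\<And>h. Re (H (ct (h - P h)) (h - P h)) \<le> (nm (h - P h))\<^sup>2 / 2"
    using zero_cell by metis
  note bg = bic_bop[OF gW(1)] and bW = bic_bop[OF gW(3)]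
  define e where "e x = C1 x + J (D (g (D x)))" for x
  have De: "D (e x) = P (D x)" for x
    using g(2)[of "D x"] by (simp add: e_def JD_lin ct_D[symmetric]) (simp add: tt_def)
  have TT: "J (D (tt (D x))) = C1 x - C1 (C1 x)" for x by (simp add: tt_D J_D_D T_T)
  show thesis
  proof (rule that[OF P Pc])
    show "kop e P True"
      unfolding kop_def krein_proj_def
    proof (intro conjI allI impI)
      show "bop e" unfolding e_def[abs_def] by (rule bop_sum[OF bop_C1 bop_JDVD[OF bg]])
      show "B (e x) y = B x (e y)" for x y by (simp add: e_def Bsimps C1_B JDVD_sym[OF gW(2)])
      show "e (e x) = e x" for x
      proof -
        have gP: "g (P (D x)) = P (g (D x))" by (rule bic_comm[OF gW(1) bprojD(1)[OF P(1)]])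
        have "e (e x) = C1 (e x) + J (D (g (P (D x))))" by (subst e_def) (simp add: De)
        also have "C1 (e x) = C1 (C1 x) + J (D (ct (g (D x))))" by (simp add: e_def bop_lin[OF bop_C1] C1_JD)
        finally have "e (e x) = C1 (C1 x) + J (D (ct (g (D x)) + P (g (D x))))" by (simp add: gP JD_lin)
        also have "ct (g (D x)) + P (g (D x)) = tt (D x) + g (D x)" using g(1)[of "D x"] by (simp add: algebra_simps)
        finally show ?thesis using TT[of x] by (simp add: JD_lin e_def)
      qed
      show "e x = (if True then x else 0)" if k: "D x = 0" for x
        using T_zero(1)[OF k[unfolded D_zero]] k by (simp add: e_def bop_0[OF bg] JD_lin)
      show "X (e x) = e (X x)" if X: "resc X" for X x
        by (simp add: e_def bop_lin[OF resc_D(1)[OF X]] resc_D(2)[OF X] resc_JDVD[OF X gW(1)])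
    qed (rule De)
    show "abd e"
    proof (rule abdI[OF bop_JDVD[OF bW]])
      fix x
      let ?h = "D x"
      have 1: "R \<i> (J (D (W ?h))) = J (D (P (g ?h))) + scl \<i> (J (D (P ?h)))"
        unfolding R_i_JD g(3,4) by (simp add: JD_lin)
      have 2: "R \<i> (J (D (g ?h))) = J (D (P ?h)) - J (D (ct ?h)) + scl \<i> (J (D (ct (g ?h))))"
        unfolding R_i_JD g(2) by (simp add: JD_lin)
      have 3: "R \<i> (C1 x) = J (D (ct ?h)) + scl \<i> (C1 (C1 x))"
        by (simp add: R_i T_C1 ct_D J_D_D)
      have 4: "J (D (ct (g ?h))) + J (D (P (g ?h))) - J (D (g ?h)) = C1 x - C1 (C1 x)"
        using arg_cong[OF g(1)[of ?h], of "\<lambda>k. J (D k)"] by (simp add: JD_lin TT)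
      have "R \<i> (J (D (W ?h)) - scl \<i> (e x)) = R \<i> (J (D (W ?h))) - scl \<i> (R \<i> (C1 x) + R \<i> (J (D (g ?h))))"
        by (simp add: e_def bop_lin[OF R_bop])
      also have "\<dots> = J (D (P (g ?h))) + C1 (C1 x) + J (D (ct (g ?h)))"
        unfolding 1 2 3 by (simp add: scale_right_distrib scale_right_diff_distrib)
      also have "\<dots> = e x" using 4 by (simp add: e_def algebra_simps)
      finally show "(e x, J (D (W ?h))) \<in> A" by (rule A_R_i)
    qed
  qed
qed

lemma low_sub: assumes "low d U" "\<And>h. U (W h) = W h" shows "low d W"
  using assms unfolding low_def by metis

lemma QQ_low: assumes "a \<le> b" shows "\<exists>d. low d (QQ a b)"
  using ct_lower[OF assms, of "max \<bar>a\<bar> \<bar>b\<bar>"] by fastforce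

lemma QQ_same: "QQ a a h = 0"
  by (simp add: QQ_def)

lemma QQ_away: assumes "a < b" "0 < a \<or> b < 0"
  shows "\<exists>s1 s2. s1 < 0 \<and> 0 < s2 \<and> (\<forall>h. QQ a b (QQ s1 s2 h) = 0)"
proof (cases "0 < a")
  case True
  then have "QQ a b (QQ (- 1) a h) = 0" for h using assms(1) QQ_QQ[of a b "- 1" a h] by (simp add: QQ_same)
  then have "- 1 < (0::real) \<and> 0 < a \<and> (\<forall>h. QQ a b (QQ (- 1) a h) = 0)" using True by simp
  then show ?thesis by blast
next
  case False
  then have "QQ a b (QQ b 1 h) = 0" for h using assms QQ_QQ[of a b b 1 h] by (simp add: QQ_same)
  then have "b < 0 \<and> (0::real) < 1 \<and> (\<forall>h. QQ a b (QQ b 1 h) = 0)" using False assms by simp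
  then show ?thesis by blast
qed

text \<open>A cell that does not contain 0 is a definite cell. For one around 0 take the projection
  of \<open>zero_kop\<close>, remove the part \<open>U2\<close> of \<open>P\<close> outside the cell
  and add the part \<open>U1\<close> of the cell outside \<open>P\<close>; both parts avoid a
  neighbourhood of 0.\<close>

lemma cell_exists:
  assumes ab: "a < b" and nz: "a \<noteq> 0" "b \<noteq> 0"
  shows "\<exists>E. kop E (QQ a b) (a < 0 \<and> 0 < b) \<and> abd E"
proof (cases "a < 0 \<and> 0 < b")
  case False
  then have "0 < a \<or> b < 0" using nz by auto
  then obtain s1 s2 where s: "s1 < 0" "0 < s2" "\<And>h. QQ a b (QQ s1 s2 h) = 0" using QQ_away[OF ab] by blast
  obtain d where l: "low d (QQ a b)" using QQ_low ab by fastforce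
  have q: "bproj (QQ a b)" using bproj_QQ ab by simp
  obtain V where "kop (\<lambda>x. J (D (V (D x)))) (QQ a b) False" "abd (\<lambda>x. J (D (V (D x))))"
    by (rule definite_cell[OF q l s], rule that, assumption+)
  moreover have "(a < 0 \<and> 0 < b) = False" using False by blast
  ultimately show ?thesis by metis
next
  case True
  obtain e P where P: "bproj P" "low (1 / 2) P" and Pc: "\<And>h. Re (H (ct (h - P h)) (h - P h)) \<le> (nm (h - P h))\<^sup>2 / 2"
    and e: "kop e P True" "abd e" using zero_kop by metis
  note Pd = bprojD[OF P(1)]
  have q: "bproj (QQ a b)" using bproj_QQ ab by simp
  note qd = bprojD[OF q]
  have qP: "QQ a b (P h) = P (QQ a b h)" for h by (rule bic_comm[OF qd(1) Pd(1)])
  define U1 where "U1 h = QQ a b (h - P h)" for h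
  define U2 where "U2 h = P (h - QQ a b h)" for h
  have U1: "bproj U1" unfolding U1_def[abs_def] by (rule bproj_diff[OF q Pd(1-3)])
  have U2: "bproj U2" unfolding U2_def[abs_def] by (rule bproj_diff[OF P(1) qd(1-3)])
  obtain d where "low d (QQ a b)" using QQ_low ab by fastforce
  then have l1: "low d U1" by (rule low_sub) (simp add: U1_def qd(3))
  have l2: "low (1 / 2) U2" by (rule low_sub[OF P(2)]) (simp add: U2_def Pd(3))
  \<comment> \<open>Off the range of \<open>P\<close> the form of \<open>ct\<close> is at most 1/2,
    but it is at least 4/5 on spectral values between -1/2 and 1/2.\<close>
  have z1: "U1 (QQ (- (1 / 2)) (1 / 2) h) = 0" for h
  proof -
    let ?q = "QQ (- (1 / 2)) (1 / 2)"
    define k where "k = U1 (?q h)"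
    have bq: "bproj ?q" by (rule bproj_QQ) simp
    have qk: "?q k = k" unfolding k_def
      using bic_comm[OF bprojD(1)[OF bq] bprojD(1)[OF U1], of "?q h"] by (simp add: bprojD(3)[OF bq])
    have "P k = 0" unfolding k_def U1_def
      by (simp add: qP[symmetric] bop_lin[OF Pd(5)] Pd(3) bop_0[OF qd(5)])
    then have "Re (H (ct k) k) \<le> (nm k)\<^sup>2 / 2" using Pc[of k] by simp
    moreover have "low (1 / (1 + (1 / 2)\<^sup>2)) ?q" by (rule ct_lower) simp_all
    then have "1 / (1 + (1 / 2)\<^sup>2) * (nm k)\<^sup>2 \<le> Re (H (ct k) k)" unfolding low_def using qk by metis
    ultimately have "(nm k)\<^sup>2 \<le> 0" by (simp add: power2_eq_square)
    then show ?thesis using nm_eq_0[of k] by (simp add: k_def)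
  qed
  have z2: "U2 (QQ a b h) = 0" for h by (simp add: U2_def qd(3) bop_0[OF Pd(5)])
  obtain E1 where E1: "kop E1 U1 False" "abd E1"
    using definite_cell[OF U1 l1 _ _ z1] by (metis half_gt_zero_iff neg_less_0_iff_less zero_less_one)
  obtain E2 where E2: "kop E2 U2 False" "abd E2"
    using definite_cell[OF U2 l2 _ _ z2] True by metis
  note F = kop_prod[OF e(1) kop_compl[OF E2(1)]]
  note G = kop_union[OF F E1(1)]
  have "abd (\<lambda>x. e (x - E2 x))"
    by (rule abd_comp[OF e(2) kopD(5)[OF e(1)] bop_minus[OF bop_id kopD(5)[OF E2(1)]]])
  from abd_union[OF this kopD(5)[OF F] E1(2) kopD(5)[OF E1(1)]]
  have ab: "abd (\<lambda>x. e (x - E2 x) + E1 x - e (E1 x - E2 (E1 x)))" .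
  have "kop (\<lambda>x. e (x - E2 x) + E1 x - e (E1 x - E2 (E1 x))) (QQ a b) (a < 0 \<and> 0 < b)"
  proof (rule kop_cong[OF G])
    show "h - (h - P (h - U2 h) - U1 (h - P (h - U2 h))) = QQ a b h" for h
    proof -
      have 1: "P (h - U2 h) = P (QQ a b h)"
        by (simp add: U2_def bop_lin[OF Pd(5)] Pd(3))
      have 2: "U1 (P (QQ a b h)) = 0"
        by (simp add: U1_def bop_lin[OF qd(5)] Pd(3))
      show ?thesis unfolding 1 bop_diff[OF bprojD(5)[OF U1]] 2
        by (simp add: U1_def bop_lin[OF qd(5)] qP)
    qed
    show "(True \<and> \<not> False \<or> False) = (a < 0 \<and> 0 < b)" using True by simp
  qed
  then show ?thesis using ab by blast
qed

text \<open>Here \<open>e a b\<close> is the spectral projection of the interval \<open>{a<..b}\<close>.\<close>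

definition "UU a b h = (if a < b then QQ a b h else 0)"
definition "e a b = (if a < b then SOME E. kop E (QQ a b) (a < 0 \<and> 0 < b) \<and> abd E else (\<lambda>x. 0))"

lemma e_kop: "a \<noteq> 0 \<Longrightarrow> b \<noteq> 0 \<Longrightarrow> kop (e a b) (UU a b) (a < 0 \<and> 0 < b)"
  and e_abd: "a \<noteq> 0 \<Longrightarrow> b \<noteq> 0 \<Longrightarrow> abd (e a b)"
proof -
  assume nz: "a \<noteq> 0" "b \<noteq> 0"
  have "kop (e a b) (UU a b) (a < 0 \<and> 0 < b) \<and> abd (e a b)"
  proof (cases "a < b")
    case True
    have UU: "UU a b = QQ a b" using True by (simp add: UU_def fun_eq_iff)
    show ?thesis unfolding e_def UU using someI_ex[OF cell_exists[OF True nz]] True by simp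
  next
    case False
    have "kop (\<lambda>x. 0) (\<lambda>h. 0) (a < 0 \<and> 0 < b)"
      by (rule kop_cong[OF kop_zero]) (use False in auto)
    then show ?thesis using abd_zero False unfolding e_def UU_def by simp
  qed
  then show "kop (e a b) (UU a b) (a < 0 \<and> 0 < b)" "abd (e a b)" by blast+
qed

lemmas e_bop = kopD(5)[OF e_kop] and e_B = kopD(7)[OF e_kop] and e_D = kopD(2)[OF e_kop]

lemma e_triv: "b \<le> a \<Longrightarrow> e a b x = 0"
  by (simp add: e_def)

lemma e_e:
  assumes "a \<noteq> 0" "b \<noteq> 0" "c \<noteq> 0" "d \<noteq> 0"
  shows "e a b (e c d x) = e (max a c) (min b d) x"
proof (rule kop_unique[of "\<lambda>x. e a b (e c d x)" _ _ "e (max a c) (min b d)"])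
  show "kop (\<lambda>x. e a b (e c d x)) (\<lambda>h. UU a b (UU c d h)) ((a < 0 \<and> 0 < b) \<and> (c < 0 \<and> 0 < d))"
    by (rule kop_prod[OF e_kop[OF assms(1,2)] e_kop[OF assms(3,4)]])
  have nz: "max a c \<noteq> 0" "min b d \<noteq> 0" using assms by (auto simp: max_def min_def)
  show "kop (e (max a c) (min b d)) (\<lambda>h. UU a b (UU c d h)) ((a < 0 \<and> 0 < b) \<and> (c < 0 \<and> 0 < d))"
  proof (rule kop_cong[OF e_kop[OF nz]])
    show "UU (max a c) (min b d) h = UU a b (UU c d h)" for h
    proof (cases "a < b \<and> c < d")
      case True
      then have "QQ a b (QQ c d h) = (if max a c \<le> min b d then QQ (max a c) (min b d) h else 0)"
        by (intro QQ_QQ) auto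
      then show ?thesis using True unfolding UU_def
        by (cases "max a c = min b d") (auto simp: QQ_same)
    next
      case False
      have q0: "QQ a b 0 = 0" unfolding QQ_def by (simp add: bop_0[OF bo_Q])
      from False show ?thesis unfolding UU_def by (auto simp: q0)
    qed
  qed auto
qed

lemma e_add:
  assumes "a \<noteq> 0" "b \<noteq> 0" "c \<noteq> 0" "a \<le> c" "c \<le> b"
  shows "e a c x + e c b x = e a b x"
proof -
  have z: "e a c (e c b x) = 0" for x
    using e_e[of a c c b x] assms e_triv[of c c] by (simp add: max_def min_def split: if_splits)
  have u0: "UU c b 0 = 0" "UU a c 0 = 0" unfolding UU_def QQ_def by (simp_all add: bop_0[OF bo_Q])
  have "e a c x + e c b x - e a c (e c b x) = e a b x"
  proof (rule kop_unique[of "\<lambda>x. e a c x + e c b x - e a c (e c b x)" _ _ "e a b", OF kop_union[OF e_kop e_kop]])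
    show "kop (e a b) (\<lambda>h. h - (h - UU a c h - UU c b (h - UU a c h))) (a < 0 \<and> 0 < c \<or> c < 0 \<and> 0 < b)"
    proof (rule kop_cong[OF e_kop])
      show "UU a b h = h - (h - UU a c h - UU c b (h - UU a c h))" for h
        using assms by (auto simp: UU_def QQ_def bop_lin[OF bo_Q] Q_Q min_def)
    qed (use assms in auto)
  qed (use assms in auto)
  then show ?thesis by (simp add: z)
qed

lemma e_form:
  assumes ab: "a < b" "0 < a \<or> b < 0"
  obtains V where "bic V" "saop V" "\<And>h. tt (V h) = QQ a b h" "\<And>h. QQ a b (V h) = V h"
    "\<And>x. e a b x = J (D (V (D x)))"
proof -
  obtain s1 s2 where s: "s1 < 0" "0 < s2" "\<And>h. QQ a b (QQ s1 s2 h) = 0" using QQ_away[OF ab] by blast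
  obtain d where l: "low d (QQ a b)" using QQ_low ab by fastforce
  have q: "bproj (QQ a b)" using bproj_QQ ab by simp
  obtain V where V: "bic V" "saop V" "\<And>h. tt (V h) = QQ a b h" "\<And>h. QQ a b (V h) = V h"
    "kop (\<lambda>x. J (D (V (D x)))) (QQ a b) False"
    by (rule definite_cell[OF q l s], rule that, assumption+)
  have "kop (e a b) (QQ a b) False"
    by (rule kop_cong[OF e_kop]) (use ab in \<open>auto simp: UU_def\<close>)
  from kop_unique[OF this V(5)] show thesis using that V(1-4) by blast
qed

text \<open>The form equals \<open>H (tt k) k\<close> for \<open>k = V (D x)\<close>, and
  \<open>tt = Cl s + s ct\<close> with \<open>s\<close> the endpoint nearer to 0 shows the sign of
  \<open>tt\<close> on the cell.\<close>

lemma e_definite: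
  assumes "a < b" "0 < a \<and> \<sigma> = 1 \<or> b < 0 \<and> \<sigma> = (-1::real)"
  shows "0 \<le> \<sigma> * Re (B (e a b x) x)"
proof -
  obtain V where V: "bic V" "saop V" "\<And>h. tt (V h) = QQ a b h" "\<And>h. QQ a b (V h) = V h"
    "\<And>x. e a b x = J (D (V (D x)))" using e_form[of a b] assms by metis
  define k where "k = V (D x)"
  have k: "QQ a b k = k" by (simp add: k_def V(4))
  have "B (e a b x) x = H k (D x)" by (simp add: V(5) k_def saopH[OF saop_D] flip: HJ1) (simp add: B_H J_J saopH[OF saop_D])
  also have "\<dots> = H (V (QQ a b (D x))) (D x)"
    using bic_comm[OF V(1) bprojD(1)[OF bproj_QQ], of a b "D x"] assms(1) V(4) by (simp add: k_def)
  also have "\<dots> = H (tt k) k"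
    using saopH[OF V(2), of "tt k" "D x"] V(3)[of "D x"] by (simp add: k_def)
  finally have eq: "B (e a b x) x = H (tt k) k" .
  have ctk: "0 \<le> Re (H (ct k) k)" by (rule posop_ge[OF posop_ct])
  have "Re (H (tt k) k) = Re (H (Cl s k) k) + s * Re (H (ct k) k)" for s
    using Cl_shift[of s k 0] by (simp add: Cl_def)
  then show ?thesis using QQ_range[OF _ k] assms ctk unfolding eq
    by (smt (verit) mult_nonneg_nonneg mult_minus_left mult_less_0_iff)
qed

end

section \<open>Definite ranges as Hilbert spaces\<close>

context krein
begin

text \<open>By \<open>definite_bound\<close> the norm of the form is equivalent to the Hilbert norm
  on the range, and the range is closed, being the fixed space of \<open>P\<close>.\<close>

lemma definite_range_hilbert:
  assumes P: "krein_proj P" and d: "definite_range \<sigma> P"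
  shows "hilbert_space scl (range P) (\<lambda>x y. of_real \<sigma> * B x y)"
proof -
  note Pd = krein_projD[OF P]
  let ?h = "\<lambda>x y. of_real \<sigma> * B x y"
  obtain C where C: "C > 0" "\<And>x. (nm (P x))\<^sup>2 \<le> C * (\<sigma> * Re (B (P x) x))"
    using definite_bound[OF P d] by blast
  have s: "\<bar>\<sigma>\<bar> = 1" using d unfolding definite_range_def by auto
  have fixd: "P x = x" if "x \<in> range P" for x using that Pd(3) by auto
  have rng: "x \<in> range P" if "P x = x" for x using that by (metis rangeI)
  have bd: "(nm x)\<^sup>2 \<le> C * Re (?h x x)" if "x \<in> range P" for x using C(2)[of x] fixd[OF that] by simp
  have sub: "subspace (range P)"
  proof (rule subspaceI)
    show "0 \<in> range P" by (rule rng) (rule bop_0[OF Pd(1)])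
    show "x + y \<in> range P" if xy: "x \<in> range P" "y \<in> range P" for x y
      by (rule rng) (simp add: bop_add[OF Pd(1)] fixd[OF xy(1)] fixd[OF xy(2)])
    show "scl c x \<in> range P" if x: "x \<in> range P" for c x
      by (rule rng) (simp add: bop_scl[OF Pd(1)] fixd[OF x])
  qed
  have ip: "inner_product_on scl (range P) ?h"
    unfolding inner_product_on_def
  proof (intro conjI ballI impI)
    show "sesquilinear_on scl (range P) ?h" unfolding sesquilinear_on_def by (simp add: Bsimps algebra_simps)
    show "hermitian_on (range P) ?h" unfolding hermitian_on_def by (simp add: Bcnj)
    show "0 < Re (?h x x)" if x: "x \<in> range P" "x \<noteq> 0" for x
    proof -
      have "0 < (nm x)\<^sup>2" using x(2) nm_eq_0[of x] by simp
      then have "0 < C * Re (?h x x)" using bd[OF x(1)] by linarith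
      then show ?thesis using C(1) by (simp add: zero_less_mult_iff)
    qed
  qed
  interpret M: Metric_space "range P" "ip_dist (range P) ?h"
    by (rule inner_product_metric[OF vector_space_axioms sub ip])
  have nmsq: "(ip_norm ?h x)\<^sup>2 = Re (?h x x)" if "x \<in> range P" for x
  proof -
    have "0 \<le> C * Re (?h x x)" using bd[OF that] zero_le_power2[of "nm x"] by linarith
    then show ?thesis using C(1) by (simp add: ip_norm_def zero_le_mult_iff)
  qed
  have le1: "nm x \<le> sqrt C * ip_norm ?h x" if x: "x \<in> range P" for x
  proof (rule power2_le_imp_le)
    show "(nm x)\<^sup>2 \<le> (sqrt C * ip_norm ?h x)\<^sup>2" using bd[OF x] nmsq[OF x] C(1) by (simp add: power_mult_distrib)
    have "0 \<le> C * Re (?h x x)" using bd[OF x] zero_le_power2[of "nm x"] by linarith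
    then have "0 \<le> ip_norm ?h x" using C(1) by (simp add: ip_norm_def zero_le_mult_iff)
    then show "0 \<le> sqrt C * ip_norm ?h x" using C(1) by simp
  qed
  have le2: "ip_norm ?h x \<le> nm x" if x: "x \<in> range P" for x
  proof (rule power2_le_imp_le)
    have "\<sigma> * Re (B x x) \<le> \<bar>\<sigma>\<bar> * \<bar>Re (B x x)\<bar>" by (simp add: abs_mult[symmetric])
    also have "\<dots> \<le> nm x * nm x" using Re_B_bound[of x x] s by simp
    finally show "(ip_norm ?h x)\<^sup>2 \<le> (nm x)\<^sup>2" unfolding nmsq[OF x] by (simp add: power2_eq_square)
  qed simp
  have "M.mcomplete"
    unfolding M.mcomplete_def
  proof (intro allI impI)
    fix X assume X: "M.MCauchy X"
    have XP: "X n \<in> range P" for n using X unfolding M.MCauchy_def by blast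
    have Xd: "X m - X n \<in> range P" for m n by (rule subspace_diff[OF sub XP XP])
    obtain l where l: "conv X l"
    proof (rule complete)
      fix e :: real assume e: "e > 0"
      have "e / sqrt C > 0" using e C(1) by simp
      then obtain N where N: "\<And>n n'. N \<le> n \<Longrightarrow> N \<le> n' \<Longrightarrow> ip_dist (range P) ?h (X n) (X n') < e / sqrt C"
        using X unfolding M.MCauchy_def by blast
      have "nm (X m - X n) < e" if mn: "m \<ge> N" "n \<ge> N" for m n
      proof -
        have "ip_norm ?h (X m - X n) < e / sqrt C" using N[OF mn] XP by (simp add: ip_dist_def)
        then have "sqrt C * ip_norm ?h (X m - X n) < e" using C(1) by (simp add: pos_less_divide_eq mult.commute)
        then show ?thesis using le1[OF Xd, of m n] by linarith
      qed
      then show "\<exists>N. \<forall>m\<ge>N. \<forall>n\<ge>N. nm (X m - X n) < e" by blast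
    qed simp
    have "conv X (P l)" using bop_conv[OF Pd(1) l] fixd[OF XP] by simp
    then have lP: "l \<in> range P" using conv_unique[OF l] rng by metis
    have "(\<lambda>n. ip_dist (range P) ?h (X n) l) \<longlonglongrightarrow> 0"
    proof (rule null_sequence_bound)
      show "norm (ip_dist (range P) ?h (X n) l) \<le> nm (X n - l)" for n
        using le2[OF subspace_diff[OF sub XP lP], of n] M.nonneg[of "X n" l] XP lP by (simp add: ip_dist_def)
      show "(\<lambda>n. nm (X n - l)) \<longlonglongrightarrow> 0" using l unfolding conv_def by blast
    qed
    then show "\<exists>x. limitin M.mtopology X x sequentially"
      unfolding M.limitin_metric_dist_null using lP XP by (intro exI[of _ l]) simp
  qed
  then show ?thesis unfolding hilbert_space_def using sub ip by blast
qed

end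

section \<open>Finite unions of intervals\<close>

type_synonym intervals = "(real \<times> real) list"

definition nzl :: "intervals \<Rightarrow> bool" where "nzl l \<longleftrightarrow> (\<forall>(a, b)\<in>set l. a \<noteq> 0 \<and> b \<noteq> 0)"
definition opn :: "intervals \<Rightarrow> real set" where "opn l = (\<Union>(a, b)\<in>set l. {a<..<b})"
definition clo :: "intervals \<Rightarrow> real set" where "clo l = (\<Union>(a, b)\<in>set l. {a..b})"

text \<open>Endpoints are immaterial, and intervals with \<open>b \<le> a\<close> carry the zero projection.\<close>

definition rep :: "real set \<Rightarrow> intervals \<Rightarrow> bool" where
  "rep S l \<longleftrightarrow> nzl l \<and> opn l \<subseteq> S \<and> S \<subseteq> clo l"

text \<open>Pieces with reversed endpoints may arise. They are empty in \<open>opn\<close> and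
  \<open>clo\<close> and carry the zero projection, so they are kept.\<close>

definition cut :: "real \<times> real \<Rightarrow> intervals \<Rightarrow> intervals" where
  "cut J l = concat (map (\<lambda>(a, b). [(a, min b (fst J)), (max a (snd J), b)]) l)"

lemma cut:
  assumes "nzl l" "fst J \<noteq> 0" "snd J \<noteq> 0"
  shows "nzl (cut J l)" "opn (cut J l) \<subseteq> opn l - {fst J..snd J}" "clo l - {fst J<..<snd J} \<subseteq> clo (cut J l)"
proof -
  show "nzl (cut J l)" using assms by (auto simp: nzl_def cut_def min_def max_def split: if_splits)
  show "opn (cut J l) \<subseteq> opn l - {fst J..snd J}" by (fastforce simp: opn_def cut_def)
  show "clo l - {fst J<..<snd J} \<subseteq> clo (cut J l)"
  proof
    fix x assume x: "x \<in> clo l - {fst J<..<snd J}"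
    then obtain a b where ab: "(a, b) \<in> set l" "x \<in> {a..b}" unfolding clo_def by auto
    have "x \<in> {a..min b (fst J)} \<or> x \<in> {max a (snd J)..b}" using x ab by auto
    moreover have "(a, min b (fst J)) \<in> set (cut J l)" "(max a (snd J), b) \<in> set (cut J l)"
      using ab(1) by (force simp: cut_def)+
    ultimately show "x \<in> clo (cut J l)" unfolding clo_def by blast
  qed
qed

lemma rep_diff:
  assumes "rep S l" "rep S' l'" shows "\<exists>m. rep (S - S') m"
proof -
  have "nzl l' \<Longrightarrow> \<exists>m. nzl m \<and> opn m \<subseteq> opn l - clo l' \<and> clo l - opn l' \<subseteq> clo m" for l'
  proof (induction l')
    case Nil
    show ?case using assms(1) by (auto simp: rep_def clo_def opn_def)
  next
    case (Cons J t)
    obtain m where m: "nzl m" "opn m \<subseteq> opn l - clo t" "clo l - opn t \<subseteq> clo m"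
      using Cons unfolding nzl_def by auto
    have J: "fst J \<noteq> 0" "snd J \<noteq> 0" using Cons.prems unfolding nzl_def by auto
    have "clo (J # t) = {fst J..snd J} \<union> clo t" "opn (J # t) = {fst J<..<snd J} \<union> opn t"
      by (auto simp: clo_def opn_def split: prod.splits)
    then show ?case using cut[OF m(1) J] m by (intro exI[of _ "cut J m"]) blast
  qed
  then obtain m where "nzl m" "opn m \<subseteq> opn l - clo l'" "clo l - opn l' \<subseteq> clo m"
    using assms(2) unfolding rep_def by blast
  then show ?thesis using assms unfolding rep_def by blast
qed

lemma rep_union: "rep S l \<Longrightarrow> rep S' l' \<Longrightarrow> rep (S \<union> S') (l @ l')"
  unfolding rep_def nzl_def opn_def clo_def by auto

lemma rep_inter: assumes "rep S l" "rep S' l'" shows "\<exists>m. rep (S \<inter> S') m"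
proof -
  obtain m where "rep (S - S') m" using rep_diff[OF assms] by blast
  from rep_diff[OF assms(1) this] show ?thesis by (simp add: Diff_Diff_Int)
qed

lemma rep_empty: "rep {} []"
  by (simp add: rep_def nzl_def opn_def clo_def)

lemma rep_nz_interval: assumes "J \<in> nz_intervals" shows "\<exists>l. rep J l"
proof -
  obtain a b where "a \<noteq> 0" "b \<noteq> 0" "J \<in> {{a..b}, {a..<b}, {a<..b}, {a<..<b}}"
    using assms unfolding nz_intervals_def by blast
  moreover from this have "{a<..<b} \<subseteq> J" "J \<subseteq> {a..b} \<or> J = {}" by auto
  ultimately have "rep J [(a, b)]" unfolding rep_def nzl_def opn_def clo_def by auto
  then show ?thesis by blast
qed

lemma rep_interval: "a \<noteq> 0 \<Longrightarrow> b \<noteq> 0 \<Longrightarrow> rep {a..b} [(a, b)]"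
  by (auto simp: rep_def nzl_def opn_def clo_def)

lemma rep_Union: "finite F \<Longrightarrow> F \<subseteq> nz_intervals \<Longrightarrow> \<exists>l. rep (\<Union>F) l"
proof (induction F rule: finite_induct)
  case empty
  show ?case using rep_empty by auto
next
  case (insert J F)
  then show ?case using rep_nz_interval[of J] rep_union by (metis Union_insert insert_subset)
qed

lemma spectral_ring_cases:
  assumes "\<Delta> \<in> spectral_ring"
  obtains S l where "rep S l" "\<Delta> = Some ` S" | S l where "rep S l" "\<Delta> = - (Some ` S)"
proof -
  obtain F where F: "finite F" "F \<subseteq> nz_intervals" "\<Delta> = Some ` \<Union>F \<or> \<Delta> = - (Some ` \<Union>F)"
    using assms unfolding spectral_ring_def by blast
  obtain l where "rep (\<Union>F) l" using rep_Union[OF F(1,2)] by blast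
  then show thesis using F(3) that by blast
qed

text \<open>A set that omits \<open>None\<close> cannot be the complement of a set of reals.\<close>

lemma spectral_ring_bounded:
  assumes "Some ` S \<in> spectral_ring" obtains l where "rep S l"
proof (rule spectral_ring_cases[OF assms])
  fix S' l assume "rep S' l" "Some ` S = Some ` S'"
  then show thesis using that by (metis inj_Some inj_image_eq_iff)
next
  fix S' :: "real set" assume "Some ` S = - (Some ` S')"
  then show thesis by (metis ComplI image_iff option.distinct(1))
qed

section \<open>Projections of finite unions of intervals\<close>

context nonneg_krein
begin

primrec EL :: "intervals \<Rightarrow> 'a \<Rightarrow> 'a" where
  "EL [] x = 0"
| "EL (p # l) x = e (fst p) (snd p) x + EL l x - e (fst p) (snd p) (EL l x)"

lemma EL_kop: "nzl l \<Longrightarrow> \<exists>Q' b. kop (EL l) Q' b" and EL_abd: "nzl l \<Longrightarrow> abd (EL l)"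
proof -
  have "nzl l \<Longrightarrow> (\<exists>Q' b. kop (EL l) Q' b) \<and> abd (EL l)" for l
  proof (induction l)
    case Nil
    have "EL [] = (\<lambda>x. 0)" by (simp add: fun_eq_iff)
    then show ?case using kop_zero abd_zero by metis
  next
    case (Cons p l)
    obtain Q' b where k: "kop (EL l) Q' b" and a: "abd (EL l)" using Cons unfolding nzl_def by auto
    have p: "fst p \<noteq> 0" "snd p \<noteq> 0" using Cons.prems unfolding nzl_def by auto
    have eq: "EL (p # l) = (\<lambda>x. e (fst p) (snd p) x + EL l x - e (fst p) (snd p) (EL l x))" by (simp add: fun_eq_iff)
    show ?case unfolding eq using kop_union[OF e_kop[OF p] k] abd_union[OF e_abd[OF p] e_bop[OF p] a kopD(5)[OF k]] by blast
  qed
  then show "nzl l \<Longrightarrow> \<exists>Q' b. kop (EL l) Q' b" "nzl l \<Longrightarrow> abd (EL l)" by blast+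
qed

lemma EL_bop: "nzl l \<Longrightarrow> bop (EL l)" and EL_proj: "nzl l \<Longrightarrow> krein_proj (EL l)" and EL_resc: "nzl l \<Longrightarrow> resc (EL l)"
  and EL_commute: "nzl l \<Longrightarrow> resc X \<Longrightarrow> X (EL l x) = EL l (X x)"
  using EL_kop kopD(1,4,5,8) by metis+

lemma EL_idem: "nzl l \<Longrightarrow> EL l (EL l x) = EL l x" and EL_B: "nzl l \<Longrightarrow> B (EL l x) y = B x (EL l y)"
  using krein_projD(2,3)[OF EL_proj] by blast+

lemma nzl_Cons: "nzl ((a, b) # l) \<longleftrightarrow> a \<noteq> 0 \<and> b \<noteq> 0 \<and> nzl l"
  by (auto simp: nzl_def)

lemma e_resc: "a \<noteq> 0 \<Longrightarrow> b \<noteq> 0 \<Longrightarrow> resc (e a b)"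
  by (rule kopD(8)[OF e_kop])

lemma EL_append:
  assumes "nzl l" "nzl l'" shows "EL (l @ l') x = EL l x + EL l' x - EL l (EL l' x)"
  using assms(1)
proof (induction l)
  case (Cons p l)
  obtain a b where p: "p = (a, b)" by force
  have ab: "a \<noteq> 0" "b \<noteq> 0" and l: "nzl l" using Cons.prems by (auto simp: p nzl_Cons)
  show ?case using Cons.IH[OF l] by (simp add: p bop_lin[OF e_bop[OF ab]])
qed simp

text \<open>The interval is cut at the endpoints of the first listed interval: the middle piece is
  absorbed by that interval, the outer two are covered by the rest of the list.\<close>

lemma covering:
  assumes "nzl m" "a \<noteq> 0" "b \<noteq> 0" "{a<..<b} \<subseteq> clo m"
  shows "EL m (e a b x) = e a b x"
  using assms
proof (induction m arbitrary: a b x)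
  case Nil
  then have "b \<le> a" by (metis clo_def UN_empty empty_set greaterThanLessThan_empty_iff subset_empty)
  then show ?case by (simp add: e_triv)
next
  case (Cons p t)
  obtain c d where p: "p = (c, d)" by force
  have cd: "c \<noteq> 0" "d \<noteq> 0" and t: "nzl t" using Cons.prems(1) by (auto simp: p nzl_Cons)
  note ecd = bop_lin[OF e_bop[OF cd]] and tl = bop_lin[OF EL_bop[OF t]]
  have cov: "{a<..<b} \<subseteq> {c..d} \<union> clo t" using Cons.prems(4) by (simp add: p clo_def)
  have by_t: "EL (p # t) y = y" if "EL t y = y" for y using that by (simp add: p)
  have by_p: "EL (p # t) y = y" if "e c d y = y" for y
    using that EL_commute[OF t e_resc[OF cd], of y] by (simp add: p)
  show ?case
  proof (cases "a < b")
    case True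
    \<comment> \<open>\<open>c1\<close> and \<open>d1\<close> are the endpoints of \<open>p\<close>
      clamped into \<open>[a, b]\<close> in the right order, so that empty pieces require no
      separate cases.\<close>
    define c1 where "c1 = min b (max a c)"
    define d1 where "d1 = max c1 (min b d)"
    have nz: "c1 \<noteq> 0" "d1 \<noteq> 0" using Cons.prems cd by (auto simp: c1_def d1_def min_def max_def)
    have ord: "a \<le> c1" "c1 \<le> d1" "d1 \<le> b" using True by (auto simp: c1_def d1_def)
    have s: "e a b x = e a c1 x + (e c1 d1 x + e d1 b x)"
      using e_add[of a b c1 x] e_add[of c1 b d1 x] nz ord Cons.prems by simp
    have 1: "EL t (e a c1 x) = e a c1 x"
    proof (rule Cons.IH[OF t])
      show "{a<..<c1} \<subseteq> clo t"
      proof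
        fix y assume "y \<in> {a<..<c1}"
        then have "y \<in> {a<..<b}" "y < c" by (auto simp: c1_def)
        then show "y \<in> clo t" using cov by auto
      qed
    qed (use Cons.prems nz in auto)
    have 3: "EL t (e d1 b x) = e d1 b x"
    proof (rule Cons.IH[OF t])
      show "{d1<..<b} \<subseteq> clo t"
      proof
        fix y assume "y \<in> {d1<..<b}"
        then have "y \<in> {a<..<b}" "d < y" using ord by (auto simp: d1_def)
        then show "y \<in> clo t" using cov by auto
      qed
    qed (use Cons.prems nz in auto)
    have 2: "e c d (e c1 d1 x) = e c1 d1 x"
    proof (cases "c1 < d1")
      case False
      then show ?thesis by (simp add: e_triv ecd)
    next
      case True
      then have "c \<le> c1" "d1 \<le> d" by (auto simp: c1_def d1_def)
      then show ?thesis using e_e[OF cd nz] by (simp add: max_absorb2 min_absorb2)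
    qed
    show ?thesis unfolding s bop_add[OF EL_bop[OF Cons.prems(1)]] by_t[OF 1] by_t[OF 3] by_p[OF 2] ..
  next
    case False
    then show ?thesis by (simp add: e_triv ecd tl)
  qed
qed

text \<open>The inserted \<open>V\<close> makes the lemma applicable to the left factor of a
  product, as in \<open>Es_Int\<close>.\<close>

lemma absorb:
  assumes l: "nzl l" and Y: "resc Y" and abs: "\<And>a b x. (a, b) \<in> set l \<Longrightarrow> Y (e a b (V x)) = e a b (V x)"
  shows "Y (EL l (V x)) = EL l (V x)"
  using l abs
proof (induction l)
  case Nil
  show ?case by (simp add: bop_0[OF resc_D(1)[OF Y]])
next
  case (Cons p l)
  obtain a b where p: "p = (a, b)" by force
  have ab: "a \<noteq> 0" "b \<noteq> 0" and l: "nzl l" using Cons.prems(1) by (auto simp: p nzl_Cons)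
  have IH: "Y (EL l (V x)) = EL l (V x)" by (rule Cons.IH[OF l]) (use Cons.prems(2) in auto)
  have h: "Y (e a b (V x)) = e a b (V x)" using Cons.prems(2) by (simp add: p)
  have c: "Y (e a b z) = e a b (Y z)" for z by (rule kopD(4)[OF e_kop[OF ab] Y])
  show ?case by (simp add: p bop_lin[OF resc_D(1)[OF Y]] IH h c[of "EL l (V x)"])
qed

lemma EL_mono:
  assumes "nzl l" "nzl m" "opn l \<subseteq> clo m" shows "EL m (EL l x) = EL l x"
proof -
  have "EL m ((\<lambda>x. EL l ((\<lambda>x. x) x)) x) = EL l ((\<lambda>x. x) x)"
  proof (rule absorb[OF assms(1) EL_resc[OF assms(2)], of "\<lambda>x. x", simplified])
    fix a b x assume ab: "(a, b) \<in> set l"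
    show "EL m (e a b x) = e a b x"
    proof (rule covering[OF assms(2)])
      show "{a<..<b} \<subseteq> clo m" using ab assms(3) unfolding opn_def by blast
    qed (use ab assms(1) in \<open>auto simp: nzl_def\<close>)
  qed
  then show ?thesis by simp
qed

definition "Es S = EL (SOME l. rep S l)"

text \<open>Representations of the same set differ only in endpoints. By \<open>EL_mono\<close> each
  projection absorbs the other, and since they commute they agree.\<close>

lemma Es_eq: assumes "rep S l" shows "Es S x = EL l x"
proof -
  define m where "m = (SOME l. rep S l)"
  have m: "rep S m" unfolding m_def using assms by (rule someI)
  have n: "nzl l" "nzl m" using assms m unfolding rep_def by blast+
  have 1: "EL m (EL l x) = EL l x" by (rule EL_mono[OF n]) (use assms m in \<open>auto simp: rep_def\<close>)
  have 2: "EL l (EL m x) = EL m x" by (rule EL_mono[OF n(2,1)]) (use assms m in \<open>auto simp: rep_def\<close>)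
  show ?thesis using 1 2 EL_commute[OF n(1) EL_resc[OF n(2)], of x] unfolding Es_def m_def by simp
qed

lemma Es_interval: "a \<noteq> 0 \<Longrightarrow> b \<noteq> 0 \<Longrightarrow> Es {a..b} x = e a b x"
  using Es_eq[OF rep_interval] by (simp add: bop_0[OF e_bop])

lemma Es_empty: "Es {} x = 0"
  using Es_eq[OF rep_empty] by simp

lemma Es_Un: assumes "rep S l" "rep S' l'" shows "Es (S \<union> S') x = Es S x + Es S' x - Es S (Es S' x)"
  using Es_eq[OF rep_union[OF assms]] Es_eq[OF assms(1)] Es_eq[OF assms(2)] EL_append assms unfolding rep_def by simp

text \<open>The two sides absorb each other: cell by cell, a product of two interval projections
  belongs to an interval whose interior lies in \<open>S \<inter> S'\<close>.\<close>

lemma Es_Int: assumes "rep S l" "rep S' l'" shows "Es (S \<inter> S') x = Es S (Es S' x)"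
proof -
  obtain m where m: "rep (S \<inter> S') m" using rep_inter[OF assms] by blast
  have n: "nzl l" "nzl l'" "nzl m" using assms m unfolding rep_def by blast+
  have s: "opn l \<subseteq> S" "opn l' \<subseteq> S'" "S \<inter> S' \<subseteq> clo m" "opn m \<subseteq> S \<inter> S'" "S \<subseteq> clo l" "S' \<subseteq> clo l'"
    using assms m unfolding rep_def by blast+
  have cell: "EL m (e a b (e c d x)) = e a b (e c d x)" if ab: "(a, b) \<in> set l" and cd: "(c, d) \<in> set l'" for a b c d x
  proof -
    have nz: "a \<noteq> 0" "b \<noteq> 0" "c \<noteq> 0" "d \<noteq> 0" using ab cd n unfolding nzl_def by auto
    have "{a<..<b} \<subseteq> S" "{c<..<d} \<subseteq> S'" using s(1,2) ab cd unfolding opn_def by auto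
    moreover have "{max a c<..<min b d} = {a<..<b} \<inter> {c<..<d}" by auto
    ultimately have "{max a c<..<min b d} \<subseteq> clo m" using s(3) by blast
    moreover have "max a c \<noteq> 0" "min b d \<noteq> 0" using nz by (auto simp: max_def min_def)
    ultimately show ?thesis unfolding e_e[OF nz] using covering[OF n(3)] by blast
  qed
  have inner: "EL m (EL l' (e a b x)) = EL l' (e a b x)" if ab: "(a, b) \<in> set l" for a b x
  proof (rule absorb[OF n(2) EL_resc[OF n(3)], where V="e a b"])
    fix c d x assume cd: "(c, d) \<in> set l'"
    have nz: "a \<noteq> 0" "b \<noteq> 0" "c \<noteq> 0" "d \<noteq> 0" using ab cd n unfolding nzl_def by auto
    show "EL m (e c d (e a b x)) = e c d (e a b x)"
      using cell[OF ab cd, of x] kopD(4)[OF e_kop[OF nz(1,2)] e_resc[OF nz(3,4)], of x] by simp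
  qed
  have "EL m (EL l (EL l' x)) = EL l (EL l' x)"
  proof (rule absorb[OF n(1) EL_resc[OF n(3)], where V="EL l'"])
    fix a b x assume ab: "(a, b) \<in> set l"
    have nz: "a \<noteq> 0" "b \<noteq> 0" using ab n unfolding nzl_def by auto
    show "EL m (e a b (EL l' x)) = e a b (EL l' x)"
      using inner[OF ab, of x] EL_commute[OF n(2) e_resc[OF nz], of x] by simp
  qed
  moreover have "EL l (EL l' (EL m x)) = EL m x"
  proof -
    have "EL l' (EL m x) = EL m x" by (rule EL_mono[OF n(3,2)]) (use s in blast)
    moreover have "EL l (EL m x) = EL m x" by (rule EL_mono[OF n(3,1)]) (use s in blast)
    ultimately show ?thesis by simp
  qed
  moreover have "EL l (EL l' (EL m x)) = EL m (EL l (EL l' x))"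
    using EL_commute[OF n(1) EL_resc[OF n(3)]] EL_commute[OF n(2) EL_resc[OF n(3)]] by simp
  ultimately show ?thesis by (simp add: Es_eq[OF m] Es_eq[OF assms(1)] Es_eq[OF assms(2)])
qed

lemma Es_Diff: assumes "rep S l" "rep S' l'" shows "Es (S - S') x = Es S x - Es S (Es S' x)"
proof -
  obtain m k where m: "rep (S - S') m" and k: "rep (S \<inter> S') k" using rep_diff[OF assms] rep_inter[OF assms] by blast
  have "Es ((S - S') \<union> (S \<inter> S')) x = Es (S - S') x + Es (S \<inter> S') x - Es ((S - S') \<inter> (S \<inter> S')) x"
    using Es_Un[OF m k] Es_Int[OF m k] by simp
  moreover have "(S - S') \<union> (S \<inter> S') = S" "(S - S') \<inter> (S \<inter> S') = {}" by blast+
  ultimately show ?thesis using Es_Int[OF assms, of x] by (simp add: Es_empty)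
qed

text \<open>Replacing \<open>x\<close> by \<open>y = x - e a b x\<close> in the tail makes the two
  parts of the union orthogonal, so their forms add.\<close>

lemma EL_definite:
  assumes "nzl l" and s: "opn l \<subseteq> {0<..} \<and> \<sigma> = 1 \<or> opn l \<subseteq> {..<0} \<and> \<sigma> = (-1::real)"
  shows "0 \<le> \<sigma> * Re (B (EL l x) x)"
  using assms
proof (induction l arbitrary: x)
  case Nil
  show ?case by (simp add: B01)
next
  case (Cons p l)
  obtain a b where p: "p = (a, b)" by force
  have ab: "a \<noteq> 0" "b \<noteq> 0" and l: "nzl l" using Cons.prems(1) by (auto simp: p nzl_Cons)
  have o: "opn (p # l) = {a<..<b} \<union> opn l" by (simp add: p opn_def)
  define y where "y = x - e a b x"
  have c: "e a b (EL l x) = EL l (e a b x)" for x by (rule EL_commute[OF l e_resc[OF ab]])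
  have eq: "B (EL (p # l) x) x = B (e a b x) x + B (EL l y) y"
  proof -
    have "B (EL l y) y = B (EL l y) x - B (EL l y) (e a b x)" by (simp add: y_def Bsimps)
    also have "B (EL l y) (e a b x) = B (e a b (EL l y)) x" by (simp add: e_B[OF ab])
    also have "e a b (EL l y) = 0"
      by (simp add: c y_def bop_lin[OF e_bop[OF ab]] kopD(6)[OF e_kop[OF ab]] bop_0[OF EL_bop[OF l]])
    finally show ?thesis by (simp add: p y_def Bsimps c bop_lin[OF EL_bop[OF l]])
  qed
  have "0 \<le> \<sigma> * Re (B (e a b x) x)"
  proof (cases "a < b")
    case True
    have "0 < a \<and> \<sigma> = 1 \<or> b < 0 \<and> \<sigma> = -1"
    proof -
      have "0 \<le> a" if "{a<..<b} \<subseteq> {0<..}"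
      proof (rule ccontr)
        assume "\<not> 0 \<le> a"
        then obtain z where "a < z" "z < min b 0" using dense[of a "min b 0"] True by auto
        then show False using that by auto
      qed
      moreover have "b \<le> 0" if "{a<..<b} \<subseteq> {..<0}"
      proof (rule ccontr)
        assume "\<not> b \<le> 0"
        then obtain z where "max a 0 < z" "z < b" using dense[of "max a 0" b] True by auto
        then show False using that by auto
      qed
      ultimately show ?thesis using Cons.prems(2) ab unfolding o by force
    qed
    then show ?thesis by (rule e_definite[OF True])
  qed (simp add: e_triv B01)
  moreover have "0 \<le> \<sigma> * Re (B (EL l y) y)" by (rule Cons.IH[OF l]) (use Cons.prems(2) o in blast)
  ultimately show ?case unfolding eq by (simp add: distrib_left)
qed

lemma EL_definite_range:
  assumes "nzl l" and "opn l \<subseteq> {0<..} \<and> \<sigma> = 1 \<or> opn l \<subseteq> {..<0} \<and> \<sigma> = (-1::real)"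
  shows "definite_range \<sigma> (EL l)"
  unfolding definite_range_def krein_proj_self[OF EL_proj[OF assms(1)]] using EL_definite[OF assms] assms(2) by blast

end

section \<open>The spectral function\<close>

context nonneg_krein
begin

lemma A_C1: assumes f: "(f, f') \<in> A" shows "C1 f' = T f"
proof -
  have "(C1 f, C1 f') \<in> A" by (rule commute_A[OF bop_C1 R_commutes_C1[symmetric] f]) simp
  then show ?thesis using C1_A[of f] A_single by blast
qed

lemma ct_D_A: "(f, f') \<in> A \<Longrightarrow> ct (D f') = tt (D f)"
  by (simp add: ct_D tt_D A_C1)

text \<open>On the spectral side this is \<open>\<lambda> = \<lambda> / (1 + \<lambda>\<^sup>2) + \<lambda>\<^sup>2 \<lambda> / (1 + \<lambda>\<^sup>2)\<close>.\<close>

lemma form_split: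
  assumes f: "(f, f') \<in> A" and f': "(f', f'') \<in> A"
  shows "Re (B f' f) = (nm (D f))\<^sup>2 + (nm (D f'))\<^sup>2"
proof -
  have "C1 (C1 f'') = T (T f)" using A_C1[OF f] A_C1[OF f'] T_C1[of f'] by simp
  then have "C1 (C1 f + C1 f'' - f) = 0" by (simp add: T_T bop_lin[OF bop_C1])
  then have "C1 f + C1 f'' - f = 0" by (rule C1_inj)
  then have eq: "f = C1 f + C1 f''" by simp
  have Cf: "(C1 f', C1 f'') \<in> A" by (rule commute_A[OF bop_C1 R_commutes_C1[symmetric] f']) simp
  have "B f' f = B f' (C1 f) + B f' (C1 f'')" by (subst eq) (simp add: Bsimps)
  also have "B f' (C1 f) = B (T f) f" by (simp add: A_C1[OF f, symmetric] C1_B)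
  also have "B f' (C1 f'') = B (C1 f') f''" by (simp add: C1_B)
  also have "B (C1 f') f'' = B (T f') f'" using A_sym[OF Cf f'] by (simp add: A_C1[OF f'])
  finally show ?thesis by (simp add: H_D[symmetric] Hself)
qed

text \<open>The lifted projection for the values between \<open>- N\<close> and \<open>N\<close>
  without the gap from \<open>s1\<close> to \<open>s2\<close>. It dominates the lift of every list
  that avoids the gap, and \<open>pencil_lower\<close> applies to it.\<close>

definition "cutU N s1 s2 h = QQ (- N) N (h - QQ s1 s2 h)"

lemma cutU:
  assumes N: "0 \<le> N" and s: "s1 < s2"
  shows "bproj (cutU N s1 s2)" "\<exists>d. low d (cutU N s1 s2)" "cutU N s1 s2 (QQ s1 s2 h) = 0"
proof -
  have q: "bproj (QQ (- N) N)" "bproj (QQ s1 s2)" using N s by (simp_all add: bproj_QQ)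
  show "bproj (cutU N s1 s2)" unfolding cutU_def[abs_def] by (rule bproj_diff[OF q(1) bprojD(1-3)[OF q(2)]])
  have "- N \<le> N" using N by simp
  from QQ_low[OF this] obtain d where "low d (QQ (- N) N)" by blast
  then show "\<exists>d. low d (cutU N s1 s2)" using low_sub[of d "QQ (- N) N" "cutU N s1 s2"] bprojD(3)[OF q(1)] by (auto simp: cutU_def)
  show "cutU N s1 s2 (QQ s1 s2 h) = 0"
    unfolding cutU_def using bprojD(3)[OF q(2)] bop_0[OF bprojD(5)[OF q(1)]] by simp
qed

lemma cutU_QQ:
  assumes "s1 < s2" "a < b" "- N \<le> a" "b \<le> N" "b \<le> s1 \<or> s2 \<le> a"
  shows "cutU N s1 s2 (QQ a b h) = QQ a b h"
proof -
  have z: "QQ s1 s2 (QQ a b h) = 0"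
  proof -
    have "QQ s1 s2 (QQ a b h) = (if max s1 a \<le> min s2 b then QQ (max s1 a) (min s2 b) h else 0)"
      using assms by (intro QQ_QQ) auto
    moreover have "max s1 a = min s2 b" if "max s1 a \<le> min s2 b" using assms that by auto
    ultimately show ?thesis by (simp add: QQ_same)
  qed
  have "QQ (- N) N (QQ a b h) = QQ a b h"
    using assms QQ_QQ[of "- N" N a b h] by (simp add: max_absorb2 min_absorb2)
  then show ?thesis unfolding cutU_def z by simp
qed

lemma EL_cut:
  assumes "nzl l" "0 \<le> N" "s1 < s2"
    and "\<And>a b. (a, b) \<in> set l \<Longrightarrow> a < b \<Longrightarrow> - N \<le> a \<and> b \<le> N \<and> (b \<le> s1 \<or> s2 \<le> a)"
  shows "cutU N s1 s2 (D (EL l x)) = D (EL l x)"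
  using assms(1,4)
proof (induction l)
  case Nil
  show ?case by (simp add: bop_0[OF bop_D] bop_0[OF bprojD(5)[OF cutU(1)[OF assms(2,3)]]])
next
  case (Cons p l)
  obtain a b where p: "p = (a, b)" by force
  have ab: "a \<noteq> 0" "b \<noteq> 0" and l: "nzl l" using Cons.prems(1) by (auto simp: p nzl_Cons)
  note U = bop_lin[OF bprojD(5)[OF cutU(1)[OF assms(2,3)]]]
  have h: "cutU N s1 s2 (D (e a b z)) = D (e a b z)" for z
    using cutU_QQ[OF assms(3), of a b N] Cons.prems(2)[of a b]
    by (cases "a < b") (simp_all add: e_D[OF ab] UU_def p U)
  have IH: "cutU N s1 s2 (D (EL l x)) = D (EL l x)" by (rule Cons.IH[OF l]) (use Cons.prems(2) in auto)
  show ?case by (simp add: p bop_lin[OF bop_D] U h IH)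
qed

lemma EL_ker:
  assumes "nzl l" "\<And>a b. (a, b) \<in> set l \<Longrightarrow> a < b \<Longrightarrow> 0 < a \<or> b < 0" "D k = 0" shows "EL l k = 0"
  using assms(1,2)
proof (induction l)
  case (Cons p l)
  obtain a b where p: "p = (a, b)" by force
  have ab: "a \<noteq> 0" "b \<noteq> 0" and l: "nzl l" using Cons.prems(1) by (auto simp: p nzl_Cons)
  have "e a b k = 0"
  proof (cases "a < b")
    case True
    then have "\<not> (a < 0 \<and> 0 < b)" using Cons.prems(2)[of a b] by (auto simp: p)
    then show ?thesis using kopD(3)[OF e_kop[OF ab] assms(3)] by (metis (full_types))
  qed (simp add: e_triv)
  moreover have "EL l k = 0" by (rule Cons.IH[OF l]) (use Cons.prems(2) in auto)
  ultimately show ?case by (simp add: p bop_0[OF e_bop[OF ab]])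
qed simp

lemma EL_A: assumes "nzl l" "(f, f') \<in> A" "EL l f = f" shows "EL l f' = f'"
proof -
  have "(EL l f, EL l f') \<in> A"
    by (rule commute_A[OF EL_bop[OF assms(1)] resc_D(4)[OF EL_resc[OF assms(1)]] assms(2)])
  then show ?thesis using assms(2,3) A_single by metis
qed

text \<open>The bounded operator \<open>W = A E\<close> has a positive \<open>J W\<close>, so
  \<open>posop_nm\<close> controls the norm of \<open>A f\<close> by the energy of
  \<open>f\<close>.\<close>

lemma bounded_part:
  assumes E: "krein_proj E" "resc E" and ab: "abd E"
  obtains W C where "bop W" "\<And>x. (E x, W x) \<in> A" "\<And>x. E (W x) = W x" "\<And>x y. B (W x) y = B x (W y)"
    "C \<ge> 0" "\<And>f f'. (f, f') \<in> A \<Longrightarrow> E f = f \<Longrightarrow> f' = W f \<and> (nm f')\<^sup>2 \<le> C * Re (B f' f)"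
proof -
  note Ed = krein_projD[OF E(1)]
  obtain W where W: "bop W" "\<And>x. (E x, W x) \<in> A" using abdE[OF ab Ed(1)] by metis
  have EW: "E (W x) = W x" for x
    using A_single[OF commute_A[OF Ed(1) resc_D(4)[OF E(2)] W(2)[of x]]] W(2)[of x] Ed(3) by metis
  have WB: "B (W x) y = B x (W y)" for x y
  proof -
    have "B (W x) y = B (W x) (E y)" using Ed(2)[of "W x" y] by (simp add: EW)
    also have "\<dots> = B (E x) (W y)" by (rule A_sym[OF W(2) W(2)])
    also have "\<dots> = B x (W y)" using Ed(2)[of x "W y"] by (simp add: EW)
    finally show ?thesis .
  qed
  have WE: "B (W x) x = B (W x) (E x)" for x using Ed(2)[of "W x" x] by (simp add: EW)
  have "posop (\<lambda>x. J (W x))"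
    unfolding posop_def saop_def using bop_comp[OF bop_J W(1)] A_nn[OF W(2)] WE by (simp add: HJ1 HJ2 WB)
  moreover obtain C where C: "C > 0" "\<And>x. nm (W x) \<le> C * nm x" using bop_bound[OF W(1)] by metis
  ultimately have pn: "(nm (J (W x)))\<^sup>2 \<le> C * Re (H (J (W x)) x)" for x
    by (intro posop_nm) simp_all
  show thesis
  proof (rule that[OF W EW WB, of C])
    show "C \<ge> 0" using C(1) by simp
    show "f' = W f \<and> (nm f')\<^sup>2 \<le> C * Re (B f' f)" if "(f, f') \<in> A" "E f = f" for f f'
      using A_single[OF that(1)] W(2)[of f] that(2) pn[of f] by (simp add: HJ1)
  qed
qed

lemma intervals_bound: "\<exists>N\<ge>0. \<forall>(a, b)\<in>set l. \<bar>a\<bar> \<le> N \<and> \<bar>b\<bar> \<le> (N::real)"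
proof (induction l)
  case (Cons p l)
  then obtain N where N: "N \<ge> 0" "\<And>a b. (a, b) \<in> set l \<Longrightarrow> \<bar>a\<bar> \<le> N \<and> \<bar>b\<bar> \<le> N" by blast
  have "\<bar>a\<bar> \<le> N + \<bar>fst p\<bar> + \<bar>snd p\<bar> \<and> \<bar>b\<bar> \<le> N + \<bar>fst p\<bar> + \<bar>snd p\<bar>" if "(a, b) \<in> set (p # l)" for a b
    using that N(1) N(2)[of a b] by auto
  moreover have "0 \<le> N + \<bar>fst p\<bar> + \<bar>snd p\<bar>" using N(1) by simp
  ultimately show ?case by blast
qed auto

text \<open>The gap controls only \<open>D f\<close>, and \<open>D\<close> is not bounded below. For
  nonzero \<open>s\<close> the vector is regained from \<open>s f = f' - (f' - s f)\<close> with
  \<open>f'\<close> controlled by \<open>D f\<close>; for \<open>s = 0\<close> a definite cell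
  inverts \<open>D\<close>.\<close>

lemma EL_lower:
  assumes l: "nzl l" and s: "s1 < s" "s < s2" and gap: "opn l \<inter> {s1<..<s2} = {}"
  obtains C where "\<And>f f'. (f, f') \<in> A \<Longrightarrow> EL l f = f \<Longrightarrow> nm f \<le> C * nm (f' - scl (of_real s) f)"
proof -
  obtain N where N: "0 \<le> N" "\<And>a b. (a, b) \<in> set l \<Longrightarrow> \<bar>a\<bar> \<le> N \<and> \<bar>b\<bar> \<le> N" using intervals_bound[of l] by blast
  have s12: "s1 < s2" using s by simp
  have cond: "- N \<le> a \<and> b \<le> N \<and> (b \<le> s1 \<or> s2 \<le> a)" if ab: "(a, b) \<in> set l" "a < b" for a b
  proof -
    have "b \<le> s1 \<or> s2 \<le> a"
    proof (rule ccontr)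
      assume "\<not> (b \<le> s1 \<or> s2 \<le> a)"
      then obtain z where "max a s1 < z" "z < min b s2" using dense[of "max a s1" "min b s2"] ab s12 by auto
      then have "z \<in> {a<..<b}" "z \<in> {s1<..<s2}" by auto
      moreover from this have "z \<in> opn l" using ab(1) unfolding opn_def by blast
      ultimately show False using gap by blast
    qed
    then show ?thesis using N(2)[OF ab(1)] by auto
  qed
  define U where "U = cutU N s1 s2"
  have U: "bproj U" "\<And>h. U (QQ s1 s2 h) = 0" unfolding U_def using cutU[OF N(1) s12] by blast+
  obtain d where d: "low d U" using cutU(2)[OF N(1) s12] unfolding U_def by blast
  have UD: "U (D f) = D f" if "EL l f = f" for f
    using EL_cut[OF l N(1) s12 cond, of f] that by (simp add: U_def)
  obtain c where c: "c > 0" "\<And>h. c * nm (U h) \<le> nm (Cl s (U h))" using pencil_lower[OF U(1) d s U(2)] by blast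
  obtain k where k: "k > 0" "\<And>x. nm (D x) \<le> k * nm x" using bop_bound[OF bop_D] by metis
  have step1: "nm (D f) \<le> (k / c) * nm (f' - scl (of_real s) f)" if f: "(f, f') \<in> A" "EL l f = f" for f f'
  proof -
    let ?g = "f' - scl (of_real s) f"
    have "Cl s (D f) = ct (D ?g)" by (simp add: Cl_def ct_D_A[OF f(1)] bop_lin[OF bop_D] bop_lin[OF bo_ct])
    then have "c * nm (D f) \<le> nm (ct (D ?g))" using c(2)[of "D f"] UD[OF f(2)] by simp
    also have "\<dots> \<le> k * nm ?g" using ct_le1[of "D ?g"] k(2)[of ?g] by simp
    finally show ?thesis using c(1) by (simp add: pos_le_divide_eq mult.commute)
  qed
  show thesis
  proof (cases "s = 0")
    case False
    obtain W K where WK: "K \<ge> 0" "\<And>f f'. (f, f') \<in> A \<Longrightarrow> EL l f = f \<Longrightarrow> (nm f')\<^sup>2 \<le> K * Re (B f' f)"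
      and WA: "\<And>x. (EL l x, W x) \<in> A"
      using bounded_part[OF EL_proj[OF l] EL_resc[OF l] EL_abd[OF l]] by metis
    obtain t where t: "t > 0" "\<And>h. nm (tt h) \<le> t * nm h" using bop_bound[OF bo_tt] by metis
    have d0: "d > 0" and dl: "\<And>h. d * (nm (U h))\<^sup>2 \<le> Re (H (ct (U h)) (U h))" using d unfolding low_def by blast+
    define M where "M = sqrt (K * (1 + (t / d)\<^sup>2))"
    have M0: "M \<ge> 0" and M2: "M\<^sup>2 = K * (1 + (t / d)\<^sup>2)" using WK(1) by (simp_all add: M_def)
    \<comment> \<open>\<open>form_split\<close> expresses the energy by \<open>D f\<close> and
      \<open>D f'\<close>. The latter is controlled by the former because
      \<open>ct (D f') = tt (D f)\<close> and \<open>ct\<close> is at least \<open>d\<close> on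
      these vectors.\<close>
    have step2: "nm f' \<le> M * nm (D f)" if f: "(f, f') \<in> A" "EL l f = f" for f f'
    proof (rule power2_le_imp_le)
      have f'E: "EL l f' = f'" by (rule EL_A[OF l f])
      have f': "(f', W f') \<in> A" using WA[of f'] f'E by simp
      have "d * (nm (D f'))\<^sup>2 \<le> Re (H (ct (D f')) (D f'))" using dl[of "D f'"] UD[OF f'E] by simp
      also have "\<dots> \<le> nm (ct (D f')) * nm (D f')" by (rule ReH_le) auto
      also have "\<dots> \<le> (t * nm (D f)) * nm (D f')" using t(2)[of "D f"] by (intro mult_right_mono) (auto simp: ct_D_A[OF f(1)])
      finally have "d * nm (D f') * nm (D f') \<le> (t * nm (D f)) * nm (D f')" by (simp add: power2_eq_square ac_simps)
      then have "d * nm (D f') \<le> t * nm (D f)"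
        using nm_pos[of "D f'"] t(1) by (cases "nm (D f') = 0") auto
      then have "nm (D f') \<le> (t / d) * nm (D f)" using d0 by (simp add: pos_le_divide_eq mult.commute)
      then have "(nm (D f'))\<^sup>2 \<le> ((t / d) * nm (D f))\<^sup>2" by (intro power_mono) auto
      then have "Re (B f' f) \<le> (1 + (t / d)\<^sup>2) * (nm (D f))\<^sup>2"
        unfolding form_split[OF f(1) f'] power_mult_distrib distrib_right by linarith
      then have "K * Re (B f' f) \<le> K * ((1 + (t / d)\<^sup>2) * (nm (D f))\<^sup>2)" using WK(1) by (rule mult_left_mono)
      then show "(nm f')\<^sup>2 \<le> (M * nm (D f))\<^sup>2" using WK(2)[OF f] M2 by (simp add: power_mult_distrib)
    qed (use M0 in simp)
    show thesis
    proof (rule that)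
      fix f f' assume f: "(f, f') \<in> A" "EL l f = f"
      let ?g = "f' - scl (of_real s) f"
      have "\<bar>s\<bar> * nm f = nm (f' - ?g)" by simp
      also have "\<dots> \<le> nm f' + nm ?g" by (rule nm_triangle_diff) auto
      also have "\<dots> \<le> M * ((k / c) * nm ?g) + nm ?g"
        using step2[OF f] mult_left_mono[OF step1[OF f] M0] by linarith
      finally have "\<bar>s\<bar> * nm f \<le> (M * (k / c) + 1) * nm ?g" by (simp add: algebra_simps)
      then show "nm f \<le> ((M * (k / c) + 1) / \<bar>s\<bar>) * nm ?g"
        using False by (simp add: pos_le_divide_eq mult.commute)
    qed
  next
    case True
    then have s0: "s1 < 0" "0 < s2" using s by auto
    obtain V where V: "bic V" "kop (\<lambda>x. J (D (V (D x)))) U False"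
      by (rule definite_cell[OF U(1) d s0 U(2)], rule that, assumption+)
    obtain v where v: "v > 0" "\<And>x. nm (V x) \<le> v * nm x" using bop_bound[OF bic_bop[OF V(1)]] by metis
    \<comment> \<open>The difference lies in the kernel of \<open>D\<close>, which
      \<open>EL l\<close> annihilates because no nontrivial interval of the list contains 0.\<close>
    have fV: "f = J (D (V (D f)))" if f: "EL l f = f" for f
    proof -
      let ?k = "f - J (D (V (D f)))"
      have "D ?k = 0" using kopD(2)[OF V(2), of f] UD[OF f] by (simp add: bop_lin[OF bop_D])
      then have "EL l ?k = 0" using EL_ker[OF l _, of ?k] cond s0 by force
      moreover have "EL l (J (D (V (D f)))) = J (D (V (D f)))"
        using EL_commute[OF l kopD(8)[OF V(2)], of f] f by simp
      ultimately show ?thesis using f by (simp add: bop_lin[OF EL_bop[OF l]])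
    qed
    show thesis
    proof (rule that)
      fix f f' assume f: "(f, f') \<in> A" "EL l f = f"
      let ?g = "f' - scl (of_real s) f"
      have "nm f = nm (D (V (D f)))" by (subst fV[OF f(2)]) simp
      also have "\<dots> \<le> k * (v * nm (D f))" using k(2)[of "V (D f)"] mult_left_mono[OF v(2)[of "D f"], of k] k(1) by linarith
      also have "\<dots> \<le> k * (v * ((k / c) * nm ?g))" using step1[OF f] k(1) v(1) by (intro mult_left_mono) auto
      finally show "nm f \<le> (k * v * (k / c)) * nm ?g" by (simp add: ac_simps)
    qed
  qed
qed

section \<open>The spectrum of the operator on a bounded spectral subspace\<close>

definition A_on :: "intervals \<Rightarrow> ('a \<times> 'a) set" where
  "A_on l = {(f, f') \<in> A. f \<in> range (EL l)}"

lemma EL_range: assumes "nzl l" shows "x \<in> range (EL l) \<longleftrightarrow> EL l x = x"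
proof
  assume "x \<in> range (EL l)"
  then obtain y where "x = EL l y" by blast
  then show "EL l x = x" by (simp add: EL_idem[OF assms])
qed (metis rangeI)

lemma EL_resolventI:
  assumes l: "nzl l" and sol: "\<And>g. EL l g = g \<Longrightarrow> \<exists>f. EL l f = f \<and> (f, g + scl z f) \<in> A"
    and low: "\<And>f f'. (f, f') \<in> A \<Longrightarrow> EL l f = f \<Longrightarrow> nm f \<le> C * nm (f' - scl z f)"
  shows "z \<in> resolvent_set scl (range (EL l)) H (A_on l)"
  unfolding resolvent_set_def mem_Collect_eq
proof (intro conjI)
  note El = bop_lin[OF EL_bop[OF l]]
  have res: "(g, f) \<in> resolvent scl (A_on l) z \<longleftrightarrow> (f, g + scl z f) \<in> A \<and> EL l f = f" for f g
    unfolding resolvent_def A_on_def using EL_range[OF l] by (auto intro!: exI[of _ "g + scl z f"])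
  show "single_valued (resolvent scl (A_on l) z)"
  proof (rule single_valuedI)
    fix g f1 f2 assume "(g, f1) \<in> resolvent scl (A_on l) z" "(g, f2) \<in> resolvent scl (A_on l) z"
    then have 1: "(f1, g + scl z f1) \<in> A" "EL l f1 = f1" and 2: "(f2, g + scl z f2) \<in> A" "EL l f2 = f2"
      unfolding res by blast+
    have "nm (f1 - f2) \<le> C * nm (g + scl z f1 - (g + scl z f2) - scl z (f1 - f2))"
      by (rule low[OF A_diff[OF 1(1) 2(1)]]) (simp add: El 1 2)
    then have "nm (f1 - f2) \<le> 0" by (simp add: scale_right_diff_distrib)
    then have "nm (f1 - f2) = 0" using nm_nonneg[of "f1 - f2", OF UNIV_I] by linarith
    then show "f1 = f2" using nm_eq_0[of "f1 - f2"] by simp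
  qed
  show "Domain (resolvent scl (A_on l) z) = range (EL l)"
  proof (intro set_eqI iffI)
    fix g assume "g \<in> Domain (resolvent scl (A_on l) z)"
    then obtain f where f: "(f, g + scl z f) \<in> A" "EL l f = f" unfolding Domain_iff res by blast
    have "EL l (g + scl z f) = g + scl z f" by (rule EL_A[OF l f])
    then have "EL l g = g" using f(2) by (simp add: El)
    then show "g \<in> range (EL l)" using EL_range[OF l] by blast
  next
    fix g assume "g \<in> range (EL l)"
    then show "g \<in> Domain (resolvent scl (A_on l) z)" unfolding Domain_iff res using sol EL_range[OF l] by blast
  qed
  show "\<exists>C. \<forall>(g, f)\<in>resolvent scl (A_on l) z. nm f \<le> C * nm g"
    using low by (intro exI[of _ C]) (fastforce simp: res)
qed

lemma EL_resolvent_nonreal: assumes l: "nzl l" and z: "Im z \<noteq> 0" shows "z \<in> resolvent_set scl (range (EL l)) H (A_on l)"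
proof -
  obtain C where C: "\<And>x. nm (R z x) \<le> C * nm x" using bop_bound[OF R_bop[OF z]] by metis
  have c: "EL l (R z g) = R z (EL l g)" for g by (rule resc_R[OF EL_resc[OF l] z])
  show ?thesis
  proof (rule EL_resolventI[OF l])
    show "\<exists>f. EL l f = f \<and> (f, g + scl z f) \<in> A" if "EL l g = g" for g
      using R_A[OF z, of g] c[of g] that by auto
    show "nm f \<le> C * nm (f' - scl z f)" if "(f, f') \<in> A" for f f'
      using C[of "f' - scl z f"] R_eq[OF z that] by simp
  qed
qed

text \<open>\<open>M\<close> is \<open>A - s\<close> on the range and the identity off it. Since
  \<open>J M\<close> is self-adjoint in the Hilbert space and bounded below,
  \<open>inverse_exists\<close> makes \<open>M\<close> surjective.\<close>

lemma EL_resolvent_real: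
  assumes l: "nzl l" and s: "s1 < s" "s < s2" and gap: "opn l \<inter> {s1<..<s2} = {}"
  shows "of_real s \<in> resolvent_set scl (range (EL l)) H (A_on l)"
proof -
  note El = bop_lin[OF EL_bop[OF l]]
  obtain C0 where C0: "\<And>f f'. (f, f') \<in> A \<Longrightarrow> EL l f = f \<Longrightarrow> nm f \<le> C0 * nm (f' - scl (of_real s) f)"
    using EL_lower[OF l s gap] by metis
  define C where "C = max C0 1"
  have C: "C > 0" "nm f \<le> C * nm (f' - scl (of_real s) f)" if "(f, f') \<in> A" "EL l f = f" for f f'
  proof -
    show "C > 0" by (simp add: C_def)
    have "C0 * nm (f' - scl (of_real s) f) \<le> C * nm (f' - scl (of_real s) f)" by (intro mult_right_mono) (auto simp: C_def)
    then show "nm f \<le> C * nm (f' - scl (of_real s) f)" using C0[OF that] by linarith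
  qed
  have Cp: "C > 0" by (simp add: C_def)
  obtain W where W: "bop W" "\<And>x. (EL l x, W x) \<in> A" "\<And>x. EL l (W x) = W x" "\<And>x y. B (W x) y = B x (W y)"
    using bounded_part[OF EL_proj[OF l] EL_resc[OF l] EL_abd[OF l]] by metis
  define M where "M x = W x - scl (of_real s) (EL l x) + (x - EL l x)" for x
  have bM: "bop M" unfolding M_def[abs_def]
    by (rule bop_sum[OF bop_minus[OF W(1) bop_scale[OF EL_bop[OF l]]] bop_minus[OF bop_id EL_bop[OF l]]])
  have EM: "EL l (M x) = W x - scl (of_real s) (EL l x)" for x by (simp add: M_def El W(3) EL_idem[OF l])
  have "saop (\<lambda>x. J (M x))"
    unfolding saop_def using bop_comp[OF bop_J bM] by (simp add: HJ1 HJ2 M_def Bsimps W(4) EL_B[OF l])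
  obtain K where K: "K > 0" "\<And>x. nm (EL l x) \<le> K * nm x" using bop_bound[OF EL_bop[OF l]] by metis
  \<comment> \<open>\<open>C * K\<close> accounts for the component of \<open>x\<close> in the
    range, \<open>1 + K\<close> for the component off it.\<close>
  define m where "m = C * K + 1 + K"
  have m: "m > 0" using Cp K(1) by (simp add: m_def add_pos_pos)
  have low: "1 / m * nm x \<le> nm (J (M x))" for x
  proof -
    have "nm (EL l x) \<le> C * nm (W x - scl (of_real s) (EL l x))" by (rule C(2)[OF W(2)]) (rule EL_idem[OF l])
    also have "\<dots> \<le> C * (K * nm (M x))" using K(2)[of "M x"] Cp by (intro mult_left_mono) (auto simp: EM)
    finally have 1: "nm (EL l x) \<le> C * K * nm (M x)" by simp
    have "x - EL l x = M x - EL l (M x)" by (simp add: EM) (simp add: M_def)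
    then have 2: "nm (x - EL l x) \<le> nm (M x) + K * nm (M x)"
      using nm_triangle_diff[of "M x" "EL l (M x)"] K(2)[of "M x"] by simp
    have "nm x \<le> nm (x - EL l x) + nm (EL l x)" by (rule nm_le_diff) auto
    then have "nm x \<le> m * nm (M x)" using 1 2 unfolding m_def by (simp add: distrib_right)
    then show ?thesis using m by (simp add: pos_divide_le_eq mult.commute)
  qed
  have m1: "1 / m > 0" using m by simp
  obtain V where V: "\<And>x. J (M (V x)) = x"
    using inverse_exists[OF \<open>saop (\<lambda>x. J (M x))\<close> m1 low] by metis
  show ?thesis
  proof (rule EL_resolventI[OF l])
    show "nm f \<le> C * nm (f' - scl (of_real s) f)" if "(f, f') \<in> A" "EL l f = f" for f f' by (rule C(2)[OF that])
    fix g assume g: "EL l g = g"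
    define f where "f = V (J g)"
    have Mf: "M f = g" using V[of "J g"] J_J unfolding f_def by metis
    have "W f - scl (of_real s) (EL l f) = g" using EM[of f] Mf g by simp
    moreover from this have "EL l f = f" using Mf by (simp add: M_def)
    ultimately have "(f, g + scl (of_real s) f) \<in> A" using W(2)[of f] by (metis diff_add_cancel)
    then show "\<exists>f. EL l f = f \<and> (f, g + scl (of_real s) f) \<in> A" using \<open>EL l f = f\<close> by blast
  qed
qed

lemma EL_spectrum: assumes S: "rep S l" shows "spectrum scl (range (EL l)) H (A_on l) \<subseteq> of_real ` closure S"
proof
  fix z assume z: "z \<in> spectrum scl (range (EL l)) H (A_on l)"
  have l: "nzl l" "opn l \<subseteq> S" using S unfolding rep_def by blast+
  have "Im z = 0" using z EL_resolvent_nonreal[OF l(1)] unfolding spectrum_def by blast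
  then have zr: "z = of_real (Re z)" by (simp add: complex_eq_iff)
  have "Re z \<in> closure S"
  proof (rule ccontr)
    assume "Re z \<notin> closure S"
    then have "open (- closure S)" "Re z \<in> - closure S" by auto
    then obtain \<epsilon> where "\<epsilon> > 0" "ball (Re z) \<epsilon> \<subseteq> - closure S" using openE by blast
    then have "opn l \<inter> {Re z - \<epsilon><..<Re z + \<epsilon>} = {}"
      using l(2) closure_subset[of S] unfolding ball_eq_greaterThanLessThan by blast
    from EL_resolvent_real[OF l(1) _ _ this] \<open>\<epsilon> > 0\<close>
    have "of_real (Re z) \<in> resolvent_set scl (range (EL l)) H (A_on l)" by simp
    then show False using z zr unfolding spectrum_def by simp
  qed
  then show "z \<in> of_real ` closure S" using zr by blast
qed

section \<open>The spectral function on the extended real line\<close>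

definition Ef :: "real option set \<Rightarrow> 'a \<Rightarrow> 'a" where
  "Ef \<Delta> = (if None \<in> \<Delta> then (\<lambda>x. x - Es (Some -` (- \<Delta>)) x) else Es (Some -` \<Delta>))"

lemma Ef_Some: "Ef (Some ` S) = Es S" and Ef_Compl: "Ef (- (Some ` S)) = (\<lambda>x. x - Es S x)"
proof -
  have "Some -` (Some ` S) = S" by auto
  then show "Ef (Some ` S) = Es S" "Ef (- (Some ` S)) = (\<lambda>x. x - Es S x)" unfolding Ef_def by auto
qed

lemma Ef_kop: assumes "\<Delta> \<in> spectral_ring" obtains Q' b where "kop (Ef \<Delta>) Q' b"
  using assms
proof (cases rule: spectral_ring_cases)
  case (1 S l)
  have "Es S = EL l" using Es_eq[OF 1(1)] by (simp add: fun_eq_iff)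
  moreover obtain Q' b where "kop (EL l) Q' b" using EL_kop[of l] 1(1) unfolding rep_def by blast
  ultimately show thesis using that unfolding 1(2) Ef_Some by simp
next
  case (2 S l)
  have "Es S = EL l" using Es_eq[OF 2(1)] by (simp add: fun_eq_iff)
  then have "Ef \<Delta> = (\<lambda>x. x - EL l x)" unfolding 2(2) Ef_Compl by simp
  moreover obtain Q' b where "kop (EL l) Q' b" using EL_kop[of l] 2(1) unfolding rep_def by blast
  ultimately show thesis using kop_compl that by metis
qed

lemma Ef_Int: assumes "\<Delta> \<in> spectral_ring" "\<Delta>' \<in> spectral_ring" shows "Ef (\<Delta> \<inter> \<Delta>') x = Ef \<Delta> (Ef \<Delta>' x)"
proof -
  have lin: "Es S (x - y) = Es S x - Es S y" if "rep S l" for S l x y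
    using that Es_eq[OF that] bop_diff[OF EL_bop[of l]] unfolding rep_def by simp
  have comm: "Es S (Es S' x) = Es S' (Es S x)" if "rep S l" "rep S' l'" for S S' l l' x
    using Es_Int[OF that] Es_Int[OF that(2,1)] by (metis Int_commute)
  show ?thesis
    using assms(1)
  proof (cases rule: spectral_ring_cases)
    case S: (1 S l)
    show ?thesis using assms(2)
    proof (cases rule: spectral_ring_cases)
      case (1 S' l')
      have "\<Delta> \<inter> \<Delta>' = Some ` (S \<inter> S')" using S(2) 1(2) by blast
      then show ?thesis using Es_Int[OF S(1) 1(1)] by (simp add: S(2) 1(2) Ef_Some)
    next
      case (2 S' l')
      have "\<Delta> \<inter> \<Delta>' = Some ` (S - S')" using S(2) 2(2) by blast
      then show ?thesis using Es_Diff[OF S(1) 2(1)] by (simp add: S(2) 2(2) Ef_Some Ef_Compl lin[OF S(1)])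
    qed
  next
    case S: (2 S l)
    show ?thesis using assms(2)
    proof (cases rule: spectral_ring_cases)
      case (1 S' l')
      have "\<Delta> \<inter> \<Delta>' = Some ` (S' - S)" using S(2) 1(2) by blast
      then show ?thesis using Es_Diff[OF 1(1) S(1)] comm[OF S(1) 1(1)] by (simp add: S(2) 1(2) Ef_Some Ef_Compl)
    next
      case (2 S' l')
      have "\<Delta> \<inter> \<Delta>' = - (Some ` (S \<union> S'))" using S(2) 2(2) by blast
      then show ?thesis using Es_Un[OF S(1) 2(1)] by (simp add: S(2) 2(2) Ef_Compl lin[OF S(1)] algebra_simps)
    qed
  qed
qed

lemma Ef_Un:
  assumes "\<Delta> \<in> spectral_ring" "\<Delta>' \<in> spectral_ring" "\<Delta> \<inter> \<Delta>' = {}"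
  shows "Ef (\<Delta> \<union> \<Delta>') x = Ef \<Delta> x + Ef \<Delta>' x"
proof -
  have co: "Ef (Some ` S \<union> - (Some ` S')) x = Es S x + (x - Es S' x)"
    if r: "rep S l" "rep S' l'" and d: "Some ` S \<inter> - (Some ` S') = {}" for S S' l l'
  proof -
    have sub: "S \<subseteq> S'" using d by (auto simp: image_iff disjoint_iff)
    have "Some ` S \<union> - (Some ` S') = - (Some ` (S' - S))" by auto
    moreover have "Es (S' - S) x = Es S' x - Es S x"
      using Es_Diff[OF r(2,1), of x] Es_Int[OF r(2,1), of x] sub by (simp add: Int_absorb1)
    ultimately show ?thesis by (simp add: Ef_Compl)
  qed
  show ?thesis
    using assms(1)
  proof (cases rule: spectral_ring_cases)
    case S: (1 S l)
    show ?thesis using assms(2)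
    proof (cases rule: spectral_ring_cases)
      case (1 S' l')
      have "\<Delta> \<union> \<Delta>' = Some ` (S \<union> S')" using S(2) 1(2) by blast
      moreover have "S \<inter> S' = {}" using assms(3) S(2) 1(2) by blast
      ultimately show ?thesis using Es_Un[OF S(1) 1(1), of x] Es_Int[OF S(1) 1(1), of x]
        by (simp add: S(2) 1(2) Ef_Some Es_empty)
    next
      case (2 S' l')
      then show ?thesis using co[OF S(1) 2(1)] assms(3) S(2) by (simp add: Ef_Some Ef_Compl)
    qed
  next
    case S: (2 S l)
    show ?thesis using assms(2)
    proof (cases rule: spectral_ring_cases)
      case (1 S' l')
      then show ?thesis using co[OF 1(1) S(1)] assms(3) S(2) by (simp add: Ef_Some Ef_Compl Un_commute Int_commute)
    next
      case (2 S' l')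
      then show ?thesis using assms(3) S(2) by blast
    qed
  qed
qed

lemma Ef_definite:
  assumes r: "\<Delta> \<in> spectral_ring" and s: "\<Delta> \<subseteq> Some ` {0<..} \<and> \<sigma> = 1 \<or> \<Delta> \<subseteq> Some ` {..<0} \<and> \<sigma> = (-1::real)"
  shows "hilbert_space scl (range (Ef \<Delta>)) (\<lambda>x y. of_real \<sigma> * B x y)"
  using r
proof (cases rule: spectral_ring_cases)
  case (1 S l)
  have l: "nzl l" "opn l \<subseteq> S" using 1(1) unfolding rep_def by blast+
  have "Es S = EL l" using Es_eq[OF 1(1)] by (simp add: fun_eq_iff)
  moreover have "definite_range \<sigma> (EL l)"
    by (rule EL_definite_range[OF l(1)]) (use s l(2) 1(2) in auto)
  ultimately show ?thesis using definite_range_hilbert[OF EL_proj[OF l(1)]] by (simp add: 1(2) Ef_Some)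
next
  case (2 S l)
  then have "None \<in> \<Delta>" by auto
  then show ?thesis using s by blast
qed

lemma Ef_spectral_function: "spectral_function scl B Kp Km A Ef"
  unfolding spectral_function_def Let_def
proof (intro conjI ballI allI impI)
  fix \<Delta> assume r: "\<Delta> \<in> spectral_ring"
  obtain Q' b where k: "kop (Ef \<Delta>) Q' b" using Ef_kop[OF r] by metis
  show "bounded_op scl H (Ef \<Delta>)" by (rule kopD(5)[OF k])
  show "B (Ef \<Delta> x) y = B x (Ef \<Delta> y)" for x y by (rule kopD(7)[OF k])
  show "in_double_commutant_of_resolvent scl H A (Ef \<Delta>)"
    unfolding in_double_commutant_of_resolvent_def
  proof (intro allI impI, elim conjE)
    fix X x assume X: "bop X"
      "\<forall>z\<in>resolvent_set scl UNIV H A. \<forall>(g, f)\<in>resolvent scl A z. (X g, X f) \<in> resolvent scl A z"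
    have "X (R z y) = R z (X y)" if z: "Im z \<noteq> 0" for z y
      using X(2) nonreal_resolvent_set[OF z] R_in_resolvent[OF z] by fastforce
    then have "resc X" unfolding resc_def using X(1) Im_i by blast
    then show "X (Ef \<Delta> x) = Ef \<Delta> (X x)" by (rule kopD(4)[OF k])
  qed
next
  show "Ef {} x = 0" "Ef UNIV x = x" for x using Ef_Some[of "{}"] Ef_Compl[of "{}"] Es_empty by simp_all
next
  fix \<Delta> assume "\<Delta> \<in> spectral_ring" "\<Delta> \<subseteq> Some ` {0<..}"
  then show "hilbert_space scl (range (Ef \<Delta>)) B" using Ef_definite[of \<Delta> 1] by simp
next
  fix \<Delta> assume "\<Delta> \<in> spectral_ring" "\<Delta> \<subseteq> Some ` {..<0}"
  then show "hilbert_space scl (range (Ef \<Delta>)) (\<lambda>x y. - B x y)" using Ef_definite[of \<Delta> "-1"] by simp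
next
  fix S assume "Some ` S \<in> spectral_ring \<and> bounded S"
  then obtain l where S: "rep S l" using spectral_ring_bounded by blast
  have l: "nzl l" using S unfolding rep_def by blast
  have E: "Ef (Some ` S) = EL l" using Es_eq[OF S] by (simp add: Ef_Some fun_eq_iff)
  obtain C where C: "\<And>x. \<exists>w. (EL l x, w) \<in> A \<and> nm w \<le> C * nm x" using EL_abd[OF l] unfolding abd_def by blast
  show "range (Ef (Some ` S)) \<subseteq> Domain A" unfolding E using C by blast
  show "\<exists>C. \<forall>(f, f')\<in>{(f, f') \<in> A. f \<in> range (Ef (Some ` S))}. nm f' \<le> C * nm f"
  proof (intro exI[of _ C] ballI, clarify)
    fix f f' x assume f: "(Ef (Some ` S) x, f') \<in> A"
    obtain w where "(EL l (EL l x), w) \<in> A" "nm w \<le> C * nm (EL l x)" using C by blast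
    then show "nm f' \<le> C * nm (Ef (Some ` S) x)" using f A_single unfolding E EL_idem[OF l] by blast
  qed
  show "spectrum scl (range (Ef (Some ` S))) H {(f, f') \<in> A. f \<in> range (Ef (Some ` S))} \<subseteq> of_real ` closure S"
    unfolding E using EL_spectrum[OF S] by (simp add: A_on_def)
qed (rule Ef_Int Ef_Un; assumption)+

end

section \<open>Regularity at infinity and the resolvent on the imaginary axis\<close>

context nonneg_krein
begin

text \<open>The energy of \<open>u = R (\<i> y) (P x)\<close> is real, so \<open>y * B u u\<close>
  is up to sign the imaginary part of \<open>B (P x) u\<close>; definiteness lets
  \<open>B u u\<close> control the squared norm of \<open>u\<close>.\<close>

lemma resolvent_bound_definite:
  assumes P: "krein_proj P" "resc P" and d: "definite_range \<sigma> P" and C: "C \<ge> 0" "\<And>x. nm (P x) \<le> C * nm x"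
    and y: "y > 0"
  shows "y * nm (R (\<i> * of_real y) (P x)) \<le> C * nm (P x)"
proof -
  define z where "z = \<i> * complex_of_real y"
  have z: "Im z \<noteq> 0" using y by (simp add: z_def)
  define u where "u = R z (P x)"
  have Pu: "P u = u" using resc_R[OF P(2) z, of "P x"] krein_projD(3)[OF P(1)] by (simp add: u_def)
  have u: "(u, P x + scl z u) \<in> A" unfolding u_def by (rule R_A[OF z])
  have s: "\<bar>\<sigma>\<bar> = 1" using d unfolding definite_range_def by auto
  have "Im (B (P x + scl z u) u) = 0" by (rule A_real[OF u])
  then have e: "y * Re (B u u) = - Im (B (P x) u)" using Bself[of u] by (simp add: Bsimps z_def)
  have "y * (nm u)\<^sup>2 \<le> y * (C * (\<sigma> * Re (B u u)))"
    using definite_bound_const[OF P(1) d C(2), of u] y by (simp add: Pu)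
  also have "\<dots> = C * (\<sigma> * (y * Re (B u u)))" by simp
  also have "\<dots> \<le> C * (nm (P x) * nm u)"
  proof (rule mult_left_mono[OF _ C(1)])
    have "\<sigma> * (y * Re (B u u)) \<le> \<bar>\<sigma>\<bar> * \<bar>y * Re (B u u)\<bar>" by (simp add: abs_mult[symmetric])
    also have "\<dots> \<le> cmod (B (P x) u)" unfolding e s using abs_Im_le_cmod[of "B (P x) u"] by simp
    also have "\<dots> \<le> nm (P x) * nm u" by (rule B_bound)
    finally show "\<sigma> * (y * Re (B u u)) \<le> nm (P x) * nm u" .
  qed
  finally have "(y * nm u) * nm u \<le> (C * nm (P x)) * nm u" by (simp add: power2_eq_square ac_simps)
  then have "y * nm u \<le> C * nm (P x)"
    using nm_pos[of u] C(1) by (cases "nm u = 0") auto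
  then show ?thesis by (simp add: u_def z_def)
qed

text \<open>This covers the possibly indefinite part around 0. For
  \<open>u = R (\<i> y) (P x)\<close> the square of \<open>nm (A u)\<close> is at most a constant
  times the energy, which is \<open>Re (B u (P x))\<close>; as \<open>\<i> y u\<close> differs from
  \<open>A u\<close> by \<open>P x\<close>, the remaining \<open>nm u\<close> can be absorbed for
  \<open>y > 1\<close>.\<close>

lemma resolvent_bound_bounded:
  assumes P: "krein_proj P" "resc P" and ab: "abd P"
  obtains C where "C \<ge> 0" "\<And>x y. y > 1 \<Longrightarrow> y * nm (R (\<i> * of_real y) (P x)) \<le> C * nm (P x)"
proof -
  obtain W C where C: "C \<ge> 0" "\<And>f f'. (f, f') \<in> A \<Longrightarrow> P f = f \<Longrightarrow> f' = W f \<and> (nm f')\<^sup>2 \<le> C * Re (B f' f)"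
    using bounded_part[OF P ab] by metis
  have "y * nm (R (\<i> * of_real y) (P x)) \<le> (C + 2) * nm (P x)" if y: "y > 1" for x y
  proof -
    define z where "z = \<i> * complex_of_real y"
    have z: "Im z \<noteq> 0" using y by (simp add: z_def)
    define u where "u = R z (P x)"
    have Pu: "P u = u" using resc_R[OF P(2) z, of "P x"] krein_projD(3)[OF P(1)] by (simp add: u_def)
    have u: "(u, P x + scl z u) \<in> A" unfolding u_def by (rule R_A[OF z])
    define p v where "p = nm (P x)" and "v = nm u"
    have pv: "p \<ge> 0" "v \<ge> 0" by (simp_all add: p_def v_def)
    have "Re (B (P x + scl z u) u) = Re (B u (P x))"
      using quad_form[of y u "P x"] y by (simp add: u_def z_def)
    also have "\<dots> \<le> v * p" using Re_B_bound[of u "P x"] by (simp add: v_def p_def)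
    finally have "(nm (P x + scl z u))\<^sup>2 \<le> C * (v * p)"
      using C(2)[OF u Pu] mult_left_mono[OF _ C(1)] by (metis order_trans)
    also have "\<dots> \<le> ((C * p + v) / 2)\<^sup>2"
      using zero_le_power2[of "C * p - v"] by (simp add: power2_eq_square field_simps)
    finally have "nm (P x + scl z u) \<le> (C * p + v) / 2"
      by (rule power2_le_imp_le) (use pv C(1) in simp)
    moreover have "y * v \<le> nm (P x + scl z u) + p"
    proof -
      have "nm (scl z u) = y * v" using y by (simp add: z_def v_def norm_mult)
      then show ?thesis using nm_triangle_diff[of "P x + scl z u" "P x"] by (simp add: p_def)
    qed
    moreover have "v \<le> y * v" using y pv(2) by (simp add: mult_le_cancel_right1)
    ultimately have "y * v \<le> (C * p + y * v) / 2 + p" by argo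
    then have "y * v \<le> (C + 2) * p" by (simp add: field_simps)
    then show ?thesis by (simp add: v_def p_def u_def z_def)
  qed
  then show thesis using that[of "C + 2"] C(1) by simp
qed

lemma e_proj: "a \<noteq> 0 \<Longrightarrow> b \<noteq> 0 \<Longrightarrow> krein_proj (e a b)"
  by (rule kopD(1)[OF e_kop])

lemma e_definite_range:
  assumes "a < b" "0 < a \<and> \<sigma> = 1 \<or> b < 0 \<and> \<sigma> = (-1::real)" shows "definite_range \<sigma> (e a b)"
proof -
  have nz: "a \<noteq> 0" "b \<noteq> 0" using assms by auto
  show ?thesis
    unfolding definite_range_def krein_proj_self[OF e_proj[OF nz]] using e_definite[OF assms] assms(2) by blast
qed

lemma convergent_bounded:
  assumes "((\<lambda>t. nm (X t - l)) \<longlongrightarrow> 0) F" and "filterlim f F sequentially"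
  shows "\<exists>M. \<forall>n::nat. nm (X (f n)) \<le> M"
proof -
  have "(\<lambda>n. nm (X (f n) - l)) \<longlonglongrightarrow> 0" using filterlim_compose[OF assms] .
  then have "Bseq (\<lambda>n. nm (X (f n) - l))" by (intro convergent_imp_Bseq convergentI)
  then obtain K where K: "\<And>n. norm (nm (X (f n) - l)) \<le> K" unfolding Bseq_def by blast
  have "nm (X (f n)) \<le> K + nm l" for n
    using nm_le_diff[of "X (f n)" l] K[of n] by simp
  then show ?thesis by blast
qed

text \<open>The given endpoints have unknown signs. Starting beyond them at some
  \<open>a > 0\<close> costs a fixed projection and leaves definite ones, to which uniform
  boundedness is applied along a sequence.\<close>

lemma regular_imp_uniform:
  assumes reg: "regular_point H Ef None"
  obtains a M where "a > 0" "M \<ge> 0" "\<And>n x. nm (e a (a + 1 + real n) x) \<le> M * nm x"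
    "\<And>n x. nm (e (- (a + 1 + real n)) (- a) x) \<le> M * nm x"
proof -
  obtain l1 l2 where l: "l1 \<noteq> 0" "l2 \<noteq> 0"
    and lim1: "\<And>x. \<exists>k. limitin (ip_topology UNIV H) (\<lambda>t. Ef (Some ` {l1..t}) x) k at_top"
    and lim2: "\<And>x. \<exists>k. limitin (ip_topology UNIV H) (\<lambda>t. Ef (Some ` {t..l2}) x) k at_bot"
    using reg unfolding regular_point_def strong_limit_exists_def by auto
  define a where "a = max \<bar>l1\<bar> \<bar>l2\<bar> + 1"
  have a: "a > 0" "l1 < a" "- a < l2" "- a < 0" by (auto simp: a_def)
  define b where "b n = a + 1 + real n" for n :: nat
  have b: "b n > a" for n by (simp add: b_def)
  have b_top: "filterlim b at_top sequentially"
    unfolding b_def by (rule filterlim_tendsto_add_at_top[OF tendsto_const filterlim_real_sequentially])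
  then have b_bot: "filterlim (\<lambda>n. - b n) at_bot sequentially" by (simp add: filterlim_uminus_at_bot)
  have up: "\<exists>M. \<forall>n. nm (e a (b n) x) \<le> M" for x
  proof -
    obtain k where "limitin (ip_topology UNIV H) (\<lambda>t. Ef (Some ` {l1..t}) x) k at_top" using lim1 by blast
    then have "((\<lambda>t. nm (Ef (Some ` {l1..t}) x - k)) \<longlongrightarrow> 0) at_top" unfolding limitin_iff by blast
    from convergent_bounded[OF this b_top] obtain M where M: "\<And>n. nm (Ef (Some ` {l1..b n}) x) \<le> M" by blast
    have "nm (e a (b n) x) \<le> M + nm (e l1 a x)" for n
    proof -
      have "b n \<noteq> 0" using b[of n] a by linarith
      then have "Ef (Some ` {l1..b n}) x = e l1 a x + e a (b n) x"
        using e_add[of l1 "b n" a x] l a b[of n] Es_interval by (simp add: Ef_Some)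
      then show ?thesis using M[of n] nm_triangle_diff[of "e l1 a x + e a (b n) x" "e l1 a x"] by simp
    qed
    then show ?thesis by blast
  qed
  have down: "\<exists>M. \<forall>n. nm (e (- b n) (- a) x) \<le> M" for x
  proof -
    obtain k where "limitin (ip_topology UNIV H) (\<lambda>t. Ef (Some ` {t..l2}) x) k at_bot" using lim2 by blast
    then have "((\<lambda>t. nm (Ef (Some ` {t..l2}) x - k)) \<longlongrightarrow> 0) at_bot" unfolding limitin_iff by blast
    from convergent_bounded[OF this b_bot] obtain M where M: "\<And>n. nm (Ef (Some ` {- b n..l2}) x) \<le> M" by blast
    have "nm (e (- b n) (- a) x) \<le> M + nm (e (- a) l2 x)" for n
    proof -
      have "- b n \<noteq> 0" using b[of n] a by linarith
      then have "Ef (Some ` {- b n..l2}) x = e (- b n) (- a) x + e (- a) l2 x"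
        using e_add[of "- b n" l2 "- a" x] l a b[of n] Es_interval by (simp add: Ef_Some)
      then show ?thesis using M[of n] nm_triangle_diff[of "e (- b n) (- a) x + e (- a) l2 x" "e (- a) l2 x"] by simp
    qed
    then show ?thesis by blast
  qed
  have nz: "a \<noteq> 0" "- a \<noteq> 0" "b n \<noteq> 0" "- b n \<noteq> 0" for n using a b[of n] by auto
  obtain M1 where M1: "\<And>n x. nm (e a (b n) x) \<le> M1 * nm x"
    using uniform_boundedness[of "\<lambda>n. e a (b n)", OF e_bop[OF nz(1,3)] up] by metis
  obtain M2 where M2: "\<And>n x. nm (e (- b n) (- a) x) \<le> M2 * nm x"
    using uniform_boundedness[of "\<lambda>n. e (- b n) (- a)", OF e_bop[OF nz(4,2)] down] by metis
  define M where "M = max 0 (max M1 M2)"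
  have "M1 * nm x \<le> M * nm x" "M2 * nm x \<le> M * nm x" for x
    by (intro mult_right_mono; simp add: M_def)+
  then show thesis using that[OF a(1), of M] order_trans[OF M1] order_trans[OF M2] by (simp add: M_def b_def)
qed

text \<open>A vector \<open>y\<close> orthogonal to all these ranges gives \<open>z = J y\<close>
  annihilated by all the projections. Then \<open>D z = 0\<close> by \<open>Q_trivial_ker\<close>,
  so \<open>z\<close> lies in the kernel of \<open>A\<close>, where the projections are the
  identity, and \<open>z = 0\<close>.\<close>

lemma e_dense:
  assumes b: "\<And>n. b n > 0" "filterlim b at_top sequentially" "incseq b"
  obtains X where "conv X x" "\<And>n. \<exists>m. e (- b m) (b m) (X n) = X n"
proof -
  have nz: "- b n \<noteq> 0" "b n \<noteq> 0" for n using b(1)[of n] by auto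
  define G where "G n = e (- b n) (b n)" for n
  have Gb: "bop (G n)" for n unfolding G_def by (rule e_bop[OF nz(1)[of n] nz(2)[of n]])
  note Gl = bop_lin[OF Gb]
  have GG: "G n (G m x) = G m x" if "m \<le> n" for m n x
    using e_e[OF nz(1)[of n] nz(2)[of n] nz(1)[of m] nz(2)[of m], of x] incseqD[OF b(3) that] by (simp add: G_def max_def min_def)
  define V where "V = {x. \<exists>n. G n x = x}"
  have up: "G n x = x" if "G m x = x" "m \<le> n" for m n x using GG[OF that(2), of x] that(1) by simp
  have V: "subspace V"
  proof (rule subspaceI)
    show "0 \<in> V" unfolding V_def by (simp add: Gl)
    show "x + y \<in> V" if xy: "x \<in> V" "y \<in> V" for x y
    proof -
      obtain n m where "G n x = x" "G m y = y" using xy unfolding V_def by blast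
      then have "G (max n m) x = x" "G (max n m) y = y" using up by simp_all
      then have "G (max n m) (x + y) = x + y" by (simp add: Gl)
      then show ?thesis unfolding V_def by blast
    qed
    show "scl c x \<in> V" if "x \<in> V" for c x using that unfolding V_def by (auto simp: Gl)
  qed
  have orth: "y = 0" if o: "\<And>v. v \<in> V \<Longrightarrow> H v y = 0" for y
  proof -
    define z where "z = J y"
    have Gz: "G n z = 0" for n
    proof (rule B_eqI2)
      fix x
      have "G n x \<in> V" unfolding V_def using GG[of n n x] by blast
      then have "H (G n x) y = 0" by (rule o)
      then have "B (G n x) z = 0" using HJ2[of "G n x" z] by (simp add: z_def J_J)
      then show "B x (G n z) = B x 0" using e_B[OF nz(1)[of n] nz(2)[of n], of x z] by (simp add: G_def B02)
    qed
    have "QQ (- t) t (D z) = 0" if t: "t > 0" for t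
    proof -
      obtain n where n: "b n \<ge> t" using b(2) unfolding filterlim_at_top eventually_sequentially by blast
      have "QQ (- b n) (b n) (D z) = 0"
        using e_D[OF nz(1)[of n] nz(2)[of n], of z] Gz[of n] b(1)[of n] by (simp add: UU_def G_def bop_0[OF bop_D])
      moreover have "QQ (- t) t (QQ (- b n) (b n) (D z)) = QQ (- t) t (D z)"
        using QQ_QQ[of "- t" t "- b n" "b n" "D z"] t n by (simp add: max_absorb1 min_absorb1)
      moreover have "QQ (- t) t 0 = 0" unfolding QQ_def by (simp add: bop_0[OF bo_Q])
      ultimately show ?thesis by simp
    qed
    then have "ct (D z) = 0" by (rule Q_trivial_ker)
    then have "H (D z) (D z) = 0" using saopH[OF saop_D, of "D z" z] by (simp add: ct_zero H01)
    then have "D z = 0" using H_eq0 by simp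
    then have "G 0 z = z" using kopD(3)[OF e_kop[OF nz(1)[of 0] nz(2)[of 0]]] b(1)[of 0] by (simp add: G_def)
    then have "z = 0" using Gz by simp
    then show ?thesis using J_J[of y] by (simp add: z_def bop_0[OF bop_J])
  qed
  have C0: "0 \<le> nm x" by simp
  have bd: "cmod (H v x) \<le> nm x * nm v" for v using Cauchy_Schwarz[of v x] by (simp add: mult.commute)
  have add: "H (u + v) x = H u x + H v x" and scl: "H (scl c v) x = c * H v x" for u v c by (simp_all add: Hsimps)
  obtain g X where g: "\<And>v. v \<in> V \<Longrightarrow> H v x = H v g" "\<And>n. X n \<in> V" "conv X g"
    using Riesz_subspace[OF V subset_UNIV add scl C0 bd] by metis
  have "x - g = 0" by (rule orth) (simp add: Hsimps g(1))
  then have "conv X x" using g(3) by simp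
  then show thesis using that g(2) unfolding V_def G_def by blast
qed

lemma resolvent_bound_regular:
  assumes reg: "regular_point H Ef None"
  obtains C where "\<And>y x. y > 1 \<Longrightarrow> y * nm (R (\<i> * of_real y) x) \<le> C * nm x"
proof -
  obtain a M where a: "a > 0" and M: "M \<ge> 0" "\<And>n x. nm (e a (a + 1 + real n) x) \<le> M * nm x"
    "\<And>n x. nm (e (- (a + 1 + real n)) (- a) x) \<le> M * nm x"
    using regular_imp_uniform[OF reg] by metis
  define b where "b n = a + 1 + real n" for n :: nat
  have b: "b n > a" "b n > 0" for n using a by (simp_all add: b_def)
  have nz: "a \<noteq> 0" "- a \<noteq> 0" "b n \<noteq> 0" "- b n \<noteq> 0" for n using a b[of n] by auto
  note M = M[folded b_def]
  obtain C0 where C0: "C0 \<ge> 0" "\<And>x y. y > 1 \<Longrightarrow> y * nm (R (\<i> * of_real y) (e (- a) a x)) \<le> C0 * nm (e (- a) a x)"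
    using resolvent_bound_bounded[OF e_proj[OF nz(2,1)] e_resc[OF nz(2,1)] e_abd[OF nz(2,1)]] by metis
  obtain K where K: "K > 0" "\<And>x. nm (e (- a) a x) \<le> K * nm x" using bop_bound[OF e_bop[OF nz(2,1)]] by metis
  \<comment> \<open>Each definite outer part contributes \<open>M * M\<close>, one factor from the
    resolvent and one from the projection; the bounded middle part contributes
    \<open>C0 * K\<close>.\<close>
  define C where "C = M * M + C0 * K + M * M"
  have bound: "y * nm (R (\<i> * of_real y) (e (- b n) (b n) x)) \<le> C * nm x" if y: "y > 1" for y n x
  proof -
    let ?R = "R (\<i> * of_real y)"
    have z: "Im (\<i> * complex_of_real y) \<noteq> 0" using y by simp
    have "e (- b n) (b n) x = e (- b n) (- a) x + (e (- a) a x + e a (b n) x)"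
      using e_add[of "- b n" "b n" "- a" x] e_add[of "- a" "b n" a x] nz a b[of n] by simp
    then have "nm (?R (e (- b n) (b n) x)) \<le> nm (?R (e (- b n) (- a) x)) + (nm (?R (e (- a) a x)) + nm (?R (e a (b n) x)))"
      using nm_triangle[of "?R (e (- b n) (- a) x)" "?R (e (- a) a x) + ?R (e a (b n) x)"]
        nm_triangle[of "?R (e (- a) a x)" "?R (e a (b n) x)"] by (simp add: bop_lin[OF R_bop[OF z]])
    then have "y * nm (?R (e (- b n) (b n) x))
        \<le> y * nm (?R (e (- b n) (- a) x)) + (y * nm (?R (e (- a) a x)) + y * nm (?R (e a (b n) x)))"
      using mult_left_mono[of _ _ y] y by (simp flip: distrib_left)
    moreover have "y * nm (?R (e (- b n) (- a) x)) \<le> M * nm (e (- b n) (- a) x)"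
      by (rule resolvent_bound_definite[OF e_proj[OF nz(4,2)] e_resc[OF nz(4,2)] e_definite_range[of _ _ "-1"] M(1) M(3)])
        (use a b[of n] y in auto)
    moreover have "y * nm (?R (e a (b n) x)) \<le> M * nm (e a (b n) x)"
      by (rule resolvent_bound_definite[OF e_proj[OF nz(1,3)] e_resc[OF nz(1,3)] e_definite_range[of _ _ 1] M(1) M(2)])
        (use a b[of n] y in auto)
    moreover have "M * nm (e (- b n) (- a) x) \<le> M * (M * nm x)" "M * nm (e a (b n) x) \<le> M * (M * nm x)"
      "C0 * nm (e (- a) a x) \<le> C0 * (K * nm x)"
      by (rule mult_left_mono; rule M K C0)+
    ultimately have "y * nm (?R (e (- b n) (b n) x)) \<le> M * (M * nm x) + (C0 * (K * nm x) + M * (M * nm x))"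
      using C0(2)[OF y, of x] by linarith
    then show ?thesis by (simp add: C_def algebra_simps)
  qed
  have "y * nm (R (\<i> * of_real y) x) \<le> C * nm x" if y: "y > 1" for y x
  proof -
    let ?R = "R (\<i> * of_real y)"
    have z: "Im (\<i> * complex_of_real y) \<noteq> 0" using y by simp
    have top: "filterlim b at_top sequentially"
      unfolding b_def by (rule filterlim_tendsto_add_at_top[OF tendsto_const filterlim_real_sequentially])
    have inc: "incseq b" by (simp add: incseq_def b_def)
    obtain X where X: "conv X x" "\<And>n. \<exists>m. e (- b m) (b m) (X n) = X n" using e_dense[OF b(2) top inc] by metis
    have "y * nm (?R (X n)) \<le> C * nm (X n)" for n using X(2)[of n] bound[OF y] by metis
    moreover have "(\<lambda>n. y * nm (?R (X n))) \<longlonglongrightarrow> y * nm (?R x)"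
      by (intro tendsto_mult tendsto_const conv_nm bop_conv[OF R_bop[OF z] X(1)])
    moreover have "(\<lambda>n. C * nm (X n)) \<longlonglongrightarrow> C * nm x" by (intro tendsto_mult tendsto_const conv_nm X(1))
    ultimately show ?thesis using LIMSEQ_le by blast
  qed
  then show thesis using that by blast
qed

text \<open>Some neighbourhood of \<infinity> then has a semidefinite spectral subspace, and its
  complement in the ring is bounded: two pieces, with no passage to a limit.\<close>

lemma resolvent_bound_not_critical:
  assumes nc: "\<not> critical_point B Ef None"
  obtains C where "\<And>y x. y > 1 \<Longrightarrow> y * nm (R (\<i> * of_real y) x) \<le> C * nm x"
proof -
  obtain \<Delta> where \<Delta>: "\<Delta> \<in> spectral_ring" "None \<in> \<Delta>"
    and s: "(\<forall>x\<in>range (Ef \<Delta>). Re (B x x) \<le> 0) \<or> (\<forall>x\<in>range (Ef \<Delta>). 0 \<le> Re (B x x))"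
    using nc unfolding critical_point_def by (auto simp: not_less)
  obtain S l where S: "rep S l" "\<Delta> = - (Some ` S)" using \<Delta> by (cases rule: spectral_ring_cases) auto
  have l: "nzl l" using S(1) unfolding rep_def by blast
  obtain Q' c where k: "kop (Ef \<Delta>) Q' c" using Ef_kop[OF \<Delta>(1)] by metis
  obtain \<sigma> where d: "definite_range \<sigma> (Ef \<Delta>)"
  proof -
    from s show thesis
    proof
      assume "\<forall>x\<in>range (Ef \<Delta>). Re (B x x) \<le> 0"
      then show thesis using that[of "-1"] by (simp add: definite_range_def)
    next
      assume "\<forall>x\<in>range (Ef \<Delta>). 0 \<le> Re (B x x)"
      then show thesis using that[of 1] by (simp add: definite_range_def)
    qed
  qed
  have split: "x = Ef \<Delta> x + EL l x" for x unfolding S(2) Ef_Compl using Es_eq[OF S(1)] by simp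
  obtain M where M: "M > 0" "\<And>x. nm (Ef \<Delta> x) \<le> M * nm x" using bop_bound[OF kopD(5)[OF k]] by metis
  obtain K where K: "K > 0" "\<And>x. nm (EL l x) \<le> K * nm x" using bop_bound[OF EL_bop[OF l]] by metis
  obtain C0 where C0: "C0 \<ge> 0" "\<And>x y. y > 1 \<Longrightarrow> y * nm (R (\<i> * of_real y) (EL l x)) \<le> C0 * nm (EL l x)"
    using resolvent_bound_bounded[OF EL_proj[OF l] EL_resc[OF l] EL_abd[OF l]] by metis
  have "y * nm (R (\<i> * of_real y) x) \<le> (M * M + C0 * K) * nm x" if y: "y > 1" for y x
  proof -
    let ?R = "R (\<i> * of_real y)"
    have z: "Im (\<i> * complex_of_real y) \<noteq> 0" using y by simp
    have "?R x = ?R (Ef \<Delta> x) + ?R (EL l x)" by (subst split[of x]) (simp add: bop_lin[OF R_bop[OF z]])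
    then have "nm (?R x) \<le> nm (?R (Ef \<Delta> x)) + nm (?R (EL l x))"
      using nm_triangle[of "?R (Ef \<Delta> x)" "?R (EL l x)"] by simp
    then have "y * nm (?R x) \<le> y * nm (?R (Ef \<Delta> x)) + y * nm (?R (EL l x))"
      using mult_left_mono[of _ _ y] y by (simp flip: distrib_left)
    moreover have "y * nm (?R (Ef \<Delta> x)) \<le> M * nm (Ef \<Delta> x)"
      by (rule resolvent_bound_definite[OF kopD(1,8)[OF k] d _ M(2)]) (use M(1) y in auto)
    moreover have "M * nm (Ef \<Delta> x) \<le> M * (M * nm x)" "C0 * nm (EL l x) \<le> C0 * (K * nm x)"
      using M K C0(1) by (simp_all add: mult_left_mono)
    ultimately have "y * nm (?R x) \<le> M * (M * nm x) + C0 * (K * nm x)" using C0(2)[OF y, of x] by linarith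
    then show ?thesis by (simp add: algebra_simps)
  qed
  then show thesis using that by blast
qed

end

section \<open>The equivalence for the coupled operator\<close>

lemma (in pfr) infinity_regular_iff:
  assumes "has_B_infty Pt.m" and "has_B_infty Nt.m"
  shows "None \<notin> singular_critical_points scl B Kp Km A \<longleftrightarrow> has_D_infty Pt.m Nt.m"
proof
  assume "None \<notin> singular_critical_points scl B Kp Km A"
  then have "\<not> critical_point B Ef None \<or> regular_point H Ef None"
    using Ef_spectral_function unfolding singular_critical_points_def by blast
  then obtain C where "\<And>y x. y > 1 \<Longrightarrow> y * nm (R (\<i> * of_real y) x) \<le> C * nm x"
    using resolvent_bound_regular resolvent_bound_not_critical by metis
  then show "has_D_infty Pt.m Nt.m" by (rule D_infty_if_resolvent_bound)
next
  assume "has_D_infty Pt.m Nt.m"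
  then obtain M where M: "M \<ge> 0" "\<And>f n (a :: nat \<Rightarrow> real).
      (\<And>k y. k < n \<Longrightarrow> 2 ^ k < y \<Longrightarrow> y \<le> 2 ^ Suc k \<Longrightarrow> a k \<le> 2 ^ k * q y f) \<Longrightarrow> (\<Sum>k<n. a k) \<le> M * (nm f)\<^sup>2"
    using dyadic_sum_bound[OF assms] by blast
  have "regular_point H E None" if "spectral_function scl B Kp Km A E" for E
  proof (rule regular_at_infinity[OF that M(1)])
    fix f :: 'a and n :: nat and a :: "nat \<Rightarrow> real"
    assume "\<And>k y. k < n \<Longrightarrow> 2 ^ k < y \<Longrightarrow> y \<le> 2 ^ Suc k \<Longrightarrow> a k \<le> 2 ^ k * q y f"
    then show "(\<Sum>k<n. a k) \<le> M * (nm f)\<^sup>2" by (rule M(2))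
  qed
  then show "None \<notin> singular_critical_points scl B Kp Km A"
    unfolding singular_critical_points_def by blast
qed

theorem theorem5p7:
  fixes scl :: "complex \<Rightarrow> 'a::ab_group_add \<Rightarrow> 'a"
    and B :: "'a \<Rightarrow> 'a \<Rightarrow> complex"
    and Kp Km :: "'a set"
    and A :: "('a \<times> 'a) set"
    and G0p G1p G0m G1m :: "'a \<Rightarrow> complex"
    and mp mm :: "complex \<Rightarrow> complex"
  assumes "krein_space scl B"
    and "partially_fund_reducible scl B Kp Km A"
    and "nonneg_operator B A"
    and "boundary_triple scl Kp B (S_plus Kp A) G0p G1p"
    and "induced_boundary_triple scl B Kp Km A G0p G1p G0m G1m"
    and "mp = weyl_function scl Kp B (S_plus Kp A) G0p G1p"
    and "mm = weyl_function scl Km (\<lambda>x y. - B x y) (S_minus Km A) G0m G1m"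
    and "has_B_infty mp"
    and "has_B_infty mm"
  shows "None \<notin> singular_critical_points scl B Kp Km A \<longleftrightarrow> has_D_infty mp mm"
proof -
  interpret vector_space scl using assms(1) unfolding krein_space_def by blast
  interpret pfr scl B Kp Km A G0p G1p G0m G1m
    by unfold_locales (use assms in \<open>auto simp: krein_space_def partially_fund_reducible_def\<close>)
  have "mp = Pt.m" "mm = Nt.m" using assms(6,7) by (simp_all add: Pt.m_def Nt.m_def fun_eq_iff)
  then show ?thesis using infinity_regular_iff assms(8,9) by simp
qed

end
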